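(* Let $n>1$. There is a bijection between the one-parameter families of isomorphism classes of quaternionic skew-Hermitian transvection involutive Lie algebras $(\mathfrak{g},\sigma,Q_o,e^{2t}\omega_o)$, $t\in\mathbb{R}$ (with $\mathfrak m$ of quaternionic dimension $n$), and the following quaternionic $(n+2)\times(n+2)$ matrices $\tau$ (all block decompositions are for $\mathbb{H}^{n+2}=\mathbb{H}\oplus\mathbb{H}^n\oplus\mathbb{H}$): (i) for $n$ even, $\tau=\begin{pmatrix}0&0&0\\ 0&A_{p,q}&0\\ 1&0&0\end{pmatrix}$ with $A_{p,q}=\begin{pmatrix}0&B_q\\ C_p&0\end{pmatrix}$ in blocks of size $\frac n2$, for integers $p,q$ with $0\le p,q,p+q\le\frac n2$; (ii) for $n$ odd, $\tau=\begin{pmatrix}0&0&0\\ 0&A_{p,q}&0\\ 1&0&0\end{pmatrix}$ with $A_{p,q}=\begin{pmatrix}0&0&B_q\\ 0&0&0\\ C_p&0&0\end{pmatrix}$ in blocks of sizes $\frac{n-1}2,1,\frac{n-1}2$, for integers $p,q$ with $0\le p,q,p+q\le\frac{n-1}2$; (iii) $\tau=\begin{pmatrix}i&0&-1\\ 0&0&0\\ 1&0&i\end{pmatrix}$; (iv) $\tau=\begin{pmatrix}0&0&-1\\ 0&jI_{p,q}&0\\ 1&0&0\end{pmatrix}$ for integers $p,q\ge0$ with $p+q=n$; (v) for $n$ even, $\tau=\begin{pmatrix}0&0&1\\ 0&I_{\frac n2,\frac n2}&0\\ 1&0&0\end{pmatrix}$. Here, in (i) and (ii), with $N=\frac n2$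 respectively $N=\frac{n-1}2$ and the splitting $N=p+q+(N-p-q)$, $C_p=\mathrm{diag}(\mathrm{Id}_p,0,0)$ and $B_q=\mathrm{diag}(0,\mathrm{Id}_q,0)$.
   Context: **qs-H tiLas.** A transvection involutive Lie algebra (tiLa) is a pair $(\mathfrak{g},\sigma)$ of a finite-dimensional real Lie algebra $\mathfrak{g}$ and an involutive automorphism $\sigma$ with $\pm1$-eigenspaces $\mathfrak{l}$, $\mathfrak{m}$ (canonical decomposition $\mathfrak{g}=\mathfrak{l}\oplus\mathfrak{m}$) such that $\mathfrak{l}=[\mathfrak{m},\mathfrak{m}]$ and no non-zero ideal of $\mathfrak{g}$ is contained in $\mathfrak{l}$. A quaternionic skew-Hermitian tiLa (qs-H tiLa) is a quadruple $(\mathfrak{g},\sigma,Q_0,\omega_0)$ where $(\mathfrak{g},\sigma)$ is a tiLa, $Q_0\subset\mathrm{End}(\mathfrak{m})$ is a linear quaternionic structure (a 3-dimensional subspace spanned by $J_1,J_2,J_3$ with $J_a^2=-\mathrm{Id}$, $J_1J_2=J_3=-J_2J_1$), $\omega_0$ is a non-degenerate 2-form on $\mathfrak{m}$ with $\omega_0(JX,JY)=\omega_0(X,Y)$ for all $J\in Q_0$ with $J^2=-\mathrm{Id}$, and both $Q_0$ and $\omega_0$ are invariant under the adjoint action of $\mathfrak{l}$ on $\mathfrak{m}$. Here $\dim_{\mathbb{R}}\mathfrak{m}=4n$, $n>1$. Two qs-H tiLas $(\mathfrak{g}_i,\sigma_i,Q_i,\omega_i)$ are isomorphic if there is a Lie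 algebra isomorphism $\varphi:\mathfrak{g}_1\to\mathfrak{g}_2$ with $\varphi\circ\sigma_1=\sigma_2\circ\varphi$, $\varphi^*Q_2=Q_1$, $\varphi^*\omega_2=\omega_1$. The one-parameter family of $(\mathfrak{g},\sigma,Q_o,\omega_o)$ consists of the isomorphism classes of $(\mathfrak{g},\sigma,Q_o,e^{2t}\omega_o)$, $t\in\mathbb{R}$. **Notation.** $I_{p,q}$ is the diagonal matrix with $p$ entries $1$ followed by $q$ entries $-1$; $i,j$ are the standard quaternion units; $*$ is conjugate transpose. Each $\tau$ is regarded as an element of $\mathfrak{so}^*(2n+4)$, realized as the Lie algebra of quaternionic matrices $$\begin{pmatrix}a&Y^*\mathbb{j}&d\\ X&A&Y\\ c&-X^*\mathbb{j}&-a^*\end{pmatrix},\ a\in\mathbb{H},\ X,Y\in\mathbb{H}^n,\ c,d\in\mathbb{R},\ A\in\mathfrak{so}^*(2n)=\{A:A^*\mathbb{j}+\mathbb{j}A=0\},$$ where the skew-Hermitian matrix $\mathbb{j}$ of the scalar 2-form on $\mathbb{H}^n$ is $\begin{pmatrix}0&\mathrm{Id}\\ -\mathrm{Id}&0\end{pmatrix}$ in (i) and (v), $\begin{pmatrix}0&0&\mathrm{Id}\\ 0&j&0\\ -\mathrm{Id}&0&0\end{pmatrix}$ in (ii), and $j\,\mathrm{Id}_n$ in (iii) and (iv) (different choices give isomorphic models). **The qs-H tiLa attached to $\tau$.** Each listed $\tau$ has the form $\begin{pmatrix}a&0&d\\ 0&A&0\\ 1&0&a\end{pmatrix}$ with $a\in\mathfrak{sp}(1)$,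 $A\in\mathfrak{so}^*(2n)$, $d\in\mathbb{R}$, and one attaches to it, with $\mathfrak{t}=\mathbb{R}\tau$, the space $$\mathfrak{m}=\left\{\begin{pmatrix}0&(AX-Xa)^*\mathbb{j}&0\\ X&0&AX-Xa\\ 0&-X^*\mathbb{j}&0\end{pmatrix}:X\in\mathbb{H}^n\right\},$$ which centralizes $\tau$ and is regarded as a subspace of $Z(\mathfrak{t})/\mathfrak{t}$, $Z(\mathfrak{t})$ being the centralizer of $\mathfrak{t}$ in $\mathfrak{so}^*(2n+4)$; then $\mathfrak{g}=\mathfrak{m}\oplus[\mathfrak{m},\mathfrak{m}]$ with bracket taken in $Z(\mathfrak{t})/\mathfrak{t}$, $\sigma=-\mathrm{id}$ on $\mathfrak{m}$ and $\mathrm{id}$ on $[\mathfrak{m},\mathfrak{m}]$, $Q_o$ is spanned by right multiplications by imaginary quaternions on $\mathfrak{m}\cong\mathbb{H}^n$, and $\omega_o$ (up to positive scale) is the bottom-left matrix entry of the $\mathfrak{so}^*(2n+4)$-commutator of two elements of $\mathfrak{m}$. *)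

theory Defs
  imports "HOL-Analysis.Analysis"
begin

section \<open>Quaternions and quaternionic matrices\<close>

datatype quat = Quat (qre: real) (qim1: real) (qim2: real) (qim3: real)

lemma quat_eq_iff:
  "x = y \<longleftrightarrow> qre x = qre y \<and> qim1 x = qim1 y \<and> qim2 x = qim2 y \<and> qim3 x = qim3 y"
  by (cases x; cases y) simp

instantiation quat :: real_algebra_1
begin

definition zero_quat :: quat where "0 = Quat 0 0 0 0"

definition one_quat :: quat where "1 = Quat 1 0 0 0"

definition plus_quat :: "quat \<Rightarrow> quat \<Rightarrow> quat" where
  "x + y = Quat (qre x + qre y) (qim1 x + qim1 y) (qim2 x + qim2 y) (qim3 x + qim3 y)"

definition uminus_quat :: "quat \<Rightarrow> quat" where
  "- x = Quat (- qre x) (- qim1 x) (- qim2 x) (- qim3 x)"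

definition minus_quat :: "quat \<Rightarrow> quat \<Rightarrow> quat" where
  "x - y = Quat (qre x - qre y) (qim1 x - qim1 y) (qim2 x - qim2 y) (qim3 x - qim3 y)"

definition times_quat :: "quat \<Rightarrow> quat \<Rightarrow> quat" where
  "x * y = Quat
     (qre x * qre y - qim1 x * qim1 y - qim2 x * qim2 y - qim3 x * qim3 y)
     (qre x * qim1 y + qim1 x * qre y + qim2 x * qim3 y - qim3 x * qim2 y)
     (qre x * qim2 y - qim1 x * qim3 y + qim2 x * qre y + qim3 x * qim1 y)
     (qre x * qim3 y + qim1 x * qim2 y - qim2 x * qim1 y + qim3 x * qre y)"

definition scaleR_quat :: "real \<Rightarrow> quat \<Rightarrow> quat" where
  "r *\<^sub>R x = Quat (r * qre x) (r * qim1 x) (r * qim2 x) (r * qim3 x)"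

instance
  by standard
    (simp_all add: quat_eq_iff zero_quat_def one_quat_def plus_quat_def uminus_quat_def
      minus_quat_def times_quat_def scaleR_quat_def algebra_simps)

end

definition quat_i :: quat where "quat_i = Quat 0 1 0 0"

definition quat_j :: quat where "quat_j = Quat 0 0 1 0"

definition qconj :: "quat \<Rightarrow> quat" where
  "qconj x = Quat (qre x) (- qim1 x) (- qim2 x) (- qim3 x)"

type_synonym 'n qmat = "quat ^ 'n ^ 'n"

text \<open>The index type for $\mathbb{H}^{n+2}=\mathbb{H}\oplus\mathbb{H}^n\oplus\mathbb{H}$, where
  $n$ is the cardinality of \<open>'n\<close>.\<close>

type_synonym 'n ext = "unit + 'n + unit"

abbreviation ix_first :: "'n ext" where "ix_first \<equiv> Inl ()"
abbreviation ix_mid :: "'n \<Rightarrow> 'n ext" where "ix_mid i \<equiv> Inr (Inl i)"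
abbreviation ix_last :: "'n ext" where "ix_last \<equiv> Inr (Inr ())"

text \<open>The arguments are the nine blocks, row by row.\<close>

definition block3 ::
  "quat \<Rightarrow> quat ^ 'n \<Rightarrow> quat \<Rightarrow> quat ^ 'n \<Rightarrow> 'n qmat \<Rightarrow> quat ^ 'n \<Rightarrow>
   quat \<Rightarrow> quat ^ 'n \<Rightarrow> quat \<Rightarrow> ('n::finite) ext qmat" where
  "block3 a u d  X A Y  c v b = (\<chi> r s.
     case r of
       Inl _ \<Rightarrow> (case s of Inl _ \<Rightarrow> a | Inr (Inl k) \<Rightarrow> u $ k | Inr (Inr _) \<Rightarrow> d)
     | Inr (Inl i) \<Rightarrow> (case s of Inl _ \<Rightarrow> X $ i | Inr (Inl k) \<Rightarrow> A $ i $ k | Inr (Inr _) \<Rightarrow> Y $ i)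
     | Inr (Inr _) \<Rightarrow> (case s of Inl _ \<Rightarrow> c | Inr (Inl k) \<Rightarrow> v $ k | Inr (Inr _) \<Rightarrow> b))"

definition mid_block :: "('n::finite) ext qmat \<Rightarrow> 'n qmat" where
  "mid_block M = (\<chi> i k. M $ ix_mid i $ ix_mid k)"

definition first_col :: "('n::finite) ext qmat \<Rightarrow> quat ^ 'n" where
  "first_col M = (\<chi> i. M $ ix_mid i $ ix_first)"

definition qadj :: "('n::finite) qmat \<Rightarrow> 'n qmat" where
  "qadj A = (\<chi> i k. qconj (A $ k $ i))"

definition star_row :: "quat ^ 'n \<Rightarrow> ('n::finite) qmat \<Rightarrow> quat ^ 'n" where \<comment> \<open>$X^*\mathbb{j}$\<close>
  "star_row X J = (\<chi> k. \<Sum>i\<in>UNIV. qconj (X $ i) * J $ i $ k)"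

definition rmult :: "quat ^ 'n \<Rightarrow> quat \<Rightarrow> quat ^ ('n::finite)" where
  "rmult X q = (\<chi> i. X $ i * q)"

definition comm :: "('m::finite) qmat \<Rightarrow> 'm qmat \<Rightarrow> 'm qmat" where
  "comm M M' = M ** M' - M' ** M"

section \<open>Quaternionic skew-Hermitian tiLas\<close>

text \<open>Structures live on a linear subspace of an ambient real vector space; the values of the
  operations outside of that subspace are irrelevant.\<close>

definition linear_map_on ::
  "'a::real_vector set \<Rightarrow> ('a \<Rightarrow> 'b::real_vector) \<Rightarrow> bool" where
  "linear_map_on V f \<longleftrightarrow>
     (\<forall>x\<in>V. \<forall>y\<in>V. f (x + y) = f x + f y) \<and> (\<forall>r. \<forall>x\<in>V. f (r *\<^sub>R x) = r *\<^sub>R f x)"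

definition bilinear_map_on ::
  "'a::real_vector set \<Rightarrow> ('a \<Rightarrow> 'a \<Rightarrow> 'b::real_vector) \<Rightarrow> bool" where
  "bilinear_map_on V f \<longleftrightarrow>
     (\<forall>x\<in>V. linear_map_on V (f x)) \<and> (\<forall>y\<in>V. linear_map_on V (\<lambda>x. f x y))"

definition fin_dim_lie_algebra :: "'a::real_vector set \<Rightarrow> ('a \<Rightarrow> 'a \<Rightarrow> 'a) \<Rightarrow> bool" where
  "fin_dim_lie_algebra V br \<longleftrightarrow>
     (\<exists>B. finite B \<and> V = span B) \<and>
     (\<forall>x\<in>V. \<forall>y\<in>V. br x y \<in> V) \<and>
     bilinear_map_on V br \<and>
     (\<forall>x\<in>V. br x x = 0) \<and>
     (\<forall>x\<in>V. \<forall>y\<in>V. \<forall>z\<in>V. br x (br y z) + br y (br z x) + br z (br x y) = 0)"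

definition lie_ideal :: "'a::real_vector set \<Rightarrow> ('a \<Rightarrow> 'a \<Rightarrow> 'a) \<Rightarrow> 'a set \<Rightarrow> bool" where
  "lie_ideal V br I \<longleftrightarrow> subspace I \<and> I \<subseteq> V \<and> (\<forall>x\<in>V. \<forall>y\<in>I. br x y \<in> I)"

definition bracket_span :: "('a::real_vector \<Rightarrow> 'a \<Rightarrow> 'a) \<Rightarrow> 'a set \<Rightarrow> 'a set" where
  "bracket_span br S = span {br x y | x y. x \<in> S \<and> y \<in> S}"

record 'a tila_data =
  alg :: "'a set"
  brk :: "'a \<Rightarrow> 'a \<Rightarrow> 'a"
  invol :: "'a \<Rightarrow> 'a"

record 'a qsH_data = "'a tila_data" +
  qstr :: "('a \<Rightarrow> 'a) set"
  sform :: "'a \<Rightarrow> 'a \<Rightarrow> real"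

definition l_part :: "('a::real_vector, 'z) tila_data_scheme \<Rightarrow> 'a set" where
  "l_part L = {x \<in> alg L. invol L x = x}"

definition m_part :: "('a::real_vector, 'z) tila_data_scheme \<Rightarrow> 'a set" where
  "m_part L = {x \<in> alg L. invol L x = - x}"

definition tila :: "('a::real_vector, 'z) tila_data_scheme \<Rightarrow> bool" where
  "tila L \<longleftrightarrow>
     fin_dim_lie_algebra (alg L) (brk L) \<and>
     invol L \<in> alg L \<rightarrow> alg L \<and> linear_map_on (alg L) (invol L) \<and>
     (\<forall>x\<in>alg L. invol L (invol L x) = x) \<and>
     (\<forall>x\<in>alg L. \<forall>y\<in>alg L. invol L (brk L x y) = brk L (invol L x) (invol L y)) \<and>
     l_part L = bracket_span (brk L) (m_part L) \<and>
     (\<forall>I. lie_ideal (alg L) (brk L) I \<and> I \<subseteq> l_part L \<longrightarrow> I = {0})"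

text \<open>Endomorphisms of a subspace \<open>m\<close> are represented by linear functions in
  \<open>m \<rightarrow>\<^sub>E m\<close>, i.e. with an arbitrary but fixed value outside of \<open>m\<close>, so that
  equality of endomorphisms is equality of functions.\<close>

definition End_on :: "'a::real_vector set \<Rightarrow> ('a \<Rightarrow> 'a) set" where
  "End_on m = {f \<in> m \<rightarrow>\<^sub>E m. linear_map_on m f}"

definition linear_quaternionic_structure ::
  "'a::real_vector set \<Rightarrow> ('a \<Rightarrow> 'a) set \<Rightarrow> bool" where
  "linear_quaternionic_structure m Q \<longleftrightarrow>
     (\<exists>J1\<in>End_on m. \<exists>J2\<in>End_on m. \<exists>J3\<in>End_on m.
        (\<forall>x\<in>m. J1 (J1 x) = - x \<and> J2 (J2 x) = - x \<and> J3 (J3 x) = - x) \<and>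
        (\<forall>x\<in>m. J1 (J2 x) = J3 x \<and> J3 x = - J2 (J1 x)) \<and>
        Q = {\<lambda>x\<in>m. a *\<^sub>R J1 x + b *\<^sub>R J2 x + c *\<^sub>R J3 x | a b c. True})"

definition qsH_tila :: "nat \<Rightarrow> 'a::real_vector qsH_data \<Rightarrow> bool" where
  "qsH_tila n L \<longleftrightarrow>
     tila L \<and> dim (m_part L) = 4 * n \<and>
     linear_quaternionic_structure (m_part L) (qstr L) \<and>
     bilinear_map_on (m_part L) (sform L) \<and>
     (\<forall>x\<in>m_part L. \<forall>y\<in>m_part L. sform L x y = - sform L y x) \<and>
     (\<forall>x\<in>m_part L. (\<forall>y\<in>m_part L. sform L x y = 0) \<longrightarrow> x = 0) \<and>
     (\<forall>J\<in>qstr L. (\<forall>x\<in>m_part L. J (J x) = - x) \<longrightarrow>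
        (\<forall>x\<in>m_part L. \<forall>y\<in>m_part L. sform L (J x) (J y) = sform L x y)) \<and>
     (\<forall>z\<in>l_part L. \<forall>J\<in>qstr L. (\<lambda>x\<in>m_part L. brk L z (J x) - J (brk L z x)) \<in> qstr L) \<and>
     (\<forall>z\<in>l_part L. \<forall>x\<in>m_part L. \<forall>y\<in>m_part L.
        sform L (brk L z x) y + sform L x (brk L z y) = 0)"

definition qsH_isomorphism ::
  "'a::real_vector qsH_data \<Rightarrow> 'b::real_vector qsH_data \<Rightarrow> ('a \<Rightarrow> 'b) \<Rightarrow> bool" where
  "qsH_isomorphism L1 L2 \<phi> \<longleftrightarrow>
     bij_betw \<phi> (alg L1) (alg L2) \<and> linear_map_on (alg L1) \<phi> \<and>
     (\<forall>x\<in>alg L1. \<forall>y\<in>alg L1. \<phi> (brk L1 x y) = brk L2 (\<phi> x) (\<phi> y)) \<and>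
     (\<forall>x\<in>alg L1. \<phi> (invol L1 x) = invol L2 (\<phi> x)) \<and>
     {\<lambda>x\<in>m_part L1. inv_into (m_part L1) \<phi> (J (\<phi> x)) | J. J \<in> qstr L2} = qstr L1 \<and>
     (\<forall>x\<in>m_part L1. \<forall>y\<in>m_part L1. sform L2 (\<phi> x) (\<phi> y) = sform L1 x y)"

text \<open>The isomorphism class of \<open>L\<close> consists of structures on subspaces of the ambient
  vector space \<open>'b\<close>, which need not be the one in which \<open>L\<close> lives.\<close>

definition iso_class ::
  "nat \<Rightarrow> 'a::real_vector qsH_data \<Rightarrow> 'b::real_vector qsH_data set" where
  "iso_class n L = {L'. qsH_tila n L' \<and> (\<exists>\<phi>. qsH_isomorphism L' L \<phi>)}"

definition rescale :: "real \<Rightarrow> 'a qsH_data \<Rightarrow> 'a qsH_data" where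
  "rescale t L = L\<lparr>sform := \<lambda>x y. exp (2 * t) * sform L x y\<rparr>"

definition one_param_family ::
  "nat \<Rightarrow> 'a::real_vector qsH_data \<Rightarrow> 'b::real_vector qsH_data set set" where
  "one_param_family n L = {iso_class n (rescale t L) | t. True}"

definition one_param_families :: "nat \<Rightarrow> 'b::real_vector qsH_data set set set" where
  "one_param_families n = {one_param_family n L | L :: 'b qsH_data. qsH_tila n L}"

section \<open>The qs-H tiLa attached to a matrix\<close>

definition so_star :: "('n::finite) qmat \<Rightarrow> 'n qmat set" where
  "so_star J = {A. qadj A ** J + J ** A = 0}"

definition so_star_ext :: "('n::finite) qmat \<Rightarrow> 'n ext qmat set" where
  "so_star_ext J =
     {block3 a (star_row Y J) (of_real d)  X A Y  (of_real c) (- star_row X J) (- qconj a)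
      | a X Y c d A. A \<in> so_star J}"

definition tau_centralizer :: "('n::finite) qmat \<Rightarrow> 'n ext qmat \<Rightarrow> 'n ext qmat set" where
  "tau_centralizer J \<tau> = {M \<in> so_star_ext J. comm M \<tau> = 0}"

text \<open>The bottom-left entry of an element of \<open>so_star_ext J\<close> is real, and that of \<open>\<tau>\<close> is 1. Hence
  every coset of the line spanned by \<open>\<tau>\<close> contains exactly one matrix with bottom-left entry 0.
  The quotient of the centralizer of \<open>\<tau>\<close> by this line is realized on these representatives;
  \<open>coset_rep \<tau> M\<close> stands for the coset of \<open>M\<close>.\<close>

definition bottom_left :: "('n::finite) ext qmat \<Rightarrow> real" where
  "bottom_left M = qre (M $ ix_last $ ix_first)"

definition coset_rep :: "('n::finite) ext qmat \<Rightarrow> 'n ext qmat \<Rightarrow> 'n ext qmat" where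
  "coset_rep \<tau> M = M - bottom_left M *\<^sub>R \<tau>"

lemma linear_bottom_left: "linear bottom_left"
  by (rule linearI)
    (simp_all add: bottom_left_def plus_quat_def scaleR_quat_def)

lemma linear_coset_rep: "linear (coset_rep \<tau>)"
  by (rule linearI)
    (simp_all add: coset_rep_def linear_add[OF linear_bottom_left]
      linear_scale[OF linear_bottom_left] algebra_simps)

lemma coset_rep_eq_iff:
  assumes "\<tau> $ ix_last $ ix_first = 1"
  shows "coset_rep \<tau> M = coset_rep \<tau> M' \<longleftrightarrow> M - M' \<in> span {\<tau>}"
proof
  assume "coset_rep \<tau> M = coset_rep \<tau> M'"
  then have "M - M' = (bottom_left M - bottom_left M') *\<^sub>R \<tau>"
    by (simp add: coset_rep_def algebra_simps)
  then show "M - M' \<in> span {\<tau>}"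
    by (simp add: span_base span_scale)
next
  assume "M - M' \<in> span {\<tau>}"
  then obtain r where "M - M' = r *\<^sub>R \<tau>"
    unfolding span_singleton by blast
  then have r: "M = M' + r *\<^sub>R \<tau>"
    by (simp add: algebra_simps)
  have "bottom_left \<tau> = 1"
    using assms by (simp add: bottom_left_def one_quat_def)
  then show "coset_rep \<tau> M = coset_rep \<tau> M'"
    by (simp add: r coset_rep_def linear_add[OF linear_bottom_left]
      linear_scale[OF linear_bottom_left] algebra_simps)
qed

definition quot_bracket ::
  "('n::finite) ext qmat \<Rightarrow> 'n ext qmat \<Rightarrow> 'n ext qmat \<Rightarrow> 'n ext qmat" where
  "quot_bracket \<tau> M M' = coset_rep \<tau> (comm M M')"

definition m_elem :: "('n::finite) qmat \<Rightarrow> 'n ext qmat \<Rightarrow> quat ^ 'n \<Rightarrow> 'n ext qmat" where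
  "m_elem J \<tau> X =
     (let a = \<tau> $ ix_first $ ix_first; A = mid_block \<tau>; Y = A *v X - rmult X a
      in block3 0 (star_row Y J) 0  X 0 Y  0 (- star_row X J) 0)"

definition tau_m :: "('n::finite) qmat \<Rightarrow> 'n ext qmat \<Rightarrow> 'n ext qmat set" where
  "tau_m J \<tau> = range (m_elem J \<tau>)"

definition tau_l :: "('n::finite) qmat \<Rightarrow> 'n ext qmat \<Rightarrow> 'n ext qmat set" where
  "tau_l J \<tau> = bracket_span (quot_bracket \<tau>) (tau_m J \<tau>)"

definition tau_tila :: "('n::finite) qmat \<Rightarrow> 'n ext qmat \<Rightarrow> 'n ext qmat qsH_data" where
  "tau_tila J \<tau> =
     \<lparr> alg = {u + v | u v. u \<in> tau_m J \<tau> \<and> v \<in> tau_l J \<tau>},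
       brk = quot_bracket \<tau>,
       invol = (\<lambda>M. THE M'. \<exists>u\<in>tau_m J \<tau>. \<exists>v\<in>tau_l J \<tau>. M = u + v \<and> M' = - u + v),
       qstr = {\<lambda>M\<in>tau_m J \<tau>. m_elem J \<tau> (rmult (first_col M) q) | q. qre q = 0},
       sform = (\<lambda>M M'. bottom_left (comm M M')) \<rparr>"

section \<open>The list of matrices\<close>

text \<open>Blocks of matrices of size $n$ are described by the positions 0, ..., $n-1$ of
  rows and columns.\<close>

definition mat_from :: "(nat \<Rightarrow> nat \<Rightarrow> quat) \<Rightarrow> ('n::finite) qmat" where
  "mat_from f = (\<chi> i k. f (to_nat_on (UNIV :: 'n set) i) (to_nat_on (UNIV :: 'n set) k))"

text \<open>The matrix with rows $(0,0,B)$, $(0,x,0)$, $(C,0,0)$ in blocks of sizes $N$, $h-N$, $N$,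
  where \<open>h\<close> is either \<open>N\<close> (no middle block) or \<open>N + 1\<close>.\<close>

definition anti_block ::
  "nat \<Rightarrow> nat \<Rightarrow> (nat \<Rightarrow> nat \<Rightarrow> quat) \<Rightarrow> quat \<Rightarrow> (nat \<Rightarrow> nat \<Rightarrow> quat) \<Rightarrow> nat \<Rightarrow> nat \<Rightarrow> quat" where
  "anti_block N h B x C r s =
     (if r < N \<and> h \<le> s then B r (s - h)
      else if N \<le> r \<and> r < h \<and> N \<le> s \<and> s < h then x
      else if h \<le> r \<and> s < N then C (r - h) s
      else 0)"

definition diag_of :: "(nat \<Rightarrow> quat) \<Rightarrow> nat \<Rightarrow> nat \<Rightarrow> quat" where
  "diag_of f r s = (if r = s then f r else 0)"

definition C_blk :: "nat \<Rightarrow> nat \<Rightarrow> nat \<Rightarrow> quat" where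
  "C_blk p = diag_of (\<lambda>r. if r < p then 1 else 0)"

text \<open>The position of the identity block in $B_q$ depends on \<open>p\<close> as well.\<close>

definition B_blk :: "nat \<Rightarrow> nat \<Rightarrow> nat \<Rightarrow> nat \<Rightarrow> quat" where
  "B_blk p q = diag_of (\<lambda>r. if p \<le> r \<and> r < p + q then 1 else 0)"

definition form_split :: "nat \<Rightarrow> nat \<Rightarrow> ('n::finite) qmat" where
  "form_split N h =
     mat_from (anti_block N h (diag_of (\<lambda>_. 1)) quat_j (diag_of (\<lambda>_. - 1)))"

definition form_diag :: "('n::finite) qmat" where
  "form_diag = mat_from (diag_of (\<lambda>_. quat_j))"

definition A_nilp :: "nat \<Rightarrow> nat \<Rightarrow> nat \<Rightarrow> nat \<Rightarrow> ('n::finite) qmat" where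
  "A_nilp N h p q = mat_from (anti_block N h (B_blk p q) 0 (C_blk p))"

definition I_sig :: "nat \<Rightarrow> nat \<Rightarrow> quat" where
  "I_sig p r = (if r < p then 1 else - 1)"

definition tau_mat :: "quat \<Rightarrow> ('n::finite) qmat \<Rightarrow> real \<Rightarrow> 'n ext qmat" where
  "tau_mat a A d = block3 a 0 (of_real d)  0 A 0  1 0 a"

text \<open>The listed matrices, each paired with the form $\mathbb{j}$ used in the model
  of $\mathfrak{so}^*(2n+4)$ to which it belongs.\<close>

definition listed_i :: "(('n::finite) qmat \<times> 'n ext qmat) set" where
  "listed_i = {(form_split N N, tau_mat 0 (A_nilp N N p q) 0) | N p q.
     CARD('n) = 2 * N \<and> p + q \<le> N}"

definition listed_ii :: "(('n::finite) qmat \<times> 'n ext qmat) set" where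
  "listed_ii = {(form_split N (N + 1), tau_mat 0 (A_nilp N (N + 1) p q) 0) | N p q.
     CARD('n) = 2 * N + 1 \<and> p + q \<le> N}"

definition listed_iii :: "(('n::finite) qmat \<times> 'n ext qmat) set" where
  "listed_iii = {(form_diag, tau_mat quat_i 0 (- 1))}"

definition listed_iv :: "(('n::finite) qmat \<times> 'n ext qmat) set" where
  "listed_iv = {(form_diag, tau_mat 0 (mat_from (diag_of (\<lambda>r. quat_j * I_sig p r))) (- 1)) | p q.
     p + q = CARD('n)}"

definition listed_v :: "(('n::finite) qmat \<times> 'n ext qmat) set" where
  "listed_v = {(form_split N N, tau_mat 0 (mat_from (diag_of (I_sig N))) 1) | N.
     CARD('n) = 2 * N}"

definition listed :: "(('n::finite) qmat \<times> 'n ext qmat) set" where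
  "listed = listed_i \<union> listed_ii \<union> listed_iii \<union> listed_iv \<union> listed_v"

end

theory Submission
  imports Defs
begin

text \<open>The odd part \<open>m\<close> is a right quaternionic vector space with a skew-Hermitian form \<open>h\<close>, the
  scalar 2-form being \<open>- 2 Re h\<close>, and a qs-H tiLa is determined by \<open>m\<close> with its triple product
  \<open>[[x, y], z]\<close>. This triple product is an algebraic curvature tensor with values in
  $\mathfrak{so}^*(2n)\oplus\mathfrak{sp}(1)$, and for $n>1$ every such tensor has the form \<open>RD D\<close>
  for a unique operator \<open>D x = A x - x a\<close> with \<open>A\<close> in $\mathfrak{so}^*(2n)$ and \<open>a\<close> imaginary.
  The tensor annihilates itself as a derivation by the Jacobi identity, so the operators \<open>R x y\<close>
  commute with \<open>D\<close>; this leaves only \<open>A = 0\<close>, or \<open>a = 0\<close> and \<open>A\<^sup>2 = d\<close> for a real number \<open>d\<close>. After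
  rescaling the form, \<open>d\<close> is 0, 1 or -1, and the normal forms of \<open>A\<close> relative to \<open>h\<close> give the
  listed matrices. Conversely an isomorphism intertwines the operators \<open>D\<close> up to scale, so the sign
  of \<open>d\<close>, the commutation of \<open>D\<close> with scalars and the signature of the real quadratic form
  \<open>Re h(x, D x)\<close> are invariants, and they separate the list.\<close>

section \<open>The quaternions as a Euclidean space\<close>

text \<open>The so* part \<open>P\<close> and the sp(1) part \<open>s\<close> of the triple product
  are coupled only by the Bianchi identity, so everything about them is extracted from it. For an
  imaginary unit I the identity is projected to the component antilinear in two arguments and linear
  in the third; there only the failure of \<open>P\<close> to be I-invariant survives, against terms
  in \<open>s\<close>. Separating these terms needs basis vectors that do not occur in the other
  arguments, and this is where n > 1 enters. Subtracting the solutions that belong to a and to A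
  leaves an invariant \<open>P\<close> with \<open>s = 0\<close>, which a
  symmetric-versus-alternating argument kills. A change of scale multiplies h by \<nu> and D by
  1/\<nu>. Hence the square of D scales by a positive factor, while Re h(x, D x) does not scale at
  all: a one-parameter family sees only the sign of d, but the whole signature. Passing to the odd
  part loses nothing, because l acts faithfully on it. Finally, classes are formed inside one fixed
  real vector space, whereas the models consist of matrices; the infinite dimension of that space
  gives room for a copy of each model.\<close>

definition quat_k :: quat where "quat_k = Quat 0 0 0 1"

lemma quat_sel_simps [simp]:
  "qre 0 = 0" "qim1 0 = 0" "qim2 0 = 0" "qim3 0 = 0"
  "qre 1 = 1" "qim1 1 = 0" "qim2 1 = 0" "qim3 1 = 0"
  "qre (x + y) = qre x + qre y" "qim1 (x + y) = qim1 x + qim1 y"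
  "qim2 (x + y) = qim2 x + qim2 y" "qim3 (x + y) = qim3 x + qim3 y"
  "qre (- x) = - qre x" "qim1 (- x) = - qim1 x" "qim2 (- x) = - qim2 x" "qim3 (- x) = - qim3 x"
  "qre (x - y) = qre x - qre y" "qim1 (x - y) = qim1 x - qim1 y"
  "qim2 (x - y) = qim2 x - qim2 y" "qim3 (x - y) = qim3 x - qim3 y"
  "qre (r *\<^sub>R x) = r * qre x" "qim1 (r *\<^sub>R x) = r * qim1 x"
  "qim2 (r *\<^sub>R x) = r * qim2 x" "qim3 (r *\<^sub>R x) = r * qim3 x"
  "qre (of_real r) = r" "qim1 (of_real r) = 0" "qim2 (of_real r) = 0" "qim3 (of_real r) = 0"
  "qre quat_i = 0" "qim1 quat_i = 1" "qim2 quat_i = 0" "qim3 quat_i = 0"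
  "qre quat_j = 0" "qim1 quat_j = 0" "qim2 quat_j = 1" "qim3 quat_j = 0"
  "qre quat_k = 0" "qim1 quat_k = 0" "qim2 quat_k = 0" "qim3 quat_k = 1"
  "qre (qconj x) = qre x" "qim1 (qconj x) = - qim1 x"
  "qim2 (qconj x) = - qim2 x" "qim3 (qconj x) = - qim3 x"
  by (simp_all add: zero_quat_def one_quat_def plus_quat_def uminus_quat_def minus_quat_def
      scaleR_quat_def quat_i_def quat_j_def quat_k_def qconj_def of_real_def)

lemma quat_sel_mult:
  "qre (x * y) = qre x * qre y - qim1 x * qim1 y - qim2 x * qim2 y - qim3 x * qim3 y"
  "qim1 (x * y) = qre x * qim1 y + qim1 x * qre y + qim2 x * qim3 y - qim3 x * qim2 y"
  "qim2 (x * y) = qre x * qim2 y - qim1 x * qim3 y + qim2 x * qre y + qim3 x * qim1 y"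
  "qim3 (x * y) = qre x * qim3 y + qim1 x * qim2 y - qim2 x * qim1 y + qim3 x * qre y"
  by (simp_all add: times_quat_def)

lemma quat_sel_sum:
  "qre (sum f S) = (\<Sum>i\<in>S. qre (f i))"
  "qconj (sum f S) = (\<Sum>i\<in>S. qconj (f i))"
  by (induction S rule: infinite_finite_induct) (simp_all add: quat_eq_iff)

lemma qconj_simps [simp]:
  "qconj (qconj x) = x" "qconj 0 = 0" "qconj 1 = 1"
  "qconj (x + y) = qconj x + qconj y" "qconj (x - y) = qconj x - qconj y"
  "qconj (- x) = - qconj x" "qconj (r *\<^sub>R x) = r *\<^sub>R qconj x" "qconj (of_real r) = of_real r"
  by (simp_all add: quat_eq_iff)

lemma qconj_mult: "qconj (x * y) = qconj y * qconj x"
  by (simp add: quat_eq_iff quat_sel_mult)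

lemma qconj_imag: "qre q = 0 \<Longrightarrow> qconj q = - q"
  by (simp add: quat_eq_iff)

lemma quat_units [simp]:
  "quat_i * quat_i = -1" "quat_j * quat_j = -1" "quat_k * quat_k = -1"
  "quat_i * quat_j = quat_k" "quat_j * quat_k = quat_i" "quat_k * quat_i = quat_j"
  "quat_j * quat_i = - quat_k" "quat_k * quat_j = - quat_i" "quat_i * quat_k = - quat_j"
  "qconj quat_i = - quat_i" "qconj quat_j = - quat_j" "qconj quat_k = - quat_k"
  by (simp_all add: quat_eq_iff quat_sel_mult)

lemma quat_decomp:
  "q = of_real (qre q) + of_real (qim1 q) * quat_i + of_real (qim2 q) * quat_j + of_real (qim3 q) * quat_k"
  by (simp add: quat_eq_iff quat_sel_mult)

lemma of_real_commute: "(of_real r :: quat) * q = q * of_real r"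
  by (simp add: quat_eq_iff quat_sel_mult)

instantiation quat :: real_inner
begin

definition inner_quat_def:
  "inner x y = qre x * qre y + qim1 x * qim1 y + qim2 x * qim2 y + qim3 x * qim3 y"

definition norm_quat_def: "norm (x :: quat) = sqrt (inner x x)"

definition sgn_quat_def: "sgn (x :: quat) = x /\<^sub>R norm x"

definition dist_quat_def: "dist x y = norm (x - y :: quat)"

definition uniformity_quat_def:
  "(uniformity :: (quat \<times> quat) filter) = (INF e\<in>{0 <..}. principal {(x, y). dist x y < e})"

definition open_quat_def:
  "open (U :: quat set) \<longleftrightarrow> (\<forall>x\<in>U. eventually (\<lambda>(x', y). x' = x \<longrightarrow> y \<in> U) uniformity)"

instance
proof
  fix x y z :: quat and r :: real
  show "inner x y = inner y x"
    by (simp add: inner_quat_def mult.commute)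
  show "inner (x + y) z = inner x z + inner y z" "inner (r *\<^sub>R x) y = r * inner x y"
    by (simp_all add: inner_quat_def algebra_simps)
  show "0 \<le> inner x x"
    by (simp add: inner_quat_def)
  show "inner x x = 0 \<longleftrightarrow> x = 0"
    by (auto simp: inner_quat_def quat_eq_iff add_nonneg_eq_0_iff)
qed (rule norm_quat_def sgn_quat_def dist_quat_def uniformity_quat_def open_quat_def)+

end

instantiation quat :: euclidean_space
begin

definition Basis_quat_def: "Basis = {1, quat_i, quat_j, quat_k}"

instance
proof
  show "(Basis :: quat set) \<noteq> {}" "finite (Basis :: quat set)"
    by (simp_all add: Basis_quat_def)
  show "inner u v = (if u = v then 1 else 0)" if "u \<in> Basis" "v \<in> Basis" for u v :: quat
    using that unfolding Basis_quat_def
    by (elim insertE emptyE; simp add: inner_quat_def) (simp_all add: quat_eq_iff)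
  show "(\<forall>u\<in>Basis. inner x u = 0) \<longleftrightarrow> x = 0" for x :: quat
    unfolding Basis_quat_def by (simp add: inner_quat_def) (simp add: quat_eq_iff)
qed

end

lemma DIM_quat [simp]: "DIM(quat) = 4"
proof -
  have "distinct [1, quat_i, quat_j, quat_k]"
    by (simp add: quat_eq_iff)
  from distinct_card[OF this] show ?thesis
    by (simp add: Basis_quat_def)
qed

definition qnorm2 :: "quat \<Rightarrow> real" where
  "qnorm2 q = (qre q)\<^sup>2 + (qim1 q)\<^sup>2 + (qim2 q)\<^sup>2 + (qim3 q)\<^sup>2"

lemma qnorm2_pos: "q \<noteq> 0 \<Longrightarrow> qnorm2 q > 0"
  using inner_gt_zero_iff[of q] by (simp add: qnorm2_def inner_quat_def power2_eq_square)

lemma qnorm2_nonneg: "qnorm2 q \<ge> 0"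
  by (simp add: qnorm2_def)

lemma qconj_mult_self: "qconj q * q = of_real (qnorm2 q)" "q * qconj q = of_real (qnorm2 q)"
  by (simp_all add: quat_eq_iff quat_sel_mult qnorm2_def power2_eq_square)

lemma quat_inverse_exists:
  assumes "q \<noteq> (0::quat)" obtains p where "p * q = 1" "q * p = 1" "p \<noteq> 0"
proof
  let ?p = "(1 / qnorm2 q) *\<^sub>R qconj q"
  show "?p * q = 1" "q * ?p = 1"
    using qnorm2_pos[OF assms] qconj_mult_self[of q] by (simp_all add: of_real_def)
  then show "?p \<noteq> 0" by auto
qed

lemma quat_no_zero_div: "(p::quat) * q = 0 \<longleftrightarrow> p = 0 \<or> q = 0"
  by (metis mult.assoc mult_1_left mult_zero_left mult_zero_right quat_inverse_exists)

lemma imag_square: "qre u = 0 \<Longrightarrow> u * u = - of_real (qnorm2 u)"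
  by (simp add: quat_eq_iff quat_sel_mult qnorm2_def power2_eq_square)

text \<open>For unit imaginary \<open>s \<noteq> -u\<close> the element \<open>s + u\<close> conjugates \<open>s\<close> to \<open>u\<close>.\<close>

lemma imag_conjugate:
  assumes s: "qre s = 0" "s \<noteq> 0" and u: "qre u = 0" "u * u = -1"
  obtains q where "qconj q * s * q = u" "q \<noteq> 0"
proof -
  define m where "m = sqrt (qnorm2 s)"
  have m: "m > 0" using qnorm2_pos[OF s(2)] by (simp add: m_def)
  define v where "v = (1 / m) *\<^sub>R s"
  have v: "qre v = 0" "v * v = -1" "s = m *\<^sub>R v"
    using m s imag_square[OF s(1)] by (simp_all add: v_def m_def of_real_def qnorm2_nonneg)
  have "\<exists>w. w \<noteq> 0 \<and> v * w = w * u"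
  proof (cases "v = - u")
    case False
    have "v * (v + u) = (v + u) * u"
      using v u by (simp add: algebra_simps)
    then show ?thesis using False by (metis add_eq_0_iff2)
  next
    case True
    \<comment> \<open>For v = -u the sum degenerates, but every nonzero imaginary t anticommuting
      with v serves as w. A quarter turn of the (i, j) component of v is such a t; if it vanishes, v
      is a multiple of k and t = i does.\<close>
    have *: "\<exists>w. w \<noteq> 0 \<and> v * w = w * u" if "qre t = 0" "v * t = - (t * v)" "t \<noteq> 0" for t
      using that True by (intro exI[of _ t]) auto
    have "Quat 0 (qim2 v) (- qim1 v) 0 \<noteq> 0 \<or> quat_i \<noteq> 0 \<and> qim1 v = 0"
      by (auto simp: quat_eq_iff)
    then show ?thesis
    proof
      assume "Quat 0 (qim2 v) (- qim1 v) 0 \<noteq> 0"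
      then show ?thesis
        using v(1) by (intro *[of "Quat 0 (qim2 v) (- qim1 v) 0"]) (auto simp: quat_eq_iff quat_sel_mult)
    next
      assume "quat_i \<noteq> 0 \<and> qim1 v = 0"
      then show ?thesis
        using v(1) by (intro *[of quat_i]) (auto simp: quat_eq_iff quat_sel_mult)
    qed
  qed
  then obtain w where w: "w \<noteq> 0" "v * w = w * u" by blast
  have nw: "qnorm2 w > 0" by (rule qnorm2_pos[OF w(1)])
  \<comment> \<open>Conjugating s = m v by c w yields u times the real number
    \<open>c * c * m * qnorm2 w\<close>; this c makes that number 1.\<close>
  define c where "c = 1 / sqrt (m * qnorm2 w)"
  have c: "c * c * m * qnorm2 w = 1" "c \<noteq> 0"
  proof -
    have "c * c = 1 / (m * qnorm2 w)" using m nw by (simp add: c_def)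
    then show "c * c * m * qnorm2 w = 1" using m nw by simp
    show "c \<noteq> 0" using m nw by (simp add: c_def)
  qed
  have "qconj (c *\<^sub>R w) * s * (c *\<^sub>R w) = (c * c * m) *\<^sub>R (qconj w * (v * w))"
    by (simp add: v(3) mult.assoc)
  also have "\<dots> = (c * c * m) *\<^sub>R ((qconj w * w) * u)"
    by (simp add: w(2) mult.assoc)
  also have "\<dots> = (c * c * m * qnorm2 w) *\<^sub>R u"
    by (simp add: qconj_mult_self of_real_def)
  also have "\<dots> = u" using c by simp
  finally show ?thesis
    using that[of "c *\<^sub>R w"] c w by auto
qed

section \<open>Skew-Hermitian forms on quaternionic vector spaces\<close>

locale qmodule =
  fixes act :: "'v::euclidean_space \<Rightarrow> quat \<Rightarrow> 'v" (infixl "\<cdot>" 72)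
  assumes act_add_left: "(x + y) \<cdot> q = x \<cdot> q + y \<cdot> q"
    and act_add_right: "x \<cdot> (p + q) = x \<cdot> p + x \<cdot> q"
    and act_mult: "x \<cdot> (p * q) = x \<cdot> p \<cdot> q"
    and act_of_real: "x \<cdot> of_real r = r *\<^sub>R x"
begin

lemma act_1 [simp]: "x \<cdot> 1 = x"
  using act_of_real[of x 1] by simp

lemma act_0_right [simp]: "x \<cdot> 0 = 0"
  using act_of_real[of x 0] by simp

lemma act_minus_right: "x \<cdot> (- q) = - (x \<cdot> q)"
  using act_add_right[of x q "- q"] by (simp add: eq_neg_iff_add_eq_0 add.commute)

lemma act_diff_right: "x \<cdot> (p - q) = x \<cdot> p - x \<cdot> q"
  using act_add_right[of x p "- q"] by (simp add: act_minus_right)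

lemma act_0_left [simp]: "0 \<cdot> q = 0"
  using act_add_left[of 0 0 q] by simp

lemma act_minus_left: "(- x) \<cdot> q = - (x \<cdot> q)"
  using act_add_left[of x "- x" q] by (simp add: eq_neg_iff_add_eq_0 add.commute)

lemma act_diff_left: "(x - y) \<cdot> q = x \<cdot> q - y \<cdot> q"
  using act_add_left[of x "- y" q] by (simp add: act_minus_left)

lemma scaleR_act: "r *\<^sub>R x = x \<cdot> of_real r"
  by (simp add: act_of_real)

lemma act_scaleR_left: "(r *\<^sub>R x) \<cdot> q = r *\<^sub>R (x \<cdot> q)"
  by (metis act_mult act_of_real of_real_commute)

lemma act_scaleR_right: "x \<cdot> (r *\<^sub>R q) = r *\<^sub>R (x \<cdot> q)"
  by (metis act_mult act_of_real of_real_commute scaleR_conv_of_real)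

lemma act_sum_left: "(\<Sum>i\<in>S. f i) \<cdot> q = (\<Sum>i\<in>S. f i \<cdot> q)"
  by (induction S rule: infinite_finite_induct) (simp_all add: act_add_left)

lemmas act_linear = act_add_left act_add_right act_minus_left act_minus_right
  act_diff_left act_diff_right act_scaleR_left act_scaleR_right

lemma linear_act_right: "linear (\<lambda>q. x \<cdot> q)"
  by (rule linearI) (simp_all add: act_linear)

lemma linear_act_left: "linear (\<lambda>x. x \<cdot> q)"
  by (rule linearI) (simp_all add: act_linear)

lemma act_cancel: "q \<noteq> 0 \<Longrightarrow> x \<cdot> q = 0 \<longleftrightarrow> x = 0"
  by (metis act_0_left act_1 act_mult quat_inverse_exists)

lemma act_eq_0_iff: "x \<cdot> q = 0 \<longleftrightarrow> x = 0 \<or> q = 0"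
  using act_cancel by auto

definition submodule :: "'v set \<Rightarrow> bool" where
  "submodule W \<longleftrightarrow> subspace W \<and> (\<forall>x\<in>W. \<forall>q. x \<cdot> q \<in> W)"

lemma submodule_UNIV: "submodule UNIV"
  by (simp add: submodule_def)

end

text \<open>Conjugate linearity in the first slot is the convention that fits a right module.
  Skewness makes every \<open>h x x\<close> imaginary and Re h a real 2-form; Re h in turn
  determines h, through the real parts of \<open>h x (y \<cdot> q)\<close>.\<close>

locale qform = qmodule +
  fixes h :: "'a \<Rightarrow> 'a \<Rightarrow> quat"
  assumes h_add_left: "h (x + y) z = h x z + h y z"
    and h_act: "h (x \<cdot> p) (y \<cdot> q) = qconj p * h x y * q"
    and h_skew: "h y x = - qconj (h x y)"
    and h_nondeg: "(\<And>y. h x y = 0) \<Longrightarrow> x = 0"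
begin

lemma h_add_right: "h x (y + z) = h x y + h x z"
  by (metis h_add_left h_skew minus_add_distrib qconj_simps(4))

lemma h_act_left: "h (x \<cdot> p) y = qconj p * h x y"
  using h_act[of x p y 1] by simp

lemma h_act_right: "h x (y \<cdot> q) = h x y * q"
  using h_act[of x 1 y q] by simp

lemma h_0 [simp]: "h 0 y = 0" "h x 0 = 0"
  using h_act_left[of 0 0 y] h_act_right[of x 0 0] by simp_all

lemma h_minus: "h (- x) y = - h x y" "h x (- y) = - h x y"
  using h_add_left[of x "- x" y] h_add_right[of x y "- y"]
  by (simp_all add: eq_neg_iff_add_eq_0 add.commute)

lemma h_diff: "h (x - y) z = h x z - h y z" "h x (y - z) = h x y - h x z"
  using h_add_left[of x "- y" z] h_add_right[of x y "- z"] by (simp_all add: h_minus)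

lemma h_scaleR: "h (r *\<^sub>R x) y = r *\<^sub>R h x y" "h x (r *\<^sub>R y) = r *\<^sub>R h x y"
  unfolding scaleR_act[of r x] scaleR_act[of r y] h_act_left h_act_right
  by (simp_all add: scaleR_conv_of_real of_real_commute)

lemma h_sum: "h (\<Sum>i\<in>S. f i) y = (\<Sum>i\<in>S. h (f i) y)" "h x (\<Sum>i\<in>S. f i) = (\<Sum>i\<in>S. h x (f i))"
  by (induction S rule: infinite_finite_induct) (simp_all add: h_add_left h_add_right)

lemmas h_linear = h_add_left h_add_right h_minus h_diff h_scaleR

lemma h_self_imag: "qre (h x x) = 0"
  using h_skew[of x x] by (simp add: quat_eq_iff)

lemma h_eqI: "(\<And>w. h x w = h y w) \<Longrightarrow> x = y"
  using h_nondeg[of "x - y"] by (simp add: h_linear)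

lemma qre_h_act: "qre (h (x \<cdot> p) (y \<cdot> p)) = qnorm2 p * qre (h x y)"
  unfolding h_act by (simp add: quat_sel_mult qnorm2_def power2_eq_square algebra_simps)

definition nondeg :: "'a set \<Rightarrow> bool" where
  "nondeg W \<longleftrightarrow> (\<forall>x\<in>W. (\<forall>y\<in>W. h x y = 0) \<longrightarrow> x = 0)"

definition perp :: "'a set \<Rightarrow> 'a set" where
  "perp U = {w. \<forall>u\<in>U. h u w = 0}"

lemma nondeg_UNIV: "nondeg UNIV"
  using h_nondeg by (auto simp: nondeg_def)

lemma submodule_perp: "submodule W \<Longrightarrow> submodule (W \<inter> perp U)"
  by (auto simp: submodule_def perp_def subspace_def h_linear h_act_right)

text \<open>The projection is a hypothesis, so that lines and hyperbolic planes are covered alike.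
  Nondegeneracy passes to the complement because a vector orthogonal to the complement is, lying in
  \<open>perp U\<close>, orthogonal to all of W.\<close>

lemma split_off:
  assumes W: "submodule W" "nondeg W" and U: "submodule U" "U \<subseteq> W"
    and proj: "\<And>w. w \<in> W \<Longrightarrow> \<exists>u\<in>U. \<forall>v\<in>U. h v (w - u) = 0"
    and ndU: "\<And>u. u \<in> U \<Longrightarrow> (\<forall>v\<in>U. h v u = 0) \<Longrightarrow> u = 0"
  shows "submodule (W \<inter> perp U)" "nondeg (W \<inter> perp U)" "dim W = dim U + dim (W \<inter> perp U)"
    "W \<subseteq> span (U \<union> (W \<inter> perp U))"
proof -
  show sub: "submodule (W \<inter> perp U)" by (rule submodule_perp[OF W(1)])
  have sum: "\<exists>u\<in>U. \<exists>v\<in>W \<inter> perp U. w = u + v" if "w \<in> W" for w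
  proof -
    obtain u where u: "u \<in> U" "\<forall>v\<in>U. h v (w - u) = 0" using proj[OF \<open>w \<in> W\<close>] by blast
    moreover have "w - u \<in> W" using that u U W(1) by (auto simp: submodule_def subspace_diff)
    ultimately show ?thesis by (intro bexI[of _ u] bexI[of _ "w - u"]) (auto simp: perp_def)
  qed
  show "nondeg (W \<inter> perp U)"
    unfolding nondeg_def
  proof (intro ballI impI)
    fix x assume x: "x \<in> W \<inter> perp U" and x0: "\<forall>y\<in>W \<inter> perp U. h x y = 0"
    have "h x y = 0" if "y \<in> W" for y
    proof -
      obtain u v where uv: "u \<in> U" "v \<in> W \<inter> perp U" "y = u + v" using sum[OF \<open>y \<in> W\<close>] by blast
      have "h x u = 0" using x uv(1) h_skew[of x u] by (auto simp: perp_def)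
      then show ?thesis using uv x0 by (simp add: h_linear)
    qed
    then show "x = 0" using W(2) x by (auto simp: nondeg_def)
  qed
  have int: "U \<inter> (W \<inter> perp U) = {0}"
    using ndU U(1) W(1) by (auto simp: perp_def submodule_def subspace_0)
  have eq: "{x + y |x y. x \<in> U \<and> y \<in> W \<inter> perp U} = W"
    using sum U W(1) by (fastforce simp: submodule_def intro: subspace_add)
  show "dim W = dim U + dim (W \<inter> perp U)"
    using dim_sums_Int[of U "W \<inter> perp U"] sub U(1) int eq by (simp add: submodule_def)
  show "W \<subseteq> span (U \<union> (W \<inter> perp U))"
  proof
    fix w assume "w \<in> W"
    then obtain u v where "u \<in> U" "v \<in> W \<inter> perp U" "w = u + v" using sum by blast
    then show "w \<in> span (U \<union> (W \<inter> perp U))" by (auto intro!: span_add intro: span_base)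
  qed
qed

lemma split_single:
  assumes W: "submodule W" "nondeg W" and e: "e \<in> W" "h e e = c" "c \<noteq> 0"
  defines "U \<equiv> range (\<lambda>q. e \<cdot> q)"
  shows "submodule (W \<inter> perp U)" "nondeg (W \<inter> perp U)" "dim W = 4 + dim (W \<inter> perp U)"
    "W \<subseteq> span (U \<union> (W \<inter> perp U))"
proof -
  obtain c' where c': "c' * c = 1" "c * c' = 1" using quat_inverse_exists[OF e(3)] by blast
  have U: "submodule U"
    by (auto simp: U_def submodule_def act_mult[symmetric]
        intro!: linear_subspace_image[OF linear_act_right, of UNIV])
  have UW: "U \<subseteq> W" using W e by (auto simp: U_def submodule_def)
  have nd: "u = 0" if "u \<in> U" "\<forall>v\<in>U. h v u = 0" for u
  proof -
    obtain q where q: "u = e \<cdot> q" using \<open>u \<in> U\<close> by (auto simp: U_def)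
    have "h (e \<cdot> 1) u = 0" using that unfolding U_def by blast
    then show ?thesis using e by (simp add: q h_act_right quat_no_zero_div)
  qed
  have cc: "c * (c' * q) = q" for q
    using c'(2) by (metis mult.assoc mult_1_left)
  \<comment> \<open>The multiple of e whose pairing with e is \<open>c * c' * h e w\<close>, that is
    \<open>h e w\<close>.\<close>
  have pr: "\<exists>u\<in>U. \<forall>v\<in>U. h v (w - u) = 0" for w
    by (intro bexI[of _ "e \<cdot> (c' * h e w)"])
       (auto simp: U_def h_linear h_act_left h_act_right e(2) cc mult.assoc)
  note split_off[OF W U UW pr nd]
  moreover have "e \<noteq> 0" using e by auto
  then have "dim U = 4"
    using dim_image_eq[OF linear_act_right, of e UNIV] unfolding U_def
    by (simp add: linear_injective_0[OF linear_act_right] act_eq_0_iff)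
  ultimately show "submodule (W \<inter> perp U)" "nondeg (W \<inter> perp U)" "dim W = 4 + dim (W \<inter> perp U)"
    "W \<subseteq> span (U \<union> (W \<inter> perp U))" by auto
qed

definition hyp_span :: "'a \<times> 'a \<Rightarrow> 'a set" where
  "hyp_span = (\<lambda>(e, f). {e \<cdot> p + f \<cdot> q |p q. True})"

definition hyp_pair :: "'a \<times> 'a \<Rightarrow> bool" where
  "hyp_pair = (\<lambda>(e, f). h e e = 0 \<and> h f f = 0 \<and> h e f = 1)"

lemma fst_hyp_span: "fst b \<in> hyp_span b"
proof -
  have "fst b = fst b \<cdot> 1 + snd b \<cdot> 0" by simp
  then show ?thesis unfolding hyp_span_def case_prod_beta by blast
qed

lemma snd_hyp_span: "snd b \<in> hyp_span b"
proof -
  have "snd b = fst b \<cdot> 0 + snd b \<cdot> 1" by simp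
  then show ?thesis unfolding hyp_span_def case_prod_beta by blast
qed

lemma split_pair:
  assumes W: "submodule W" "nondeg W" and b: "fst b \<in> W" "snd b \<in> W" "hyp_pair b"
  defines "U \<equiv> hyp_span b"
  shows "submodule (W \<inter> perp U)" "nondeg (W \<inter> perp U)" "dim W = 8 + dim (W \<inter> perp U)"
    "W \<subseteq> span (U \<union> (W \<inter> perp U))"
proof -
  obtain e f where bef: "b = (e, f)" by (cases b)
  have ef: "e \<in> W" "f \<in> W" "h e e = 0" "h f f = 0" "h e f = 1" "h f e = -1"
    using b h_skew[of f e] by (auto simp: bef hyp_pair_def)
  have U: "U = {e \<cdot> p + f \<cdot> q |p q. True}" by (simp add: U_def hyp_span_def bef)
  define T where "T = (\<lambda>(p, q). e \<cdot> p + f \<cdot> q)"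
  have UT: "U = range T" by (auto simp: U T_def)
  have linT: "linear T"
    by (rule linearI) (auto simp: T_def act_linear algebra_simps split: prod.splits)
  have injT: "p = 0 \<and> q = 0" if "e \<cdot> p + f \<cdot> q = 0" for p q
  proof -
    have "h e (e \<cdot> p + f \<cdot> q) = q" "h f (e \<cdot> p + f \<cdot> q) = - p"
      by (simp_all add: h_linear h_act_right ef)
    then show ?thesis using that by simp
  qed
  have Usub: "submodule U"
    unfolding submodule_def
  proof
    show "subspace U" unfolding UT using linear_subspace_image[OF linT, of UNIV] by simp
    show "\<forall>x\<in>U. \<forall>q. x \<cdot> q \<in> U"
    proof (intro ballI allI)
      fix x r assume "x \<in> U"
      then obtain p q where "x = e \<cdot> p + f \<cdot> q" by (auto simp: U)
      then have "x \<cdot> r = e \<cdot> (p * r) + f \<cdot> (q * r)" by (simp add: act_add_left act_mult)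
      then show "x \<cdot> r \<in> U" unfolding U by blast
    qed
  qed
  have UW: "U \<subseteq> W" using W ef by (auto simp: U submodule_def intro!: subspace_add)
  have eU: "e \<in> U" "f \<in> U"
    using fst_hyp_span[of b] snd_hyp_span[of b] by (simp_all add: U_def bef)
  have nd: "u = 0" if u: "u \<in> U" and 0: "\<forall>v\<in>U. h v u = 0" for u
  proof -
    obtain p q where pq: "u = e \<cdot> p + f \<cdot> q" using u by (auto simp: U)
    have "h e u = 0" "h f u = 0" using 0 eU by auto
    then show ?thesis by (simp add: pq h_linear h_act_right ef)
  qed
  \<comment> \<open>The coefficients of w along e and f are read off by pairing with f and e; the
    sign comes from \<open>h f e = -1\<close>.\<close>
  have pr: "\<exists>u\<in>U. \<forall>v\<in>U. h v (w - u) = 0" for w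
  proof (intro bexI[of _ "e \<cdot> (- h f w) + f \<cdot> h e w"] ballI)
    fix v assume "v \<in> U"
    then obtain p q where pq: "v = e \<cdot> p + f \<cdot> q" by (auto simp: U)
    show "h v (w - (e \<cdot> (- h f w) + f \<cdot> h e w)) = 0"
      by (simp add: pq h_linear h_act_left h_act_right ef algebra_simps)
  qed (auto simp: U)
  note split_off[OF W Usub UW pr nd]
  moreover have "dim U = 8"
  proof -
    have "\<forall>x. T x = 0 \<longrightarrow> x = 0" using injT by (simp add: T_def zero_prod_def)
    then have "inj T" by (simp only: linear_injective_0[OF linT])
    then show ?thesis using dim_image_eq[OF linT, of UNIV] unfolding UT by simp
  qed
  ultimately show "submodule (W \<inter> perp U)" "nondeg (W \<inter> perp U)" "dim W = 8 + dim (W \<inter> perp U)"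
    "W \<subseteq> span (U \<union> (W \<inter> perp U))" by auto
qed

text \<open>If h vanishes on the diagonal, polarization and skewness make all values on W real.
  Replacing y by \<open>y \<cdot> quat_i\<close> multiplies a value by i, which is compatible with
  reality only for the value 0.\<close>

lemma exists_anisotropic:
  assumes W: "submodule W" "nondeg W" "W \<noteq> {0}"
  obtains v where "v \<in> W" "h v v \<noteq> 0"
proof (rule ccontr)
  assume contr: "\<not> thesis"
  have sW: "subspace W" using W by (simp add: submodule_def)
  have iso: "h v v = 0" if "v \<in> W" for v using contr that \<open>\<And>v. v \<in> W \<Longrightarrow> h v v \<noteq> 0 \<Longrightarrow> thesis\<close> by blast
  have re: "h x y = of_real (qre (h x y))" if "x \<in> W" "y \<in> W" for x y
  proof -
    have "h (x + y) (x + y) = 0" using that sW by (intro iso subspace_add)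
    then have "h x y = qconj (h x y)" using iso that h_skew[of y x] by (simp add: h_linear)
    then show ?thesis by (simp add: quat_eq_iff)
  qed
  have "h x y = 0" if "x \<in> W" "y \<in> W" for x y
  proof -
    have "y \<cdot> quat_i \<in> W" using that W by (simp add: submodule_def)
    from re[OF that(1) this] re[OF that] show ?thesis
      by (simp add: h_act_right quat_eq_iff quat_sel_mult)
  qed
  then have "x = 0" if "x \<in> W" for x using W(2) that by (auto simp: nondeg_def)
  then show False using W(3) sW by (auto simp: subspace_0)
qed

text \<open>A skew-Hermitian form over the quaternions has no signature: rescaling v by q conjugates
  \<open>h v v\<close>, and by \<open>imag_conjugate\<close> any nonzero imaginary value can be
  moved to the prescribed unit.\<close>

lemma exists_unit:
  assumes W: "submodule W" "nondeg W" "W \<noteq> {0}" and u: "qre u = 0" "u * u = -1"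
  obtains e where "e \<in> W" "h e e = u"
proof -
  obtain v where v: "v \<in> W" "h v v \<noteq> 0" using exists_anisotropic[OF W] by blast
  obtain q where "qconj q * h v v * q = u" using imag_conjugate[OF h_self_imag v(2) u] by blast
  then show ?thesis using that[of "v \<cdot> q"] v W(1) by (auto simp: h_act submodule_def)
qed

definition orthonormal :: "quat \<Rightarrow> 'a set \<Rightarrow> bool" where
  "orthonormal u S \<longleftrightarrow> (\<forall>e\<in>S. \<forall>e'\<in>S. h e e' = (if e = e' then u else 0))"

text \<open>Induction on the dimension, shared by the plain basis theorem (A the identity) and by
  the normal form for a square root of -1. \<open>P\<close> is what is known about A on the chosen
  vectors, enough to keep the orthogonal complement invariant.\<close>

lemma orthonormal_decomposition:
  assumes "submodule W" "nondeg W" "A ` W \<subseteq> W" and u: "u \<noteq> 0"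
    and ex: "\<And>W. submodule W \<Longrightarrow> nondeg W \<Longrightarrow> A ` W \<subseteq> W \<Longrightarrow> W \<noteq> {0} \<Longrightarrow>
       \<exists>e\<in>W. h e e = u \<and> P e"
    and inv: "\<And>e W. h e e = u \<Longrightarrow> P e \<Longrightarrow> A ` W \<subseteq> W \<Longrightarrow>
       A ` (W \<inter> perp (range (\<lambda>q. e \<cdot> q))) \<subseteq> perp (range (\<lambda>q. e \<cdot> q))"
  shows "\<exists>S. finite S \<and> S \<subseteq> W \<and> orthonormal u S \<and> (\<forall>e\<in>S. P e) \<and> dim W = 4 * card S \<and>
     W \<subseteq> span (\<Union>e\<in>S. range (\<lambda>q. e \<cdot> q))"
  using assms(1-3)
proof (induction "dim W" arbitrary: W rule: less_induct)
  case less
  show ?case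
  proof (cases "W = {0}")
    case True
    then show ?thesis by (intro exI[of _ "{}"]) (auto simp: orthonormal_def)
  next
    case False
    obtain e where e: "e \<in> W" "h e e = u" "P e"
      using ex[OF less.prems False] by blast
    define U where "U = range (\<lambda>q. e \<cdot> q)"
    note sp = split_single[OF less.prems(1,2) e(1,2) u, folded U_def]
    have "A ` (W \<inter> perp U) \<subseteq> W \<inter> perp U"
      using inv[OF e(2,3) less.prems(3)] less.prems(3) by (auto simp: U_def)
    from less.hyps[OF _ sp(1,2) this] sp(3) obtain S where
      S: "finite S" "S \<subseteq> W \<inter> perp U" "orthonormal u S" "\<forall>e\<in>S. P e" "dim (W \<inter> perp U) = 4 * card S"
      "W \<inter> perp U \<subseteq> span (\<Union>e\<in>S. range (\<lambda>q. e \<cdot> q))" by auto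
    have eU: "e \<in> U" unfolding U_def by (metis act_1 rangeI)
    have orth: "h e e' = 0" "h e' e = 0" if "e' \<in> S" for e'
      using S(2) that eU h_skew[of e' e] by (auto simp: perp_def)
    have "e \<notin> S" using orth e(2) u by auto
    have "W \<subseteq> span (U \<union> (W \<inter> perp U))" by (rule sp(4))
    also have "\<dots> \<subseteq> span (span (\<Union>e\<in>insert e S. range (\<lambda>q. e \<cdot> q)))"
    proof (rule span_mono)
      have "W \<inter> perp U \<subseteq> span (\<Union>e\<in>insert e S. range (\<lambda>q. e \<cdot> q))"
        by (rule order_trans[OF S(6)]) (auto intro!: span_mono)
      then show "U \<union> (W \<inter> perp U) \<subseteq> span (\<Union>e\<in>insert e S. range (\<lambda>q. e \<cdot> q))"
        by (auto simp: U_def intro!: span_base)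
    qed
    finally have "W \<subseteq> span (\<Union>e\<in>insert e S. range (\<lambda>q. e \<cdot> q))" by (simp add: span_span)
    moreover have "orthonormal u (insert e S)"
      using S(3) orth e(2) \<open>e \<notin> S\<close> by (auto simp: orthonormal_def)
    moreover have "dim W = 4 * card (insert e S)"
      using S(1,5) sp(3) \<open>e \<notin> S\<close> by simp
    moreover have "insert e S \<subseteq> W" "\<forall>e\<in>insert e S. P e" "finite (insert e S)"
      using S(1,2,4) e by auto
    ultimately show ?thesis by (intro exI[of _ "insert e S"] conjI)
  qed
qed

text \<open>\<open>small\<close> is the stopping rule: the zero space if A forces hyperbolic pairs,
  dimension at most 4 if one quaternionic line may be left over. \<open>P\<close> lists the ways in
  which A may act on a pair.\<close>

lemma hyperbolic_decomposition:
  assumes "submodule W" "nondeg W" "A ` W \<subseteq> W"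
    and ex: "\<And>W. submodule W \<Longrightarrow> nondeg W \<Longrightarrow> A ` W \<subseteq> W \<Longrightarrow> \<not> small W \<Longrightarrow>
       \<exists>b. fst b \<in> W \<and> snd b \<in> W \<and> hyp_pair b \<and> P b"
    and inv: "\<And>b. hyp_pair b \<Longrightarrow> P b \<Longrightarrow> A ` perp (hyp_span b) \<subseteq> perp (hyp_span b)"
  shows "\<exists>B W0. finite B \<and> (\<forall>b\<in>B. fst b \<in> W \<and> snd b \<in> W \<and> hyp_pair b \<and> P b) \<and>
     (\<forall>b\<in>B. \<forall>b'\<in>B. b \<noteq> b' \<longrightarrow> hyp_span b' \<subseteq> perp (hyp_span b)) \<and>
     (\<forall>b\<in>B. W0 \<subseteq> perp (hyp_span b)) \<and>
     small W0 \<and> submodule W0 \<and> nondeg W0 \<and> W0 \<subseteq> W \<and> A ` W0 \<subseteq> W0 \<and>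
     dim W = 8 * card B + dim W0 \<and> W \<subseteq> span ((\<Union>b\<in>B. hyp_span b) \<union> W0)"
  using assms(1-3)
proof (induction "dim W" arbitrary: W rule: less_induct)
  case less
  show ?case
  proof (cases "small W")
    case True
    then show ?thesis using less.prems by (intro exI[of _ "{}"] exI[of _ W]) (auto intro: span_base)
  next
    case False
    obtain b where b: "fst b \<in> W" "snd b \<in> W" "hyp_pair b" "P b"
      using ex[OF less.prems False] by blast
    define U where "U = hyp_span b"
    note sp = split_pair[OF less.prems(1,2) b(1-3), folded U_def]
    have "A ` (W \<inter> perp U) \<subseteq> W \<inter> perp U"
      using inv[OF b(3,4)] less.prems(3) by (auto simp: U_def)
    from less.hyps[OF _ sp(1,2) this] sp(3) obtain B W0 where
      B: "finite B" "\<forall>b\<in>B. fst b \<in> W \<inter> perp U \<and> snd b \<in> W \<inter> perp U \<and> hyp_pair b \<and> P b"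
      "\<forall>b\<in>B. \<forall>b'\<in>B. b \<noteq> b' \<longrightarrow> hyp_span b' \<subseteq> perp (hyp_span b)"
      "\<forall>b\<in>B. W0 \<subseteq> perp (hyp_span b)"
      "small W0" "submodule W0" "nondeg W0" "W0 \<subseteq> W \<inter> perp U" "A ` W0 \<subseteq> W0"
      "dim (W \<inter> perp U) = 8 * card B + dim W0"
      "W \<inter> perp U \<subseteq> span ((\<Union>b\<in>B. hyp_span b) \<union> W0)" by auto
    have sub: "hyp_span b' \<subseteq> perp U" if "b' \<in> B" for b'
      using B(2) that sp(1) by (auto simp: hyp_span_def submodule_def perp_def h_linear h_act_right split: prod.splits)
    have sub': "U \<subseteq> perp (hyp_span b')" if "b' \<in> B" for b'
    proof
      fix x assume x: "x \<in> U"
      have "h v x = 0" if "v \<in> hyp_span b'" for v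
        using sub[OF \<open>b' \<in> B\<close>] that x h_skew[of v x] by (auto simp: perp_def)
      then show "x \<in> perp (hyp_span b')" by (simp add: perp_def)
    qed
    have "b \<notin> B"
    proof
      assume "b \<in> B"
      moreover have "snd b \<in> U" "fst b \<in> U" unfolding U_def by (simp_all add: fst_hyp_span snd_hyp_span)
      ultimately have "h (fst b) (snd b) = 0" using B(2) by (auto simp: perp_def)
      then show False using b(3) by (auto simp: hyp_pair_def case_prod_beta)
    qed
    have "W \<subseteq> span (U \<union> (W \<inter> perp U))" by (rule sp(4))
    also have "\<dots> \<subseteq> span (span ((\<Union>b\<in>insert b B. hyp_span b) \<union> W0))"
    proof (rule span_mono)
      have "W \<inter> perp U \<subseteq> span ((\<Union>b\<in>insert b B. hyp_span b) \<union> W0)"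
        by (rule order_trans[OF B(11)]) (auto intro!: span_mono)
      then show "U \<union> (W \<inter> perp U) \<subseteq> span ((\<Union>b\<in>insert b B. hyp_span b) \<union> W0)"
        by (auto simp: U_def intro!: span_base)
    qed
    finally have span: "W \<subseteq> span ((\<Union>b\<in>insert b B. hyp_span b) \<union> W0)" by (simp add: span_span)
    have orth: "\<forall>a\<in>insert b B. \<forall>a'\<in>insert b B. a \<noteq> a' \<longrightarrow> hyp_span a' \<subseteq> perp (hyp_span a)"
      using B(3) sub sub' unfolding U_def by blast
    have "W0 \<subseteq> perp U" "W0 \<subseteq> W" using B(8) by auto
    moreover have "dim W = 8 * card (insert b B) + dim W0"
      using sp(3) B(1,10) \<open>b \<notin> B\<close> by simp
    moreover have "\<forall>a\<in>insert b B. fst a \<in> W \<and> snd a \<in> W \<and> hyp_pair a \<and> P a"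
      using B(2) b by blast
    moreover have "\<forall>a\<in>insert b B. W0 \<subseteq> perp (hyp_span a)"
      using B(4) \<open>W0 \<subseteq> perp U\<close> unfolding U_def by blast
    moreover have "finite (insert b B)" using B(1) by simp
    ultimately show ?thesis
      using B(5,6,7,9) span orth
      by - (rule exI[of _ "insert b B"], rule exI[of _ W0], (rule conjI; assumption?)+)
  qed
qed

end

section \<open>Algebraic curvature tensors\<close>

context qform
begin

lemma orthonormal_basis_exists:
  assumes "qre u = 0" "u * u = -1"
  obtains S where "finite S" "orthonormal u S" "DIM('a) = 4 * card S"
    "span (\<Union>e\<in>S. range (\<lambda>q. e \<cdot> q)) = UNIV"
proof -
  have "u \<noteq> 0" using assms(2) by auto
  have "\<exists>S. finite S \<and> S \<subseteq> UNIV \<and> orthonormal u S \<and> (\<forall>e\<in>S. True) \<and> dim (UNIV::'a set) = 4 * card S \<and>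
     UNIV \<subseteq> span (\<Union>e\<in>S. range (\<lambda>q. e \<cdot> q))"
    by (rule orthonormal_decomposition[of _ id])
       (use submodule_UNIV nondeg_UNIV \<open>u \<noteq> 0\<close> exists_unit[OF _ _ _ assms] in \<open>auto simp: id_def\<close>)
  then show ?thesis using that by auto
qed

lemma linear_eq_on_generators:
  assumes "linear f" "linear g" "span (\<Union>e\<in>S. range (\<lambda>q. e \<cdot> q)) = UNIV"
    and "\<And>e q. e \<in> S \<Longrightarrow> f (e \<cdot> q) = g (e \<cdot> q)"
  shows "f x = g x"
  using linear_eq_on_span[OF assms(1,2), of "\<Union>e\<in>S. range (\<lambda>q. e \<cdot> q)" x] assms(3,4) by auto

lemma linear_h: "linear (\<lambda>x. h x y)" "linear (h x)"
  by (auto intro!: linearI simp: h_linear)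

lemma riesz:
  assumes F: "linear F" "\<And>y q. F (y \<cdot> q) = F y * q"
  obtains v where "\<And>y. h v y = F y"
proof -
  obtain S where S: "finite S" "orthonormal quat_j S" "span (\<Union>e\<in>S. range (\<lambda>q. e \<cdot> q)) = UNIV"
    using orthonormal_basis_exists[of quat_j] by auto
  \<comment> \<open>Since \<open>h e e\<close> is j, the conjugate of the coefficient of e
    contributes \<open>F e * (- quat_j)\<close>, and the remaining j cancels.\<close>
  define v where "v = (\<Sum>e\<in>S. e \<cdot> (quat_j * qconj (F e)))"
  have e: "h v e = F e" if "e \<in> S" for e
  proof -
    have "h v e = (\<Sum>e'\<in>S. if e' = e then F e * (- quat_j) * quat_j else 0)"
      unfolding v_def h_sum
      using S(2) that by (intro sum.cong) (auto simp: orthonormal_def h_act_left qconj_mult)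
    also have "\<dots> = F e" using S(1) that by (simp add: mult.assoc)
    finally show ?thesis .
  qed
  have "h v y = F y" for y
    by (rule linear_eq_on_generators[OF linear_h(2) F(1) S(3)]) (simp add: h_act_right F e)
  then show ?thesis by (rule that)
qed

text \<open>The so* part and the sp(1) part of the operators sending z to
  \<open>P x y z - z \<cdot> s x y\<close>. The last clause is the first Bianchi identity of these
  operators, with the two parts on different sides.\<close>

definition curvature :: "('a \<Rightarrow> 'a \<Rightarrow> 'a \<Rightarrow> 'a) \<Rightarrow> ('a \<Rightarrow> 'a \<Rightarrow> quat) \<Rightarrow> bool" where
  "curvature P s \<longleftrightarrow>
     (\<forall>y z. linear (\<lambda>x. P x y z)) \<and> (\<forall>x y z. P y x z = - P x y z) \<and>
     (\<forall>x y z w. P x y (z + w) = P x y z + P x y w) \<and>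
     (\<forall>x y z q. P x y (z \<cdot> q) = P x y z \<cdot> q) \<and>
     (\<forall>x y z w. h (P x y z) w = - h z (P x y w)) \<and>
     (\<forall>y. linear (\<lambda>x. s x y)) \<and> (\<forall>x y. s y x = - s x y) \<and> (\<forall>x y. qre (s x y) = 0) \<and>
     (\<forall>x y z. P x y z + P y z x + P z x y = z \<cdot> s x y + x \<cdot> s y z + y \<cdot> s z x)"

lemma curvatureD:
  assumes "curvature P s"
  shows "linear (\<lambda>x. P x y z)" "P y x z = - P x y z" "P x y (z + w) = P x y z + P x y w"
    "P x y (z \<cdot> q) = P x y z \<cdot> q" "h (P x y z) w = - h z (P x y w)"
    "linear (\<lambda>x. s x y)" "s y x = - s x y" "qre (s x y) = 0"
    "P x y z + P y z x + P z x y = z \<cdot> s x y + x \<cdot> s y z + y \<cdot> s z x"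
  using assms unfolding curvature_def
  by - (elim conjE, ((erule allE)+, assumption
      | erule allE, erule allE, assumption | erule allE, erule allE, erule allE, assumption
      | erule allE, erule allE, erule allE, erule allE, assumption | erule allE, assumption)[1])+

text \<open>All conditions are linear, so known solutions can be subtracted until only zero
  remains.\<close>

lemma curvature_diff:
  assumes c: "curvature P s" and c': "curvature P' s'"
  shows "curvature (\<lambda>x y z. P x y z - P' x y z) (\<lambda>x y. s x y - s' x y)"
  unfolding curvature_def
proof (intro conjI allI)
  fix x y z w q
  note d = curvatureD[OF c] and d' = curvatureD[OF c']
  show "linear (\<lambda>x. P x y z - P' x y z)" "linear (\<lambda>x. s x y - s' x y)"
    by (intro linear_compose_sub d d')+
  show "P y x z - P' y x z = - (P x y z - P' x y z)" "s y x - s' y x = - (s x y - s' x y)"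
    by (simp_all add: d(2,7)[of x y] d'(2,7)[of x y])
  show "P x y (z + w) - P' x y (z + w) = P x y z - P' x y z + (P x y w - P' x y w)"
    "P x y (z \<cdot> q) - P' x y (z \<cdot> q) = (P x y z - P' x y z) \<cdot> q"
    by (simp_all add: d(3,4) d'(3,4) act_diff_left)
  show "h (P x y z - P' x y z) w = - h z (P x y w - P' x y w)"
    using d(5)[of x y z w] d'(5)[of x y z w] by (simp add: h_diff)
  show "qre (s x y - s' x y) = 0" by (simp add: d(8) d'(8))
  have "P x y z - P' x y z + (P y z x - P' y z x) + (P z x y - P' z x y) =
    (P x y z + P y z x + P z x y) - (P' x y z + P' y z x + P' z x y)" by simp
  also have "\<dots> = z \<cdot> (s x y - s' x y) + x \<cdot> (s y z - s' y z) + y \<cdot> (s z x - s' z x)"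
    unfolding d(9) d'(9) by (simp add: act_diff_right)
  finally show "P x y z - P' x y z + (P y z x - P' y z x) + (P z x y - P' z x y) = \<dots>" .
qed

definition scalar_P :: "quat \<Rightarrow> 'a \<Rightarrow> 'a \<Rightarrow> 'a \<Rightarrow> 'a" where
  "scalar_P a x y z = x \<cdot> (a * h y z) - y \<cdot> (a * h x z)"

definition scalar_s :: "quat \<Rightarrow> 'a \<Rightarrow> 'a \<Rightarrow> quat" where
  "scalar_s a x y = (2 * qre (h x y)) *\<^sub>R a"

lemma curvature_scalar:
  assumes a: "qre a = 0"
  shows "curvature (scalar_P a) (scalar_s a)"
  unfolding curvature_def
proof (intro conjI allI)
  fix x y z w :: 'a and q
  show "linear (\<lambda>x. scalar_P a x y z)"
    by (rule linearI) (simp_all add: scalar_P_def act_linear h_linear algebra_simps)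
  show "scalar_P a y x z = - scalar_P a x y z" by (simp add: scalar_P_def)
  show "scalar_P a x y (z + w) = scalar_P a x y z + scalar_P a x y w"
    by (simp add: scalar_P_def act_linear h_linear algebra_simps)
  show "scalar_P a x y (z \<cdot> q) = scalar_P a x y z \<cdot> q"
    by (simp add: scalar_P_def act_linear h_act_right act_mult)
  show "h (scalar_P a x y z) w = - h z (scalar_P a x y w)"
    using h_skew[of y z] h_skew[of x z]
    by (simp add: scalar_P_def h_linear h_act_left h_act_right qconj_mult qconj_imag[OF a] mult.assoc)
  show "linear (\<lambda>x. scalar_s a x y)"
    by (rule linearI) (simp_all add: scalar_s_def h_linear algebra_simps)
  show "scalar_s a y x = - scalar_s a x y"
    using h_skew[of x y] by (simp add: scalar_s_def)
  show "qre (scalar_s a x y) = 0" by (simp add: scalar_s_def a)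
  \<comment> \<open>By skewness only twice the real part of h survives the exchange of y and z,
    which is why the real 2-form appears in \<open>scalar_s\<close>.\<close>
  have re: "a * h y z - a * h z y = scalar_s a y z" for y z
    using h_skew[of y z] a by (simp add: scalar_s_def quat_eq_iff quat_sel_mult)
  show "scalar_P a x y z + scalar_P a y z x + scalar_P a z x y =
    z \<cdot> scalar_s a x y + x \<cdot> scalar_s a y z + y \<cdot> scalar_s a z x"
    by (simp add: re[symmetric] scalar_P_def act_linear)
qed

definition so_op :: "('a \<Rightarrow> 'a) \<Rightarrow> bool" where
  "so_op A \<longleftrightarrow> linear A \<and> (\<forall>x q. A (x \<cdot> q) = A x \<cdot> q) \<and> (\<forall>x y. h (A x) y = - h x (A y))"

text \<open>For any u, v the map sending z to u h(v, z) + v h(u, z) is in so*. The first four terms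
  are this map for (x, A y) minus the one for (y, A x); the multiple of A is what the Bianchi
  identity requires in addition.\<close>

definition so_P :: "('a \<Rightarrow> 'a) \<Rightarrow> 'a \<Rightarrow> 'a \<Rightarrow> 'a \<Rightarrow> 'a" where
  "so_P A x y z = x \<cdot> h (A y) z - A x \<cdot> h y z - y \<cdot> h (A x) z + A y \<cdot> h x z + (2 * qre (h x y)) *\<^sub>R A z"

definition so_s :: "('a \<Rightarrow> 'a) \<Rightarrow> 'a \<Rightarrow> 'a \<Rightarrow> quat" where
  "so_s A x y = h (A x) y - h (A y) x"

lemma so_op_herm: "so_op A \<Longrightarrow> h (A y) x = qconj (h (A x) y)"
  unfolding so_op_def by (metis h_skew minus_minus)

lemma so_op_linear:
  assumes "so_op A"
  shows "A (x + y) = A x + A y" "A (x - y) = A x - A y" "A (- x) = - A x" "A (r *\<^sub>R x) = r *\<^sub>R A x"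
    "A (x \<cdot> q) = A x \<cdot> q" "A 0 = 0"
  using assms unfolding so_op_def
  by (simp_all add: linear_add linear_diff linear_neg linear_scale linear_0)

lemma curvature_so:
  assumes A: "so_op A"
  shows "curvature (so_P A) (so_s A)"
  unfolding curvature_def
proof (intro conjI allI)
  fix x y z w :: 'a and q
  note [simp] = so_op_linear[OF A]
  have hA: "h z (A w) = - h (A z) w" for z w using A by (simp add: so_op_def)
  have sk: "h (A x) y = qconj (h (A y) x)" for x y by (rule so_op_herm[OF A])
  show "linear (\<lambda>x. so_P A x y z)"
    by (rule linearI) (simp_all add: so_P_def act_linear h_linear algebra_simps)
  show "so_P A y x z = - so_P A x y z"
    using h_skew[of x y] by (simp add: so_P_def)
  show "so_P A x y (z + w) = so_P A x y z + so_P A x y w"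
    by (simp add: so_P_def act_linear h_linear algebra_simps)
  show "so_P A x y (z \<cdot> q) = so_P A x y z \<cdot> q"
    by (simp add: so_P_def act_linear h_act_right act_mult)
  have c: "qconj (h u v) = - h v u" for u v using h_skew[of v u] by simp
  show "h (so_P A x y z) w = - h z (so_P A x y w)"
    unfolding so_P_def
    by (simp add: h_linear h_act_left h_act_right c hA)
  show "linear (\<lambda>x. so_s A x y)"
    by (rule linearI) (simp_all add: so_s_def h_linear algebra_simps)
  show "so_s A y x = - so_s A x y" by (simp add: so_s_def)
  show "qre (so_s A x y) = 0" using sk[of x y] by (simp add: so_s_def)
  have re: "v \<cdot> h x y - v \<cdot> h y x = (2 * qre (h x y)) *\<^sub>R v" for v x y
  proof -
    have "h x y - h y x = (2 * qre (h x y)) *\<^sub>R 1"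
      using h_skew[of y x] by (simp add: quat_eq_iff)
    then show ?thesis by (metis act_diff_right act_scaleR_right act_1)
  qed
  show "so_P A x y z + so_P A y z x + so_P A z x y =
    z \<cdot> so_s A x y + x \<cdot> so_s A y z + y \<cdot> so_s A z x"
    unfolding so_P_def so_s_def re[symmetric] by (simp add: act_linear)
qed

end

text \<open>The quaternions as a right vector space over the complex subfield generated by \<open>I\<close>:
  \<open>cpart\<close> projects to that subfield, \<open>dpart\<close> to its orthogonal complement.\<close>

definition cpart :: "quat \<Rightarrow> quat \<Rightarrow> quat" where
  "cpart I q = (1/2) *\<^sub>R (q - I * q * I)"

definition dpart :: "quat \<Rightarrow> quat \<Rightarrow> quat" where
  "dpart I q = (1/2) *\<^sub>R (q + I * q * I)"

text \<open>An abstract pair of anticommuting units, so that one argument serves for i, j and k in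
  turn.\<close>

definition frame :: "quat \<Rightarrow> quat \<Rightarrow> bool" where
  "frame I J \<longleftrightarrow> qre I = 0 \<and> qre J = 0 \<and> I * I = -1 \<and> J * J = -1 \<and> J * I = - (I * J) \<and>
     (\<forall>q. \<exists>r0 r1 r2 r3. q = of_real r0 + r1 *\<^sub>R I + r2 *\<^sub>R J + r3 *\<^sub>R (J * I))"

lemma frames: "frame quat_i quat_j" "frame quat_j quat_k" "frame quat_k quat_i"
proof -
  have "\<exists>r0 r1 r2 r3. q = of_real r0 + r1 *\<^sub>R quat_i + r2 *\<^sub>R quat_j + r3 *\<^sub>R (quat_j * quat_i)" for q
    by (rule exI[of _ "qre q"], rule exI[of _ "qim1 q"], rule exI[of _ "qim2 q"], rule exI[of _ "- qim3 q"])
       (simp add: quat_eq_iff)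
  then show "frame quat_i quat_j" by (simp add: frame_def)
  have "\<exists>r0 r1 r2 r3. q = of_real r0 + r1 *\<^sub>R quat_j + r2 *\<^sub>R quat_k + r3 *\<^sub>R (quat_k * quat_j)" for q
    by (rule exI[of _ "qre q"], rule exI[of _ "qim2 q"], rule exI[of _ "qim3 q"], rule exI[of _ "- qim1 q"])
       (simp add: quat_eq_iff)
  then show "frame quat_j quat_k" by (simp add: frame_def)
  have "\<exists>r0 r1 r2 r3. q = of_real r0 + r1 *\<^sub>R quat_k + r2 *\<^sub>R quat_i + r3 *\<^sub>R (quat_i * quat_k)" for q
    by (rule exI[of _ "qre q"], rule exI[of _ "qim3 q"], rule exI[of _ "qim1 q"], rule exI[of _ "- qim2 q"])
       (simp add: quat_eq_iff)
  then show "frame quat_k quat_i" by (simp add: frame_def)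
qed

lemma unit_mult:
  assumes "I * I = (-1::quat)" shows "I * (I * q) = - q"
  by (simp add: assms mult.assoc[symmetric])

lemma parts_add: "cpart I q + dpart I q = q"
proof -
  have "cpart I q + dpart I q = (1/2) *\<^sub>R (q + q)"
    unfolding cpart_def dpart_def by (simp add: scaleR_add_right scaleR_diff_right)
  then show ?thesis by (simp flip: scaleR_2)
qed

lemma parts_linear:
  "cpart I (p + q) = cpart I p + cpart I q" "dpart I (p + q) = dpart I p + dpart I q"
  "cpart I (p - q) = cpart I p - cpart I q" "dpart I (p - q) = dpart I p - dpart I q"
  "cpart I (- q) = - cpart I q" "dpart I (- q) = - dpart I q"
  "cpart I (r *\<^sub>R q) = r *\<^sub>R cpart I q" "dpart I (r *\<^sub>R q) = r *\<^sub>R dpart I q"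
  "cpart I 0 = 0" "dpart I 0 = 0"
  by (simp_all add: cpart_def dpart_def algebra_simps)

lemma parts_commute:
  assumes "I * I = -1"
  shows "I * cpart I q = cpart I q * I" "I * dpart I q = - (dpart I q * I)"
    "cpart I (q * I) = cpart I q * I" "dpart I (q * I) = dpart I q * I"
    "cpart I (I * q) = cpart I q * I" "dpart I (I * q) = - (dpart I q * I)"
  using assms unit_mult[OF assms]
  by (simp_all add: cpart_def dpart_def algebra_simps mult.assoc)

lemma parts_mult:
  "I * u = u * I \<Longrightarrow> dpart I (u * q) = u * dpart I q"
  "I * u = u * I \<Longrightarrow> cpart I (u * q) = u * cpart I q"
  "I * u = - (u * I) \<Longrightarrow> dpart I (u * q) = u * cpart I q"
  "I * u = - (u * I) \<Longrightarrow> cpart I (u * q) = u * dpart I q"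
  by (simp_all add: cpart_def dpart_def distrib_left right_diff_distrib flip: mult.assoc)

lemma qre_mult_commute: "qre (p * q) = qre (q * p)"
  by (simp add: quat_sel_mult)

text \<open>Moving I cyclically does not change the real part, whereas moving it across u changes
  the sign.\<close>

lemma anticommute_imag:
  assumes "I * I = -1" "I * u = - (u * I)" shows "qre u = 0"
proof -
  have "qre (I * (u * I)) = qre ((u * I) * I)" by (rule qre_mult_commute)
  also have "I * (u * I) = (I * u) * I" by (simp add: mult.assoc)
  finally have "qre (- (u * (I * I))) = qre (u * (I * I))"
    by (simp add: assms(2) mult.assoc)
  then show ?thesis by (simp add: assms(1))
qed

section \<open>The Bianchi identity relative to one imaginary unit\<close>

context qform
begin

text \<open>The coefficients that \<open>s\<close> leaves behind in
  \<open>curvature_complex_part\<close>. \<open>cc\<close> is, up to a factor, the component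
  antilinear in both arguments of the part of s commuting with I; \<open>bb\<close> is the component
  antilinear in the first and linear in the second argument of the part anticommuting with
  I.\<close>

definition cc :: "quat \<Rightarrow> ('a \<Rightarrow> 'a \<Rightarrow> quat) \<Rightarrow> 'a \<Rightarrow> 'a \<Rightarrow> quat" where
  "cc I s x y = cpart I (s x y) + (cpart I (s (x \<cdot> I) y) + cpart I (s x (y \<cdot> I))) * I
     - cpart I (s (x \<cdot> I) (y \<cdot> I))"

definition bb :: "quat \<Rightarrow> ('a \<Rightarrow> 'a \<Rightarrow> quat) \<Rightarrow> 'a \<Rightarrow> 'a \<Rightarrow> quat" where
  "bb I s y z = dpart I (s y z) + dpart I (s (y \<cdot> I) z) * I
     - (dpart I (s y (z \<cdot> I)) + dpart I (s (y \<cdot> I) (z \<cdot> I)) * I) * I"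

lemma act_unit: "I * I = -1 \<Longrightarrow> v \<cdot> I \<cdot> I = - v"
  by (simp add: act_minus_right flip: act_mult)

lemma curvature_linear:
  assumes c: "curvature P s"
  shows "P (x + y) z w = P x z w + P y z w" "P (- x) z w = - P x z w" "P (r *\<^sub>R x) z w = r *\<^sub>R P x z w"
    "P z (x + y) w = P z x w + P z y w" "P z (- x) w = - P z x w" "P z (r *\<^sub>R x) w = r *\<^sub>R P z x w"
    "s (x + y) z = s x z + s y z" "s (- x) z = - s x z" "s (r *\<^sub>R x) z = r *\<^sub>R s x z"
    "s z (x + y) = s z x + s z y" "s z (- x) = - s z x" "s z (r *\<^sub>R x) = r *\<^sub>R s z x"
proof -
  note d = curvatureD[OF c]
  have "linear (\<lambda>x. - P x z w)" "linear (\<lambda>x. - s x z)"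
    by (intro linear_compose_neg d)+
  then have l: "linear (\<lambda>x. P z x w)" "linear (\<lambda>x. s z x)"
    by (simp_all only: d(2)[of z] d(7)[of z])
  note m = d(1)[of z w] d(6)[of z]
  show "P (x + y) z w = P x z w + P y z w" "s (x + y) z = s x z + s y z"
    using m[THEN linear_add] by auto
  show "P (- x) z w = - P x z w" "s (- x) z = - s x z"
    using m[THEN linear_neg] by auto
  show "P (r *\<^sub>R x) z w = r *\<^sub>R P x z w" "s (r *\<^sub>R x) z = r *\<^sub>R s x z"
    using m[THEN linear_scale] by auto
  show "P z (x + y) w = P z x w + P z y w" "s z (x + y) = s z x + s z y"
    using l[THEN linear_add] by auto
  show "P z (- x) w = - P z x w" "s z (- x) = - s z x"
    using l[THEN linear_neg] by auto
  show "P z (r *\<^sub>R x) w = r *\<^sub>R P z x w" "s z (r *\<^sub>R x) = r *\<^sub>R s z x"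
    using l[THEN linear_scale] by auto
qed

lemma curvature_complex_part:
  assumes c: "curvature P s" and I: "I * I = -1"
  shows "(P x y z - P (x \<cdot> I) (y \<cdot> I) z) + (P (x \<cdot> I) y z + P x (y \<cdot> I) z) \<cdot> I
     = z \<cdot> cc I s x y + x \<cdot> bb I s y z - y \<cdot> bb I s x z" (is "?W = ?R")
proof -
  note d = curvatureD[OF c]
  define B where "B x y z = P x y z + P y z x + P z x y" for x y z
  define C where "C x y z = z \<cdot> s x y + x \<cdot> s y z + y \<cdot> s z x" for x y z
  \<comment> \<open>Eight times the projection of a real trilinear map to its component antilinear
    in x and y and linear in z, with respect to right multiplication by I. It kills
    \<open>P y z x\<close> and \<open>P z x y\<close>, which are linear in x and in y, and only
    doubles the z-linear term obtained from \<open>P x y z\<close>.\<close>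
  define T where "T F = F x y z + F (x \<cdot> I) y z \<cdot> I + F x (y \<cdot> I) z \<cdot> I - F (x \<cdot> I) (y \<cdot> I) z
     - (F x y (z \<cdot> I) \<cdot> I - F (x \<cdot> I) y (z \<cdot> I) - F x (y \<cdot> I) (z \<cdot> I)
        - F (x \<cdot> I) (y \<cdot> I) (z \<cdot> I) \<cdot> I)" for F :: "'a \<Rightarrow> 'a \<Rightarrow> 'a \<Rightarrow> 'a"
  note aI = act_unit[OF I]
  have "B = C" by (intro ext) (simp add: B_def C_def d(9))
  then have "T B = T C" by simp
  moreover have "T B = 2 *\<^sub>R ?W"
    unfolding T_def B_def d(2)[of z x] d(2)[of z "x \<cdot> I"] d(2)[of "z \<cdot> I" x] d(2)[of "z \<cdot> I" "x \<cdot> I"]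
    by (simp add: d(4) act_linear aI scaleR_2)
  moreover have "T C = 2 *\<^sub>R ?R"
    unfolding T_def C_def cc_def bb_def cpart_def dpart_def d(7)[of z x] d(7)[of z "x \<cdot> I"]
      d(7)[of "z \<cdot> I" x] d(7)[of "z \<cdot> I" "x \<cdot> I"]
    by (simp add: act_linear act_mult aI algebra_simps)
  ultimately show ?thesis by simp
qed

lemma cc_bb_commute:
  assumes I: "I * I = -1"
  shows "I * cc I s x y = cc I s x y * I" "I * bb I s x y = - (bb I s x y * I)"
proof -
  note p = parts_commute[OF I]
  have pI: "I * (cpart I q * r) = cpart I q * (I * r)" "I * (dpart I q * r) = - (dpart I q * (I * r))" for q r
    by (simp_all add: p flip: mult.assoc)
  show "I * cc I s x y = cc I s x y * I" "I * bb I s x y = - (bb I s x y * I)"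
    by (simp_all add: cc_def bb_def algebra_simps p(1,2) pI I)
qed

text \<open>Pair \<open>curvature_complex_part\<close> with z. As P x y is skew,
  \<open>h (P x y z) z\<close> is real; neither it nor its product with I has a part anticommuting
  with I, so P drops out and a relation between \<open>cc\<close> and \<open>bb\<close> alone
  remains.\<close>

lemma curvature_skew_relation:
  assumes c: "curvature P s" and I: "I * I = -1" "qre I = 0"
  shows "qconj (cc I s x y) * dpart I (h z z)
     = bb I s y z * cpart I (h x z) - bb I s x z * cpart I (h y z)"
proof -
  note d = curvatureD[OF c]
  have real: "h (P x y z) z = of_real (qre (h (P x y z) z))" for x y z
    using d(5)[of x y z z] h_skew[of z "P x y z"] by (simp add: quat_eq_iff)
  have dr: "dpart I (of_real r) = 0" for r
    using I(1) by (simp add: dpart_def of_real_def)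
  have c0: "dpart I (h (P x y z) z) = 0" "dpart I (h (P x y z \<cdot> I) z) = 0" for x y z
    unfolding h_act_left
    by (subst real, simp add: dr qconj_imag[OF I(2)] parts_linear parts_commute[OF I(1)])+
  have "dpart I (h ((P x y z - P (x \<cdot> I) (y \<cdot> I) z) + (P (x \<cdot> I) y z + P x (y \<cdot> I) z) \<cdot> I) z) = 0"
    by (simp add: h_linear act_add_left parts_linear c0)
  then have "dpart I (h (z \<cdot> cc I s x y + x \<cdot> bb I s y z - y \<cdot> bb I s x z) z) = 0"
    by (simp only: curvature_complex_part[OF c I(1)])
  moreover have cq: "I * qconj (cc I s x y) = qconj (cc I s x y) * I"
    using arg_cong[OF cc_bb_commute(1)[OF I(1), of s x y], of qconj]
    by (simp add: qconj_mult qconj_imag[OF I(2)])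
  have bq: "qconj (bb I s x y) = - bb I s x y" for x y
    by (rule qconj_imag[OF anticommute_imag[OF I(1) cc_bb_commute(2)[OF I(1)]]])
  ultimately show ?thesis
    by (simp add: h_linear h_act_left parts_linear parts_mult(1)[OF cq] bq
        parts_mult(3)[OF cc_bb_commute(2)[OF I(1)]] algebra_simps)
qed

lemma frame_ext:
  assumes fr: "frame I J" and f: "linear f" and g: "linear g"
    and S: "span (\<Union>e\<in>S. range (\<lambda>q. e \<cdot> q)) = UNIV"
    and e: "\<And>e. e \<in> S \<Longrightarrow> f e = g e" "\<And>e. e \<in> S \<Longrightarrow> f (e \<cdot> I) = g (e \<cdot> I)"
      "\<And>e. e \<in> S \<Longrightarrow> f (e \<cdot> J) = g (e \<cdot> J)" "\<And>e. e \<in> S \<Longrightarrow> f (e \<cdot> J \<cdot> I) = g (e \<cdot> J \<cdot> I)"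
  shows "f x = g x"
proof (rule linear_eq_on_generators[OF f g S])
  fix v q assume v: "v \<in> S"
  obtain r0 r1 r2 r3 where q: "q = of_real r0 + r1 *\<^sub>R I + r2 *\<^sub>R J + r3 *\<^sub>R (J * I)"
    using fr unfolding frame_def by blast
  show "f (v \<cdot> q) = g (v \<cdot> q)"
    by (simp add: q act_linear act_of_real act_mult linear_add[OF f] linear_add[OF g]
        linear_scale[OF f] linear_scale[OF g] e v)
qed

text \<open>The relation of \<open>curvature_skew_relation\<close> is tested on a basis. A third
  basis vector forces \<open>cc\<close> to vanish, and the remaining symmetry of \<open>bb\<close>
  leaves one quaternion a as its only freedom.\<close>

lemma curvature_unit_part:
  assumes c: "curvature P s" and fr: "frame I J" and dim: "DIM('a) \<ge> 8"
  obtains a where "I * a = - (a * I)" "\<And>x y. cc I s x y = 0"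
    "\<And>y z. bb I s y z = a * cpart I (h y z)"
    "\<And>x y z. P x y z - P (x \<cdot> I) (y \<cdot> I) z = (1/2) *\<^sub>R (x \<cdot> (a * h y z) - y \<cdot> (a * h x z))"
proof -
  have I: "qre I = 0" "I * I = -1" and J: "qre J = 0" "J * J = -1" and JI: "J * I = - (I * J)"
    using fr by (auto simp: frame_def)
  obtain S where S: "finite S" "orthonormal J S" "DIM('a) = 4 * card S"
    "span (\<Union>e\<in>S. range (\<lambda>q. e \<cdot> q)) = UNIV"
    using orthonormal_basis_exists[OF J] .
  note lin = curvature_linear[OF c]
  note pc = parts_commute[OF I(2)]
  \<comment> \<open>A basis over the complex numbers generated by I: each e of the quaternionic
    basis contributes e and \<open>e \<cdot> J\<close>. The vectors
    \<open>G \<iota> \<cdot> J\<close> are dual to it up to sign.\<close>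
  define G :: "'a \<times> bool \<Rightarrow> 'a" where "G \<iota> = (if snd \<iota> then fst \<iota> \<cdot> J else fst \<iota>)" for \<iota>
  define X where "X = S \<times> (UNIV :: bool set)"
  have cpJ: "cpart I J = 0" "dpart I J = J"
    using JI I(2) J(2) unit_mult[OF I(2)] by (simp_all add: cpart_def dpart_def mult.assoc)
  have cp1: "cpart I 1 = 1" using I(2) by (simp add: cpart_def flip: scaleR_2)
  have hS: "h e e' = (if e = e' then J else 0)" if "e \<in> S" "e' \<in> S" for e e'
    using S(2) that by (simp add: orthonormal_def)
  have pair: "cpart I (h (G \<iota>) (G \<kappa> \<cdot> J)) = (if \<iota> = \<kappa> then -1 else 0)" if "\<iota> \<in> X" "\<kappa> \<in> X" for \<iota> \<kappa>
    using that J unit_mult[OF J(2)]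
    by (cases \<iota>; cases \<kappa>) (auto simp: X_def G_def h_act_left h_act_right hS qconj_imag mult.assoc
        parts_linear cpJ cp1)
  have self: "dpart I (h (G \<iota> \<cdot> J) (G \<iota> \<cdot> J)) = J" if "\<iota> \<in> X" for \<iota>
    using that J unit_mult[OF J(2)]
    by (cases \<iota>) (auto simp: X_def G_def h_act_left h_act_right hS qconj_imag mult.assoc
        parts_linear cpJ)
  \<comment> \<open>Real dimension at least 8 means at least two quaternionic, hence four complex,
    basis vectors.\<close>
  have third: "\<exists>\<nu>\<in>X. \<nu> \<noteq> \<iota> \<and> \<nu> \<noteq> \<kappa>" for \<iota> \<kappa>
  proof (rule ccontr)
    assume "\<not> ?thesis"
    then have "X \<subseteq> {\<iota>, \<kappa>}" by auto
    then have "card X \<le> card {\<iota>, \<kappa>}" by (rule card_mono[rotated]) simp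
    also have "\<dots> \<le> 2" by (simp add: card_insert_if)
    finally show False using S(1,3) dim by (simp add: X_def card_cartesian_product)
  qed
  have ext: "f x = g x" if f: "linear f" and g: "linear g"
    and "\<And>\<iota>. \<iota> \<in> X \<Longrightarrow> f (G \<iota>) = g (G \<iota>)" "\<And>\<iota>. \<iota> \<in> X \<Longrightarrow> f (G \<iota> \<cdot> I) = g (G \<iota> \<cdot> I)"
    for f g :: "'a \<Rightarrow> quat" and x
    by (rule frame_ext[OF fr f g S(4)])
       (use that(3,4)[of "(_, False)"] that(3,4)[of "(_, True)"] in \<open>auto simp: X_def G_def\<close>)
  have ext': "f x = g x" if f: "linear f" and g: "linear g"
    and "\<And>\<iota>. \<iota> \<in> X \<Longrightarrow> f (G \<iota> \<cdot> J) = g (G \<iota> \<cdot> J)" "\<And>\<iota>. \<iota> \<in> X \<Longrightarrow> f (G \<iota> \<cdot> J \<cdot> I) = g (G \<iota> \<cdot> J \<cdot> I)"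
    for f g :: "'a \<Rightarrow> quat" and x
  proof (rule frame_ext[OF fr f g S(4)])
    fix e assume e: "e \<in> S"
    note aJ = act_unit[OF J(2)]
    show "f (e \<cdot> J) = g (e \<cdot> J)" "f (e \<cdot> J \<cdot> I) = g (e \<cdot> J \<cdot> I)"
      using that(3,4)[of "(e, False)"] e by (simp_all add: X_def G_def)
    show "f e = g e" "f (e \<cdot> I) = g (e \<cdot> I)"
      using that(3,4)[of "(e, True)"] e linear_neg[OF f] linear_neg[OF g]
      by (simp_all add: X_def G_def aJ act_minus_left)
  qed
  note rel = curvature_skew_relation[OF c I(2,1)]
  have ccI: "cc I s (x \<cdot> I) y = - (cc I s x y * I)" for x y
    by (simp add: cc_def act_unit[OF I(2)] lin parts_linear algebra_simps I(2))
  have ccskew: "cc I s y x = - cc I s x y" for x y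
    unfolding cc_def curvatureD(7)[OF c, of y] curvatureD(7)[OF c, of "y \<cdot> I"]
    by (simp add: parts_linear algebra_simps)
  have ccI': "cc I s x (y \<cdot> I) = - (cc I s x y * I)" for x y
    using ccskew[of "y \<cdot> I" x] ccskew[of y x] by (simp add: ccI)
  have lincc: "linear (\<lambda>x. cc I s x y)" for y
    by (rule linearI) (simp_all add: cc_def act_linear lin parts_linear algebra_simps)
  \<comment> \<open>Taking for z the dual vector of a third index makes both pairings on the right
    vanish, while the left factor is the invertible J.\<close>
  have cc0: "cc I s (G \<iota>) (G \<kappa>) = 0" if ik: "\<iota> \<in> X" "\<kappa> \<in> X" for \<iota> \<kappa>
  proof -
    obtain \<nu> where l: "\<nu> \<in> X" "\<nu> \<noteq> \<iota>" "\<nu> \<noteq> \<kappa>" using third by blast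
    have "qconj (cc I s (G \<iota>) (G \<kappa>)) * J = 0"
      using rel[of "G \<iota>" "G \<kappa>" "G \<nu> \<cdot> J"] ik l by (simp add: pair self)
    then have "qconj (cc I s (G \<iota>) (G \<kappa>)) = 0" using J(2) quat_no_zero_div by auto
    then show ?thesis by (simp add: quat_eq_iff)
  qed
  have cc0': "cc I s x (G \<kappa>) = 0" if "\<kappa> \<in> X" for x \<kappa>
    by (rule ext[OF lincc linear_zero]) (simp_all add: cc0 that ccI)
  have cc: "cc I s x y = 0" for x y
  proof -
    have "cc I s y x = 0"
      by (rule ext[OF lincc linear_zero]) (simp_all add: ccskew[of _ x] cc0' ccI')
    then show ?thesis using ccskew[of y x] by simp
  qed
  have rel': "bb I s y z * cpart I (h x z) = bb I s x z * cpart I (h y z)" for x y z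
    using rel[of x y z] by (simp add: cc)
  have linbb: "linear (\<lambda>y. bb I s y z)" "linear (\<lambda>z. bb I s y z)" for y z
    by (rule linearI; simp add: bb_def act_linear lin parts_linear algebra_simps)+
  have bbI: "bb I s (y \<cdot> I) z = - (bb I s y z * I)" "bb I s y (z \<cdot> I) = bb I s y z * I" for y z
    by (simp_all add: bb_def act_unit[OF I(2)] lin parts_linear algebra_simps I(2))
  have bb0: "bb I s (G \<iota>) (G \<kappa> \<cdot> J) = 0" if "\<iota> \<in> X" "\<kappa> \<in> X" "\<iota> \<noteq> \<kappa>" for \<iota> \<kappa>
    using rel'[of "G \<iota>" "G \<kappa> \<cdot> J" "G \<kappa>"] that by (simp add: pair)
  \<comment> \<open>Testing against the sum of two dual vectors compares the two diagonal
    values.\<close>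
  have bbeq: "bb I s (G \<iota>) (G \<iota> \<cdot> J) = bb I s (G \<kappa>) (G \<kappa> \<cdot> J)" if "\<iota> \<in> X" "\<kappa> \<in> X" for \<iota> \<kappa>
  proof (cases "\<iota> = \<kappa>")
    case False
    then show ?thesis
      using rel'[of "G \<iota>" "(G \<iota> + G \<kappa>) \<cdot> J" "G \<kappa>"] that
      by (simp add: pair bb0 act_add_left h_add_right parts_linear linear_add[OF linbb(2)])
  qed simp
  obtain \<mu> where mu: "\<mu> \<in> X" using third by blast
  define a where "a = - bb I s (G \<mu>) (G \<mu> \<cdot> J)"
  have aI: "I * a = - (a * I)" using cc_bb_commute(2)[OF I(2)] by (simp add: a_def)
  have lina: "linear (\<lambda>y. a * cpart I (h y z))" "linear (\<lambda>z. a * cpart I (h y z))" for y z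
    by (rule linearI; simp add: h_linear parts_linear algebra_simps)+
  have aI1: "a * cpart I (h (y \<cdot> I) z) = - (a * cpart I (h y z) * I)" for y z
    by (simp add: h_act_left qconj_imag I parts_linear pc mult.assoc)
  have aI2: "a * cpart I (h y (z \<cdot> I)) = a * cpart I (h y z) * I" for y z
    by (simp add: h_act_right pc mult.assoc)
  have b1: "bb I s (G \<iota>) (G \<kappa> \<cdot> J) = a * cpart I (h (G \<iota>) (G \<kappa> \<cdot> J))" if "\<iota> \<in> X" "\<kappa> \<in> X" for \<iota> \<kappa>
    using that bb0[OF that] bbeq[OF that(1) mu] by (auto simp: pair a_def)
  have b2: "bb I s y (G \<kappa> \<cdot> J) = a * cpart I (h y (G \<kappa> \<cdot> J))" if "\<kappa> \<in> X" for y \<kappa>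
    by (rule ext[OF linbb(1) lina(1)]) (simp_all add: b1 that bbI aI1)
  have bb: "bb I s y z = a * cpart I (h y z)" for y z
    by (rule ext'[OF linbb(2) lina(2)]) (simp_all add: b2 bbI aI2)
  have W: "(P x y z - P (x \<cdot> I) (y \<cdot> I) z) + (P (x \<cdot> I) y z + P x (y \<cdot> I) z) \<cdot> I
     = x \<cdot> (a * cpart I (h y z)) - y \<cdot> (a * cpart I (h x z))" for x y z
    using curvature_complex_part[OF c I(2), of x y z] by (simp add: cc bb)
  \<comment> \<open>J anticommutes with I. Subtracting the relation at \<open>z \<cdot> J\<close>,
    multiplied by J, cancels the terms with a single I and doubles the others; on the right it
    supplies the part of h missing from \<open>cpart\<close>.\<close>
  have UU: "P x y z - P (x \<cdot> I) (y \<cdot> I) z = (1/2) *\<^sub>R (x \<cdot> (a * h y z) - y \<cdot> (a * h x z))" for x y z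
  proof -
    have "J * (I * J) = - (I * (J * J))" using JI by (simp flip: mult.assoc)
    then have jij: "J * (I * J) = I" by (simp add: J(2))
    have JIJ: "v \<cdot> J \<cdot> I \<cdot> J = v \<cdot> I" for v
      by (simp add: jij mult.assoc flip: act_mult)
    have cpJ': "cpart I (q * J) * J = - dpart I q" for q
      by (simp add: cpart_def dpart_def algebra_simps mult.assoc jij J(2))
    have "2 *\<^sub>R (P x y z - P (x \<cdot> I) (y \<cdot> I) z) =
       ((P x y z - P (x \<cdot> I) (y \<cdot> I) z) + (P (x \<cdot> I) y z + P x (y \<cdot> I) z) \<cdot> I) -
       ((P x y (z \<cdot> J) - P (x \<cdot> I) (y \<cdot> I) (z \<cdot> J)) + (P (x \<cdot> I) y (z \<cdot> J) + P x (y \<cdot> I) (z \<cdot> J)) \<cdot> I) \<cdot> J"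
      by (simp add: curvatureD(4)[OF c] act_linear act_unit[OF J(2)] JIJ scaleR_2)
    also have "\<dots> = x \<cdot> (a * cpart I (h y z)) - y \<cdot> (a * cpart I (h x z)) -
       (x \<cdot> (a * (cpart I (h y z * J) * J)) - y \<cdot> (a * (cpart I (h x z * J) * J)))"
      unfolding W by (simp add: act_linear h_act_right act_mult)
    also have "\<dots> = x \<cdot> (a * (cpart I (h y z) + dpart I (h y z))) - y \<cdot> (a * (cpart I (h x z) + dpart I (h x z)))"
      unfolding cpJ' by (simp add: act_linear distrib_left)
    finally have "2 *\<^sub>R (P x y z - P (x \<cdot> I) (y \<cdot> I) z) = x \<cdot> (a * h y z) - y \<cdot> (a * h x z)"
      by (simp add: parts_add)
    from arg_cong[OF this, of "\<lambda>v. (1/2) *\<^sub>R v"] show ?thesis by simp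
  qed
  show ?thesis by (rule that[OF aI cc bb UU])
qed

end

section \<open>The part invariant under the quaternion units\<close>

context qform
begin

text \<open>The elements 1, i, j, k form a group up to signs, and signs cancel between the two
  arguments; so averaging over these four elements already produces invariance.\<close>

definition unit_invariant :: "('a \<Rightarrow> 'a \<Rightarrow> 'a \<Rightarrow> 'a) \<Rightarrow> bool" where
  "unit_invariant P \<longleftrightarrow> (\<forall>u\<in>{quat_i, quat_j, quat_k}. \<forall>x y z. P (x \<cdot> u) (y \<cdot> u) z = P x y z)"

lemma unit_invariant_diff:
  "unit_invariant P \<Longrightarrow> unit_invariant P' \<Longrightarrow> unit_invariant (\<lambda>x y z. P x y z - P' x y z)"
  by (simp add: unit_invariant_def)

lemma act_units:
  "v \<cdot> quat_i \<cdot> quat_i = - v" "v \<cdot> quat_j \<cdot> quat_j = - v" "v \<cdot> quat_k \<cdot> quat_k = - v"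
  "v \<cdot> quat_i \<cdot> quat_j = v \<cdot> quat_k" "v \<cdot> quat_j \<cdot> quat_k = v \<cdot> quat_i" "v \<cdot> quat_k \<cdot> quat_i = v \<cdot> quat_j"
  "v \<cdot> quat_j \<cdot> quat_i = - (v \<cdot> quat_k)" "v \<cdot> quat_k \<cdot> quat_j = - (v \<cdot> quat_i)"
  "v \<cdot> quat_i \<cdot> quat_k = - (v \<cdot> quat_j)"
  by (simp_all add: act_minus_right flip: act_mult)

lemma unit_invariant_so:
  assumes A: "so_op A" shows "unit_invariant (so_P A)"
proof -
  have "so_P A (x \<cdot> u) (y \<cdot> u) z = so_P A x y z" if "qnorm2 u = 1" for x y z u
  proof -
    have "x \<cdot> u \<cdot> (qconj u * q) = x \<cdot> q" for x q
      using qconj_mult_self(2)[of u] that by (simp flip: act_mult mult.assoc)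
    moreover have "qre (h (x \<cdot> u) (y \<cdot> u)) = qre (h x y)" by (simp add: qre_h_act that)
    ultimately show ?thesis
      by (simp add: so_P_def so_op_linear[OF A] h_act_left del: of_real_mult)
  qed
  then show ?thesis by (simp add: unit_invariant_def qnorm2_def)
qed

text \<open>The average of P over 1, i, j, k is invariant, and by \<open>curvature_unit_part\<close>
  P differs from each of its translates by a tensor of the form \<open>scalar_P\<close>.\<close>

lemma curvature_scalar_split:
  assumes c: "curvature P s" and dim: "DIM('a) \<ge> 8"
  obtains a where "qre a = 0" "unit_invariant (\<lambda>x y z. P x y z - scalar_P a x y z)"
proof -
  obtain a1 where a1: "quat_i * a1 = - (a1 * quat_i)"
    "P x y z - P (x \<cdot> quat_i) (y \<cdot> quat_i) z = (1/2) *\<^sub>R (x \<cdot> (a1 * h y z) - y \<cdot> (a1 * h x z))" for x y z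
    using curvature_unit_part[OF c frames(1) dim] by metis
  obtain a2 where a2: "quat_j * a2 = - (a2 * quat_j)"
    "P x y z - P (x \<cdot> quat_j) (y \<cdot> quat_j) z = (1/2) *\<^sub>R (x \<cdot> (a2 * h y z) - y \<cdot> (a2 * h x z))" for x y z
    using curvature_unit_part[OF c frames(2) dim] by metis
  obtain a3 where a3: "quat_k * a3 = - (a3 * quat_k)"
    "P x y z - P (x \<cdot> quat_k) (y \<cdot> quat_k) z = (1/2) *\<^sub>R (x \<cdot> (a3 * h y z) - y \<cdot> (a3 * h x z))" for x y z
    using curvature_unit_part[OF c frames(3) dim] by metis
  \<comment> \<open>Each translate contributes a half, and the average over four terms contributes a
    quarter.\<close>
  define a where "a = (1/8) *\<^sub>R (a1 + a2 + a3)"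
  have "qre a = 0"
    using anticommute_imag[OF _ a1(1)] anticommute_imag[OF _ a2(1)] anticommute_imag[OF _ a3(1)]
    by (simp add: a_def)
  have "4 *\<^sub>R (P x y z - scalar_P a x y z) = P x y z + P (x \<cdot> quat_i) (y \<cdot> quat_i) z +
      P (x \<cdot> quat_j) (y \<cdot> quat_j) z + P (x \<cdot> quat_k) (y \<cdot> quat_k) z" for x y z
  proof -
    have p: "P (x \<cdot> quat_i) (y \<cdot> quat_i) z = P x y z - (1/2) *\<^sub>R (x \<cdot> (a1 * h y z) - y \<cdot> (a1 * h x z))"
      "P (x \<cdot> quat_j) (y \<cdot> quat_j) z = P x y z - (1/2) *\<^sub>R (x \<cdot> (a2 * h y z) - y \<cdot> (a2 * h x z))"
      "P (x \<cdot> quat_k) (y \<cdot> quat_k) z = P x y z - (1/2) *\<^sub>R (x \<cdot> (a3 * h y z) - y \<cdot> (a3 * h x z))"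
      using a1(2)[of x y z] a2(2)[of x y z] a3(2)[of x y z] by (simp_all add: algebra_simps)
    have "4 *\<^sub>R P x y z = P x y z + P x y z + P x y z + P x y z"
      by (metis numeral_Bit0 scaleR_2 scaleR_add_left add.assoc)
    then show ?thesis
      unfolding p by (simp add: scalar_P_def a_def act_linear algebra_simps)
  qed
  then have P0: "P x y z - scalar_P a x y z = (1/4) *\<^sub>R (P x y z + P (x \<cdot> quat_i) (y \<cdot> quat_i) z +
      P (x \<cdot> quat_j) (y \<cdot> quat_j) z + P (x \<cdot> quat_k) (y \<cdot> quat_k) z)" for x y z
    by (metis (no_types, lifting) scaleR_scaleR mult.commute nonzero_mult_div_cancel_left
        scaleR_one times_divide_eq_right zero_neq_numeral mult_1_right)
  have "unit_invariant (\<lambda>x y z. P x y z - scalar_P a x y z)"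
    unfolding unit_invariant_def P0
    by (simp add: act_units curvature_linear[OF c] add_ac)
  then show ?thesis using that \<open>qre a = 0\<close> by blast
qed

text \<open>For an I-invariant P the projected Bianchi identity involves only s. With two
  independent basis vectors its coefficients can be compared one by one.\<close>

lemma curvature_s_constraints:
  assumes c: "curvature P s" and fr: "I * I = -1" and dim: "DIM('a) \<ge> 8"
    and inv: "\<And>x y z. P (x \<cdot> I) (y \<cdot> I) z = P x y z"
  shows "s x y + s (x \<cdot> I) y * I + s x (y \<cdot> I) * I - s (x \<cdot> I) (y \<cdot> I) = 0" (is "?ca x y = 0")
    and "s x y + I * s x y * I + s (x \<cdot> I) y * I - I * s (x \<cdot> I) y = 0" (is "?ba x y = 0")
proof -
  note d = curvatureD[OF c] and aI = act_unit[OF fr] and lin = curvature_linear[OF c]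
  define ca where "ca x y = ?ca x y" for x y
  define ba where "ba x y = ?ba x y" for x y
  have "P (x \<cdot> I) y z + P x (y \<cdot> I) z = 0" for x y z
    using inv[of x "y \<cdot> I" z] by (simp add: aI lin eq_neg_iff_add_eq_0 add.commute neg_eq_iff_add_eq_0)
  then have W: "(P x y z - P (x \<cdot> I) (y \<cdot> I) z) + (P (x \<cdot> I) y z + P x (y \<cdot> I) z) \<cdot> I = 0" for x y z
    by (simp add: inv)
  \<comment> \<open>This time T projects, up to a factor, to the component antilinear in x and y
    with z left alone. Two of the P-terms are linear in x or y and disappear, the third one vanishes
    by invariance.\<close>
  have E: "z \<cdot> ca x y + x \<cdot> ba y z - y \<cdot> ba x z = 0" for x y z
  proof -
    define B where "B x y z = P x y z + P y z x + P z x y" for x y z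
    define C where "C x y z = z \<cdot> s x y + x \<cdot> s y z + y \<cdot> s z x" for x y z
    define T where "T F = F x y z + F (x \<cdot> I) y z \<cdot> I + F x (y \<cdot> I) z \<cdot> I - F (x \<cdot> I) (y \<cdot> I) z"
      for F :: "'a \<Rightarrow> 'a \<Rightarrow> 'a \<Rightarrow> 'a"
    have "B = C" by (intro ext) (simp add: B_def C_def d(9))
    then have "T B = T C" by simp
    moreover have "T B = 0"
      unfolding T_def B_def d(2)[of z x] d(2)[of z "x \<cdot> I"] W[of x y z, symmetric]
      by (simp add: d(4) act_linear aI)
    moreover have "T C = z \<cdot> ca x y + x \<cdot> ba y z - y \<cdot> ba x z"
      unfolding T_def C_def ca_def ba_def d(7)[of z x] d(7)[of z "x \<cdot> I"]
      by (simp add: act_linear act_mult aI algebra_simps)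
    ultimately show ?thesis by simp
  qed
  have baI: "I * ba x y = - (ba x y * I)" for x y
    using unit_mult[OF fr] by (simp add: ba_def algebra_simps mult.assoc fr)
  have ba_re: "qre (ba x y) = 0" for x y
    by (rule anticommute_imag[OF fr baI])
  obtain S where S: "finite S" "orthonormal quat_j S" "DIM('a) = 4 * card S"
    "span (\<Union>e\<in>S. range (\<lambda>q. e \<cdot> q)) = UNIV"
    using orthonormal_basis_exists[of quat_j] by auto
  have indep: "p = 0 \<and> r = 0" if "e \<in> S" "e' \<in> S" "e \<noteq> e'" "e \<cdot> p + e' \<cdot> r = 0" for e e' p r
  proof -
    have "h e (e \<cdot> p + e' \<cdot> r) = quat_j * p" "h e' (e \<cdot> p + e' \<cdot> r) = quat_j * r"
      using S(2) that(1-3) by (simp_all add: orthonormal_def h_linear h_act_right)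
    moreover have "quat_j \<noteq> 0" by (simp add: quat_eq_iff)
    ultimately show ?thesis using that(4) by (metis h_0(2) quat_no_zero_div)
  qed
  have linca: "linear (\<lambda>x. ca x y)" "linear (\<lambda>y. ca x y)" and linba: "linear (\<lambda>x. ba x y)" "linear (\<lambda>y. ba x y)" for x y
    by (rule linearI; simp add: ca_def ba_def act_linear lin algebra_simps)+
  have other: "\<exists>e'\<in>S. e' \<noteq> e" for e
  proof (rule ccontr)
    assume "\<not> ?thesis"
    then have "S \<subseteq> {e}" by auto
    then have "card S \<le> 1" using card_mono[of "{e}" S] by simp
    then show False using S(3) dim by simp
  qed
  have 1: "ca (e \<cdot> q) (e \<cdot> r) = 0" if e: "e \<in> S" for e q r
  proof -
    obtain e' where e': "e' \<in> S" "e' \<noteq> e" using other by blast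
    have "e' \<cdot> ca (e \<cdot> q) (e \<cdot> r) + e \<cdot> (q * ba (e \<cdot> r) e' - r * ba (e \<cdot> q) e') = 0"
      using E[of e' "e \<cdot> q" "e \<cdot> r"] by (simp add: act_linear act_mult algebra_simps)
    then show ?thesis using indep[OF e'(1) e e'(2)] by blast
  qed
  have 2: "ba (e \<cdot> q) (e \<cdot> t) = 0" if e: "e \<in> S" for e q t
  proof -
    obtain e' where e': "e' \<in> S" "e' \<noteq> e" using other by blast
    have "e' \<cdot> ba (e \<cdot> q) (e \<cdot> t) + e \<cdot> (t * ca e' (e \<cdot> q) - q * ba e' (e \<cdot> t)) = 0"
      using E[of "e \<cdot> t" e' "e \<cdot> q"] by (simp add: act_linear act_mult algebra_simps)
    then show ?thesis using indep[OF e'(1) e e'(2)] by blast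
  qed
  have 3: "t * ca (e' \<cdot> p) (e \<cdot> q) = q * ba (e' \<cdot> p) (e \<cdot> t)" if e: "e \<in> S" "e' \<in> S" "e' \<noteq> e" for e e' p q t
  proof -
    have "e' \<cdot> (p * ba (e \<cdot> q) (e \<cdot> t)) + e \<cdot> (t * ca (e' \<cdot> p) (e \<cdot> q) - q * ba (e' \<cdot> p) (e \<cdot> t)) = 0"
      using E[of "e \<cdot> t" "e' \<cdot> p" "e \<cdot> q"] by (simp add: act_linear act_mult algebra_simps)
    then have "t * ca (e' \<cdot> p) (e \<cdot> q) - q * ba (e' \<cdot> p) (e \<cdot> t) = 0"
      using indep[OF e(2,1,3)] by blast
    then show ?thesis by simp
  qed
  have 4: "ca (e' \<cdot> p) (e \<cdot> q) = 0" if e: "e \<in> S" "e' \<in> S" "e' \<noteq> e" for e e' p q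
  proof (cases "q = 0")
    case True
    then show ?thesis using linear_0[OF linca(2)] by simp
  next
    case False
    \<comment> \<open>With t = q times the conjugate of u, the left side of 3 becomes q times the
      squared norm of u. Cancelling q exhibits this real number as a value of the imaginary-valued
      \<open>ba\<close>, so it is 0.\<close>
    define u where "u = ca (e' \<cdot> p) (e \<cdot> q)"
    obtain q' where q': "q' * q = 1" using quat_inverse_exists[OF False] by blast
    have "q * qconj u * u = q * ba (e' \<cdot> p) (e \<cdot> (q * qconj u))"
      using 3[OF e, of "q * qconj u" p q] by (simp add: u_def)
    then have "q' * (q * (qconj u * u)) = q' * (q * ba (e' \<cdot> p) (e \<cdot> (q * qconj u)))"
      by (simp add: mult.assoc)
    then have "qconj u * u = ba (e' \<cdot> p) (e \<cdot> (q * qconj u))"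
      by (simp add: q' flip: mult.assoc)
    then have "qnorm2 u = 0" using ba_re by (metis qconj_mult_self(1) quat_sel_simps(25))
    then show ?thesis using qnorm2_pos[of u] by (auto simp: u_def)
  qed
  have 5: "ba (e' \<cdot> p) (e \<cdot> t) = 0" if e: "e \<in> S" "e' \<in> S" "e' \<noteq> e" for e e' p t
    using 3[OF e, of t p 1] 4[OF e, of p 1] by simp
  have gen: "F x y = (0::quat)" if "\<And>e e' p q. e \<in> S \<Longrightarrow> e' \<in> S \<Longrightarrow> F (e' \<cdot> p) (e \<cdot> q) = 0"
    "\<And>y. linear (\<lambda>x. F x y)" "\<And>x. linear (\<lambda>y. F x y)" for F :: "'a \<Rightarrow> 'a \<Rightarrow> quat" and x y
  proof -
    note F = that
    have F0: "F x (e \<cdot> q) = 0" if e: "e \<in> S" for x e q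
      by (rule linear_eq_on_generators[OF F(2) linear_zero S(4)]) (rule F(1)[OF e])
    show ?thesis
      by (rule linear_eq_on_generators[OF F(3) linear_zero S(4)]) (rule F0)
  qed
  have "ca x y = 0"
    by (rule gen[OF _ linca]) (use 1 4 in blast)
  moreover have "ba x y = 0"
    by (rule gen[OF _ linba]) (use 2 5 in blast)
  ultimately show "?ca x y = 0" "?ba x y = 0" by (simp_all add: ca_def ba_def)
qed

text \<open>The constraints for i, j, k say that s is the imaginary part of a quaternionic Hermitian
  form; such a form comes from an operator A by \<open>riesz\<close>, and subtracting its tensor
  removes s.\<close>

lemma invariant_curvature_s:
  assumes c: "curvature P s" and dim: "DIM('a) \<ge> 8" and inv: "unit_invariant P"
  obtains A where "so_op A" "\<And>x y. s x y = so_s A x y"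
proof -
  have i: "P (x \<cdot> quat_i) (y \<cdot> quat_i) z = P x y z" "P (x \<cdot> quat_j) (y \<cdot> quat_j) z = P x y z"
    "P (x \<cdot> quat_k) (y \<cdot> quat_k) z = P x y z" for x y z
    using inv by (simp_all add: unit_invariant_def)
  note d = curvatureD[OF c] and lin = curvature_linear[OF c]
  note si = curvature_s_constraints[OF c quat_units(1) dim i(1)]
  note sj = curvature_s_constraints[OF c quat_units(2) dim i(2)]
  note sk = curvature_s_constraints[OF c quat_units(3) dim i(3)]
  note cmp = quat_eq_iff quat_sel_mult d(8)
  have I: "qim2 (s (x \<cdot> quat_i) y) = qim3 (s x y)" "qim3 (s (x \<cdot> quat_i) y) = - qim2 (s x y)"
    "qim1 (s (x \<cdot> quat_i) (y \<cdot> quat_i)) = qim1 (s x y)" for x y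
    using si[of x y] by (simp_all add: cmp)
  have J: "qim3 (s (x \<cdot> quat_j) y) = qim1 (s x y)" "qim1 (s (x \<cdot> quat_j) y) = - qim3 (s x y)" for x y
    using sj[of x y] by (simp_all add: cmp)
  have K: "qim1 (s (x \<cdot> quat_k) y) = qim2 (s x y)" "qim2 (s (x \<cdot> quat_k) y) = - qim1 (s x y)" for x y
    using sk[of x y] by (simp_all add: cmp)
  \<comment> \<open>The real part is forced: under
    \<open>f (x \<cdot> quat_i) y = - quat_i * f x y\<close> the i-component at
    \<open>x \<cdot> quat_i\<close> is minus the real part at x.\<close>
  define f where "f x y = of_real (- qim1 (s (x \<cdot> quat_i) y)) + s x y" for x y
  have fi: "f (x \<cdot> quat_i) y = - quat_i * f x y" for x y
    by (simp add: f_def cmp I act_units lin)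
  have fj: "f (x \<cdot> quat_j) y = - quat_j * f x y" for x y
    using K(1)[of "x \<cdot> quat_j" y] K(1)[of x y]
    by (simp add: f_def cmp J act_units lin)
  have flin: "f (x + x') y = f x y + f x' y" "f (r *\<^sub>R x) y = r *\<^sub>R f x y" for x x' y r
    by (simp_all add: f_def cmp act_linear lin)
  have f_act: "f (x \<cdot> q) y = qconj q * f x y" for x y q
  proof -
    have "f (x \<cdot> q) y = f (qre q *\<^sub>R x + qim1 q *\<^sub>R (x \<cdot> quat_i) + qim2 q *\<^sub>R (x \<cdot> quat_j)
      + qim3 q *\<^sub>R (x \<cdot> quat_i \<cdot> quat_j)) y"
      by (subst quat_decomp[of q]) (simp add: act_linear act_mult act_of_real act_units act_scaleR_left)
    also have "\<dots> = qconj q * f x y"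
      unfolding flin fi fj by (simp add: quat_eq_iff quat_sel_mult)
    finally show ?thesis .
  qed
  have f_herm: "f y x = qconj (f x y)" for x y
    using I(3)[of "x \<cdot> quat_i" y] d(7)[of x y] d(7)[of "y \<cdot> quat_i" x]
    by (simp add: f_def cmp act_units lin)
  have "\<exists>v. \<forall>y. h v y = (1/2) *\<^sub>R f x y" for x
  proof -
    have "linear (\<lambda>y. (1/2) *\<^sub>R f x y)"
      unfolding f_herm[of x] by (rule linearI) (simp_all add: flin algebra_simps)
    moreover have "(1/2) *\<^sub>R f x (y \<cdot> q) = (1/2) *\<^sub>R f x y * q" for y q
      unfolding f_herm[of x] by (simp add: f_act qconj_mult)
    ultimately show ?thesis by (rule riesz) blast
  qed
  then obtain A where A: "\<And>x y. h (A x) y = (1/2) *\<^sub>R f x y" by metis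
  have "so_op A"
    unfolding so_op_def
  proof (intro conjI allI linearI)
    fix x y :: 'a and q and r :: real
    show "A (x + y) = A x + A y" "A (r *\<^sub>R x) = r *\<^sub>R A x"
      by (rule h_eqI; simp add: A h_linear flin algebra_simps)+
    show "A (x \<cdot> q) = A x \<cdot> q"
      by (rule h_eqI) (simp add: A h_act_left f_act)
    show "h (A x) y = - h x (A y)"
      using h_skew[of x "A y"] f_herm[of x y] by (simp add: A)
  qed
  moreover have "s x y = so_s A x y" for x y
  proof -
    have "so_s A x y = (1/2) *\<^sub>R (f x y - qconj (f x y))"
      by (simp add: so_s_def A f_herm[of x y] algebra_simps)
    then show ?thesis by (simp add: f_def cmp)
  qed
  ultimately show ?thesis by (rule that)
qed

text \<open>With s = 0 the tensor has too much symmetry: a complex combination of its values is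
  symmetric in three arguments, and paired with a fourth one it becomes alternating in the last
  two.\<close>

lemma invariant_curvature_zero:
  assumes c: "curvature P (\<lambda>x y. 0)" and inv: "unit_invariant P"
  shows "P x y z = 0"
proof -
  note d = curvatureD[OF c] and lin = curvature_linear[OF c]
  have i: "P (x \<cdot> quat_i) (y \<cdot> quat_i) z = P x y z" "P (x \<cdot> quat_j) (y \<cdot> quat_j) z = P x y z"
    "P (x \<cdot> quat_k) (y \<cdot> quat_k) z = P x y z" for x y z
    using inv by (simp_all add: unit_invariant_def)
  have sym: "P z (x \<cdot> quat_j) y = P x (z \<cdot> quat_j) y" "P z (x \<cdot> quat_k) y = P x (z \<cdot> quat_k) y" for x y z
    using i(2)[of "x \<cdot> quat_j" z y] i(3)[of "x \<cdot> quat_k" z y] d(2)[of z "x \<cdot> quat_j" y] d(2)[of z "x \<cdot> quat_k" y]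
    by (simp_all add: act_units lin) (metis minus_minus)+
  have b: "P x y z \<cdot> u = P x (z \<cdot> u) y - P y (z \<cdot> u) x" for x y z u
    using d(9)[of x y "z \<cdot> u"] d(2)[of "z \<cdot> u" x y]
    by (simp add: d(4) algebra_simps eq_neg_iff_add_eq_0)
  \<comment> \<open>Invariance makes both terms symmetric in x and z. The combination with i is
    chosen so that exchanging x and y, by the Bianchi identity, costs \<open>P x y z\<close> acted
    on by j - k i, which is 0.\<close>
  define Z where "Z x z y = P x (z \<cdot> quat_j) y - P x (z \<cdot> quat_k) y \<cdot> quat_i" for x y z
  have Z1: "Z x z y = Z z x y" for x y z by (simp add: Z_def sym[of z x])
  have Z2: "Z x z y = Z y z x" for x y z
  proof -
    have "Z x z y - Z y z x = (P x (z \<cdot> quat_j) y - P y (z \<cdot> quat_j) x)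
      - (P x (z \<cdot> quat_k) y - P y (z \<cdot> quat_k) x) \<cdot> quat_i"
      by (simp add: Z_def act_linear)
    also have "\<dots> = P x y z \<cdot> quat_j - P x y z \<cdot> quat_k \<cdot> quat_i"
      by (simp only: b[of x y z])
    finally show ?thesis by (simp add: act_units)
  qed
  have herm: "h (P x y z) w = qconj (h (P x y w) z)" for x y z w
    using d(5)[of x y z w] h_skew[of "P x y w" z] by simp
  define t where "t x z y w = dpart quat_i (h (Z x z y) w)" for x y z w
  have t_anti: "t x z w y = - t x z y w" for x y z w
    unfolding t_def Z_def h_linear h_act_left herm[of _ _ w y]
    by (simp add: dpart_def quat_eq_iff quat_sel_mult field_simps)
  have t2: "t x z y w = t y z x w" for x y z w
    using Z1[of x z y] Z2[of x z y] by (simp add: t_def)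
  \<comment> \<open>Symmetric in x, z, y and alternating in y, w: moving along the transpositions
    and back to the start changes the sign an odd number of times.\<close>
  have t0: "t x z y w = 0" for x y z w
  proof -
    have "t x z y w = - t x z w y" by (rule t_anti)
    also have "t x z w y = t w z x y" by (rule t2)
    also have "\<dots> = - t w z y x" by (rule t_anti)
    also have "t w z y x = t y z w x" by (rule t2)
    also have "\<dots> = - t y z x w" by (rule t_anti)
    also have "t y z x w = t x z y w" by (rule t2)
    finally have "t x z y w = - t x z y w" by simp
    then show ?thesis by (simp add: quat_eq_iff)
  qed
  have Z0: "Z x z y = 0" for x y z
  proof (rule h_nondeg)
    fix w
    show "h (Z x z y) w = 0"
      using t0[of x z y w] t0[of x z y "w \<cdot> quat_j"]
      by (simp add: t_def dpart_def h_act_right quat_eq_iff quat_sel_mult)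
  qed
  \<comment> \<open>Moving j out of the last argument of Z conflicts with the factor i in its second
    term; the discrepancy is a nonzero multiple of the value sought, acted on by k.\<close>
  have "P x (z \<cdot> quat_k) y = 0" for x y z
  proof -
    have "Z x z (y \<cdot> quat_j) = 0" "Z x z y \<cdot> quat_j = 0" by (simp_all add: Z0)
    then have "P x (z \<cdot> quat_k) y \<cdot> quat_k = 0"
      by (simp add: Z_def d(4) act_linear act_units flip: scaleR_2)
    then show ?thesis using act_cancel[of quat_k] by (simp add: quat_eq_iff)
  qed
  from this[of x "- (y \<cdot> quat_k)" z] show ?thesis by (simp add: act_linear act_units)
qed

theorem curvature_classification:
  assumes c: "curvature P s" and dim: "DIM('a) \<ge> 8"
  obtains A a where "so_op A" "qre a = 0"
    "\<And>x y z. P x y z = so_P A x y z + scalar_P a x y z"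
    "\<And>x y. s x y = so_s A x y + scalar_s a x y"
proof -
  obtain a where a: "qre a = 0" "unit_invariant (\<lambda>x y z. P x y z - scalar_P a x y z)"
    using curvature_scalar_split[OF c dim] .
  note c1 = curvature_diff[OF c curvature_scalar[OF a(1)]]
  obtain A where A: "so_op A" "\<And>x y. s x y - scalar_s a x y = so_s A x y"
    using invariant_curvature_s[OF c1 dim a(2)] by blast
  note c2 = curvature_diff[OF c1 curvature_so[OF A(1)]]
  have c3: "curvature (\<lambda>x y z. P x y z - scalar_P a x y z - so_P A x y z) (\<lambda>x y. 0)"
    using c2 by (simp add: A(2))
  have "P x y z - scalar_P a x y z - so_P A x y z = 0" for x y z
    by (rule invariant_curvature_zero[OF c3 unit_invariant_diff[OF a(2) unit_invariant_so[OF A(1)]]])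
  then have "P x y z = so_P A x y z + scalar_P a x y z" for x y z
    by (simp add: algebra_simps)
  moreover have "s x y = so_s A x y + scalar_s a x y" for x y
    using A(2)[of x y] by (simp add: algebra_simps)
  ultimately show ?thesis using that A(1) a(1) by blast
qed

end

section \<open>The operator D behind a triple product, and its square\<close>

context qform
begin

text \<open>The tensor is written directly in terms of D rather than of A and a. In this form it is
  visibly natural: whatever preserves h up to a twist of scalars carries \<open>RD D\<close> to the
  tensor of the transported D.\<close>

definition RD :: "('a \<Rightarrow> 'a) \<Rightarrow> 'a \<Rightarrow> 'a \<Rightarrow> 'a \<Rightarrow> 'a" where
  "RD D x y z = x \<cdot> h (D y) z - D x \<cdot> h y z - y \<cdot> h (D x) z + D y \<cdot> h x z
     - z \<cdot> (h (D x) y - h (D y) x) + (2 * qre (h x y)) *\<^sub>R D z"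

definition Dop :: "('a \<Rightarrow> 'a) \<Rightarrow> quat \<Rightarrow> 'a \<Rightarrow> 'a" where
  "Dop A a x = A x - x \<cdot> a"

lemma h_sym_part: "h x y - h y x = (2 * qre (h x y)) *\<^sub>R 1"
  using h_skew[of y x] by (simp add: quat_eq_iff)

text \<open>The scalar enters as 2a because \<open>- x \<cdot> a\<close> contributes the same term
  twice, inside \<open>h (D y) z\<close> and through \<open>D x \<cdot> h y z\<close>.\<close>

lemma RD_Dop:
  assumes a: "qre a = 0"
  shows "RD (Dop A a) x y z = so_P A x y z + scalar_P (2 *\<^sub>R a) x y z
     - z \<cdot> (so_s A x y + scalar_s (2 *\<^sub>R a) x y)"
proof -
  have "a * h x y - a * h y x = (2 * qre (h x y)) *\<^sub>R a"
    unfolding right_diff_distrib[symmetric] h_sym_part by simp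
  then have *: "z \<cdot> (a * h x y) = z \<cdot> (a * h y x) + (2 * qre (h x y)) *\<^sub>R (z \<cdot> a)"
    by (simp add: algebra_simps flip: act_scaleR_right act_add_right)
  show ?thesis
    unfolding RD_def Dop_def so_P_def scalar_P_def so_s_def scalar_s_def
    by (simp add: act_linear h_linear h_act_left h_act_right qconj_imag[OF a] act_mult[symmetric]
        * scaleR_2 algebra_simps)
qed

lemma exists_nonzero: "DIM('a) > 0 \<Longrightarrow> \<exists>x::'a. x \<noteq> 0"
  using nonzero_Basis by blast

lemma dual_vector:
  assumes "x \<noteq> 0" obtains z where "h x z = 1"
proof -
  obtain y where "h x y \<noteq> 0" using h_nondeg assms by blast
  then obtain p where "h x y * p = 1" using quat_inverse_exists by blast
  then show ?thesis using that[of "y \<cdot> p"] by (simp add: h_act_right)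
qed

lemma commute_imag_zero:
  assumes "qre s = 0" "quat_i * s = s * quat_i" "quat_j * s = s * quat_j" shows "s = 0"
  using assms by (simp add: quat_eq_iff quat_sel_mult)

text \<open>Right multiplication by s commutes with all right scalars only if s is central, and the
  only central imaginary quaternion is 0. Hence so* and sp(1) meet trivially.\<close>

lemma so_op_act_zero:
  assumes A: "so_op A" "\<And>x. A x = x \<cdot> s" and s: "qre s = 0"
  shows "s = 0"
proof -
  obtain x :: 'a where x: "x \<noteq> 0" using exists_nonzero by auto
  have "x \<cdot> q \<cdot> s = x \<cdot> s \<cdot> q" for q
    by (metis A(2) so_op_linear(5)[OF A(1)])
  then have "x \<cdot> (q * s - s * q) = 0" for q
    by (simp add: act_linear act_mult)
  then have "q * s - s * q = 0" for q using x act_eq_0_iff by blast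
  then show ?thesis using s by (intro commute_imag_zero) auto
qed

text \<open>Injectivity of the map from D to its tensor. Vanishing splits into an so* part and an
  sp(1) part, and the second alone recovers A and a.\<close>

lemma RD_zero:
  assumes A: "so_op A" and a: "qre a = 0" and z: "\<And>x y z. RD (Dop A a) x y z = 0"
  shows "A x = 0" "a = 0"
proof -
  have cP: "so_op (\<lambda>z. so_P A x y z + scalar_P (2 *\<^sub>R a) x y z)" for x y
  proof -
    have a2: "qre (2 *\<^sub>R a) = 0" using a by simp
    note d = curvatureD[OF curvature_so[OF A]] and d' = curvatureD[OF curvature_scalar[OF a2]]
    have real: "so_P A x y (r *\<^sub>R z) = r *\<^sub>R so_P A x y z"
      "scalar_P (2 *\<^sub>R a) x y (r *\<^sub>R z) = r *\<^sub>R scalar_P (2 *\<^sub>R a) x y z" for r z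
      using d(4)[of x y z "of_real r"] d'(4)[of x y z "of_real r"] by (simp_all only: act_of_real)
    show ?thesis
      unfolding so_op_def
      by (intro conjI allI linearI)
         (simp_all add: d(3,4) d'(3,4) real act_linear algebra_simps h_linear d(5)[of x y] d'(5)[of x y])
  qed
  have s0: "so_s A x y + scalar_s (2 *\<^sub>R a) x y = 0" for x y
  proof (rule so_op_act_zero[OF cP])
    show "so_P A x y z + scalar_P (2 *\<^sub>R a) x y z = z \<cdot> (so_s A x y + scalar_s (2 *\<^sub>R a) x y)" for z
      using z[of x y z] by (simp add: RD_Dop[OF a])
    show "qre (so_s A x y + scalar_s (2 *\<^sub>R a) x y) = 0"
      using curvatureD(8)[OF curvature_so[OF A]] a by (simp add: scalar_s_def)
  qed
  show A0: "A x = 0" for x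
  proof (rule ccontr)
    assume "A x \<noteq> 0"
    then obtain y where y: "h (A x) y = 1" using dual_vector by blast
    \<comment> \<open>All imaginary quaternions would be real multiples of one fixed a, which i and
      j contradict.\<close>
    have "q - qconj q = - (4 * qre (h x (y \<cdot> q))) *\<^sub>R a" for q
      using s0[of x "y \<cdot> q"] so_op_herm[OF A, of "y \<cdot> q" x]
      by (simp add: so_s_def scalar_s_def h_act_right y eq_neg_iff_add_eq_0 mult.commute)
    from this[of quat_i] this[of quat_j] show False
      by (auto simp: quat_eq_iff)
  qed
  obtain x :: 'a where "x \<noteq> 0" using exists_nonzero by auto
  then obtain y where "h x y = 1" using dual_vector by blast
  then show "a = 0"
    using s0[of x y] by (simp add: so_s_def scalar_s_def A0)
qed

text \<open>An infinitesimal symmetry of the quaternionic structure and the 2-form induces a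
  derivation of the quaternions; derivations are inner, and removing the inner one leaves a map
  commuting with scalars.\<close>

lemma derivation_split:
  assumes T: "linear T"
    and nrm: "\<And>q. qre q = 0 \<Longrightarrow> \<exists>q'. qre q' = 0 \<and> (\<forall>x. T (x \<cdot> q) = T x \<cdot> q + x \<cdot> q')"
    and sk: "\<And>x y. qre (h (T x) y) + qre (h x (T y)) = 0"
  obtains A s where "so_op A" "qre s = 0" "\<And>x. T x = A x - x \<cdot> s"
proof -
  obtain x0 :: 'a where x0: "x0 \<noteq> 0" using exists_nonzero by auto
  obtain i' where i': "qre i' = 0" "\<And>x. T (x \<cdot> quat_i) = T x \<cdot> quat_i + x \<cdot> i'"
    using nrm[of quat_i] by auto
  obtain j' where j': "qre j' = 0" "\<And>x. T (x \<cdot> quat_j) = T x \<cdot> quat_j + x \<cdot> j'"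
    using nrm[of quat_j] by auto
  have "x0 \<cdot> (i' * quat_i + quat_i * i') = 0" "x0 \<cdot> (j' * quat_j + quat_j * j') = 0"
    "x0 \<cdot> (i' * quat_j + quat_i * j' + j' * quat_i + quat_j * i') = 0"
    using i'(2)[of "x0 \<cdot> quat_i"] j'(2)[of "x0 \<cdot> quat_j"] j'(2)[of "x0 \<cdot> quat_i"] i'(2)[of "x0 \<cdot> quat_j"]
    by (simp_all add: act_units i'(2) j'(2) act_linear act_mult linear_neg[OF T] algebra_simps
        neg_eq_iff_add_eq_0)
  then have rel: "i' * quat_i + quat_i * i' = 0" "j' * quat_j + quat_j * j' = 0"
    "i' * quat_j + quat_i * j' + j' * quat_i + quat_j * i' = 0"
    using x0 act_eq_0_iff by blast+
  \<comment> \<open>Obtained by solving i' = s i - i s and j' = s j - j s for the components of s;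
    the relations \<open>rel\<close> make these equations consistent.\<close>
  define s where "s = Quat 0 (qim3 j' / 2) (- qim3 i' / 2) (qim2 i' / 2)"
  have s: "qre s = 0" "i' = s * quat_i - quat_i * s" "j' = s * quat_j - quat_j * s"
    using rel i'(1) j'(1) by (simp_all add: s_def quat_eq_iff quat_sel_mult)
  define A where "A x = T x + x \<cdot> s" for x
  have Alin: "linear A" unfolding A_def by (intro linear_compose_add T linear_act_left)
  have Ai: "A (x \<cdot> quat_i) = A x \<cdot> quat_i" "A (x \<cdot> quat_j) = A x \<cdot> quat_j" for x
    using s(2,3) by (simp_all add: A_def i' j' act_linear act_mult)
  have Aact: "A (x \<cdot> q) = A x \<cdot> q" for x q
  proof -
    have e: "v \<cdot> q = qre q *\<^sub>R v + qim1 q *\<^sub>R (v \<cdot> quat_i) + qim2 q *\<^sub>R (v \<cdot> quat_j)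
      + qim3 q *\<^sub>R (v \<cdot> quat_i \<cdot> quat_j)" for v
      by (subst quat_decomp[of q]) (simp add: act_linear act_mult act_of_real act_units act_scaleR_left)
    show ?thesis
      unfolding e by (simp add: linear_add[OF Alin] linear_scale[OF Alin] Ai)
  qed
  have re: "qre (h (A x) y) + qre (h x (A y)) = 0" for x y
    using sk[of x y] s(1)
    by (simp add: A_def h_linear h_act_left h_act_right qconj_imag quat_sel_mult algebra_simps)
  \<comment> \<open>As A commutes with scalars, the real identity may be applied to all y q, and
    this recovers every component.\<close>
  have "h (A x) y = - h x (A y)" for x y
  proof -
    have "qre (h (A x) (y \<cdot> q)) + qre (h x (A (y \<cdot> q))) = 0" for q by (rule re)
    from this[of quat_i] this[of quat_j] this[of quat_k] re[of x y]
    show ?thesis by (simp add: Aact h_act_right quat_eq_iff quat_sel_mult)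
  qed
  then have "so_op A" using Alin Aact by (simp add: so_op_def)
  then show ?thesis using that[of A s] s(1) by (simp add: A_def)
qed

lemma so_op_act_unique:
  assumes "so_op A" "so_op A'" "qre s = 0" "qre s' = 0" "\<And>x. A x - x \<cdot> s = A' x - x \<cdot> s'"
  shows "A x = A' x" "s = s'"
proof -
  have so: "so_op (\<lambda>x. A x - A' x)"
    using assms(1,2) unfolding so_op_def by (auto intro!: linear_compose_sub simp: act_linear h_linear)
  have "A x - A' x = x \<cdot> (s - s')" for x
    using assms(5)[of x] by (simp add: act_linear algebra_simps)
  from so_op_act_zero[OF so this] assms(3,4) show "s = s'" by simp
  then show "A x = A' x" using assms(5)[of x] by simp
qed

definition derivation :: "('a \<Rightarrow> 'a) \<Rightarrow> bool" where
  "derivation T \<longleftrightarrow> linear T \<and>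
     (\<forall>q. qre q = 0 \<longrightarrow> (\<exists>q'. qre q' = 0 \<and> (\<forall>x. T (x \<cdot> q) = T x \<cdot> q + x \<cdot> q'))) \<and>
     (\<forall>x y. qre (h (T x) y) + qre (h x (T y)) = 0)"

text \<open>The splitting of each R x y is chosen separately; its uniqueness is what makes
  \<open>P\<close> and \<open>s\<close> depend linearly and alternatingly on x and y.\<close>

theorem curvature_form:
  assumes R: "\<And>y z. linear (\<lambda>x. R x y z)" "\<And>x y z. R y x z = - R x y z"
    "\<And>x y z. R x y z + R y z x + R z x y = 0" "\<And>x y. derivation (R x y)"
    and dim: "DIM('a) \<ge> 8"
  obtains A a where "so_op A" "qre a = 0" "\<And>x y z. R x y z = RD (Dop A a) x y z"
proof -
  have "\<exists>A s. so_op A \<and> qre s = 0 \<and> (\<forall>z. R x y z = A z - z \<cdot> s)" for x y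
    using R(4)[of x y] unfolding derivation_def by (metis derivation_split)
  then obtain P s where Ps: "\<And>x y. so_op (P x y)" "\<And>x y. qre (s x y) = 0"
    "\<And>x y z. R x y z = P x y z - z \<cdot> s x y" by metis
  have uniq: "P' z = P x y z" "s' = s x y" if "so_op P'" "qre s' = 0" "\<And>z. R x y z = P' z - z \<cdot> s'" for P' s' x y z
  proof -
    have e: "P' z - z \<cdot> s' = P x y z - z \<cdot> s x y" for z using that(3)[of z] Ps(3)[of x y z] by simp
    show "P' z = P x y z" "s' = s x y"
      using so_op_act_unique[OF that(1) Ps(1) that(2) Ps(2) e] by blast+
  qed
  have so_comb: "so_op (\<lambda>z. A z + A' z)" "so_op (\<lambda>z. r *\<^sub>R A z)" "so_op (\<lambda>z. - A z)"
    if "so_op A" "so_op A'" for A A' r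
    using that unfolding so_op_def
    by (auto intro!: linear_compose_add linear_compose_scale_right linear_compose_neg simp: act_linear h_linear)
  note lR = linear_add[OF R(1)] linear_scale[OF R(1)]
  have add: "P x y z + P x' y z = P (x + x') y z" "s x y + s x' y = s (x + x') y" for x x' y z
  proof -
    have q: "qre (s x y + s x' y) = 0" by (simp add: Ps(2))
    have e: "R (x + x') y z = (P x y z + P x' y z) - z \<cdot> (s x y + s x' y)" for z
      unfolding lR(1) Ps(3)[of x y] Ps(3)[of x' y] by (simp add: act_linear)
    show "P x y z + P x' y z = P (x + x') y z" "s x y + s x' y = s (x + x') y"
      using uniq[OF so_comb(1)[OF Ps(1) Ps(1)] q e] .
  qed
  have sc: "r *\<^sub>R P x y z = P (r *\<^sub>R x) y z" "r *\<^sub>R s x y = s (r *\<^sub>R x) y" for x y z r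
  proof -
    have q: "qre (r *\<^sub>R s x y) = 0" by (simp add: Ps(2))
    have e: "R (r *\<^sub>R x) y z = r *\<^sub>R P x y z - z \<cdot> (r *\<^sub>R s x y)" for z
      unfolding lR(2) Ps(3)[of x y] by (simp add: act_linear algebra_simps)
    show "r *\<^sub>R P x y z = P (r *\<^sub>R x) y z" "r *\<^sub>R s x y = s (r *\<^sub>R x) y"
      using uniq[OF so_comb(2)[OF Ps(1) Ps(1)] q e] .
  qed
  have sk: "- P x y z = P y x z" "- s x y = s y x" for x y z
  proof -
    have q: "qre (- s x y) = 0" by (simp add: Ps(2))
    have e: "R y x z = - P x y z - z \<cdot> (- s x y)" for z
      unfolding R(2)[of y x] Ps(3)[of x y] by (simp add: act_linear)
    show "- P x y z = P y x z" "- s x y = s y x"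
      using uniq[OF so_comb(3)[OF Ps(1) Ps(1)] q e] .
  qed
  have "curvature P s"
    unfolding curvature_def
  proof (intro conjI allI)
    fix x y z w :: 'a and q
    show "linear (\<lambda>x. P x y z)" "linear (\<lambda>x. s x y)"
      by (rule linearI; simp add: add sc)+
    show "P x y z + P y z x + P z x y = z \<cdot> s x y + x \<cdot> s y z + y \<cdot> s z x"
      using R(3)[of x y z] by (simp add: Ps(3) algebra_simps)
    show "h (P x y z) w = - h z (P x y w)" using Ps(1) by (simp add: so_op_def)
  qed (simp_all add: sk Ps(2) so_op_linear[OF Ps(1)])
  from curvature_classification[OF this dim] obtain A a where
    A: "so_op A" "qre a = 0" "\<And>x y z. P x y z = so_P A x y z + scalar_P a x y z"
    "\<And>x y. s x y = so_s A x y + scalar_s a x y" by blast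
  \<comment> \<open>Halved because \<open>RD_Dop\<close> doubles the scalar.\<close>
  have a2: "qre ((1/2) *\<^sub>R a) = 0" using A(2) by simp
  have "R x y z = RD (Dop A ((1/2) *\<^sub>R a)) x y z" for x y z
    unfolding RD_Dop[OF a2] Ps(3) A(3,4) by simp
  then show ?thesis using that A(1) a2 by blast
qed

text \<open>\<open>RD D\<close> is assembled from h, scalars and D. A map T in so* + sp(1)
  differentiates h and the scalars compatibly, so the only defect is the commutator of T with
  D.\<close>

lemma RD_invariance:
  assumes T: "so_op E" "qre s = 0" "\<And>x. T x = E x - x \<cdot> s"
    and D: "linear D"
  shows "T (RD D u v w) - RD D (T u) v w - RD D u (T v) w - RD D u v (T w)
     = RD (\<lambda>x. T (D x) - D (T x)) u v w"
proof -
  have lin: "T (x + y) = T x + T y" "T (x - y) = T x - T y" "T (r *\<^sub>R x) = r *\<^sub>R T x" for x y r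
    by (simp_all add: T(3) so_op_linear[OF T(1)] act_linear algebra_simps)
  have act: "T (x \<cdot> q) = T x \<cdot> q + x \<cdot> (s * q - q * s)" for x q
    by (simp add: T(3) so_op_linear[OF T(1)] act_linear act_mult)
  have "h (E x) y + h x (E y) = 0" for x y using T(1) by (simp add: so_op_def)
  then have hT: "s * h x y - h x y * s = h (T x) y + h x (T y)" for x y
    by (simp add: T(3) h_linear h_act_left h_act_right qconj_imag[OF T(2)] algebra_simps)
  then have hT': "s * h x y = h (T x) y + h x (T y) + h x y * s" for x y
    by (metis diff_add_cancel)
  have re: "qre (h (T u) v) + qre (h u (T v)) = 0"
    using arg_cong[OF hT[of u v], of qre] by (simp add: quat_sel_mult)
  then have re': "qre (h u (T v)) = - qre (h (T u) v)" by simp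
  show ?thesis
    unfolding RD_def
    by (simp add: lin act act_linear h_linear right_diff_distrib left_diff_distrib hT' re' linear_add[OF D]
        linear_diff[OF D] algebra_simps)
qed

lemma so_op_commutator:
  assumes "so_op A" "so_op B" shows "so_op (\<lambda>x. A (B x) - B (A x))"
  unfolding so_op_def
proof (intro conjI allI)
  note l = so_op_linear[OF assms(1)] so_op_linear[OF assms(2)]
  have sk: "h (A x) y = - h x (A y)" "h (B x) y = - h x (B y)" for x y
    using assms by (simp_all add: so_op_def)
  show "linear (\<lambda>x. A (B x) - B (A x))" by (rule linearI) (simp_all add: l algebra_simps)
  show "A (B (x \<cdot> q)) - B (A (x \<cdot> q)) = (A (B x) - B (A x)) \<cdot> q" for x q
    by (simp add: l act_linear)
  show "h (A (B x) - B (A x)) y = - h x (A (B y) - B (A y))" for x y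
    by (simp add: h_linear sk)
qed

text \<open>The hypothesis makes every T = R x y annihilate the tensor, so the tensor of the
  commutator of T and D vanishes, and with it the commutator: P x y commutes with A and s x y with
  a. There are enough operators s x y to force a = 0 unless A = 0, and enough P x y to force A A to
  be a real scalar when a = 0.\<close>

theorem curvature_operator_square:
  assumes A: "so_op A" and a: "qre a = 0"
    and inv: "\<And>x y u v w. RD (Dop A a) x y (RD (Dop A a) u v w) =
       RD (Dop A a) (RD (Dop A a) x y u) v w + RD (Dop A a) u (RD (Dop A a) x y v) w
       + RD (Dop A a) u v (RD (Dop A a) x y w)"
  shows "(\<forall>x. A x = 0) \<or> a = 0 \<and> (\<exists>d. \<forall>x. A (A x) = d *\<^sub>R x)"
proof -
  have a2: "qre (2 *\<^sub>R a) = 0" using a by simp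
  define P where "P x y z = so_P A x y z + scalar_P (2 *\<^sub>R a) x y z" for x y z
  define s where "s x y = so_s A x y + scalar_s (2 *\<^sub>R a) x y" for x y
  note d = curvatureD[OF curvature_so[OF A]] and d' = curvatureD[OF curvature_scalar[OF a2]]
  have real: "so_P A x y (r *\<^sub>R z) = r *\<^sub>R so_P A x y z"
    "scalar_P (2 *\<^sub>R a) x y (r *\<^sub>R z) = r *\<^sub>R scalar_P (2 *\<^sub>R a) x y z" for x y r z
    using d(4)[of x y z "of_real r"] d'(4)[of x y z "of_real r"] by (simp_all only: act_of_real)
  have soP: "so_op (P x y)" for x y
    unfolding so_op_def P_def
    by (intro conjI allI linearI)
       (simp_all add: d(3,4) d'(3,4) real act_linear algebra_simps h_linear d(5)[of x y] d'(5)[of x y])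
  have res: "qre (s x y) = 0" for x y by (simp add: s_def d(8) d'(8))
  have T: "RD (Dop A a) x y z = P x y z - z \<cdot> s x y" for x y z
    by (simp add: RD_Dop[OF a] P_def s_def)
  have linD: "linear (Dop A a)"
    unfolding Dop_def using A by (auto intro!: linear_compose_sub linear_act_left simp: so_op_def)
  have key: "P x y (A z) = A (P x y z)" "s x y * a = a * s x y" for x y z
  proof -
    have eq: "RD (Dop A a) x y (Dop A a w) - Dop A a (RD (Dop A a) x y w) =
      Dop (\<lambda>z. P x y (A z) - A (P x y z)) (s x y * a - a * s x y) w" for w
      unfolding T by (simp add: Dop_def so_op_linear[OF A] so_op_linear[OF soP] act_linear act_mult algebra_simps)
    have z: "RD (Dop (\<lambda>z. P x y (A z) - A (P x y z)) (s x y * a - a * s x y)) u v w = 0" for u v w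
      using RD_invariance[OF soP res T linD, of x y u v w] inv[of x y u v w] unfolding eq by simp
    have r: "qre (s x y * a - a * s x y) = 0" by (simp add: quat_sel_mult)
    from RD_zero[OF so_op_commutator[OF soP A] r z]
    show "P x y (A z) = A (P x y z)" "s x y * a = a * s x y" by simp_all
  qed
  show ?thesis
  proof (cases "a = 0")
    case False
    have "A x = 0" for x
    proof (rule ccontr)
      assume "A x \<noteq> 0"
      then obtain y where y: "h (A x) y = 1" using dual_vector by blast
      \<comment> \<open>For these arguments s equals \<open>q - qconj q\<close> up to a multiple of
        a, so a commutes with every imaginary quaternion.\<close>
      have "(q - qconj q) * a = a * (q - qconj q)" for q
        using key(2)[of x "y \<cdot> q"] so_op_herm[OF A, of "y \<cdot> q" x]
        by (simp add: s_def so_s_def scalar_s_def h_act_right y algebra_simps)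
      from this[of quat_i] this[of quat_j] have "a = 0"
        by (intro commute_imag_zero[OF a]) (simp_all add: quat_eq_iff quat_sel_mult)
      then show False using False by simp
    qed
    then show ?thesis by simp
  next
    case True
    have hA: "h x (A y) = - h (A x) y" for x y using A by (simp add: so_op_def)
    have P: "P x y z = so_P A x y z" for x y z by (simp add: P_def True scalar_P_def)
    define B where "B x = A (A x)" for x
    have Bact: "B (x \<cdot> q) = B x \<cdot> q" "B (- x) = - B x" for x q by (simp_all add: B_def so_op_linear[OF A])
    \<comment> \<open>The commutator of A with \<open>so_P A x y\<close>: the terms containing A
      twice on different vectors cancel and only B = A A is left.\<close>
    have eq: "B x \<cdot> h y z - x \<cdot> h (B y) z + y \<cdot> h (B x) z - B y \<cdot> h x z = 0" for x y z
      using key(1)[of x y z]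
      by (simp add: P so_P_def so_op_linear[OF A] hA act_linear B_def algebra_simps)
    have eig: "\<exists>r. B y = r *\<^sub>R y" for y
    proof (cases "y = 0")
      case True
      then show ?thesis by (simp add: B_def so_op_linear[OF A])
    next
      case False
      then obtain z where z: "h y z = 1" using dual_vector by blast
      define \<beta> where "\<beta> = h (B y) z"
      \<comment> \<open>Putting \<open>y \<cdot> u\<close> and y into the first two places for
        imaginary u gives By in terms of y. Comparing the units u then shows that the quaternionic
        eigenvalue \<mu> is real.\<close>
      have u: "B y \<cdot> u = y \<cdot> (u * \<beta>)" if "qconj u = - u" for u
      proof -
        have "2 *\<^sub>R (B y \<cdot> u - y \<cdot> (u * \<beta>)) = 0"
          using eq[of "y \<cdot> u" y z] that
          by (simp add: z \<beta>_def[symmetric] Bact h_act_left act_linear act_mult scaleR_2 algebra_simps)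
        then show ?thesis by simp
      qed
      define \<mu> where "\<mu> = - (quat_i * \<beta> * quat_i)"
      have By: "B y = y \<cdot> \<mu>"
        using arg_cong[OF u[of quat_i], of "\<lambda>v. v \<cdot> quat_i"]
        by (simp add: act_units \<mu>_def act_linear act_mult) (metis minus_minus)
      have "\<beta> = qconj \<mu>" by (simp add: \<beta>_def By h_act_left z)
      moreover have "\<mu> * u = u * \<beta>" if "qconj u = - u" for u
      proof -
        have "y \<cdot> (\<mu> * u - u * \<beta>) = 0" using u[OF that] by (simp add: By act_linear act_mult)
        then show ?thesis using False by (simp add: act_eq_0_iff)
      qed
      from this[of quat_i] this[of quat_j] this[of quat_k] \<open>\<beta> = qconj \<mu>\<close> have "\<mu> = of_real (qre \<mu>)"
        by (simp add: quat_eq_iff quat_sel_mult)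
      then have "B y = qre \<mu> *\<^sub>R y" using By by (metis act_of_real)
      then show ?thesis ..
    qed
    obtain x0 :: 'a where x0: "x0 \<noteq> 0" using exists_nonzero by auto
    obtain r where r: "B x0 = r *\<^sub>R x0" using eig by blast
    have "B y = r *\<^sub>R y" for y
    proof (cases "y = 0")
      case True
      then show ?thesis by (simp add: B_def so_op_linear[OF A])
    next
      case False
      obtain t where t: "B y = t *\<^sub>R y" using eig by blast
      obtain z where z: "h y z = 1" using dual_vector False by blast
      have "(r - t) *\<^sub>R (x0 + y \<cdot> h x0 z) = 0"
        using eq[of x0 y z] by (simp add: r t z h_linear act_linear algebra_simps)
      then consider "r = t" | "x0 = y \<cdot> (- h x0 z)"
        by (auto simp: act_linear eq_neg_iff_add_eq_0)
      then show ?thesis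
      proof cases
        case 2
        then have "B x0 = t *\<^sub>R x0" by (metis Bact(1) act_scaleR_left t)
        then show ?thesis using r x0 t by simp
      qed (simp add: t)
    qed
    then show ?thesis using True by (auto simp: B_def)
  qed
qed

end

section \<open>Normal forms\<close>

lemma enum_append:
  fixes p q :: nat
  assumes "bij_betw w1 {..<p} S1" "bij_betw w2 {..<q} S2" "S1 \<inter> S2 = {}"
  shows "bij_betw (\<lambda>r. if r < p then w1 r else w2 (r - p)) {..<p + q} (S1 \<union> S2)"
proof -
  let ?w = "\<lambda>r. if r < p then w1 r else w2 (r - p)"
  have 1: "bij_betw ?w {..<p} S1" using assms(1) by (subst bij_betw_cong[of "{..<p}" ?w w1]) auto
  have "bij_betw (\<lambda>r. r - p) {p..<p + q} {..<q}"
    by (rule bij_betw_byWitness[of _ "\<lambda>r. r + p"]) auto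
  from bij_betw_trans[OF this assms(2)] have "bij_betw ?w {p..<p + q} S2"
    by (subst bij_betw_cong[of _ _ "w2 \<circ> (\<lambda>r. r - p)"]) auto
  from bij_betw_combine[OF 1 this assms(3)] show ?thesis
    by (simp add: ivl_disj_un)
qed

lemma sum_single:
  assumes "finite S" "a \<in> S" "\<And>x. x \<in> S \<Longrightarrow> x \<noteq> a \<Longrightarrow> f x = 0"
  shows "sum f S = f a"
  using assms by (simp add: sum.remove[of S a] sum.neutral)

lemma to_nat_on_bij: "bij_betw (to_nat_on (UNIV :: 'n::finite set)) UNIV {..<CARD('n)}"
  by (rule to_nat_on_finite) simp

lemma to_nat_on_less [simp]: "to_nat_on (UNIV :: 'n::finite set) i < CARD('n)"
  using to_nat_on_bij[where 'n='n] by (auto simp: bij_betw_def)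

context qform
begin

text \<open>Independence is not demanded: spanning by as many vectors as the quaternionic dimension
  implies it, which is used in \<open>realizes_imp_isometry\<close>.\<close>

definition realizes :: "('n::finite) qmat \<Rightarrow> 'n qmat \<Rightarrow> ('a \<Rightarrow> 'a) \<Rightarrow> ('n \<Rightarrow> 'a) \<Rightarrow> bool" where
  "realizes J M A v \<longleftrightarrow> (\<forall>i k. h (v i) (v k) = J $ i $ k) \<and>
     (\<forall>k. A (v k) = (\<Sum>i\<in>UNIV. v i \<cdot> M $ i $ k)) \<and> span (\<Union>i. range (\<lambda>q. v i \<cdot> q)) = UNIV"

lemma realizes_mat_from:
  assumes "\<And>r s. r < CARD('n) \<Longrightarrow> s < CARD('n) \<Longrightarrow> h (w r) (w s) = f r s"
    and "\<And>s. s < CARD('n) \<Longrightarrow> A (w s) = (\<Sum>r<CARD('n). w r \<cdot> g r s)"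
    and "span (\<Union>r<CARD('n). range (\<lambda>q. w r \<cdot> q)) = UNIV"
  shows "realizes (mat_from f :: ('n::finite) qmat) (mat_from g) A (\<lambda>i. w (to_nat_on UNIV i))"
proof -
  have "(\<Union>i::'n. range (\<lambda>q. w (to_nat_on UNIV i) \<cdot> q)) = (\<Union>r\<in>to_nat_on UNIV ` (UNIV::'n set). range (\<lambda>q. w r \<cdot> q))"
    by (simp only: image_image)
  also have "to_nat_on UNIV ` (UNIV::'n set) = {..<CARD('n)}"
    using to_nat_on_bij[where 'n='n] by (simp add: bij_betw_def)
  finally have U: "(\<Union>i::'n. range (\<lambda>q. w (to_nat_on UNIV i) \<cdot> q)) = (\<Union>r<CARD('n). range (\<lambda>q. w r \<cdot> q))" .
  show ?thesis
    unfolding realizes_def U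
    using assms sum.reindex_bij_betw[OF to_nat_on_bij[where 'n='n], of "\<lambda>r. w r \<cdot> g r s" for s]
    by (simp add: mat_from_def)
qed

lemma so_op_perp_invariant:
  assumes A: "so_op A" and U: "A ` U \<subseteq> U"
  shows "A ` perp U \<subseteq> perp U"
proof -
  have "h u (A w) = - h (A u) w" for u w using A by (simp add: so_op_def)
  then show ?thesis using U by (auto simp: perp_def)
qed

lemma orthonormal_realizes:
  assumes dim: "DIM('a) = 4 * CARD('n::finite)"
    and S: "finite S" "orthonormal quat_j S" "DIM('a) = 4 * card S"
    "span (\<Union>e\<in>S. range (\<lambda>q. e \<cdot> q)) = UNIV"
    and A: "\<And>e. e \<in> S \<Longrightarrow> A e = e \<cdot> quat_j \<or> A e = - (e \<cdot> quat_j)"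
  shows "\<exists>p q v. p + q = CARD('n) \<and>
    realizes (form_diag :: 'n qmat) (mat_from (diag_of (\<lambda>r. quat_j * I_sig p r))) A v"
proof -
  define S1 where "S1 = {e\<in>S. A e = e \<cdot> quat_j}"
  define p where "p = card S1"
  define q where "q = card (S - S1)"
  have pq: "p + q = CARD('n)"
  proof -
    have "S1 \<subseteq> S" by (auto simp: S1_def)
    then show ?thesis
      using dim S(1,3) card_mono[OF S(1), of S1]
      by (simp add: p_def q_def card_Diff_subset finite_subset)
  qed
  obtain w1 where w1: "bij_betw w1 {..<p} S1"
    using ex_bij_betw_nat_finite[of S1] S(1) by (auto simp: p_def S1_def lessThan_atLeast0)
  obtain w2 where w2: "bij_betw w2 {..<q} (S - S1)"
    using ex_bij_betw_nat_finite[of "S - S1"] S(1) by (auto simp: q_def lessThan_atLeast0)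
  define w where "w r = (if r < p then w1 r else w2 (r - p))" for r
  have "S1 \<union> (S - S1) = S" by (auto simp: S1_def)
  then have w: "bij_betw w {..<CARD('n)} S"
    using enum_append[OF w1 w2] pq by (simp add: w_def[abs_def])
  have wS: "w r \<in> S" if "r < CARD('n)" for r
    using w that by (auto simp: bij_betw_def)
  have inj: "w r = w s \<longleftrightarrow> r = s" if "r < CARD('n)" "s < CARD('n)" for r s
    using w that by (auto simp: bij_betw_def inj_on_def)
  have Aw: "A (w r) = w r \<cdot> (quat_j * I_sig p r)" if r: "r < CARD('n)" for r
  proof (cases "r < p")
    case True
    then have "w r \<in> S1" using w1 by (auto simp: w_def bij_betw_def)
    then show ?thesis using True by (simp add: S1_def I_sig_def)
  next
    case False
    then have "w r \<in> S - S1" using w2 r pq by (auto simp: w_def bij_betw_def)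
    then show ?thesis using False A[of "w r"] by (auto simp add: S1_def I_sig_def act_minus_right)
  qed
  have "realizes (form_diag :: 'n qmat) (mat_from (diag_of (\<lambda>r. quat_j * I_sig p r))) A
     (\<lambda>i. w (to_nat_on UNIV i))"
    unfolding form_diag_def
  proof (rule realizes_mat_from)
    show "h (w r) (w s) = diag_of (\<lambda>_. quat_j) r s" if "r < CARD('n)" "s < CARD('n)" for r s
      using S(2) wS[OF that(1)] wS[OF that(2)] inj[OF that] by (auto simp: orthonormal_def diag_of_def)
    show "A (w s) = (\<Sum>r<CARD('n). w r \<cdot> diag_of (\<lambda>r. quat_j * I_sig p r) r s)" if "s < CARD('n)" for s
      using that by (subst sum_single[of _ s]) (auto simp: diag_of_def Aw)
    show "span (\<Union>r<CARD('n). range (\<lambda>q. w r \<cdot> q)) = UNIV"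
    proof -
      have im: "w ` {..<CARD('n)} = S" using w by (simp add: bij_betw_def)
      have "(\<Union>r<CARD('n). range (\<lambda>q. w r \<cdot> q)) = (\<Union>e\<in>S. range (\<lambda>q. e \<cdot> q))"
        unfolding im[symmetric] by (simp only: image_image)
      then show ?thesis using S(4) by simp
    qed
  qed
  then show ?thesis using pq by blast
qed

lemma normal_form_zero:
  assumes dim: "DIM('a) = 4 * CARD('n::finite)"
  shows "\<exists>v. realizes (form_diag :: 'n qmat) 0 (\<lambda>_. 0) v"
proof -
  obtain S where S: "finite S" "orthonormal quat_j S" "DIM('a) = 4 * card S"
    "span (\<Union>e\<in>S. range (\<lambda>q. e \<cdot> q)) = UNIV"
    using orthonormal_basis_exists[of quat_j] by auto
  \<comment> \<open>\<open>orthonormal_realizes\<close> looks at its operator only on S, so the map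
    \<open>e \<cdot> quat_j\<close> may be inserted merely to obtain an enumerated basis; afterwards
    the operator is replaced by 0.\<close>
  obtain p q v where "realizes (form_diag :: 'n qmat) (mat_from (diag_of (\<lambda>r. quat_j * I_sig p r))) (\<lambda>e. e \<cdot> quat_j) v"
    using orthonormal_realizes[OF dim S, of "\<lambda>e. e \<cdot> quat_j"] by auto
  then have "realizes (form_diag :: 'n qmat) 0 (\<lambda>_. 0) v" by (simp add: realizes_def)
  then show ?thesis by (intro exI)
qed

text \<open>The vectors with \<open>A v = v \<cdot> quat_j\<close> form a complex half V of the
  space, on which h takes values in the complex numbers generated by j. Its j-component is a
  Hermitian form, and diagonalizing that form diagonalizes A.\<close>

lemma normal_form_complex:
  assumes A: "so_op A" "\<And>x. A (A x) = - x" and dim: "DIM('a) = 4 * CARD('n::finite)"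
  shows "\<exists>p q v. p + q = CARD('n) \<and>
    realizes (form_diag :: 'n qmat) (mat_from (diag_of (\<lambda>r. quat_j * I_sig p r))) A v"
proof -
  define P where "P e \<longleftrightarrow> A e = e \<cdot> quat_j \<or> A e = - (e \<cdot> quat_j)" for e
  have hA: "h (A x) y = - h x (A y)" for x y using A(1) by (simp add: so_op_def)
  note l = so_op_linear[OF A(1)]
  have ex: "\<exists>e\<in>W. h e e = quat_j \<and> P e"
    if W: "submodule W" "nondeg W" "A ` W \<subseteq> W" "W \<noteq> {0}" for W
  proof -
    define V where "V = {v\<in>W. A v = v \<cdot> quat_j}"
    have sW: "subspace W" and aW: "\<And>x q. x \<in> W \<Longrightarrow> x \<cdot> q \<in> W" using W(1) by (auto simp: submodule_def)
    have AW: "A w \<in> W" if "w \<in> W" for w using W(3) that by auto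
    have split: "\<exists>v\<in>V. \<exists>v'\<in>V. w = v + v' \<cdot> quat_i" if w: "w \<in> W" for w
    proof (intro bexI)
      let ?v = "(1/2) *\<^sub>R (w - A w \<cdot> quat_j)"
      let ?v' = "- (1/2) *\<^sub>R ((w + A w \<cdot> quat_j) \<cdot> quat_i)"
      have "?v + ?v' \<cdot> quat_i = (1/2) *\<^sub>R (w + w)"
        by (simp add: act_linear act_units algebra_simps)
      then show "w = ?v + ?v' \<cdot> quat_i" by (simp flip: scaleR_2)
      show "?v \<in> V" "?v' \<in> V"
        using w aW AW sW unfolding V_def
        by (auto simp: l A(2) act_linear act_units intro!: subspace_scale subspace_add subspace_diff
          simp: algebra_simps)
    qed
    have hV: "h x y * quat_j = quat_j * h x y" if "x \<in> V" "y \<in> V" for x y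
      using hA[of x y] that by (simp add: V_def h_act_left h_act_right)
    have hV': "qim1 (h x y) = 0" "qim3 (h x y) = 0" if "x \<in> V" "y \<in> V" for x y
      using hV[OF that] by (simp_all add: quat_eq_iff quat_sel_mult)
    have Vadd: "x + y \<in> V" "x \<cdot> quat_j \<in> V" if "x \<in> V" "y \<in> V" for x y
      using that sW aW by (auto simp: V_def l act_linear subspace_add)
    \<comment> \<open>Otherwise polarization makes h vanish on V, hence on W, because V and V i
      together span W.\<close>
    have "\<exists>v\<in>V. qim2 (h v v) \<noteq> 0"
    proof (rule ccontr)
      assume "\<not> ?thesis"
      then have 0: "qim2 (h v v) = 0" if "v \<in> V" for v using that by blast
      have 1: "qim2 (h x y) = 0" if "x \<in> V" "y \<in> V" for x y
        using 0[OF Vadd(1)[OF that]] 0[OF that(1)] 0[OF that(2)] h_skew[of y x] by (simp add: h_linear)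
      have hV0: "h x y = 0" if "x \<in> V" "y \<in> V" for x y
        using 1[OF that] hV'[OF that] 1[OF that(1) Vadd(2)[OF that(2,2)]]
        by (simp add: quat_eq_iff h_act_right quat_sel_mult)
      have "h x y = 0" if x: "x \<in> W" and y: "y \<in> W" for x y
      proof -
        obtain a b where ab: "a \<in> V" "b \<in> V" "x = a + b \<cdot> quat_i" using split[OF x] by blast
        obtain c d where cd: "c \<in> V" "d \<in> V" "y = c + d \<cdot> quat_i" using split[OF y] by blast
        show ?thesis using ab cd by (simp add: h_linear h_act_left h_act_right hV0)
      qed
      then have "x = 0" if "x \<in> W" for x using W(2) that by (auto simp: nondeg_def)
      then show False using W(4) subspace_0[OF sW] by auto
    qed
    then obtain v where v: "v \<in> V" "qim2 (h v v) \<noteq> 0" by blast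
    define c where "c = qim2 (h v v)"
    have hv: "h v v = c *\<^sub>R quat_j"
      using hV'[OF v(1,1)] h_self_imag[of v] by (simp add: quat_eq_iff c_def)
    have vW: "v \<in> W" "A v = v \<cdot> quat_j" using v(1) by (simp_all add: V_def)
    show ?thesis
    proof (cases "c > 0")
      case True
      let ?e = "(1 / sqrt c) *\<^sub>R v"
      have "?e \<in> W" using vW sW by (simp add: subspace_scale)
      moreover have "h ?e ?e = quat_j" using True by (simp add: h_scaleR hv)
      moreover have "P ?e" by (simp add: P_def l vW act_linear)
      ultimately show ?thesis by blast
    next
      case False
      then have c: "- c > 0" using v(2) by (simp add: c_def)
      \<comment> \<open>For a negative value the vector v i is used. It changes the sign of both h
        and the eigenvalue, so the signature of the Hermitian form is stored in the signs of
        A.\<close>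
      let ?e = "(1 / sqrt (- c)) *\<^sub>R (v \<cdot> quat_i)"
      have "?e \<in> W" using vW sW aW by (simp add: subspace_scale)
      moreover have "h ?e ?e = quat_j"
        using c by (simp add: h_scaleR h_act hv)
      moreover have "P ?e" by (simp add: P_def l vW act_linear act_units)
      ultimately show ?thesis by blast
    qed
  qed
  have inv: "A ` (W \<inter> perp (range (\<lambda>q. e \<cdot> q))) \<subseteq> perp (range (\<lambda>q. e \<cdot> q))" if "P e" for e W
  proof -
    have "A ` range (\<lambda>q. e \<cdot> q) \<subseteq> range (\<lambda>q. e \<cdot> q)"
      using \<open>P e\<close> by (auto simp: P_def l simp flip: act_mult act_minus_right)
    from so_op_perp_invariant[OF A(1) this] show ?thesis by auto
  qed
  have "quat_j \<noteq> 0" by (simp add: quat_eq_iff)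
  have "\<exists>S. finite S \<and> S \<subseteq> UNIV \<and> orthonormal quat_j S \<and> (\<forall>e\<in>S. P e) \<and> dim (UNIV::'a set) = 4 * card S \<and>
     UNIV \<subseteq> span (\<Union>e\<in>S. range (\<lambda>q. e \<cdot> q))"
    by (rule orthonormal_decomposition[of _ A])
       (use submodule_UNIV nondeg_UNIV \<open>quat_j \<noteq> 0\<close> ex inv in auto)
  then obtain S where S: "finite S" "orthonormal quat_j S" "DIM('a) = 4 * card S"
    "span (\<Union>e\<in>S. range (\<lambda>q. e \<cdot> q)) = UNIV" and SP: "\<And>e. e \<in> S \<Longrightarrow> P e" by auto
  show ?thesis by (rule orthonormal_realizes[OF dim S]) (use SP P_def in blast)
qed

lemma hyp_span_invariant:
  assumes A: "so_op A" and b: "A (fst b) \<in> hyp_span b" "A (snd b) \<in> hyp_span b"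
  shows "A ` perp (hyp_span b) \<subseteq> perp (hyp_span b)"
proof (rule so_op_perp_invariant[OF A], rule image_subsetI)
  note l = so_op_linear[OF A]
  fix x assume "x \<in> hyp_span b"
  then obtain p q where x: "x = fst b \<cdot> p + snd b \<cdot> q" by (auto simp: hyp_span_def case_prod_beta)
  obtain p1 q1 p2 q2 where "A (fst b) = fst b \<cdot> p1 + snd b \<cdot> q1" "A (snd b) = fst b \<cdot> p2 + snd b \<cdot> q2"
    using b by (auto simp: hyp_span_def case_prod_beta)
  then have "A x = fst b \<cdot> (p1 * p + p2 * q) + snd b \<cdot> (q1 * p + q2 * q)"
    by (simp add: x l act_linear act_mult)
  then show "A x \<in> hyp_span b" unfolding hyp_span_def case_prod_beta by blast
qed

lemma hyp_span_zero: "0 \<in> hyp_span b" "x \<in> hyp_span b \<Longrightarrow> - x \<in> hyp_span b"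
proof -
  have "0 = fst b \<cdot> 0 + snd b \<cdot> 0" by simp
  then show "0 \<in> hyp_span b" unfolding hyp_span_def case_prod_beta by blast
  assume "x \<in> hyp_span b"
  then obtain p q where "x = fst b \<cdot> p + snd b \<cdot> q" by (auto simp: hyp_span_def case_prod_beta)
  then have "- x = fst b \<cdot> (- p) + snd b \<cdot> (- q)" by (simp add: act_linear)
  then show "- x \<in> hyp_span b" unfolding hyp_span_def case_prod_beta by blast
qed

text \<open>The family \<open>(e\<^sub>0, ..., e\<^sub>N\<^sub>-\<^sub>1, m, f\<^sub>0, ..., f\<^sub>N\<^sub>-\<^sub>1)\<close> made of hyperbolic pairs \<open>(e\<^sub>r, f\<^sub>r)\<close>
  and, if \<open>t = N + 1\<close>, a middle vector \<open>m\<close>.\<close>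

definition split_family :: "nat \<Rightarrow> nat \<Rightarrow> (nat \<Rightarrow> 'a \<times> 'a) \<Rightarrow> 'a \<Rightarrow> nat \<Rightarrow> 'a" where
  "split_family N t b m r = (if r < N then fst (b r) else if r < t then m else snd (b (r - t)))"

lemma split_family_realizes:
  fixes b :: "nat \<Rightarrow> 'a \<times> 'a"
  assumes n: "CARD('n) = t + N" "t = N \<or> t = N + 1"
    and b: "bij_betw b {..<N} B" "\<And>b. b \<in> B \<Longrightarrow> hyp_pair b"
      "\<And>b b'. b \<in> B \<Longrightarrow> b' \<in> B \<Longrightarrow> b \<noteq> b' \<Longrightarrow> hyp_span b' \<subseteq> perp (hyp_span b)"
    and m: "t = N + 1 \<Longrightarrow> h m m = quat_j \<and> (\<forall>b\<in>B. m \<in> perp (hyp_span b))"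
    and sp: "UNIV \<subseteq> span ((\<Union>b\<in>B. hyp_span b) \<union> (if t = N then {0} else range (\<lambda>q. m \<cdot> q)))"
    and A: "\<And>s. s < CARD('n) \<Longrightarrow> A (split_family N t b m s) = (\<Sum>r<CARD('n). split_family N t b m r \<cdot> g r s)"
  shows "realizes (form_split N t :: ('n::finite) qmat) (mat_from g) A (\<lambda>i. split_family N t b m (to_nat_on UNIV i))"
  unfolding form_split_def
proof (rule realizes_mat_from)
  let ?w = "split_family N t b m"
  have bB: "b r \<in> B" if "r < N" for r using b(1) that by (auto simp: bij_betw_def)
  have inj: "b r = b s \<longleftrightarrow> r = s" if "r < N" "s < N" for r s
    using b(1) that by (auto simp: bij_betw_def inj_on_def)
  have hp: "h (fst (b r)) (fst (b r)) = 0" "h (snd (b r)) (snd (b r)) = 0" "h (fst (b r)) (snd (b r)) = 1"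
    "h (snd (b r)) (fst (b r)) = -1" if "r < N" for r
    using b(2)[OF bB[OF that]] h_skew[of "snd (b r)" "fst (b r)"] by (auto simp: hyp_pair_def case_prod_beta)
  have ho: "h x y = 0" if "r < N" "s < N" "r \<noteq> s" "x \<in> {fst (b r), snd (b r)}" "y \<in> {fst (b s), snd (b s)}" for r s x y
    using b(3)[OF bB[OF that(1)] bB[OF that(2)]] inj[OF that(1,2)] that(3-5)
      fst_hyp_span[of "b r"] snd_hyp_span[of "b r"] fst_hyp_span[of "b s"] snd_hyp_span[of "b s"]
    unfolding perp_def by blast
  have hm: "h x m = 0" "h m x = 0" if "t = N + 1" "r < N" "x \<in> {fst (b r), snd (b r)}" for r x
  proof -
    show "h x m = 0"
      using m[OF that(1)] bB[OF that(2)] that(3) fst_hyp_span[of "b r"] snd_hyp_span[of "b r"]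
      unfolding perp_def by blast
    then show "h m x = 0" using h_skew[of m x] by simp
  qed
  show "A (?w s) = (\<Sum>r<CARD('n). ?w r \<cdot> g r s)" if "s < CARD('n)" for s
    by (rule A[OF that])
  have gram: "h (fst (b r)) (fst (b s)) = 0" "h (snd (b r)) (snd (b s)) = 0"
    "h (fst (b r)) (snd (b s)) = (if r = s then 1 else 0)"
    "h (snd (b r)) (fst (b s)) = (if r = s then -1 else 0)" if "r < N" "s < N" for r s
    using hp[OF that(1)] ho[OF that] by auto
  show "h (?w r) (?w s) = anti_block N t (diag_of (\<lambda>_. 1)) quat_j (diag_of (\<lambda>_. - 1)) r s"
    if r: "r < CARD('n)" and s: "s < CARD('n)" for r s
  proof -
    have cases: "u < N \<or> u = N \<and> t = N + 1 \<or> u \<ge> t \<and> u - t < N" if "u < CARD('n)" for u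
      using that n by linarith
    have t: "t \<ge> N" using n by auto
    from cases[OF r] show ?thesis
    proof (elim disjE conjE)
      assume r: "r < N"
      from cases[OF s] show ?thesis
        by (elim disjE conjE) (use r t gram hm in \<open>simp_all add: split_family_def anti_block_def diag_of_def\<close>)
    next
      assume r: "r = N" "t = N + 1"
      from cases[OF s] show ?thesis
        by (elim disjE conjE) (use r hm m in \<open>simp_all add: split_family_def anti_block_def diag_of_def\<close>)
    next
      assume r: "r \<ge> t" "r - t < N"
      from cases[OF s] show ?thesis
        by (elim disjE conjE) (use r t gram hm in \<open>auto simp: split_family_def anti_block_def diag_of_def\<close>)
    qed
  qed
  let ?U = "span (\<Union>r<CARD('n). range (\<lambda>q. ?w r \<cdot> q))"
  have w: "?w r \<cdot> q \<in> ?U" if "r < CARD('n)" for r q using that by (auto intro!: span_base)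
  have e: "fst (b r) \<cdot> p \<in> ?U" "snd (b r) \<cdot> p \<in> ?U" if "r < N" for r p
    using w[of r p] w[of "t + r" p] that n by (auto simp: split_family_def)
  have "hyp_span b' \<subseteq> ?U" if "b' \<in> B" for b'
  proof -
    obtain r where "r < N" "b' = b r" using b(1) \<open>b' \<in> B\<close> by (auto simp: bij_betw_def)
    then show ?thesis using e by (auto simp: hyp_span_def case_prod_beta intro!: span_add)
  qed
  moreover have "(if t = N then {0} else range (\<lambda>q. m \<cdot> q)) \<subseteq> ?U"
    using w[of N] n by (auto simp: split_family_def span_0)
  ultimately have "span ((\<Union>b\<in>B. hyp_span b) \<union> (if t = N then {0} else range (\<lambda>q. m \<cdot> q))) \<subseteq> ?U"
    by (intro span_minimal) (auto simp: subspace_span)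
  then show "?U = UNIV" using sp by blast
qed

text \<open>Both eigenspaces of A are isotropic because A is skew. They are therefore dual to each
  other, and pairs of dual eigenvectors exhaust the space.\<close>

lemma normal_form_paracomplex:
  assumes A: "so_op A" "\<And>x. A (A x) = x" and dim: "DIM('a) = 4 * CARD('n::finite)"
  shows "\<exists>N v. CARD('n) = 2 * N \<and>
    realizes (form_split N N :: 'n qmat) (mat_from (diag_of (I_sig N))) A v"
proof -
  define P where "P b \<longleftrightarrow> A (fst b) = fst b \<and> A (snd b) = - snd b" for b
  have hA: "h (A x) y = - h x (A y)" for x y using A(1) by (simp add: so_op_def)
  note l = so_op_linear[OF A(1)]
  have ex: "\<exists>b. fst b \<in> W \<and> snd b \<in> W \<and> hyp_pair b \<and> P b"
    if W: "submodule W" "nondeg W" "A ` W \<subseteq> W" "\<not> W = {0}" for W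
  proof -
    have sW: "subspace W" and aW: "\<And>x q. x \<in> W \<Longrightarrow> x \<cdot> q \<in> W" using W(1) by (auto simp: submodule_def)
    obtain w where w: "w \<in> W" "h w w \<noteq> 0" using exists_anisotropic W by blast
    have Aw: "A w \<in> W" using W(3) w by auto
    define e where "e = w + A w"
    define f where "f = w - A w"
    have eW: "e \<in> W" "f \<in> W" using w Aw sW by (auto simp: e_def f_def intro: subspace_add subspace_diff)
    have Ae: "A e = e" "A f = - f" by (simp_all add: e_def f_def l A(2))
    have he: "h e e = 0" "h f f = 0"
      using hA[of e e] hA[of f f] by (simp_all add: Ae h_minus quat_eq_iff)
    have "h e f \<noteq> 0"
    proof
      assume ef: "h e f = 0"
      then have fe: "h f e = 0" using h_skew[of f e] by simp
      have ww: "w = (1/2) *\<^sub>R (e + f)" by (simp add: e_def f_def flip: scaleR_2)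
      have "h w w = h ((1/2) *\<^sub>R (e + f)) ((1/2) *\<^sub>R (e + f))"
        by (rule arg_cong2[where f=h, OF ww ww])
      also have "\<dots> = 0"
        unfolding h_scaleR h_add_left[of e f] h_add_right[of _ e f] he ef fe by simp
      finally show False using w(2) by simp
    qed
    then obtain c where c: "h e f * c = 1" using quat_inverse_exists by blast
    have "hyp_pair (e, f \<cdot> c)" using he c by (simp add: hyp_pair_def h_act_left h_act_right)
    moreover have "P (e, f \<cdot> c)" using Ae by (simp add: P_def l(5) act_linear)
    ultimately show ?thesis using eW aW by (intro exI[of _ "(e, f \<cdot> c)"]) auto
  qed
  have inv: "A ` perp (hyp_span b) \<subseteq> perp (hyp_span b)" if "P b" for b
    by (rule hyp_span_invariant[OF A(1)]) (use that in \<open>auto simp: P_def intro: fst_hyp_span snd_hyp_span hyp_span_zero\<close>)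
  obtain B W0 where B: "finite B" "\<And>b. b \<in> B \<Longrightarrow> hyp_pair b" "\<And>b. b \<in> B \<Longrightarrow> P b"
    "\<And>b b'. b \<in> B \<Longrightarrow> b' \<in> B \<Longrightarrow> b \<noteq> b' \<Longrightarrow> hyp_span b' \<subseteq> perp (hyp_span b)"
    "W0 = {0}" "DIM('a) = 8 * card B + dim W0" "UNIV \<subseteq> span ((\<Union>b\<in>B. hyp_span b) \<union> W0)"
  proof -
    have "\<exists>B W0. finite B \<and> (\<forall>b\<in>B. fst b \<in> UNIV \<and> snd b \<in> UNIV \<and> hyp_pair b \<and> P b) \<and>
     (\<forall>b\<in>B. \<forall>b'\<in>B. b \<noteq> b' \<longrightarrow> hyp_span b' \<subseteq> perp (hyp_span b)) \<and>
     (\<forall>b\<in>B. W0 \<subseteq> perp (hyp_span b)) \<and>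
     W0 = {0} \<and> submodule W0 \<and> nondeg W0 \<and> W0 \<subseteq> UNIV \<and> A ` W0 \<subseteq> W0 \<and>
     dim (UNIV::'a set) = 8 * card B + dim W0 \<and> UNIV \<subseteq> span ((\<Union>b\<in>B. hyp_span b) \<union> W0)"
      by (rule hyperbolic_decomposition[of UNIV A "\<lambda>W. W = {0}" P])
         (use submodule_UNIV nondeg_UNIV ex inv in auto)
    then show ?thesis using that by auto
  qed
  define N where "N = card B"
  have n: "CARD('n) = N + N" using B(5,6) dim by (simp add: N_def)
  obtain b where b: "bij_betw b {..<N} B"
    using ex_bij_betw_nat_finite[OF B(1)] by (auto simp: N_def lessThan_atLeast0)
  have bP: "A (fst (b r)) = fst (b r)" "A (snd (b r)) = - snd (b r)" if "r < N" for r
    using B(3)[of "b r"] b that by (auto simp: P_def bij_betw_def)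
  have "realizes (form_split N N :: 'n qmat) (mat_from (diag_of (I_sig N))) A
     (\<lambda>i. split_family N N b 0 (to_nat_on UNIV i))"
  proof (rule split_family_realizes[OF n _ b B(2,4)])
    fix s assume s: "s < CARD('n)"
    show "A (split_family N N b 0 s) = (\<Sum>r<CARD('n). split_family N N b 0 r \<cdot> diag_of (I_sig N) r s)"
      using s n bP[of s] bP[of "s - N"]
      by (subst sum_single[of _ s]) (auto simp: diag_of_def I_sig_def split_family_def act_minus_right)
  qed (use B(5,7) in auto)
  then show ?thesis using n by (intro exI conjI) auto
qed

text \<open>The real numbers \<open>h v (A v)\<close> form a quadratic form. A vector on which it is
  nonzero generates, together with its image, an A-stable hyperbolic plane; if it vanishes
  identically, then A is 0 on W and any hyperbolic plane will do.\<close>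

lemma exists_hyperbolic_nilpotent:
  assumes A: "so_op A" "\<And>x. A (A x) = 0"
    and W: "submodule W" "nondeg W" "A ` W \<subseteq> W" "dim W > 4"
  shows "\<exists>b. fst b \<in> W \<and> snd b \<in> W \<and> hyp_pair b \<and>
    (A (fst b) = snd b \<and> A (snd b) = 0 \<or> A (snd b) = fst b \<and> A (fst b) = 0 \<or>
     A (fst b) = 0 \<and> A (snd b) = 0)"
proof -
  have hA: "h (A x) y = - h x (A y)" for x y using A(1) by (simp add: so_op_def)
  note l = so_op_linear[OF A(1)]
  have sW: "subspace W" and aW: "\<And>x q. x \<in> W \<Longrightarrow> x \<cdot> q \<in> W" using W(1) by (auto simp: submodule_def)
  have AW: "A w \<in> W" if "w \<in> W" for w using W(3) that by auto
  have real: "h v (A v) = of_real (qre (h v (A v)))" for v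
    using hA[of v v] h_skew[of "A v" v] by (simp add: quat_eq_iff)
  show ?thesis
  proof (cases "\<exists>v\<in>W. h v (A v) \<noteq> 0")
    case True
    then obtain v where v: "v \<in> W" "h v (A v) \<noteq> 0" by blast
    define c where "c = qre (h v (A v))"
    have c: "h v (A v) = of_real c" "c \<noteq> 0" using real[of v] v(2) by (auto simp: c_def)
    define g where "g = (1 / c) *\<^sub>R A v"
    \<comment> \<open>The correction by the isotropic g removes the value h v v without changing the
      pairing with g or the image under A.\<close>
    define e where "e = v - g \<cdot> ((1/2) *\<^sub>R h v v)"
    have vg: "h v g = 1" "h g v = -1" "h g g = 0" "A g = 0"
      using c h_skew[of g v] hA[of v "A v"]
      by (simp_all add: g_def h_linear A(2) l of_real_def hA)
    have half: "x - (1/2) *\<^sub>R x = (1/2) *\<^sub>R x" for x :: quat by (simp add: quat_eq_iff)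
    have ee: "h e e = 0"
      using h_self_imag[of v]
      by (simp add: e_def h_linear h_act_left h_act_right vg qconj_imag half)
    have eg: "h e g = 1" by (simp add: e_def h_linear h_act_left vg)
    have Ae: "A e = c *\<^sub>R g" using c by (simp add: e_def l vg(4)) (simp add: g_def)
    have eW: "e \<in> W" "g \<in> W"
      using v AW sW aW by (auto simp: e_def g_def intro!: subspace_diff subspace_scale)
    define m where "m = sqrt \<bar>c\<bar>"
    have m: "m > 0" "m * m = \<bar>c\<bar>" using c(2) by (simp_all add: m_def)
    define E where "E = (1 / m) *\<^sub>R e"
    define G where "G = m *\<^sub>R g"
    have EG: "h E E = 0" "h G G = 0" "h E G = 1" "h G E = -1" "A G = 0" "E \<in> W" "G \<in> W"
      using m(1) ee eg vg eW sW h_skew[of g e] by (simp_all add: E_def G_def h_linear l subspace_scale)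
    have AE: "A E = (c / (m * m)) *\<^sub>R G"
      using m(1) by (simp add: E_def G_def l Ae)
    show ?thesis
    proof (cases "c > 0")
      case True
      then have "A E = G" using AE m by simp
      then show ?thesis using EG by (intro exI[of _ "(E, G)"]) (auto simp: hyp_pair_def)
    next
      case False
      \<comment> \<open>A negative sign cannot be scaled away; exchanging the two members of the
        pair turns it into A mapping the second vector to the first. This separates the p pairs from
        the q pairs.\<close>
      then have "A E = - G" using AE m c(2) by simp
      then show ?thesis
        using EG sW by (intro exI[of _ "(G, - E)"]) (auto simp: hyp_pair_def h_minus l subspace_neg)
    qed
  next
    case False
    \<comment> \<open>Polarization gives the real part; applying it to w times i, j, k gives the
      other components.\<close>
    have "h v (A w) = 0" if v: "v \<in> W" and w: "w \<in> W" for v w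
    proof -
      have re: "qre (h v (A w)) = 0" if w: "w \<in> W" for w
      proof -
        have "h (v + w) (A (v + w)) = 0" using False v w sW by (auto intro: subspace_add)
        then have "h v (A w) + h w (A v) = 0" using False v w by (simp add: l h_linear add.commute)
        then show ?thesis using hA[of v w] h_skew[of "A v" w] by (simp add: quat_eq_iff)
      qed
      from re[OF w] re[OF aW[OF w], of quat_i] re[OF aW[OF w], of quat_j] re[OF aW[OF w], of quat_k]
      show ?thesis by (simp add: l h_act_right quat_eq_iff quat_sel_mult)
    qed
    then have "h (A w) v = 0" if "v \<in> W" "w \<in> W" for v w
      using h_skew[of "A w" v] that by simp
    then have A0: "A w = 0" if "w \<in> W" for w
      using W(2) AW[OF that] that by (auto simp: nondeg_def)
    have jj: "qre quat_j = 0" "quat_j * quat_j = -1" "quat_j \<noteq> 0" by (simp_all add: quat_eq_iff)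
    have "W \<noteq> {0}" using W(4) by auto
    then obtain e1 where e1: "e1 \<in> W" "h e1 e1 = quat_j"
      by (rule exists_unit[OF W(1,2) _ jj(1,2)])
    let ?U = "range (\<lambda>q. e1 \<cdot> q)"
    note sp = split_single[OF W(1,2) e1 jj(3)]
    have "W \<inter> perp ?U \<noteq> {0}"
    proof
      assume "W \<inter> perp ?U = {0}"
      then show False using sp(3) W(4) by (simp only: dim_singleton) simp
    qed
    then obtain e2 where e2: "e2 \<in> W \<inter> perp ?U" "h e2 e2 = quat_j"
      by (rule exists_unit[OF sp(1,2) _ jj(1,2)])
    have "e1 \<cdot> 1 \<in> ?U" by blast
    then have "h (e1 \<cdot> 1) e2 = 0" using e2(1) unfolding perp_def by blast
    then have e12: "h e1 e2 = 0" "h e2 e1 = 0" using h_skew[of e2 e1] by simp_all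
    \<comment> \<open>The value of h on \<open>e2 \<cdot> quat_i\<close> is -j, so adding it to e1
      gives an isotropic vector. The difference is isotropic too and pairs with the sum to 2 j,
      which the last factor of f normalizes to 1.\<close>
    define e where "e = e1 + e2 \<cdot> quat_i"
    define f where "f = (e1 - e2 \<cdot> quat_i) \<cdot> ((-1/2) *\<^sub>R quat_j)"
    have "e \<in> W" "f \<in> W"
      using e1 e2 sW aW by (auto simp: e_def f_def intro!: aW subspace_add subspace_diff)
    moreover have "hyp_pair (e, f)"
      by (simp add: hyp_pair_def e_def f_def h_linear h_act_left h_act_right e12 e1 e2 mult.assoc
          quat_eq_iff quat_sel_mult)
    ultimately show ?thesis using A0 by (intro exI[of _ "(e, f)"]) auto
  qed
qed

text \<open>Hyperbolic planes are split off until at most one line W0 is left, which decides the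
  parity of n. Sorting the pairs by the direction in which A acts gives p, q and the pairs killed by
  A.\<close>

lemma normal_form_nilpotent:
  assumes A: "so_op A" "\<And>x. A (A x) = 0" and dim: "DIM('a) = 4 * CARD('n::finite)"
  shows "\<exists>N t p q v. CARD('n) = t + N \<and> (t = N \<or> t = N + 1) \<and> p + q \<le> N \<and>
    realizes (form_split N t :: 'n qmat) (A_nilp N t p q) A v"
proof -
  note l = so_op_linear[OF A(1)]
  define P where "P b \<longleftrightarrow> A (fst b) = snd b \<and> A (snd b) = 0 \<or> A (snd b) = fst b \<and> A (fst b) = 0 \<or>
     A (fst b) = 0 \<and> A (snd b) = 0" for b
  have inv: "A ` perp (hyp_span b) \<subseteq> perp (hyp_span b)" if "P b" for b
    by (rule hyp_span_invariant[OF A(1)])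
       (use that fst_hyp_span[of b] snd_hyp_span[of b] hyp_span_zero(1)[of b] in \<open>auto simp: P_def\<close>)
  obtain B W0 where B: "finite B" "\<And>b. b \<in> B \<Longrightarrow> hyp_pair b" "\<And>b. b \<in> B \<Longrightarrow> P b"
    "\<And>b b'. b \<in> B \<Longrightarrow> b' \<in> B \<Longrightarrow> b \<noteq> b' \<Longrightarrow> hyp_span b' \<subseteq> perp (hyp_span b)"
    "\<And>b. b \<in> B \<Longrightarrow> W0 \<subseteq> perp (hyp_span b)" "dim W0 \<le> 4" "submodule W0" "nondeg W0" "A ` W0 \<subseteq> W0"
    "DIM('a) = 8 * card B + dim W0" "UNIV \<subseteq> span ((\<Union>b\<in>B. hyp_span b) \<union> W0)"
  proof -
    have "\<exists>B W0. finite B \<and> (\<forall>b\<in>B. fst b \<in> UNIV \<and> snd b \<in> UNIV \<and> hyp_pair b \<and> P b) \<and>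
     (\<forall>b\<in>B. \<forall>b'\<in>B. b \<noteq> b' \<longrightarrow> hyp_span b' \<subseteq> perp (hyp_span b)) \<and>
     (\<forall>b\<in>B. W0 \<subseteq> perp (hyp_span b)) \<and>
     dim W0 \<le> 4 \<and> submodule W0 \<and> nondeg W0 \<and> W0 \<subseteq> UNIV \<and> A ` W0 \<subseteq> W0 \<and>
     dim (UNIV::'a set) = 8 * card B + dim W0 \<and> UNIV \<subseteq> span ((\<Union>b\<in>B. hyp_span b) \<union> W0)"
    proof (rule hyperbolic_decomposition[of UNIV A "\<lambda>W. dim W \<le> 4" P])
      show "\<exists>b. fst b \<in> W \<and> snd b \<in> W \<and> hyp_pair b \<and> P b"
        if "submodule W" "nondeg W" "A ` W \<subseteq> W" "\<not> dim W \<le> 4" for W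
        unfolding P_def using exists_hyperbolic_nilpotent[OF A that(1-3)] that(4) by simp
    qed (use submodule_UNIV nondeg_UNIV inv in auto)
    then show ?thesis
      apply (elim exE conjE)
      subgoal for B W0 by (rule that[of B W0]) (assumption | simp | blast)+
      done
  qed
  define N where "N = card B"
  obtain m t where m: "CARD('n) = t + N" "t = N \<or> t = N + 1"
    "t = N + 1 \<Longrightarrow> h m m = quat_j \<and> (\<forall>b\<in>B. m \<in> perp (hyp_span b))"
    "UNIV \<subseteq> span ((\<Union>b\<in>B. hyp_span b) \<union> (if t = N then {0} else range (\<lambda>q. m \<cdot> q)))" "A m = 0"
  proof (cases "W0 = {0}")
    case True
    then show ?thesis using that[of N 0] B(10,11) dim l by (simp add: N_def)
  next
    case False
    have jj: "qre quat_j = 0" "quat_j * quat_j = -1" "quat_j \<noteq> 0" by (simp_all add: quat_eq_iff)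
    obtain m where m: "m \<in> W0" "h m m = quat_j" by (rule exists_unit[OF B(7,8) False jj(1,2)])
    let ?U = "range (\<lambda>q. m \<cdot> q)"
    note sp = split_single[OF B(7,8) m jj(3)]
    have d4: "dim W0 = 4" "dim (W0 \<inter> perp ?U) = 0" using sp(3) B(6) by auto
    then have "W0 \<inter> perp ?U = {0}"
      using sp(1) subspace_0[of "W0 \<inter> perp ?U"] by (auto simp: submodule_def)
    then have W0: "W0 \<subseteq> span ?U" using sp(4) by (metis Un_insert_right span_insert_0 sup_bot.right_neutral)
    moreover have sub: "span ?U = ?U"
      by (rule span_eq_iff[THEN iffD2]) (rule linear_subspace_image[OF linear_act_right subspace_UNIV])
    ultimately obtain q where q: "A m = m \<cdot> q" using B(9) m(1) by blast
    \<comment> \<open>On a single line A is left multiplication of the coordinate by a quaternion of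
      square 0, hence 0.\<close>
    have "m \<cdot> (q * q) = 0" using A(2)[of m] by (simp add: q l act_mult)
    moreover have "m \<noteq> 0" using m(2) jj(3) by auto
    ultimately have "q * q = 0" using act_eq_0_iff by blast
    then have Am: "A m = 0" using q quat_no_zero_div by auto
    have n: "CARD('n) = N + 1 + N" using B(10) d4(1) dim by (simp add: N_def)
    have "UNIV \<subseteq> span ((\<Union>b\<in>B. hyp_span b) \<union> ?U)"
      by (rule order_trans[OF B(11) span_mono]) (use W0 sub in blast)
    moreover have "\<forall>b\<in>B. m \<in> perp (hyp_span b)" using m(1) B(5) by blast
    ultimately show ?thesis using that[OF n _ _ _ Am] m(2) by simp
  qed
  \<comment> \<open>The three sets are made disjoint by successive removal, and their order is the
    order of the blocks in \<open>C_blk\<close> and \<open>B_blk\<close>.\<close>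
  define B1 where "B1 = {b\<in>B. A (fst b) = snd b \<and> A (snd b) = 0}"
  define B2 where "B2 = {b\<in>B - B1. A (snd b) = fst b \<and> A (fst b) = 0}"
  define B3 where "B3 = B - B1 - B2"
  have disj: "B1 \<inter> B2 = {}" "(B1 \<union> B2) \<inter> B3 = {}" "(B1 \<union> B2) \<union> B3 = B"
    by (auto simp: B1_def B2_def B3_def)
  have fin: "finite B1" "finite B2" "finite B3" using B(1) by (auto simp: B1_def B2_def B3_def)
  have N: "N = card B1 + card B2 + card B3"
    unfolding N_def using disj fin by (metis card_Un_disjoint finite_Un)
  obtain b1 where b1: "bij_betw b1 {..<card B1} B1"
    using ex_bij_betw_nat_finite[OF fin(1)] by (auto simp: lessThan_atLeast0)
  obtain b2 where b2: "bij_betw b2 {..<card B2} B2"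
    using ex_bij_betw_nat_finite[OF fin(2)] by (auto simp: lessThan_atLeast0)
  obtain b3 where b3: "bij_betw b3 {..<card B3} B3"
    using ex_bij_betw_nat_finite[OF fin(3)] by (auto simp: lessThan_atLeast0)
  define p where "p = card B1"
  define q where "q = card B2"
  define b where "b r = (if r < p + q then (if r < p then b1 r else b2 (r - p)) else b3 (r - (p + q)))" for r
  have b: "bij_betw b {..<N} B"
    using enum_append[OF enum_append[OF b1 b2 disj(1)] b3 disj(2)] unfolding disj(3) N b_def[abs_def] p_def q_def .
  have b1': "b r \<in> B1" if "r < p" for r
    using b1 that by (auto simp: b_def p_def bij_betw_def)
  have b2': "b r \<in> B2" if "p \<le> r" "r < p + q" for r
    using b2 that by (auto simp: b_def p_def q_def bij_betw_def)
  have b3': "b r \<in> B3" if "p + q \<le> r" "r < N" for r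
    using b3 that N by (auto simp: b_def p_def q_def bij_betw_def)
  have Ab: "A (fst (b r)) = (if r < p then snd (b r) else 0)"
    "A (snd (b r)) = (if p \<le> r \<and> r < p + q then fst (b r) else 0)" if r: "r < N" for r
  proof -
    consider "r < p" | "p \<le> r" "r < p + q" | "p + q \<le> r" by linarith
    then have "A (fst (b r)) = (if r < p then snd (b r) else 0) \<and>
      A (snd (b r)) = (if p \<le> r \<and> r < p + q then fst (b r) else 0)"
    proof cases
      case 1
      then show ?thesis using b1'[of r] by (simp add: B1_def)
    next
      case 2
      then show ?thesis using b2'[of r] by (simp add: B2_def)
    next
      case 3
      then have "b r \<in> B3" using b3' r by blast
      then show ?thesis using 3 B(3)[of "b r"] by (auto simp: B1_def B2_def B3_def P_def)
    qed
    then show "A (fst (b r)) = (if r < p then snd (b r) else 0)"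
      "A (snd (b r)) = (if p \<le> r \<and> r < p + q then fst (b r) else 0)" by blast+
  qed
  have "realizes (form_split N t :: 'n qmat) (mat_from (anti_block N t (B_blk p q) 0 (C_blk p))) A
     (\<lambda>i. split_family N t b m (to_nat_on UNIV i))"
  proof (rule split_family_realizes[OF m(1,2) b B(2,4) m(3,4)])
    let ?w = "split_family N t b m"
    let ?g = "anti_block N t (B_blk p q) 0 (C_blk p)"
    fix s assume s: "s < CARD('n)"
    have t: "t \<ge> N" using m(2) by auto
    consider "s < N" | "s = N" "t = N + 1" | "s \<ge> t" "s - t < N" using s m(1,2) by linarith
    then show "A (?w s) = (\<Sum>r<CARD('n). ?w r \<cdot> ?g r s)"
    proof cases
      case 1
      then show ?thesis using t m(1) Ab(1)[OF 1]
        by (subst sum_single[of _ "t + s"])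
           (auto simp: split_family_def anti_block_def C_blk_def diag_of_def)
    next
      case 2
      have "?g r s = 0" for r using 2 by (simp add: anti_block_def)
      then show ?thesis using 2 m(5) by (simp add: split_family_def)
    next
      case 3
      then show ?thesis using t m(1) Ab(2)[OF 3(2)]
        by (subst sum_single[of _ "s - t"])
           (auto simp: split_family_def anti_block_def B_blk_def diag_of_def)
    qed
  qed
  moreover have "p + q \<le> N" using N by (simp add: p_def q_def)
  ultimately show ?thesis
    using m(1,2) unfolding A_nilp_def by blast
qed

end

section \<open>Isomorphisms of qs-H tiLas\<close>

lemma linear_map_onD:
  assumes "linear_map_on V f" "subspace V"
  shows "x \<in> V \<Longrightarrow> y \<in> V \<Longrightarrow> f (x + y) = f x + f y" "x \<in> V \<Longrightarrow> f (r *\<^sub>R x) = r *\<^sub>R f x"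
    "x \<in> V \<Longrightarrow> f (- x) = - f x" "x \<in> V \<Longrightarrow> y \<in> V \<Longrightarrow> f (x - y) = f x - f y" "f 0 = 0"
proof -
  show add: "f (x + y) = f x + f y" if "x \<in> V" "y \<in> V" for x y using assms that by (auto simp: linear_map_on_def)
  show sc: "f (r *\<^sub>R x) = r *\<^sub>R f x" if "x \<in> V" for x r using assms that by (auto simp: linear_map_on_def)
  show neg: "f (- x) = - f x" if "x \<in> V" for x using sc[OF that, of "-1"] by simp
  show "f (x - y) = f x - f y" if "x \<in> V" "y \<in> V"
    using add[OF that(1) subspace_neg[OF assms(2) that(2)]] neg[OF that(2)] by simp
  show "f 0 = 0" using sc[OF subspace_0[OF assms(2)], of 0] by simp
qed

definition trip :: "('a::real_vector, 'z) tila_data_scheme \<Rightarrow> 'a \<Rightarrow> 'a \<Rightarrow> 'a \<Rightarrow> 'a" where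
  "trip L x y z = brk L (brk L x y) z"

locale tila_loc =
  fixes L :: "('a::real_vector, 'z) tila_data_scheme"
  assumes tila: "tila L"
begin

abbreviation "V \<equiv> alg L"
abbreviation "br \<equiv> brk L"
abbreviation "m \<equiv> m_part L"
abbreviation "l \<equiv> l_part L"

lemma subV: "subspace V"
  using tila unfolding tila_def fin_dim_lie_algebra_def by (metis subspace_span)

lemma br_closed: "x \<in> V \<Longrightarrow> y \<in> V \<Longrightarrow> br x y \<in> V"
  using tila unfolding tila_def fin_dim_lie_algebra_def by blast

lemma br_lin: "x \<in> V \<Longrightarrow> linear_map_on V (br x)" "y \<in> V \<Longrightarrow> linear_map_on V (\<lambda>x. br x y)"
  using tila unfolding tila_def fin_dim_lie_algebra_def bilinear_map_on_def by blast+

lemmas br_right = linear_map_onD[OF br_lin(1) subV]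
lemmas br_left = linear_map_onD[OF br_lin(2) subV]

lemma br_self: "x \<in> V \<Longrightarrow> br x x = 0"
  using tila unfolding tila_def fin_dim_lie_algebra_def by blast

lemma jacobi: "x \<in> V \<Longrightarrow> y \<in> V \<Longrightarrow> z \<in> V \<Longrightarrow> br x (br y z) + br y (br z x) + br z (br x y) = 0"
  using tila unfolding tila_def fin_dim_lie_algebra_def by blast

lemma br_skew: "x \<in> V \<Longrightarrow> y \<in> V \<Longrightarrow> br y x = - br x y"
  using br_self[of "x + y"] br_self[of x] br_self[of y] subspace_add[OF subV, of x y]
  by (simp add: br_left br_right eq_neg_iff_add_eq_0 add.commute)

lemma br_derivation:
  assumes "x \<in> V" "y \<in> V" "z \<in> V"
  shows "br (br x y) z = br x (br y z) - br y (br x z)"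
proof -
  have "br z (br x y) = - br (br x y) z" using br_skew[OF br_closed[OF assms(1,2)] assms(3)] .
  moreover have "br y (br z x) = - br y (br x z)"
    unfolding br_skew[OF assms(1,3)] by (rule br_right(3)[OF assms(2) br_closed[OF assms(1,3)]])
  ultimately show ?thesis using jacobi[OF assms] by (simp add: algebra_simps)
qed

lemma sig: "x \<in> V \<Longrightarrow> invol L x \<in> V" "linear_map_on V (invol L)"
  "x \<in> V \<Longrightarrow> invol L (invol L x) = x"
  "x \<in> V \<Longrightarrow> y \<in> V \<Longrightarrow> invol L (br x y) = br (invol L x) (invol L y)"
  using tila unfolding tila_def by auto

lemmas sig_lin = linear_map_onD[OF sig(2) subV]

lemma mV: "x \<in> m \<Longrightarrow> x \<in> V" and lV: "x \<in> l \<Longrightarrow> x \<in> V"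
  by (auto simp: m_part_def l_part_def)

lemma subm: "subspace m" and subl: "subspace l"
  using subV unfolding m_part_def l_part_def
  by (auto intro!: subspaceI simp: sig_lin subspace_0 subspace_add subspace_scale)

lemma l_span: "l = bracket_span br m"
  using tila unfolding tila_def by blast

lemma mm: "x \<in> m \<Longrightarrow> y \<in> m \<Longrightarrow> br x y \<in> l"
  unfolding l_span bracket_span_def by (rule span_base) blast

lemma lm: "z \<in> l \<Longrightarrow> x \<in> m \<Longrightarrow> br z x \<in> m"
  by (simp add: m_part_def l_part_def br_closed sig(4) br_right(3))

lemma ll: "z \<in> l \<Longrightarrow> w \<in> l \<Longrightarrow> br z w \<in> l"
  by (simp add: l_part_def br_closed sig(4))

lemma trip_m: "x \<in> m \<Longrightarrow> y \<in> m \<Longrightarrow> z \<in> m \<Longrightarrow> trip L x y z \<in> m"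
  unfolding trip_def by (intro lm mm)

definition "pm x = (1/2) *\<^sub>R (x - invol L x)"
definition "pl x = (1/2) *\<^sub>R (x + invol L x)"

lemma pm_pl: "pl x + pm x = x"
proof -
  have "pl x + pm x = (1/2) *\<^sub>R (x + x)"
    unfolding pm_def pl_def by (simp add: scaleR_add_right scaleR_diff_right)
  then show ?thesis by (simp flip: scaleR_2)
qed

lemma pm_in: "x \<in> V \<Longrightarrow> pm x \<in> m" and pl_in: "x \<in> V \<Longrightarrow> pl x \<in> l"
  using subV
  by (simp_all add: pm_def pl_def m_part_def l_part_def subspace_scale subspace_add subspace_diff sig sig_lin
      algebra_simps)

lemma pm_m: "x \<in> m \<Longrightarrow> pm x = x" "x \<in> m \<Longrightarrow> pl x = 0"
  and pm_l: "x \<in> l \<Longrightarrow> pm x = 0" "x \<in> l \<Longrightarrow> pl x = x"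
  by (simp_all add: pm_def pl_def m_part_def l_part_def flip: scaleR_2)

lemma pm_pl_lin:
  "x \<in> V \<Longrightarrow> y \<in> V \<Longrightarrow> pm (x + y) = pm x + pm y" "x \<in> V \<Longrightarrow> pm (r *\<^sub>R x) = r *\<^sub>R pm x"
  "x \<in> V \<Longrightarrow> y \<in> V \<Longrightarrow> pl (x + y) = pl x + pl y" "x \<in> V \<Longrightarrow> pl (r *\<^sub>R x) = r *\<^sub>R pl x"
  "x \<in> V \<Longrightarrow> pm (invol L x) = - pm x" "x \<in> V \<Longrightarrow> pl (invol L x) = pl x"
  by (simp_all add: pm_def pl_def sig_lin sig(3) algebra_simps)

text \<open>The kernel of the action of \<open>l\<close> on \<open>m\<close> is an ideal contained in \<open>l\<close>.\<close>

lemma faithful: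
  assumes z: "z \<in> l" "\<And>x. x \<in> m \<Longrightarrow> br z x = 0"
  shows "z = 0"
proof -
  define I where "I = {z\<in>l. \<forall>x\<in>m. br z x = 0}"
  have sI: "subspace I"
    using subspace_0[OF subl] subspace_add[OF subl] subspace_scale[OF subl]
    by (auto simp: I_def br_left mV lV intro!: subspaceI)
  have "br x y \<in> I" if x: "x \<in> V" and y: "y \<in> I" for x y
  proof -
    have yl: "y \<in> l" "\<And>u. u \<in> m \<Longrightarrow> br y u = 0" using y by (auto simp: I_def)
    have "br x y = br (pl x) y + br (pm x) y"
      using br_left(1)[OF lV[OF yl(1)] lV[OF pl_in[OF x]] mV[OF pm_in[OF x]]] by (simp add: pm_pl)
    also have "br (pm x) y = 0"
      using br_skew[OF lV[OF yl(1)] mV[OF pm_in[OF x]]] yl(2)[OF pm_in[OF x]] by simp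
    finally have e: "br x y = br (pl x) y" by simp
    have "br (br (pl x) y) u = 0" if u: "u \<in> m" for u
      using br_derivation[OF lV[OF pl_in[OF x]] lV[OF yl(1)] mV[OF u]] yl(2)[OF u] yl(2)[OF lm[OF pl_in[OF x] u]]
        br_right(5)[OF lV[OF pl_in[OF x]]] by simp
    then show ?thesis using ll[OF pl_in[OF x] yl(1)] by (simp add: I_def e)
  qed
  then have "lie_ideal V br I"
    using sI lV by (auto simp: lie_ideal_def I_def)
  moreover have "I \<subseteq> l" by (auto simp: I_def)
  ultimately have "I = {0}" using tila unfolding tila_def by blast
  moreover have "z \<in> I" using z by (simp add: I_def)
  ultimately show ?thesis by simp
qed

lemma faithful_eq:
  assumes "z \<in> l" "w \<in> l" "\<And>x. x \<in> m \<Longrightarrow> br z x = br w x"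
  shows "z = w"
  using faithful[of "z - w"] assms subspace_diff[OF subl] by (auto simp: br_left mV lV)

end

lemma qsH_tilaD:
  assumes "qsH_tila n L"
  shows "tila L" "dim (m_part L) = 4 * n" "linear_quaternionic_structure (m_part L) (qstr L)"
    "bilinear_map_on (m_part L) (sform L)"
    "x \<in> m_part L \<Longrightarrow> y \<in> m_part L \<Longrightarrow> sform L x y = - sform L y x"
    "x \<in> m_part L \<Longrightarrow> (\<And>y. y \<in> m_part L \<Longrightarrow> sform L x y = 0) \<Longrightarrow> x = 0"
    "J \<in> qstr L \<Longrightarrow> (\<And>x. x \<in> m_part L \<Longrightarrow> J (J x) = - x) \<Longrightarrow>
       x \<in> m_part L \<Longrightarrow> y \<in> m_part L \<Longrightarrow> sform L (J x) (J y) = sform L x y"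
    "z \<in> l_part L \<Longrightarrow> J \<in> qstr L \<Longrightarrow> (\<lambda>x\<in>m_part L. brk L z (J x) - J (brk L z x)) \<in> qstr L"
    "z \<in> l_part L \<Longrightarrow> x \<in> m_part L \<Longrightarrow> y \<in> m_part L \<Longrightarrow> sform L (brk L z x) y + sform L x (brk L z y) = 0"
proof -
  let ?m = "m_part L"
  note a = assms[unfolded qsH_tila_def]
  show "tila L" "dim ?m = 4 * n" "linear_quaternionic_structure ?m (qstr L)" "bilinear_map_on ?m (sform L)"
    using a by - ((elim conjE, assumption)+)
  have 1: "\<forall>x\<in>?m. \<forall>y\<in>?m. sform L x y = - sform L y x"
    "\<forall>x\<in>?m. (\<forall>y\<in>?m. sform L x y = 0) \<longrightarrow> x = 0"
    "\<forall>J\<in>qstr L. (\<forall>x\<in>?m. J (J x) = - x) \<longrightarrow> (\<forall>x\<in>?m. \<forall>y\<in>?m. sform L (J x) (J y) = sform L x y)"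
    "\<forall>z\<in>l_part L. \<forall>J\<in>qstr L. (\<lambda>x\<in>?m. brk L z (J x) - J (brk L z x)) \<in> qstr L"
    "\<forall>z\<in>l_part L. \<forall>x\<in>?m. \<forall>y\<in>?m. sform L (brk L z x) y + sform L x (brk L z y) = 0"
    using a by - ((elim conjE, assumption)+)
  show "x \<in> ?m \<Longrightarrow> y \<in> ?m \<Longrightarrow> sform L x y = - sform L y x" by (rule 1(1)[rule_format])
  show "x \<in> ?m \<Longrightarrow> (\<And>y. y \<in> ?m \<Longrightarrow> sform L x y = 0) \<Longrightarrow> x = 0" using 1(2) by blast
  show "J \<in> qstr L \<Longrightarrow> (\<And>x. x \<in> ?m \<Longrightarrow> J (J x) = - x) \<Longrightarrow>
       x \<in> ?m \<Longrightarrow> y \<in> ?m \<Longrightarrow> sform L (J x) (J y) = sform L x y" using 1(3) by blast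
  show "z \<in> l_part L \<Longrightarrow> J \<in> qstr L \<Longrightarrow> (\<lambda>x\<in>?m. brk L z (J x) - J (brk L z x)) \<in> qstr L"
    by (rule 1(4)[rule_format])
  show "z \<in> l_part L \<Longrightarrow> x \<in> ?m \<Longrightarrow> y \<in> ?m \<Longrightarrow> sform L (brk L z x) y + sform L x (brk L z y) = 0"
    by (rule 1(5)[rule_format])
qed

lemma qstr_closed:
  assumes L: "qsH_tila n L" and J: "J \<in> qstr L"
  shows "x \<in> m_part L \<Longrightarrow> J x \<in> m_part L" "J \<in> extensional (m_part L)"
proof -
  interpret tila_loc L using qsH_tilaD(1)[OF L] by unfold_locales
  obtain J1 J2 J3 where "J1 \<in> End_on m" "J2 \<in> End_on m" "J3 \<in> End_on m"
    "qstr L = {\<lambda>x\<in>m. a *\<^sub>R J1 x + b *\<^sub>R J2 x + c *\<^sub>R J3 x | a b c. True}"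
    using qsH_tilaD(3)[OF L] unfolding linear_quaternionic_structure_def by blast
  then show "x \<in> m \<Longrightarrow> J x \<in> m" "J \<in> extensional m"
    using J subm by (auto simp: End_on_def intro!: subspace_add subspace_scale)
qed

text \<open>An isomorphism seen on the odd part only: the triple product replaces the bracket and no
  map of l is mentioned. The correspondence of the quaternionic structures is stated in both
  directions, so that its inverse is at hand.\<close>

definition miso :: "'a::real_vector qsH_data \<Rightarrow> 'b::real_vector qsH_data \<Rightarrow> ('a \<Rightarrow> 'b) \<Rightarrow> bool" where
  "miso L1 L2 \<psi> \<longleftrightarrow> bij_betw \<psi> (m_part L1) (m_part L2) \<and> linear_map_on (m_part L1) \<psi> \<and>
     (\<forall>x\<in>m_part L1. \<forall>y\<in>m_part L1. \<forall>z\<in>m_part L1. \<psi> (trip L1 x y z) = trip L2 (\<psi> x) (\<psi> y) (\<psi> z)) \<and>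
     (\<forall>J\<in>qstr L1. \<exists>J'\<in>qstr L2. \<forall>x\<in>m_part L1. \<psi> (J x) = J' (\<psi> x)) \<and>
     (\<forall>J'\<in>qstr L2. \<exists>J\<in>qstr L1. \<forall>x\<in>m_part L1. \<psi> (J x) = J' (\<psi> x)) \<and>
     (\<forall>x\<in>m_part L1. \<forall>y\<in>m_part L1. sform L2 (\<psi> x) (\<psi> y) = sform L1 x y)"

lemma misoD:
  assumes "miso L1 L2 \<psi>"
  shows "bij_betw \<psi> (m_part L1) (m_part L2)" "linear_map_on (m_part L1) \<psi>"
    "x \<in> m_part L1 \<Longrightarrow> y \<in> m_part L1 \<Longrightarrow> z \<in> m_part L1 \<Longrightarrow> \<psi> (trip L1 x y z) = trip L2 (\<psi> x) (\<psi> y) (\<psi> z)"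
    "J \<in> qstr L1 \<Longrightarrow> \<exists>J'\<in>qstr L2. \<forall>x\<in>m_part L1. \<psi> (J x) = J' (\<psi> x)"
    "J' \<in> qstr L2 \<Longrightarrow> \<exists>J\<in>qstr L1. \<forall>x\<in>m_part L1. \<psi> (J x) = J' (\<psi> x)"
    "x \<in> m_part L1 \<Longrightarrow> y \<in> m_part L1 \<Longrightarrow> sform L2 (\<psi> x) (\<psi> y) = sform L1 x y"
    "x \<in> m_part L1 \<Longrightarrow> \<psi> x \<in> m_part L2"
  using assms unfolding miso_def by (auto simp: bij_betw_def)

lemma miso_inverse:
  assumes L1: "qsH_tila n L1" and L2: "qsH_tila n L2" and iso: "miso L1 L2 \<psi>"
  shows "miso L2 L1 (inv_into (m_part L1) \<psi>)"
proof -
  interpret t1: tila_loc L1 using qsH_tilaD(1)[OF L1] by unfold_locales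
  note d = misoD[OF iso]
  let ?g = "inv_into (m_part L1) \<psi>"
  have inj: "inj_on \<psi> (m_part L1)" and im: "\<psi> ` m_part L1 = m_part L2" using d(1) by (auto simp: bij_betw_def)
  have g: "?g y \<in> m_part L1" "\<psi> (?g y) = y" if "y \<in> m_part L2" for y
    using that unfolding im[symmetric] by (auto intro: inv_into_into f_inv_into_f)
  have gI: "?g y = x" if "x \<in> m_part L1" "\<psi> x = y" for x y
    using that inj by (auto simp: inv_into_f_f)
  note lin = linear_map_onD[OF d(2) t1.subm]
  show ?thesis
    unfolding miso_def
  proof (intro conjI ballI)
    show "bij_betw ?g (m_part L2) (m_part L1)" by (rule bij_betw_inv_into[OF d(1)])
    show "linear_map_on (m_part L2) ?g"
      unfolding linear_map_on_def
      by (intro conjI ballI allI; rule gI) (auto simp: g lin t1.subm subspace_add subspace_scale)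
    show "?g (trip L2 x y z) = trip L1 (?g x) (?g y) (?g z)" if "x \<in> m_part L2" "y \<in> m_part L2" "z \<in> m_part L2" for x y z
      by (rule gI) (use that in \<open>simp_all add: g d(3) t1.trip_m\<close>)
    show "\<exists>J'\<in>qstr L1. \<forall>x\<in>m_part L2. ?g (J x) = J' (?g x)" if J: "J \<in> qstr L2" for J
    proof -
      obtain J' where J': "J' \<in> qstr L1" "\<forall>x\<in>m_part L1. \<psi> (J' x) = J (\<psi> x)" using d(5)[OF J] by blast
      have "?g (J x) = J' (?g x)" if "x \<in> m_part L2" for x
        by (rule gI) (use that J' qstr_closed(1)[OF L1 J'(1)] in \<open>auto simp: g\<close>)
      then show ?thesis using J'(1) by blast
    qed
    show "\<exists>J\<in>qstr L2. \<forall>x\<in>m_part L2. ?g (J x) = J' (?g x)" if J: "J' \<in> qstr L1" for J'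
    proof -
      obtain J where J': "J \<in> qstr L2" "\<forall>x\<in>m_part L1. \<psi> (J' x) = J (\<psi> x)" using d(4)[OF J] by blast
      have "?g (J x) = J' (?g x)" if "x \<in> m_part L2" for x
        by (rule gI) (use that J' qstr_closed(1)[OF L1 J] in \<open>auto simp: g\<close>)
      then show ?thesis using J'(1) by blast
    qed
    show "sform L1 (?g x) (?g y) = sform L2 x y" if "x \<in> m_part L2" "y \<in> m_part L2" for x y
      using d(6)[OF g(1)[OF that(1)] g(1)[OF that(2)]] that by (simp add: g)
  qed
qed

lemma miso_trans:
  assumes "miso L1 L2 \<psi>" "miso L2 L3 \<xi>"
  shows "miso L1 L3 (\<xi> \<circ> \<psi>)"
proof -
  note d = misoD[OF assms(1)] and e = misoD[OF assms(2)]
  show ?thesis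
    unfolding miso_def
  proof (intro conjI ballI)
    show "bij_betw (\<xi> \<circ> \<psi>) (m_part L1) (m_part L3)" using d(1) e(1) by (rule bij_betw_trans)
    show "linear_map_on (m_part L1) (\<xi> \<circ> \<psi>)"
      using d(2,7) e(2) by (auto simp: linear_map_on_def)
    show "(\<xi> \<circ> \<psi>) (trip L1 x y z) = trip L3 ((\<xi> \<circ> \<psi>) x) ((\<xi> \<circ> \<psi>) y) ((\<xi> \<circ> \<psi>) z)"
      if "x \<in> m_part L1" "y \<in> m_part L1" "z \<in> m_part L1" for x y z
      using that by (simp add: d(3,7) e(3))
    show "\<exists>J'\<in>qstr L3. \<forall>x\<in>m_part L1. (\<xi> \<circ> \<psi>) (J x) = J' ((\<xi> \<circ> \<psi>) x)" if J: "J \<in> qstr L1" for J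
    proof -
      obtain J' where J': "J' \<in> qstr L2" "\<forall>x\<in>m_part L1. \<psi> (J x) = J' (\<psi> x)" using d(4)[OF J] by blast
      obtain J'' where "J'' \<in> qstr L3" "\<forall>x\<in>m_part L2. \<xi> (J' x) = J'' (\<xi> x)" using e(4)[OF J'(1)] by blast
      then show ?thesis using J' d(7) by (intro bexI[of _ J'']) auto
    qed
    show "\<exists>J\<in>qstr L1. \<forall>x\<in>m_part L1. (\<xi> \<circ> \<psi>) (J x) = J' ((\<xi> \<circ> \<psi>) x)" if J: "J' \<in> qstr L3" for J'
    proof -
      obtain J'' where J'': "J'' \<in> qstr L2" "\<forall>x\<in>m_part L2. \<xi> (J'' x) = J' (\<xi> x)" using e(5)[OF J] by blast
      obtain J where "J \<in> qstr L1" "\<forall>x\<in>m_part L1. \<psi> (J x) = J'' (\<psi> x)" using d(5)[OF J''(1)] by blast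
      then show ?thesis using J'' d(7) by (intro bexI[of _ J]) auto
    qed
  qed (simp add: d(6,7) e(6))
qed

lemma isomorphism_imp_miso:
  assumes L1: "qsH_tila n L1" and L2: "qsH_tila n L2" and iso: "qsH_isomorphism L1 L2 \<phi>"
  shows "miso L1 L2 \<phi>"
proof -
  interpret t1: tila_loc L1 using qsH_tilaD(1)[OF L1] by unfold_locales
  interpret t2: tila_loc L2 using qsH_tilaD(1)[OF L2] by unfold_locales
  have i: "bij_betw \<phi> (alg L1) (alg L2)" "linear_map_on (alg L1) \<phi>"
    "\<And>x y. x \<in> alg L1 \<Longrightarrow> y \<in> alg L1 \<Longrightarrow> \<phi> (brk L1 x y) = brk L2 (\<phi> x) (\<phi> y)"
    "\<And>x. x \<in> alg L1 \<Longrightarrow> \<phi> (invol L1 x) = invol L2 (\<phi> x)"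
    "{\<lambda>x\<in>m_part L1. inv_into (m_part L1) \<phi> (J (\<phi> x)) | J. J \<in> qstr L2} = qstr L1"
    "\<And>x y. x \<in> m_part L1 \<Longrightarrow> y \<in> m_part L1 \<Longrightarrow> sform L2 (\<phi> x) (\<phi> y) = sform L1 x y"
    using iso unfolding qsH_isomorphism_def by blast+
  note lin = linear_map_onD[OF i(2) t1.subV]
  have inj: "inj_on \<phi> (alg L1)" and im: "\<phi> ` alg L1 = alg L2" using i(1) by (auto simp: bij_betw_def)
  have iff: "\<phi> x \<in> m_part L2 \<longleftrightarrow> x \<in> m_part L1" if x: "x \<in> alg L1" for x
  proof -
    have "invol L2 (\<phi> x) = - \<phi> x \<longleftrightarrow> \<phi> (invol L1 x) = \<phi> (- x)"
      using x by (simp add: i(4) lin)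
    also have "\<dots> \<longleftrightarrow> invol L1 x = - x"
      using inj x t1.sig(1) subspace_neg[OF t1.subV] by (auto simp: inj_on_eq_iff)
    finally show ?thesis using x im by (auto simp: m_part_def)
  qed
  have imm: "\<phi> ` m_part L1 = m_part L2"
  proof (intro equalityI subsetI)
    fix y assume "y \<in> \<phi> ` m_part L1"
    then show "y \<in> m_part L2" using iff t1.mV by (auto simp del: mem_Collect_eq)
  next
    fix y assume y: "y \<in> m_part L2"
    then obtain x where "x \<in> alg L1" "y = \<phi> x" using t2.mV[OF y] unfolding im[symmetric] by (elim imageE)
    then show "y \<in> \<phi> ` m_part L1" using iff y by simp
  qed
  have bij: "bij_betw \<phi> (m_part L1) (m_part L2)"
    using imm inj t1.mV by (auto simp: bij_betw_def inj_on_def)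
  have q: "\<phi> ((\<lambda>x\<in>m_part L1. inv_into (m_part L1) \<phi> (J (\<phi> x))) x) = J (\<phi> x)" if "J \<in> qstr L2" "x \<in> m_part L1" for J x
  proof -
    have "\<phi> x \<in> m_part L2" using that imm by blast
    then have "J (\<phi> x) \<in> \<phi> ` m_part L1" using qstr_closed(1)[OF L2 that(1)] imm by blast
    then show ?thesis using that by (simp add: f_inv_into_f)
  qed
  show ?thesis
    unfolding miso_def
  proof (intro conjI ballI bij i(6))
    show "linear_map_on (m_part L1) \<phi>" using i(2) t1.mV by (auto simp: linear_map_on_def)
    show "\<phi> (trip L1 x y z) = trip L2 (\<phi> x) (\<phi> y) (\<phi> z)" if "x \<in> m_part L1" "y \<in> m_part L1" "z \<in> m_part L1" for x y z
      using that by (simp add: trip_def i(3) t1.mV t1.br_closed)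
    show "\<exists>J'\<in>qstr L2. \<forall>x\<in>m_part L1. \<phi> (J x) = J' (\<phi> x)" if "J \<in> qstr L1" for J
      using that q unfolding i(5)[symmetric] by blast
    show "\<exists>J\<in>qstr L1. \<forall>x\<in>m_part L1. \<phi> (J x) = J' (\<phi> x)" if "J' \<in> qstr L2" for J'
      using that q unfolding i(5)[symmetric] by blast
  qed
qed

text \<open>The even part consists of the operators on m spanned by the brackets of odd elements.
  Conjugation by \<psi> carries these operators over by the triple product, and faithfulness turns
  operators back into elements.\<close>

theorem miso_imp_isomorphism:
  assumes L1: "qsH_tila n L1" and L2: "qsH_tila n L2" and iso: "miso L1 L2 \<psi>"
  shows "\<exists>\<phi>. qsH_isomorphism L1 L2 \<phi>"
proof -
  interpret t1: tila_loc L1 using qsH_tilaD(1)[OF L1] by unfold_locales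
  interpret t2: tila_loc L2 using qsH_tilaD(1)[OF L2] by unfold_locales
  note d = misoD[OF iso]
  note lin = linear_map_onD[OF d(2) t1.subm]
  have inj: "inj_on \<psi> (m_part L1)" and im: "\<psi> ` m_part L1 = m_part L2" using d(1) by (auto simp: bij_betw_def)
  \<comment> \<open>z' is the element of the second algebra that acts as the conjugate of z by
    \<psi>. A relation is used because existence of z' is known at first only for brackets.\<close>
  define R where "R z z' \<longleftrightarrow> z' \<in> l_part L2 \<and> (\<forall>u\<in>m_part L1. brk L2 z' (\<psi> u) = \<psi> (brk L1 z u))" for z z'
  have R_unique: "z' = z''" if "R z z'" "R z z''" for z z' z''
  proof (rule t2.faithful_eq)
    fix x assume "x \<in> m_part L2"
    then obtain u where "u \<in> m_part L1" "x = \<psi> u" using im by blast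
    then show "brk L2 z' x = brk L2 z'' x" using that by (simp add: R_def)
  qed (use that in \<open>simp_all add: R_def\<close>)
  have R_br: "R (brk L1 x y) (brk L2 (\<psi> x) (\<psi> y))" if "x \<in> m_part L1" "y \<in> m_part L1" for x y
    using that d(3,7) t2.mm by (simp add: R_def trip_def)
  have R_add: "R (z + w) (z' + w')" if "R z z'" "R w w'" "z \<in> l_part L1" "w \<in> l_part L1" for z w z' w'
    using that subspace_add[OF t2.subl] t1.lm
    by (auto simp: R_def t1.br_left t2.br_left t1.mV t1.lV t2.mV t2.lV d(7) lin)
  have R_sc: "R (r *\<^sub>R z) (r *\<^sub>R z')" if "R z z'" "z \<in> l_part L1" for z z' r
    using that subspace_scale[OF t2.subl] t1.lm
    by (auto simp: R_def t1.br_left t2.br_left t1.mV t1.lV t2.mV t2.lV d(7) lin)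
  have R_0: "R 0 0" 
    using subspace_0[OF t2.subl] by (auto simp: R_def t1.br_left t2.br_left t1.mV t2.mV d(7) lin)
  \<comment> \<open>Brackets correspond to brackets by the triple product, and the relation is
    linear, so it extends to their span.\<close>
  have R_ex: "\<exists>z'. R z z'" if "z \<in> l_part L1" for z
  proof -
    have sp: "l_part L1 = span {brk L1 x y |x y. x \<in> m_part L1 \<and> y \<in> m_part L1}"
      using t1.l_span by (simp add: bracket_span_def)
    have "z \<in> l_part L1 \<and> (\<exists>z'. R z z')"
    proof (rule span_induct[of z "{brk L1 x y |x y. x \<in> m_part L1 \<and> y \<in> m_part L1}"])
      show "z \<in> span {brk L1 x y |x y. x \<in> m_part L1 \<and> y \<in> m_part L1}" using that sp by simp
      show "subspace {z. z \<in> l_part L1 \<and> (\<exists>z'. R z z')}"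
        using R_0 R_add R_sc t1.subl by (intro subspaceI) (auto simp: subspace_0 intro: subspace_add subspace_scale, blast+)
    qed (use R_br t1.mm in auto)
    then show ?thesis by blast
  qed
  define \<theta> where "\<theta> z = (SOME z'. R z z')" for z
  have th: "R z (\<theta> z)" if "z \<in> l_part L1" for z
    unfolding \<theta>_def using R_ex[OF that] by (rule someI_ex)
  have thI: "\<theta> z = z'" if "z \<in> l_part L1" "R z z'" for z z'
    using R_unique th that by blast
  have th_l: "\<theta> z \<in> l_part L2" and th_act: "\<And>u. u \<in> m_part L1 \<Longrightarrow> brk L2 (\<theta> z) (\<psi> u) = \<psi> (brk L1 z u)"
    if "z \<in> l_part L1" for z
    using th[OF that] by (auto simp: R_def)
  have th_add: "\<theta> (z + w) = \<theta> z + \<theta> w" if "z \<in> l_part L1" "w \<in> l_part L1" for z w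
    by (rule thI[OF subspace_add[OF t1.subl that] R_add[OF th[OF that(1)] th[OF that(2)] that]])
  have th_sc: "\<theta> (r *\<^sub>R z) = r *\<^sub>R \<theta> z" if "z \<in> l_part L1" for z r
    by (rule thI[OF subspace_scale[OF t1.subl that] R_sc[OF th[OF that] that]])
  have th_0: "\<theta> 0 = 0" by (rule thI[OF subspace_0[OF t1.subl] R_0])
  define \<phi> where "\<phi> x = \<theta> (t1.pl x) + \<psi> (t1.pm x)" for x
  have phi_m: "\<phi> x = \<psi> x" if "x \<in> m_part L1" for x
    using that by (simp add: \<phi>_def t1.pm_m th_0)
  have phi_l: "\<phi> x = \<theta> x" if "x \<in> l_part L1" for x
    using that by (simp add: \<phi>_def t1.pm_l lin)
  have phi_V: "\<phi> x \<in> alg L2" if "x \<in> alg L1" for x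
    using t2.lV[OF th_l[OF t1.pl_in[OF that]]] t2.mV[OF d(7)[OF t1.pm_in[OF that]]] subspace_add[OF t2.subV]
    by (simp add: \<phi>_def)
  have phi_lin: "linear_map_on (alg L1) \<phi>"
    unfolding linear_map_on_def
    by (simp add: \<phi>_def t1.pm_pl_lin th_add th_sc lin t1.pm_in t1.pl_in algebra_simps)
  note plin = linear_map_onD[OF phi_lin t1.subV]
  have phi_br: "\<phi> (brk L1 x y) = brk L2 (\<phi> x) (\<phi> y)" if x: "x \<in> alg L1" and y: "y \<in> alg L1" for x y
  proof -
    have mm: "\<phi> (brk L1 x y) = brk L2 (\<phi> x) (\<phi> y)" if "x \<in> m_part L1" "y \<in> m_part L1" for x y
      using thI[OF t1.mm[OF that] R_br[OF that]] that by (simp add: phi_l phi_m t1.mm)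
    have lm: "\<phi> (brk L1 x y) = brk L2 (\<phi> x) (\<phi> y)" if "x \<in> l_part L1" "y \<in> m_part L1" for x y
      using that by (simp add: phi_l phi_m t1.lm th_act)
    have ml: "\<phi> (brk L1 x y) = brk L2 (\<phi> x) (\<phi> y)" if "x \<in> m_part L1" "y \<in> l_part L1" for x y
      using lm[OF that(2,1)] that t1.br_skew[of y x] t2.br_skew[of "\<phi> y" "\<phi> x"] plin(3)[OF t1.br_closed[of y x]]
      by (simp add: phi_V t1.mV t1.lV)
    have ll: "\<phi> (brk L1 x y) = brk L2 (\<phi> x) (\<phi> y)" if x: "x \<in> l_part L1" and y: "y \<in> l_part L1" for x y
    proof -
      have "R (brk L1 x y) (brk L2 (\<theta> x) (\<theta> y))"
        unfolding R_def
      proof (intro conjI ballI)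
        show "brk L2 (\<theta> x) (\<theta> y) \<in> l_part L2" using x y by (intro t2.ll th_l)
        fix u assume u: "u \<in> m_part L1"
        show "brk L2 (brk L2 (\<theta> x) (\<theta> y)) (\<psi> u) = \<psi> (brk L1 (brk L1 x y) u)"
          using x y u t1.br_derivation[of x y u] t2.br_derivation[of "\<theta> x" "\<theta> y" "\<psi> u"]
          by (simp add: t1.lV t1.mV t2.lV t2.mV th_l d(7) th_act t1.lm lin)
      qed
      then show ?thesis using thI[OF t1.ll[OF x y]] x y by (simp add: phi_l t1.ll)
    qed
    let ?xl = "t1.pl x" and ?xm = "t1.pm x" and ?yl = "t1.pl y" and ?ym = "t1.pm y"
    note in1 = t1.pl_in[OF x] t1.pm_in[OF x] t1.pl_in[OF y] t1.pm_in[OF y]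
    note in2 = t1.lV[OF in1(1)] t1.mV[OF in1(2)] t1.lV[OF in1(3)] t1.mV[OF in1(4)]
    have "\<phi> (brk L1 (?xl + ?xm) (?yl + ?ym)) = brk L2 (\<phi> (?xl + ?xm)) (\<phi> (?yl + ?ym))"
      using in2 ll[OF in1(1,3)] lm[OF in1(1,4)] ml[OF in1(2,3)] mm[OF in1(2,4)]
      by (simp add: t1.br_left t1.br_right t2.br_left t2.br_right plin phi_V t1.br_closed
          subspace_add[OF t1.subV] subspace_add[OF t2.subV])
    then show ?thesis by (simp add: t1.pm_pl)
  qed
  have phi_inj: "inj_on \<phi> (alg L1)"
  proof (rule inj_onI)
    fix x y assume xy: "x \<in> alg L1" "y \<in> alg L1" "\<phi> x = \<phi> y"
    define v where "v = x - y"
    have v: "v \<in> alg L1" "\<phi> v = 0" using xy subspace_diff[OF t1.subV] by (auto simp: v_def plin)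
    have a: "\<theta> (t1.pl v) \<in> l_part L2" "\<psi> (t1.pm v) \<in> m_part L2"
      using th_l[OF t1.pl_in[OF v(1)]] d(7)[OF t1.pm_in[OF v(1)]] .
    \<comment> \<open>The element lies in both the even and the odd part, hence is 0.\<close>
    have e: "\<theta> (t1.pl v) = - \<psi> (t1.pm v)" using v(2) by (simp add: \<phi>_def eq_neg_iff_add_eq_0)
    then have "\<theta> (t1.pl v) \<in> m_part L2" using a(2) subspace_neg[OF t2.subm] by simp
    then have z: "\<theta> (t1.pl v) = 0" using a(1) t2.pm_m(2) t2.pm_l(2) by metis
    then have "\<psi> (t1.pm v) = \<psi> 0" using e by (simp add: lin)
    then have "t1.pm v = 0" using inj t1.pm_in[OF v(1)] subspace_0[OF t1.subm] by (auto dest: inj_onD)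
    moreover have "t1.pl v = 0"
    proof (rule t1.faithful[OF t1.pl_in[OF v(1)]])
      fix u assume u: "u \<in> m_part L1"
      have "\<psi> (brk L1 (t1.pl v) u) = \<psi> 0"
        using th_act[OF t1.pl_in[OF v(1)] u] z d(7)[OF u] by (simp add: t2.br_left t2.mV lin)
      then show "brk L1 (t1.pl v) u = 0"
        using inj t1.lm[OF t1.pl_in[OF v(1)] u] subspace_0[OF t1.subm] by (auto dest: inj_onD)
    qed
    ultimately have "v = 0" using t1.pm_pl[of v] by simp
    then show "x = y" by (simp add: v_def)
  qed
  have phi_surj: "alg L2 \<subseteq> \<phi> ` alg L1"
  proof
    fix y assume y: "y \<in> alg L2"
    have sub: "subspace (\<phi> ` alg L1)"
    proof (rule subspaceI)
      show "0 \<in> \<phi> ` alg L1" using plin(5) subspace_0[OF t1.subV] by (metis imageI)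
      show "a + b \<in> \<phi> ` alg L1" if "a \<in> \<phi> ` alg L1" "b \<in> \<phi> ` alg L1" for a b
        using that plin(1) subspace_add[OF t1.subV] by (metis (no_types, lifting) image_iff)
      show "r *\<^sub>R a \<in> \<phi> ` alg L1" if "a \<in> \<phi> ` alg L1" for r a
        using that plin(2) subspace_scale[OF t1.subV] by (metis (no_types, lifting) image_iff)
    qed
    have m2: "u \<in> \<phi> ` alg L1" if u: "u \<in> m_part L2" for u
    proof -
      obtain v where "v \<in> m_part L1" "u = \<psi> v" using u unfolding im[symmetric] by (elim imageE)
      then show ?thesis using phi_m[of v] t1.mV[of v] by (auto intro!: image_eqI[of _ _ v])
    qed
    have "brk L2 a b \<in> \<phi> ` alg L1" if ab: "a \<in> m_part L2" "b \<in> m_part L2" for a b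
    proof -
      obtain a' b' where "a' \<in> alg L1" "a = \<phi> a'" "b' \<in> alg L1" "b = \<phi> b'"
        using m2[OF ab(1)] m2[OF ab(2)] by (elim imageE)
      then show ?thesis using phi_br[of a' b'] t1.br_closed[of a' b'] by (auto intro!: image_eqI[of _ _ "brk L1 a' b'"])
    qed
    then have "l_part L2 \<subseteq> \<phi> ` alg L1"
      unfolding t2.l_span bracket_span_def by (intro span_minimal sub) auto
    then have "t2.pl y + t2.pm y \<in> \<phi> ` alg L1"
      using m2[OF t2.pm_in[OF y]] t2.pl_in[OF y] subspace_add[OF sub] by blast
    then show "y \<in> \<phi> ` alg L1" by (simp add: t2.pm_pl)
  qed
  have phi_sig: "\<phi> (invol L1 x) = invol L2 (\<phi> x)" if x: "x \<in> alg L1" for x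
  proof -
    have "invol L2 (\<theta> (t1.pl x)) = \<theta> (t1.pl x)" "invol L2 (\<psi> (t1.pm x)) = - \<psi> (t1.pm x)"
      using th_l[OF t1.pl_in[OF x]] d(7)[OF t1.pm_in[OF x]] by (auto simp: l_part_def m_part_def)
    then show ?thesis
      using x th_l[OF t1.pl_in[OF x]] d(7)[OF t1.pm_in[OF x]] t1.pm_in[OF x]
      by (simp add: \<phi>_def t1.pm_pl_lin lin t2.sig_lin t2.lV t2.mV)
  qed
  have Jphi: "(\<lambda>x\<in>m_part L1. inv_into (m_part L1) \<phi> (J' (\<phi> x))) = J"
    if J: "J \<in> qstr L1" and e: "\<forall>x\<in>m_part L1. \<psi> (J x) = J' (\<psi> x)" for J J'
  proof
    fix x
    show "(\<lambda>x\<in>m_part L1. inv_into (m_part L1) \<phi> (J' (\<phi> x))) x = J x"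
    proof (cases "x \<in> m_part L1")
      case True
      have Jx: "J x \<in> m_part L1" by (rule qstr_closed(1)[OF L1 J True])
      have "J' (\<phi> x) = \<phi> (J x)" using True Jx e by (simp add: phi_m)
      moreover have "inj_on \<phi> (m_part L1)" using phi_inj t1.mV by (auto simp: inj_on_def)
      ultimately show ?thesis using True Jx by simp
    next
      case False
      then show ?thesis using qstr_closed(2)[OF L1 J] by (simp add: extensional_def)
    qed
  qed
  have "{\<lambda>x\<in>m_part L1. inv_into (m_part L1) \<phi> (J (\<phi> x)) | J. J \<in> qstr L2} = qstr L1"
  proof (intro set_eqI iffI)
    fix K assume "K \<in> {\<lambda>x\<in>m_part L1. inv_into (m_part L1) \<phi> (J (\<phi> x)) | J. J \<in> qstr L2}"
    then obtain J' where J': "J' \<in> qstr L2" "K = (\<lambda>x\<in>m_part L1. inv_into (m_part L1) \<phi> (J' (\<phi> x)))" by blast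
    obtain J where "J \<in> qstr L1" "\<forall>x\<in>m_part L1. \<psi> (J x) = J' (\<psi> x)" using d(5)[OF J'(1)] by blast
    then show "K \<in> qstr L1" using Jphi J'(2) by metis
  next
    fix K assume K: "K \<in> qstr L1"
    obtain J' where "J' \<in> qstr L2" "\<forall>x\<in>m_part L1. \<psi> (K x) = J' (\<psi> x)" using d(4)[OF K] by blast
    then show "K \<in> {\<lambda>x\<in>m_part L1. inv_into (m_part L1) \<phi> (J (\<phi> x)) | J. J \<in> qstr L2}"
      using Jphi[OF K] by (metis (mono_tags, lifting) mem_Collect_eq)
  qed
  moreover have "bij_betw \<phi> (alg L1) (alg L2)"
    using phi_inj phi_surj phi_V by (auto simp: bij_betw_def)
  ultimately have "qsH_isomorphism L1 L2 \<phi>"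
    unfolding qsH_isomorphism_def using phi_lin phi_br phi_sig d(6) by (simp add: phi_m)
  then show ?thesis by (intro exI)
qed

lemma rescale_simps [simp]:
  "m_part (rescale t L) = m_part L" "l_part (rescale t L) = l_part L" "trip (rescale t L) = trip L"
  "qstr (rescale t L) = qstr L" "alg (rescale t L) = alg L" "brk (rescale t L) = brk L"
  "sform (rescale t L) x y = exp (2 * t) * sform L x y"
  by (simp_all add: rescale_def m_part_def l_part_def trip_def fun_eq_iff)

lemma rescale_rescale: "rescale s (rescale t L) = rescale (s + t) L"
  by (simp add: rescale_def fun_eq_iff exp_add distrib_left)

lemma qsH_tila_rescale:
  assumes "qsH_tila n L" shows "qsH_tila n (rescale t L)"
proof -
  have tila: "tila (rescale t L) = tila L"
    by (simp add: tila_def) (simp add: rescale_def)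
  have scale: "exp (2 * t) * a + exp (2 * t) * b = 0 \<longleftrightarrow> a + b = 0"
    "exp (2 * t) * a = - (exp (2 * t) * b) \<longleftrightarrow> a = - b" for a b :: real
    by (simp_all flip: distrib_left) (metis exp_not_eq_zero mult_cancel_left mult_minus_right)
  have bil: "bilinear_map_on V f \<Longrightarrow> bilinear_map_on V (\<lambda>x y. c * f x y)" for V :: "'a set" and f and c :: real
    unfolding bilinear_map_on_def linear_map_on_def by (simp add: algebra_simps)
  have sf: "sform (rescale t L) = (\<lambda>x y. exp (2 * t) * sform L x y)" by (simp add: fun_eq_iff)
  note d = qsH_tilaD[OF assms]
  show ?thesis
    unfolding qsH_tila_def tila rescale_simps sf
  proof (intro conjI ballI impI d(1-3))
    show "bilinear_map_on (m_part L) (\<lambda>x y. exp (2 * t) * sform L x y)" by (rule bil[OF d(4)])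
    show "exp (2 * t) * sform L x y = - (exp (2 * t) * sform L y x)" if "x \<in> m_part L" "y \<in> m_part L" for x y
      unfolding scale using that by (rule d(5))
    show "x = 0" if "x \<in> m_part L" "\<forall>y\<in>m_part L. exp (2 * t) * sform L x y = 0" for x
      by (rule d(6)[OF that(1)]) (use that(2) in simp)
    show "exp (2 * t) * sform L (J x) (J y) = exp (2 * t) * sform L x y"
      if "J \<in> qstr L" "\<forall>x\<in>m_part L. J (J x) = - x" "x \<in> m_part L" "y \<in> m_part L" for J x y
      using d(7)[OF that(1) _ that(3,4)] that(2) by simp
    show "(\<lambda>x\<in>m_part L. brk L z (J x) - J (brk L z x)) \<in> qstr L" if "z \<in> l_part L" "J \<in> qstr L" for z J
      using that by (rule d(8))
    show "exp (2 * t) * sform L (brk L z x) y + exp (2 * t) * sform L x (brk L z y) = 0"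
      if "z \<in> l_part L" "x \<in> m_part L" "y \<in> m_part L" for z x y
      unfolding scale using that by (rule d(9))
  qed
qed

lemma miso_rescale: "miso L1 L2 \<psi> \<Longrightarrow> miso (rescale t L1) (rescale t L2) \<psi>"
  by (simp add: miso_def)

lemma iso_class_eq:
  assumes "qsH_tila n L1" "qsH_tila n L2" "miso L1 L2 \<psi>"
  shows "iso_class n L1 = iso_class n L2"
proof -
  have *: "iso_class n L1 \<subseteq> iso_class n L2"
    if L: "qsH_tila n L1" "qsH_tila n L2" "miso L1 L2 \<psi>" for L1 :: "'x::real_vector qsH_data" and L2 :: "'y::real_vector qsH_data" and \<psi>
  proof
    fix L' assume "L' \<in> iso_class n L1"
    then obtain \<phi> where L': "qsH_tila n L'" "qsH_isomorphism L' L1 \<phi>" by (auto simp: iso_class_def)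
    have "miso L' L2 (\<psi> \<circ> \<phi>)" by (rule miso_trans[OF isomorphism_imp_miso[OF L'(1) L(1) L'(2)] L(3)])
    from miso_imp_isomorphism[OF L'(1) L(2) this] L'(1) show "L' \<in> iso_class n L2" by (simp add: iso_class_def)
  qed
  show ?thesis
    using *[OF assms] *[OF assms(2,1) miso_inverse[OF assms]] by blast
qed

text \<open>An isomorphism onto one rescaled member rescales along with the form, so it shifts the
  parameter by t.\<close>

lemma one_param_family_eq:
  assumes L1: "qsH_tila n L1" and L2: "qsH_tila n L2" and iso: "miso L1 (rescale t L2) \<psi>"
  shows "one_param_family n L1 = one_param_family n L2"
proof -
  have eq: "iso_class n (rescale s L1) = iso_class n (rescale (s + t) L2)" for s
    using iso_class_eq[OF qsH_tila_rescale[OF L1] qsH_tila_rescale[OF qsH_tila_rescale[OF L2]] miso_rescale[OF iso]]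
    by (simp add: rescale_rescale)
  have "\<exists>s'. iso_class n (rescale s L2) = iso_class n (rescale s' L1)" for s
    by (rule exI[of _ "s - t"]) (simp add: eq)
  then show ?thesis
    unfolding one_param_family_def eq by (auto simp: eq)
qed

text \<open>Transport of a structure along an injection into another ambient space;
  \<open>inv f\<close> is relevant only on the image.\<close>

definition push :: "('a::real_vector \<Rightarrow> 'b::real_vector) \<Rightarrow> 'a qsH_data \<Rightarrow> 'b qsH_data" where
  "push f L = \<lparr> alg = f ` alg L, brk = (\<lambda>x y. f (brk L (inv f x) (inv f y))),
     invol = (\<lambda>x. f (invol L (inv f x))),
     qstr = {\<lambda>x\<in>f ` m_part L. f (J (inv f x)) | J. J \<in> qstr L},
     sform = (\<lambda>x y. sform L (inv f x) (inv f y)) \<rparr>"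

lemma qsH_tila_push:
  assumes L: "qsH_tila n L" and f: "linear f" "inj f"
  shows "qsH_tila n (push f L)" "miso L (push f L) f"
proof -
  interpret tila_loc L using qsH_tilaD(1)[OF L] by unfold_locales
  note d = qsH_tilaD[OF L]
  have i [simp]: "inv f (f x) = x" for x using f(2) by simp
  note lf = linear_add[OF f(1)] linear_scale[OF f(1)] linear_neg[OF f(1)] linear_0[OF f(1)]
  have fi: "f x = f y \<longleftrightarrow> x = y" for x y using f(2) by (simp add: inj_eq)
  have f0: "f x = 0 \<longleftrightarrow> x = 0" for x using fi[of x 0] by (simp add: lf)
  have sel [simp]: "alg (push f L) = f ` alg L" "brk (push f L) (f x) (f y) = f (brk L x y)"
    "invol (push f L) (f x) = f (invol L x)" "sform (push f L) (f x) (f y) = sform L x y" for x y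
    by (simp_all add: push_def)
  have mp [simp]: "m_part (push f L) = f ` m" and lp [simp]: "l_part (push f L) = f ` l"
    by (auto simp: m_part_def l_part_def fi lf(3)[symmetric])
  have q: "qstr (push f L) = {\<lambda>x\<in>f ` m. f (J (inv f x)) | J. J \<in> qstr L}" by (simp add: push_def)
  have lin_push: "linear_map_on (f ` W) g \<longleftrightarrow> linear_map_on W (\<lambda>x. g (f x))" if "subspace W"
    for W and g :: "'b \<Rightarrow> 'z::real_vector"
    by (simp add: linear_map_on_def lf(1,2)[symmetric])
  have lin_comp: "linear_map_on W (\<lambda>x. f (g x)) \<longleftrightarrow> linear_map_on W g" for W and g :: "'a \<Rightarrow> 'a"
    by (simp add: linear_map_on_def lf(1,2)[symmetric] fi)
  have bil_push: "bilinear_map_on (f ` W) g \<longleftrightarrow> bilinear_map_on W (\<lambda>x y. g (f x) (f y))" if "subspace W"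
    for W and g :: "'b \<Rightarrow> 'b \<Rightarrow> 'z::real_vector"
    by (simp add: bilinear_map_on_def lin_push[OF that])
  have bil_comp: "bilinear_map_on W (\<lambda>x y. f (g x y)) \<longleftrightarrow> bilinear_map_on W g" for W and g :: "'a \<Rightarrow> 'a \<Rightarrow> 'a"
    by (simp add: bilinear_map_on_def lin_comp)
  have lie: "fin_dim_lie_algebra (f ` V) (brk (push f L))"
  proof -
    have t: "fin_dim_lie_algebra V br" using tila by (simp add: tila_def)
    then obtain B where "finite B" "V = span B" by (auto simp: fin_dim_lie_algebra_def)
    then have "finite (f ` B) \<and> f ` V = span (f ` B)" by (simp add: linear_span_image[OF f(1)])
    then have "\<exists>B. finite B \<and> f ` V = span B" by blast
    then show ?thesis
      using t unfolding fin_dim_lie_algebra_def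
      by (simp add: bil_push[OF subV] bil_comp lf(1)[symmetric] f0)
  qed
  have lspan: "f ` l = bracket_span (brk (push f L)) (f ` m)"
  proof -
    have "{brk (push f L) x y |x y. x \<in> f ` m \<and> y \<in> f ` m} = f ` {br x y |x y. x \<in> m \<and> y \<in> m}"
      by (auto simp: image_iff) (metis sel(2))+
    then show ?thesis
      unfolding l_span bracket_span_def by (simp add: linear_span_image[OF f(1)])
  qed
  have ideal: "I = {0}" if I: "lie_ideal (f ` V) (brk (push f L)) I" "I \<subseteq> f ` l" for I
  proof -
    define I' where "I' = f -` I"
    have I': "I = f ` I'" using I(2) by (auto simp: I'_def)
    have "subspace I'"
      unfolding I'_def by (rule linear_subspace_vimage[OF f(1)]) (use I(1) in \<open>simp add: lie_ideal_def\<close>)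
    moreover have "I' \<subseteq> V" "I' \<subseteq> l" using I(2) lV by (auto simp: I'_def fi)
    moreover have "br x y \<in> I'" if "x \<in> V" "y \<in> I'" for x y
      using I(1) that by (auto simp: lie_ideal_def I'_def simp flip: sel(2))
    ultimately have "I' = {0}" using tila unfolding tila_def lie_ideal_def by blast
    then show ?thesis using I' by (simp add: lf)
  qed
  have tila': "tila (push f L)"
    unfolding tila_def sel(1) mp lp
    using lie lspan ideal sig
    by (auto simp: lin_push[OF subV] lin_comp fi)
  have dim: "dim (f ` m) = 4 * n"
  proof -
    obtain B where B: "B \<subseteq> m" "independent B" "m \<subseteq> span B" "card B = dim m" by (rule basis_exists)
    have "independent (f ` B)"
      by (rule linear_independent_injective_image[OF f(1) B(2)]) (use f(2) in \<open>auto simp: inj_on_def\<close>)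
    moreover have "f ` m \<subseteq> span (f ` B)" using B(3) by (auto simp: linear_span_image[OF f(1)])
    moreover have "card (f ` B) = dim m" using card_image[of f B] f(2) B(4) by (auto simp: inj_on_def)
    moreover have "f ` B \<subseteq> f ` m" using B(1) by blast
    ultimately show ?thesis using d(2) dim_unique[of "f ` B" "f ` m"] by metis
  qed
  have qp: "(\<lambda>x\<in>f ` m. f (J (inv f x))) \<in> qstr (push f L)" if "J \<in> qstr L" for J
    using that by (auto simp: q)
  have lqs: "linear_quaternionic_structure (f ` m) (qstr (push f L))"
  proof -
    obtain J1 J2 J3 where J: "J1 \<in> End_on m" "J2 \<in> End_on m" "J3 \<in> End_on m"
      "\<forall>x\<in>m. J1 (J1 x) = - x \<and> J2 (J2 x) = - x \<and> J3 (J3 x) = - x"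
      "\<forall>x\<in>m. J1 (J2 x) = J3 x \<and> J3 x = - J2 (J1 x)"
      "qstr L = {\<lambda>x\<in>m. a *\<^sub>R J1 x + b *\<^sub>R J2 x + c *\<^sub>R J3 x | a b c. True}"
      using d(3) unfolding linear_quaternionic_structure_def by blast
    define K where "K J = (\<lambda>x\<in>f ` m. f (J (inv f x)))" for J
    have Kf: "K J (f x) = f (J x)" if "x \<in> m" for J x using that by (simp add: K_def)
    have KE: "K J \<in> End_on (f ` m)" if "J \<in> End_on m" for J
    proof -
      have "linear_map_on (f ` m) (K J)"
        unfolding lin_push[OF subm]
        using that subspace_add[OF subm] subspace_scale[OF subm]
        by (auto simp: linear_map_on_def Kf End_on_def lf(1,2)[symmetric])
      then show ?thesis using that by (auto simp: End_on_def K_def)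
    qed
    have Jm: "J1 x \<in> m" "J2 x \<in> m" "J3 x \<in> m" if "x \<in> m" for x using J(1-3) that by (auto simp: End_on_def)
    have Q: "qstr (push f L) = {\<lambda>x\<in>f ` m. a *\<^sub>R K J1 x + b *\<^sub>R K J2 x + c *\<^sub>R K J3 x | a b c. True}"
    proof -
      have e: "(\<lambda>x\<in>f ` m. f ((\<lambda>x\<in>m. a *\<^sub>R J1 x + b *\<^sub>R J2 x + c *\<^sub>R J3 x) (inv f x))) =
        (\<lambda>x\<in>f ` m. a *\<^sub>R K J1 x + b *\<^sub>R K J2 x + c *\<^sub>R K J3 x)" for a b c
        by (rule restrict_ext) (auto simp: Kf lf)
      show ?thesis
        unfolding q J(6)
      proof (intro set_eqI iffI)
        fix g assume "g \<in> {\<lambda>x\<in>f ` m. f (J (inv f x)) |J.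
          J \<in> {\<lambda>x\<in>m. a *\<^sub>R J1 x + b *\<^sub>R J2 x + c *\<^sub>R J3 x | a b c. True}}"
        then obtain a b c where "g = (\<lambda>x\<in>f ` m. f ((\<lambda>x\<in>m. a *\<^sub>R J1 x + b *\<^sub>R J2 x + c *\<^sub>R J3 x) (inv f x)))"
          by blast
        then show "g \<in> {\<lambda>x\<in>f ` m. a *\<^sub>R K J1 x + b *\<^sub>R K J2 x + c *\<^sub>R K J3 x | a b c. True}"
          unfolding e by blast
      next
        fix g assume "g \<in> {\<lambda>x\<in>f ` m. a *\<^sub>R K J1 x + b *\<^sub>R K J2 x + c *\<^sub>R K J3 x | a b c. True}"
        then show "g \<in> {\<lambda>x\<in>f ` m. f (J (inv f x)) |J.
          J \<in> {\<lambda>x\<in>m. a *\<^sub>R J1 x + b *\<^sub>R J2 x + c *\<^sub>R J3 x | a b c. True}}"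
          unfolding e[symmetric] by blast
      qed
    qed
    show ?thesis
      unfolding linear_quaternionic_structure_def
      by (rule bexI[of _ "K J1"], rule bexI[of _ "K J2"], rule bexI[of _ "K J3"])
         (use J Jm KE Q in \<open>auto simp: Kf lf(3)[symmetric] fi\<close>)
  qed
  show "qsH_tila n (push f L)"
    unfolding qsH_tila_def mp lp
  proof (intro conjI ballI impI tila' dim lqs)
    show "bilinear_map_on (f ` m) (sform (push f L))"
      using d(4) by (simp add: bil_push[OF subm])
    show "sform (push f L) x y = - sform (push f L) y x" if "x \<in> f ` m" "y \<in> f ` m" for x y
    proof -
      obtain a b where "a \<in> m" "x = f a" "b \<in> m" "y = f b" using \<open>x \<in> f ` m\<close> \<open>y \<in> f ` m\<close> by blast
      then show ?thesis using d(5)[of a b] by (simp only: sel)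
    qed
    show "x = 0" if "x \<in> f ` m" "\<forall>y\<in>f ` m. sform (push f L) x y = 0" for x
      using that d(6) by (auto simp: f0)
    show "sform (push f L) (J x) (J y) = sform (push f L) x y"
      if "J \<in> qstr (push f L)" "\<forall>x\<in>f ` m. J (J x) = - x" "x \<in> f ` m" "y \<in> f ` m" for J x y
    proof -
      obtain K where K: "K \<in> qstr L" "J = (\<lambda>x\<in>f ` m. f (K (inv f x)))" using \<open>J \<in> qstr (push f L)\<close> by (auto simp: q)
      have Jf: "J (f x) = f (K x)" if "x \<in> m" for x using that by (simp add: K)
      have "K (K x) = - x" if "x \<in> m" for x
      proof -
        have "J (J (f x)) = - f x" using \<open>\<forall>x\<in>f ` m. J (J x) = - x\<close> that by blast
        then show ?thesis using that qstr_closed(1)[OF L K(1)] by (simp add: Jf lf(3)[symmetric] fi)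
      qed
      then have "sform L (K x) (K y) = sform L x y" if "x \<in> m" "y \<in> m" for x y
        using d(7)[OF K(1)] that by blast
      then show ?thesis using that(3,4) by (auto simp: Jf)
    qed
    show "(\<lambda>x\<in>f ` m. brk (push f L) z (J x) - J (brk (push f L) z x)) \<in> qstr (push f L)"
      if "z \<in> f ` l" "J \<in> qstr (push f L)" for z J
    proof -
      obtain K where K: "K \<in> qstr L" "J = (\<lambda>x\<in>f ` m. f (K (inv f x)))" using \<open>J \<in> qstr (push f L)\<close> by (auto simp: q)
      obtain w where w: "w \<in> l" "z = f w" using \<open>z \<in> f ` l\<close> by blast
      have "(\<lambda>x\<in>f ` m. brk (push f L) z (J x) - J (brk (push f L) z x)) =
        (\<lambda>x\<in>f ` m. f ((\<lambda>x\<in>m. br w (K x) - K (br w x)) (inv f x)))"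
        by (rule restrict_ext) (auto simp: w K lm linear_diff[OF f(1)] fi)
      then show ?thesis using qp[OF d(8)[OF w(1) K(1)]] by simp
    qed
    show "sform (push f L) (brk (push f L) z x) y + sform (push f L) x (brk (push f L) z y) = 0"
      if "z \<in> f ` l" "x \<in> f ` m" "y \<in> f ` m" for z x y
      using that d(9) by auto
  qed
  show "miso L (push f L) f"
    unfolding miso_def mp
  proof (intro conjI ballI)
    show "bij_betw f m (f ` m)" using f(2) by (auto simp: bij_betw_def inj_on_def)
    show "linear_map_on m f" by (simp add: linear_map_on_def lf)
    show "f (trip L x y z) = trip (push f L) (f x) (f y) (f z)" for x y z by (simp add: trip_def)
    show "\<exists>J'\<in>qstr (push f L). \<forall>x\<in>m. f (J x) = J' (f x)" if "J \<in> qstr L" for J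
      using qp[OF that] by (rule bexI[rotated]) auto
    show "\<exists>J\<in>qstr L. \<forall>x\<in>m. f (J x) = J' (f x)" if "J' \<in> qstr (push f L)" for J'
      using that by (auto simp: q)
  qed simp
qed

text \<open>A space that is not finitely spanned contains independent sets of every finite size, and
  a basis can be mapped onto one of the right size.\<close>

lemma exists_linear_injection:
  assumes inf: "\<not> (\<exists>B :: 'g::real_vector set. finite B \<and> span B = UNIV)"
  obtains f :: "'a::euclidean_space \<Rightarrow> 'g::real_vector" where "linear f" "inj f"
proof -
  have "\<exists>C :: 'g set. finite C \<and> independent C \<and> card C = k" for k
  proof (induction k)
    case 0
    then show ?case by (intro exI[of _ "{}"]) (simp add: independent_empty)
  next
    case (Suc k)
    then obtain C :: "'g set" where C: "finite C" "independent C" "card C = k" by blast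
    obtain x where "x \<notin> span C" using inf C(1) by blast
    then show ?case
      using C span_base[of x C] by (intro exI[of _ "insert x C"]) (auto simp: independent_insert)
  qed
  then obtain C :: "'g set" where C: "finite C" "independent C" "card C = DIM('a)" by blast
  obtain \<beta> where \<beta>: "bij_betw \<beta> (Basis :: 'a set) C"
    using finite_same_card_bij[OF finite_Basis C(1)] C(3) by auto
  obtain f where f: "linear f" "\<And>b. b \<in> Basis \<Longrightarrow> f b = \<beta> b"
    using linear_independent_extend[OF independent_Basis, of \<beta>] by blast
  have "inj_on f (span Basis)"
  proof (rule linear_inj_on_span_independent_image[OF f(1)])
    have "f ` Basis = C" using f(2) \<beta> by (auto simp: bij_betw_def)
    then show "independent (f ` Basis)" using C(2) by simp
    show "inj_on f Basis" using \<beta> f(2) by (simp add: bij_betw_def inj_on_def)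
  qed
  then show ?thesis using that f(1) by simp
qed

section \<open>The model attached to a matrix\<close>

lemma quat_sel_two [simp]:
  "qre (2 * q) = 2 * qre q" "qim1 (2 * q) = 2 * qim1 q" "qim2 (2 * q) = 2 * qim2 q" "qim3 (2 * q) = 2 * qim3 q"
  by (simp_all only: mult_2 quat_sel_simps)

definition hform :: "('n::finite) qmat \<Rightarrow> quat ^ 'n \<Rightarrow> quat ^ 'n \<Rightarrow> quat" where
  "hform J X Y = (\<Sum>k\<in>UNIV. star_row X J $ k * Y $ k)"

text \<open>Both conditions hold for each of the matrices used as the scalar form, and the second
  gives nondegeneracy without any determinant.\<close>

locale form_model =
  fixes J :: "('n::finite) qmat"
  assumes J_skew: "qadj J = - J" and J_sq: "J ** J = - mat 1"
begin

lemma J_entry: "qconj (J $ i $ k) = - J $ k $ i"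
  using arg_cong[OF J_skew, of "\<lambda>M. M $ k $ i"] by (simp add: qadj_def)

lemma hform_sum: "hform J X Y = (\<Sum>i\<in>UNIV. \<Sum>k\<in>UNIV. qconj (X $ i) * J $ i $ k * Y $ k)"
  unfolding hform_def star_row_def by (subst sum.swap) (simp add: sum_distrib_right)

lemma star_row_linear:
  "star_row (X + Y) J = star_row X J + star_row Y J" "star_row (X - Y) J = star_row X J - star_row Y J"
  "star_row (r *\<^sub>R X) J = r *\<^sub>R star_row X J" "star_row 0 J = 0" "star_row (- X) J = - star_row X J"
  by (simp_all add: star_row_def vec_eq_iff distrib_right left_diff_distrib sum.distrib sum_subtractf
      scaleR_sum_right sum_negf)

lemma star_row_rmult: "star_row (rmult X q) J = (\<chi> k. qconj q * star_row X J $ k)"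
  by (simp add: star_row_def rmult_def vec_eq_iff qconj_mult sum_distrib_left mult.assoc)

lemma star_row_zero: "star_row X J = 0 \<Longrightarrow> X = 0"
proof -
  assume 0: "star_row X J = 0"
  \<comment> \<open>Multiplying the row by J once more recovers the conjugates of the entries of X
    up to sign.\<close>
  have "(\<Sum>k\<in>UNIV. star_row X J $ k * J $ k $ l) = - qconj (X $ l)" for l
  proof -
    have "(\<Sum>k\<in>UNIV. star_row X J $ k * J $ k $ l) = (\<Sum>i\<in>UNIV. qconj (X $ i) * (J ** J) $ i $ l)"
      unfolding star_row_def matrix_matrix_mult_def
      by (simp add: sum_distrib_right sum_distrib_left mult.assoc) (rule sum.swap)
    also have "\<dots> = (\<Sum>i\<in>UNIV. if i = l then - qconj (X $ i) else 0)"
      by (rule sum.cong) (simp_all add: J_sq mat_def)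
    finally show ?thesis by simp
  qed
  then have "qconj (X $ l) = 0" for l using 0 by (metis (no_types, lifting) neg_equal_0_iff_equal mult_zero_left sum.neutral zero_index)
  then show "X = 0" by (metis (no_types) qconj_simps(1,2) vec_eq_iff zero_index)
qed

sublocale qform rmult "hform J"
proof
  fix X Y Z :: "quat ^ 'n" and p q :: quat and r :: real
  show "rmult (X + Y) q = rmult X q + rmult Y q" "rmult X (p + q) = rmult X p + rmult X q"
    "rmult X (p * q) = rmult (rmult X p) q"
    by (simp_all add: rmult_def vec_eq_iff distrib_left distrib_right mult.assoc)
  show "rmult X (of_real r) = r *\<^sub>R X"
    by (simp add: rmult_def vec_eq_iff) (metis of_real_commute scaleR_conv_of_real)
  show "hform J (X + Y) Z = hform J X Z + hform J Y Z"
    by (simp add: hform_def star_row_linear distrib_right sum.distrib)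
  show "hform J (rmult X p) (rmult Y q) = qconj p * hform J X Y * q"
    unfolding hform_def star_row_rmult
    by (simp add: rmult_def sum_distrib_left sum_distrib_right mult.assoc)
  show "hform J Y X = - qconj (hform J X Y)"
  proof -
    have "hform J Y X = (\<Sum>k\<in>UNIV. \<Sum>i\<in>UNIV. qconj (Y $ i) * J $ i $ k * X $ k)"
      unfolding hform_sum by (rule sum.swap)
    also have "\<dots> = - qconj (hform J X Y)"
      unfolding hform_sum by (simp add: quat_sel_sum qconj_mult J_entry mult.assoc sum_negf)
    finally show ?thesis .
  qed
  show "X = 0" if "\<And>Y. hform J X Y = 0"
  proof (rule star_row_zero)
    have "star_row X J $ k = 0" for k
    proof -
      have "hform J X (axis k 1) = (\<Sum>i\<in>UNIV. if i = k then star_row X J $ i else 0)"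
        unfolding hform_def by (rule sum.cong) (simp_all add: axis_def)
      then show ?thesis using that[of "axis k 1"] by simp
    qed
    then show "star_row X J = 0" by (simp add: vec_eq_iff)
  qed
qed

lemma star_row_so:
  assumes "A \<in> so_star J"
  shows "star_row (A *v X) J = - (\<chi> k. \<Sum>i\<in>UNIV. star_row X J $ i * A $ i $ k)"
proof -
  have "star_row (A *v X) J $ k = - (\<Sum>i\<in>UNIV. star_row X J $ i * A $ i $ k)" for k
  proof -
    have e: "(qadj A ** J) $ l $ k = - (J ** A) $ l $ k" for l
    proof -
      have "(qadj A ** J + J ** A) $ l $ k = 0" using assms by (simp add: so_star_def)
      then show ?thesis by (simp add: eq_neg_iff_add_eq_0)
    qed
    have "star_row (A *v X) J $ k = (\<Sum>i\<in>UNIV. \<Sum>l\<in>UNIV. qconj (X $ l) * qconj (A $ i $ l) * J $ i $ k)"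
      by (simp add: star_row_def matrix_vector_mult_def quat_sel_sum qconj_mult sum_distrib_right)
    also have "\<dots> = (\<Sum>l\<in>UNIV. qconj (X $ l) * (qadj A ** J) $ l $ k)"
      by (subst sum.swap) (simp add: qadj_def matrix_matrix_mult_def sum_distrib_left mult.assoc)
    also have "\<dots> = - (\<Sum>l\<in>UNIV. qconj (X $ l) * (J ** A) $ l $ k)"
      unfolding e by (simp add: sum_negf)
    also have "\<dots> = - (\<Sum>l\<in>UNIV. \<Sum>i\<in>UNIV. qconj (X $ l) * J $ l $ i * A $ i $ k)"
      by (simp add: matrix_matrix_mult_def sum_distrib_left mult.assoc)
    also have "\<dots> = - (\<Sum>i\<in>UNIV. star_row X J $ i * A $ i $ k)"
      by (subst sum.swap) (simp add: star_row_def sum_distrib_right)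
    finally show ?thesis .
  qed
  then show ?thesis by (simp add: vec_eq_iff)
qed

lemma matrix_rmult: "(A :: 'n qmat) *v rmult X q = rmult (A *v X) q"
  by (simp add: matrix_vector_mult_def rmult_def vec_eq_iff sum_distrib_right mult.assoc)

lemma linear_matrix: "linear (\<lambda>X. (A :: 'n qmat) *v X)"
  by (rule linearI)
     (simp_all add: matrix_vector_mult_def vec_eq_iff distrib_left sum.distrib scaleR_sum_right)

lemma so_op_matrix:
  assumes "A \<in> so_star J" shows "so_op (\<lambda>X. A *v X)"
  unfolding so_op_def
proof (intro conjI allI linear_matrix matrix_rmult)
  fix X Y
  have "hform J (A *v X) Y = - (\<Sum>k\<in>UNIV. \<Sum>i\<in>UNIV. star_row X J $ i * A $ i $ k * Y $ k)"
    unfolding hform_def star_row_so[OF assms] by (simp add: sum_negf sum_distrib_right)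
  also have "\<dots> = - (\<Sum>i\<in>UNIV. star_row X J $ i * (A *v Y) $ i)"
    by (subst sum.swap) (simp add: matrix_vector_mult_def sum_distrib_left mult.assoc)
  finally show "hform J (A *v X) Y = - hform J X (A *v Y)" by (simp add: hform_def)
qed

end

section \<open>Block matrices and their commutators\<close>

lemma sum_ext:
  fixes f :: "('n::finite) ext \<Rightarrow> quat"
  shows "sum f UNIV = f ix_first + (\<Sum>i\<in>UNIV. f (ix_mid i)) + f ix_last"
proof -
  have "sum f UNIV = sum (f \<circ> Inl) UNIV + sum (f \<circ> Inr) UNIV"
    by (subst UNIV_Plus_UNIV[symmetric], subst sum.Plus) simp_all
  also have "sum (f \<circ> Inr) UNIV = sum (f \<circ> Inr \<circ> Inl) UNIV + sum (f \<circ> Inr \<circ> Inr) UNIV"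
    by (subst UNIV_Plus_UNIV[symmetric], subst sum.Plus) simp_all
  finally show ?thesis by (simp add: UNIV_unit add.assoc)
qed

lemma ext_eq_iff:
  fixes M M' :: "('n::finite) ext qmat"
  shows "M = M' \<longleftrightarrow>
     M $ ix_first $ ix_first = M' $ ix_first $ ix_first \<and> (\<forall>k. M $ ix_first $ ix_mid k = M' $ ix_first $ ix_mid k) \<and>
     M $ ix_first $ ix_last = M' $ ix_first $ ix_last \<and> (\<forall>i. M $ ix_mid i $ ix_first = M' $ ix_mid i $ ix_first) \<and>
     (\<forall>i k. M $ ix_mid i $ ix_mid k = M' $ ix_mid i $ ix_mid k) \<and>
     (\<forall>i. M $ ix_mid i $ ix_last = M' $ ix_mid i $ ix_last) \<and>
     M $ ix_last $ ix_first = M' $ ix_last $ ix_first \<and> (\<forall>k. M $ ix_last $ ix_mid k = M' $ ix_last $ ix_mid k) \<and>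
     M $ ix_last $ ix_last = M' $ ix_last $ ix_last" (is "?L \<longleftrightarrow> ?R")
proof
  assume R: ?R
  have c: "r = ix_first \<or> (\<exists>i. r = ix_mid i) \<or> r = ix_last" for r :: "'n ext"
    by (metis old.sum.exhaust old.unit.exhaust)
  have "M $ r $ s = M' $ r $ s" for r s using c[of r] c[of s] R by auto
  then show ?L by (simp add: vec_eq_iff)
qed simp

lemma block3_nth [simp]:
  "block3 a u d X A Y c v b $ ix_first $ ix_first = a" "block3 a u d X A Y c v b $ ix_first $ ix_mid k = u $ k"
  "block3 a u d X A Y c v b $ ix_first $ ix_last = d" "block3 a u d X A Y c v b $ ix_mid i $ ix_first = X $ i"
  "block3 a u d X A Y c v b $ ix_mid i $ ix_mid k = A $ i $ k" "block3 a u d X A Y c v b $ ix_mid i $ ix_last = Y $ i"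
  "block3 a u d X A Y c v b $ ix_last $ ix_first = c" "block3 a u d X A Y c v b $ ix_last $ ix_mid k = v $ k"
  "block3 a u d X A Y c v b $ ix_last $ ix_last = b"
  by (simp_all add: block3_def)

lemma block3_eq_iff:
  "block3 a u d X A Y c v b = block3 a' u' d' X' A' Y' c' v' b' \<longleftrightarrow>
     a = a' \<and> u = u' \<and> d = d' \<and> X = X' \<and> A = A' \<and> Y = Y' \<and> c = c' \<and> v = v' \<and> b = b'"
  unfolding ext_eq_iff by (simp add: vec_eq_iff)

lemma block3_linear:
  "block3 a u d X A Y c v b + block3 a' u' d' X' A' Y' c' v' b' =
     block3 (a + a') (u + u') (d + d') (X + X') (A + A') (Y + Y') (c + c') (v + v') (b + b')"
  "block3 a u d X A Y c v b - block3 a' u' d' X' A' Y' c' v' b' =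
     block3 (a - a') (u - u') (d - d') (X - X') (A - A') (Y - Y') (c - c') (v - v') (b - b')"
  "r *\<^sub>R block3 a u d X A Y c v b =
     block3 (r *\<^sub>R a) (r *\<^sub>R u) (r *\<^sub>R d) (r *\<^sub>R X) (r *\<^sub>R A) (r *\<^sub>R Y) (r *\<^sub>R c) (r *\<^sub>R v) (r *\<^sub>R b)"
  "block3 0 0 0 0 0 0 0 0 0 = (0 :: ('n::finite) ext qmat)"
  unfolding ext_eq_iff by simp_all

definition dotp :: "quat ^ 'n \<Rightarrow> quat ^ ('n::finite) \<Rightarrow> quat" where
  "dotp u X = (\<Sum>k\<in>UNIV. u $ k * X $ k)"

definition lmult :: "quat \<Rightarrow> quat ^ 'n \<Rightarrow> quat ^ ('n::finite)" where
  "lmult q u = (\<chi> k. q * u $ k)"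

definition outer :: "quat ^ 'n \<Rightarrow> quat ^ 'n \<Rightarrow> ('n::finite) qmat" where
  "outer X u = (\<chi> i k. X $ i * u $ k)"

lemma block3_mult:
  "block3 a u d X A Y c v b ** block3 a' u' d' X' A' Y' c' v' b' =
   block3 (a * a' + dotp u X' + d * c') (lmult a u' + u v* A' + lmult d v') (a * d' + dotp u Y' + d * b')
     (rmult X a' + A *v X' + rmult Y c') (outer X u' + A ** A' + outer Y v') (rmult X d' + A *v Y' + rmult Y b')
     (c * a' + dotp v X' + b * c') (lmult c u' + v v* A' + lmult b v') (c * d' + dotp v Y' + b * b')"
  unfolding ext_eq_iff
  by (simp add: matrix_matrix_mult_def sum_ext dotp_def lmult_def outer_def rmult_def
      vector_matrix_mult_def matrix_vector_mult_def)

lemma block_ops_zero [simp]: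
  "dotp 0 X = 0" "dotp u 0 = 0" "lmult 0 u = 0" "lmult q 0 = 0" "outer 0 u = 0" "outer X 0 = 0"
  "(0 :: quat ^ 'n) v* A = 0" "u v* (0 :: 'n qmat) = 0" "rmult 0 q = 0" "rmult X 0 = 0"
  "(0 :: ('n::finite) qmat) *v X = 0" "A *v (0 :: quat ^ 'n) = 0" "(0 :: 'n qmat) ** A = 0" "A ** (0 :: 'n qmat) = 0"
  by (simp_all add: dotp_def lmult_def outer_def rmult_def vec_eq_iff vector_matrix_mult_def
      matrix_vector_mult_def matrix_matrix_mult_def)

lemma dotp_star_row: "dotp (star_row X J) Y = hform J X Y" "dotp (- star_row X J) Y = - hform J X Y"
  by (simp_all add: dotp_def hform_def sum_negf)

lemma matrix_diff_distrib:
  fixes A B C :: "('n::finite) qmat"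
  shows "A ** (B - C) = A ** B - A ** C" "(B - C) ** A = B ** A - C ** A" "(B + C) ** A = B ** A + C ** A"
  by (simp_all add: vec_eq_iff matrix_matrix_mult_def right_diff_distrib left_diff_distrib distrib_right
      sum_subtractf sum.distrib)

lemma comm_jacobi: "comm x (comm y z) + comm y (comm z x) + comm z (comm x y) = (0 :: ('n::finite) qmat)"
  unfolding comm_def by (simp add: matrix_diff_distrib matrix_mul_assoc)

lemma comm_linear:
  fixes x y z :: "('n::finite) qmat"
  shows "comm (x + y) z = comm x z + comm y z" "comm x (y + z) = comm x y + comm x z"
    "comm (r *\<^sub>R x) z = r *\<^sub>R comm x z" "comm x (r *\<^sub>R z) = r *\<^sub>R comm x z"
    "comm (x - y) z = comm x z - comm y z" "comm x (y - z) = comm x y - comm x z" "comm x x = 0"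
    "comm y x = - comm x y" "comm 0 x = 0" "comm x 0 = 0"
  unfolding comm_def
  by (simp_all add: vec_eq_iff matrix_matrix_mult_def distrib_left distrib_right left_diff_distrib
      right_diff_distrib sum.distrib sum_subtractf scaleR_sum_right scaleR_diff_right)

lemma matrix_vector_real:
  "(A + B :: ('n::finite) qmat) *v X = A *v X + B *v X" "(A - B) *v X = A *v X - B *v X"
  "(r *\<^sub>R A) *v X = r *\<^sub>R (A *v X)" "(- A) *v X = - (A *v X)"
  by (simp_all add: vec_eq_iff matrix_vector_mult_def distrib_right left_diff_distrib sum.distrib
      sum_subtractf scaleR_sum_right sum_negf)

lemma outer_vec: "outer X u *v Z = rmult X (dotp u Z)"
  by (simp add: vec_eq_iff outer_def matrix_vector_mult_def rmult_def dotp_def sum_distrib_left mult.assoc)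

text \<open>The condition \<open>D_sq\<close> is what commuting of m with \<tau> amounts to:
  comparing the blocks in the middle row and last column of the two products gives exactly D (D X) =
  d X.\<close>

locale tau_model = form_model J for J :: "('n::finite) qmat" +
  fixes a :: quat and A :: "'n qmat" and d :: real
  assumes a_imag: "qre a = 0" and A_so: "A \<in> so_star J"
    and D_sq: "\<And>X. Dop (\<lambda>X. A *v X) a (Dop (\<lambda>X. A *v X) a X) = d *\<^sub>R X"
begin

abbreviation "\<tau> \<equiv> tau_mat a A d"
abbreviation "D \<equiv> Dop (\<lambda>X. A *v X) a"
abbreviation "hf \<equiv> hform J"
abbreviation "M \<equiv> m_elem J \<tau>"

definition lelem :: "quat \<Rightarrow> 'n qmat \<Rightarrow> 'n ext qmat" where
  "lelem a' A' = block3 a' 0 0  0 A' 0  0 0 a'"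

lemma M_eq: "M X = block3 0 (star_row (D X) J) 0  X 0 (D X)  0 (- star_row X J) 0"
proof -
  have "mid_block \<tau> = A" by (simp add: mid_block_def tau_mat_def vec_eq_iff)
  moreover have "\<tau> $ ix_first $ ix_first = a" by (simp add: tau_mat_def)
  ultimately show ?thesis by (simp add: m_elem_def Let_def Dop_def)
qed

lemma linear_D: "linear D"
  unfolding Dop_def by (intro linear_compose_sub linear_matrix linear_act_left)

lemma D_skew: "hf (D X) Y + hf X (D Y) = - (hf X Y * a - a * hf X Y)"
proof -
  have "hf (A *v X) Y = - hf X (A *v Y)" using so_op_matrix[OF A_so] by (simp add: so_op_def)
  then show ?thesis
    by (simp add: Dop_def h_linear h_act_left h_act_right qconj_imag[OF a_imag])
qed

lemma linear_M: "linear M"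
  by (rule linearI)
    (simp_all add: M_eq block3_linear star_row_linear linear_add[OF linear_D] linear_scale[OF linear_D])

lemma first_col_M [simp]: "first_col (M X) = X"
  by (simp add: first_col_def M_eq vec_eq_iff)

lemma inj_M: "inj M"
  by (metis first_col_M injI)

lemma M_eq_iff [simp]: "M X = M Y \<longleftrightarrow> X = Y"
  using inj_M by (simp add: inj_eq)

lemma tau_m_range: "tau_m J \<tau> = range M"
  by (simp add: tau_m_def)

lemma bottom_left_block3 [simp]: "bottom_left (block3 a' u d' X A' Y c v b) = qre c"
  by (simp add: bottom_left_def)

lemma star_row_D: "star_row (D X) J = - (star_row X J v* A) + lmult a (star_row X J)"
  by (simp add: Dop_def star_row_linear star_row_so[OF A_so] star_row_rmult qconj_imag[OF a_imag]
      vec_eq_iff vector_matrix_mult_def lmult_def)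

text \<open>The column blocks reduce to \<open>D_sq\<close>. The row blocks are the same equations
  transported by \<open>star_row\<close>, which turns A and a into right and left multiplications,
  so they impose nothing new.\<close>

lemma M_tau: "comm (M X) \<tau> = 0"
proof -
  have e1: "A *v D X = d *\<^sub>R X + rmult (D X) a" using D_sq[of X] by (simp add: Dop_def algebra_simps)
  have e2: "A *v X = D X + rmult X a" by (simp add: Dop_def)
  have e3: "star_row (D X) J v* A = lmult a (star_row (D X) J) - d *\<^sub>R star_row X J"
    using star_row_D[of "D X"] unfolding D_sq star_row_linear by (simp add: algebra_simps)
  have e4: "star_row X J v* A = lmult a (star_row X J) - star_row (D X) J"
    using star_row_D[of X] by (simp add: algebra_simps)
  have l: "lmult (of_real r) u = r *\<^sub>R u" "lmult 1 u = u" "lmult q (- u) = - lmult q u" "(- u) v* A = - (u v* A)" for r q u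
    by (simp_all add: lmult_def vec_eq_iff scaleR_conv_of_real[of _ "_ :: quat"] vector_matrix_mult_def sum_negf)
  show ?thesis
    unfolding comm_def M_eq unfolding tau_mat_def block3_mult block3_linear(1-3) block3_linear(4)[symmetric] block3_eq_iff
    by (simp add: l act_of_real e1 e2 e3 e4)
qed

lemma comm_M: "comm (M X) (M Y) = block3 (hf (D X) Y - hf (D Y) X) 0 (hf (D X) (D Y) - hf (D Y) (D X))  0
     (outer X (star_row (D Y) J) - outer (D X) (star_row Y J) - outer Y (star_row (D X) J) + outer (D Y) (star_row X J)) 0
     (- (of_real (2 * qre (hf X Y)))) 0 (hf Y (D X) - hf X (D Y))"
proof -
  have o: "outer X (- u) = - outer X u" for X u :: "quat ^ 'n" by (simp add: outer_def vec_eq_iff)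
  have re: "of_real (2 * qre (hf X Y)) = hf X Y - hf Y X"
    using h_skew[of Y X] by (simp add: quat_eq_iff)
  show ?thesis
    unfolding comm_def M_eq block3_mult block3_linear block3_eq_iff re
    by (simp add: dotp_star_row o)
qed

lemma bottom_left_comm_M: "bottom_left (comm (M X) (M Y)) = - 2 * qre (hf X Y)"
  by (simp add: comm_M)

text \<open>The diagonal blocks of the commutator after passing to the representative: its
  bottom-left entry is -2 Re h, so 2 Re h times \<tau> is added.\<close>

definition a2 :: "quat ^ 'n \<Rightarrow> quat ^ 'n \<Rightarrow> quat" where
  "a2 X Y = hf (D X) Y - hf (D Y) X + (2 * qre (hf X Y)) *\<^sub>R a"

definition A2 :: "quat ^ 'n \<Rightarrow> quat ^ 'n \<Rightarrow> 'n qmat" where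
  "A2 X Y = outer X (star_row (D Y) J) - outer (D X) (star_row Y J) - outer Y (star_row (D X) J)
     + outer (D Y) (star_row X J) + (2 * qre (hf X Y)) *\<^sub>R A"

lemma bracket_M: "quot_bracket \<tau> (M X) (M Y) = lelem (a2 X Y) (A2 X Y)"
proof -
  \<comment> \<open>Skewness of D up to a commutator and D D = d determine the top-right corner, and
    it is cancelled by the corner of the added multiple of \<tau>.\<close>
  have "qre (hf (D X) (D Y)) = - (d * qre (hf X Y))"
    using arg_cong[OF D_skew[of X "D Y"], of qre] by (simp add: D_sq h_linear quat_sel_mult)
  then have e1: "hf (D X) (D Y) - hf (D Y) (D X) + (2 * qre (hf X Y)) *\<^sub>R of_real d = 0"
    by (simp add: h_sym_part of_real_def)
  \<comment> \<open>The two diagonal corners agree because X and Y may be exchanged in the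
    commutator of a with hf X Y: the difference of the two values of hf is real.\<close>
  have e2: "hf Y (D X) - hf X (D Y) = hf (D X) Y - hf (D Y) X"
  proof -
    have "a * (hf X Y - hf Y X) = (hf X Y - hf Y X) * a"
      by (simp add: h_sym_part)
    then have "hf Y X * a - a * hf Y X = hf X Y * a - a * hf X Y"
      by (simp add: algebra_simps)
    then have "hf (D Y) X + hf Y (D X) = hf (D X) Y + hf X (D Y)"
      unfolding D_skew by simp
    then show ?thesis by (simp add: algebra_simps)
  qed
  have b: "of_real (2 * qre (hf X Y)) = (2 * qre (hf X Y)) *\<^sub>R (1::quat)"
    by (rule of_real_def)
  show ?thesis
    unfolding quot_bracket_def coset_rep_def comm_M lelem_def b
    by (simp add: tau_mat_def block3_linear block3_eq_iff a2_def A2_def e1 e2)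
qed

text \<open>A convenient superset of the even part. Its members are block diagonal and explicit,
  whereas the span of brackets has no explicit description.\<close>

definition Lset :: "'n ext qmat set" where
  "Lset = {lelem a' A' | a' A'. qre a' = 0 \<and> A' \<in> so_star J \<and> a' * a = a * a' \<and> A' ** A = A ** A'}"

lemma so_star_linear:
  "A1 \<in> so_star J \<Longrightarrow> B1 \<in> so_star J \<Longrightarrow> A1 + B1 \<in> so_star J" "A1 \<in> so_star J \<Longrightarrow> r *\<^sub>R A1 \<in> so_star J"
  "0 \<in> so_star J"
proof -
  have q: "qadj (X + Y) = qadj X + qadj Y" "qadj (r *\<^sub>R X) = r *\<^sub>R qadj X" "qadj (0::'n qmat) = 0" for X Y :: "'n qmat" and r
    by (simp_all add: qadj_def vec_eq_iff)
  have m: "(r *\<^sub>R X) ** Y = r *\<^sub>R (X ** Y)" "X ** (r *\<^sub>R Y) = r *\<^sub>R (X ** Y)" for X Y :: "'n qmat" and r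
    by (simp_all add: vec_eq_iff matrix_matrix_mult_def scaleR_sum_right)
  show "0 \<in> so_star J" by (simp add: so_star_def q)
  show "r *\<^sub>R A1 \<in> so_star J" if "A1 \<in> so_star J"
    using that by (simp add: so_star_def q m flip: scaleR_add_right)
  show "A1 + B1 \<in> so_star J" if "A1 \<in> so_star J" "B1 \<in> so_star J"
  proof -
    have "(qadj A1 ** J + J ** A1) + (qadj B1 ** J + J ** B1) = 0" using that by (simp add: so_star_def)
    then show ?thesis
      by (simp add: so_star_def q matrix_add_ldistrib matrix_diff_distrib(3) add_ac)
  qed
qed

lemma outer_so: "outer X (star_row Y J) + outer Y (star_row X J) \<in> so_star J"
proof -
  have 1: "qadj (outer X (star_row Y J)) ** J = - (\<chi> i k. (\<Sum>l\<in>UNIV. J $ i $ l * Y $ l) * star_row X J $ k)" for X Y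
  proof -
    have "qconj (star_row Y J $ i) = - (\<Sum>l\<in>UNIV. J $ i $ l * Y $ l)" for i
      by (simp add: star_row_def quat_sel_sum qconj_mult J_entry sum_negf)
    moreover have "(\<Sum>l\<in>UNIV. q * qconj (X $ l) * J $ l $ k) = q * star_row X J $ k" for q k
      by (simp add: star_row_def sum_distrib_left mult.assoc)
    ultimately show ?thesis
      by (simp add: vec_eq_iff qadj_def outer_def matrix_matrix_mult_def qconj_mult sum_negf)
  qed
  have 2: "J ** outer X (star_row Y J) = (\<chi> i k. (\<Sum>l\<in>UNIV. J $ i $ l * X $ l) * star_row Y J $ k)" for X Y
    by (simp add: vec_eq_iff outer_def matrix_matrix_mult_def sum_distrib_right mult.assoc)
  have q: "qadj (X + Y) = qadj X + qadj Y" for X Y :: "'n qmat" by (simp add: qadj_def vec_eq_iff)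
  show ?thesis
    unfolding so_star_def by (simp add: q matrix_add_ldistrib matrix_diff_distrib(3) 1 2)
qed

lemma bracket_M_Lset: "quot_bracket \<tau> (M X) (M Y) \<in> Lset"
proof -
  have "A2 X Y = (outer X (star_row (D Y) J) + outer (D Y) (star_row X J)) +
    ((-1) *\<^sub>R (outer Y (star_row (D X) J) + outer (D X) (star_row Y J)) + (2 * qre (hf X Y)) *\<^sub>R A)"
    by (simp add: A2_def)
  then have so: "A2 X Y \<in> so_star J"
    using so_star_linear outer_so A_so by metis
  have re: "qre (a2 X Y) = 0"
    using arg_cong[OF D_skew[of X Y], of qre] h_skew[of "D Y" X]
    by (simp add: a2_def a_imag quat_sel_mult)
  \<comment> \<open>The Jacobi identity shows that brackets centralize \<tau>; the commutation of
    \<open>a2\<close> with a and of \<open>A2\<close> with A is then read off from the blocks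
    instead of being computed.\<close>
  have "comm (comm (M X) (M Y)) \<tau> = 0"
    using comm_jacobi[of "M X" "M Y" \<tau>] comm_linear(8)[of \<tau> "M X"] M_tau[of X] M_tau[of Y]
      comm_linear(8)[of \<tau> "comm (M X) (M Y)"] by (simp add: comm_linear(1-7,9,10))
  then have "comm (quot_bracket \<tau> (M X) (M Y)) \<tau> = 0"
    by (simp add: quot_bracket_def coset_rep_def comm_linear(1-7,9,10))
  then have "comm (lelem (a2 X Y) (A2 X Y)) \<tau> = 0" by (simp add: bracket_M)
  then have "a2 X Y * a = a * a2 X Y" "A2 X Y ** A = A ** A2 X Y"
    unfolding comm_def lelem_def tau_mat_def block3_mult block3_linear(1-3) block3_linear(4)[symmetric] block3_eq_iff
    by simp_all
  then show ?thesis using so re by (auto simp: Lset_def bracket_M)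
qed

lemma bracket_lelem_M:
  assumes "qre a' = 0" "A' \<in> so_star J" "a' * a = a * a'" "A' ** A = A ** A'"
  shows "quot_bracket \<tau> (lelem a' A') (M X) = M (A' *v X - rmult X a')"
proof -
  have AA: "A' *v (A *v X) = A *v (A' *v X)" by (simp add: matrix_vector_mul_assoc assms(4))
  have D: "A' *v D X - rmult (D X) a' = D (A' *v X - rmult X a')"
    by (simp add: Dop_def matrix_vector_mult_diff_distrib matrix_rmult AA act_linear
        act_mult[symmetric] assms(3))
  have sr: "star_row (A' *v X - rmult X a') J = - (star_row X J v* A') + lmult a' (star_row X J)" for X
    by (simp add: star_row_linear star_row_so[OF assms(2)] star_row_rmult qconj_imag[OF assms(1)]
        vec_eq_iff vector_matrix_mult_def lmult_def)
  have l: "lmult q (- u) = - lmult q u" "(- u) v* A = - (u v* A)" for q u A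
    by (simp_all add: lmult_def vec_eq_iff vector_matrix_mult_def sum_negf)
  have "comm (lelem a' A') (M X) = M (A' *v X - rmult X a')"
    unfolding comm_def M_eq D[symmetric] sr lelem_def block3_mult block3_linear block3_eq_iff
    by (simp add: l)
  then show ?thesis by (simp add: quot_bracket_def coset_rep_def M_eq)
qed

text \<open>The point where the matrix model meets the abstract theory: its triple product is the
  tensor of the operator D built from the blocks of \<tau>.\<close>

lemma trip_M:
  "quot_bracket \<tau> (quot_bracket \<tau> (M X) (M Y)) (M Z) = M (RD D X Y Z)"
proof -
  have "quot_bracket \<tau> (M X) (M Y) \<in> Lset" by (rule bracket_M_Lset)
  then have c: "qre (a2 X Y) = 0 \<and> A2 X Y \<in> so_star J \<and> a2 X Y * a = a * a2 X Y \<and> A2 X Y ** A = A ** A2 X Y"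
    unfolding bracket_M Lset_def lelem_def by (auto simp: block3_eq_iff)
  have "A2 X Y *v Z - rmult Z (a2 X Y) = RD D X Y Z"
    by (simp add: A2_def a2_def RD_def matrix_vector_real outer_vec dotp_star_row act_linear Dop_def[of _ _ Z]
        algebra_simps)
  then show ?thesis using c by (simp add: bracket_M bracket_lelem_M)
qed

end

section \<open>The axioms of a qs-H tiLa for the model\<close>

context tau_model
begin

abbreviation "qb \<equiv> quot_bracket \<tau>"
abbreviation "T \<equiv> tau_tila J \<tau>"
abbreviation "mm \<equiv> tau_m J \<tau>"
abbreviation "ll \<equiv> tau_l J \<tau>"

lemma qb_linear:
  "qb (x + y) z = qb x z + qb y z" "qb z (x + y) = qb z x + qb z y"
  "qb (r *\<^sub>R x) z = r *\<^sub>R qb x z" "qb z (r *\<^sub>R x) = r *\<^sub>R qb z x"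
  "qb x x = 0" "qb (- x) z = - qb x z" "qb z (- x) = - qb z x"
proof -
  note c = linear_add[OF linear_coset_rep] linear_scale[OF linear_coset_rep] linear_0[OF linear_coset_rep]
  show "qb (x + y) z = qb x z + qb y z" "qb z (x + y) = qb z x + qb z y" for x y
    by (simp_all add: quot_bracket_def comm_linear(1-7) c)
  show sc: "qb (r *\<^sub>R x) z = r *\<^sub>R qb x z" "qb z (r *\<^sub>R x) = r *\<^sub>R qb z x" for r x
    by (simp_all add: quot_bracket_def comm_linear(1-7) c)
  show "qb x x = 0" by (simp add: quot_bracket_def comm_linear(1-7) c)
  show "qb (- x) z = - qb x z" "qb z (- x) = - qb z x"
    using sc[of "-1" x] by simp_all
qed

lemma qb_skew: "qb y x = - qb x y"
  unfolding quot_bracket_def comm_linear(8)[of y x] by (rule linear_neg[OF linear_coset_rep])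

text \<open>Passing to a representative changes an inner commutator by a multiple of \<tau>, which
  the outer element does not see since it commutes with \<tau>.\<close>

lemma qb_jacobi:
  assumes "comm x \<tau> = 0" "comm y \<tau> = 0" "comm z \<tau> = 0"
  shows "qb x (qb y z) + qb y (qb z x) + qb z (qb x y) = 0"
proof -
  have q: "qb x (qb y z) = coset_rep \<tau> (comm x (comm y z))" if "comm x \<tau> = 0" for x y z
    using that by (simp add: quot_bracket_def coset_rep_def[of _ "comm y z"] comm_linear(1-7))
  show ?thesis
    unfolding q[OF assms(1)] q[OF assms(2)] q[OF assms(3)]
    by (simp add: comm_jacobi linear_0[OF linear_coset_rep] flip: linear_add[OF linear_coset_rep])
qed

lemma subspace_m: "subspace mm"
  unfolding tau_m_range by (rule linear_subspace_image[OF linear_M subspace_UNIV])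

lemma subspace_ll: "subspace ll"
  by (simp add: tau_l_def bracket_span_def subspace_span)

lemma lelem_linear:
  "lelem a' A' + lelem b' B' = lelem (a' + b') (A' + B')" "r *\<^sub>R lelem a' A' = lelem (r *\<^sub>R a') (r *\<^sub>R A')"
  "lelem 0 0 = 0"
  by (simp_all add: lelem_def block3_linear)

lemma subspace_Lset: "subspace Lset"
proof (rule subspaceI)
  have "lelem 0 0 \<in> Lset" using so_star_linear(3) unfolding Lset_def by (intro CollectI exI[of _ 0]) simp
  then show "0 \<in> Lset" by (simp add: lelem_linear)
  show "x + y \<in> Lset" if x: "x \<in> Lset" and y: "y \<in> Lset" for x y
  proof -
    obtain a1 A1 where 1: "x = lelem a1 A1" "qre a1 = 0" "A1 \<in> so_star J" "a1 * a = a * a1" "A1 ** A = A ** A1"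
      using x by (auto simp: Lset_def)
    obtain a2 A2 where 2: "y = lelem a2 A2" "qre a2 = 0" "A2 \<in> so_star J" "a2 * a = a * a2" "A2 ** A = A ** A2"
      using y by (auto simp: Lset_def)
    have "x + y = lelem (a1 + a2) (A1 + A2)" by (simp add: 1 2 lelem_linear)
    moreover have "(a1 + a2) * a = a * (a1 + a2)" using 1 2 by (simp add: algebra_simps)
    moreover have "(A1 + A2) ** A = A ** (A1 + A2)" using 1 2 by (simp add: matrix_add_ldistrib matrix_diff_distrib)
    ultimately show ?thesis using 1 2 so_star_linear(1) unfolding Lset_def
      by (intro CollectI exI[of _ "a1 + a2"] exI[of _ "A1 + A2"]) simp
  qed
  show "r *\<^sub>R x \<in> Lset" if x: "x \<in> Lset" for r x
  proof -
    obtain a1 A1 where 1: "x = lelem a1 A1" "qre a1 = 0" "A1 \<in> so_star J" "a1 * a = a * a1" "A1 ** A = A ** A1"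
      using x by (auto simp: Lset_def)
    have "(r *\<^sub>R A1) ** A = A ** (r *\<^sub>R A1)"
      using 1(5) by (simp add: vec_eq_iff matrix_matrix_mult_def flip: scaleR_sum_right)
    then show ?thesis using 1 so_star_linear(2) unfolding Lset_def
      by (intro CollectI exI[of _ "r *\<^sub>R a1"] exI[of _ "r *\<^sub>R A1"]) (simp add: lelem_linear)
  qed
qed

lemma ll_Lset: "ll \<subseteq> Lset"
  unfolding tau_l_def bracket_span_def tau_m_range
  by (rule span_minimal[OF _ subspace_Lset]) (use bracket_M_Lset in auto)

lemma Lset_E:
  assumes "z \<in> Lset"
  obtains a' A' where "z = lelem a' A'" "qre a' = 0" "A' \<in> so_star J" "a' * a = a * a'" "A' ** A = A ** A'"
    "\<And>X. qb z (M X) = M (A' *v X - rmult X a')"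
  using assms bracket_lelem_M unfolding Lset_def by blast

lemma comm_tau:
  assumes "x \<in> mm \<or> x \<in> ll" shows "comm x \<tau> = 0"
  using assms
proof
  assume "x \<in> mm"
  then show ?thesis using M_tau by (auto simp: tau_m_range)
next
  assume "x \<in> ll"
  then have "x \<in> Lset" using ll_Lset by blast
  then obtain a' A' where z: "x = lelem a' A'" "a' * a = a * a'" "A' ** A = A ** A'" by (elim Lset_E)
  have "lmult q 0 = (0 :: quat ^ 'n)" for q by simp
  show ?thesis
    unfolding comm_def z(1) lelem_def tau_mat_def block3_mult block3_linear(2) block3_linear(4)[symmetric] block3_eq_iff
    using z(2,3) by (simp add: of_real_commute)
qed

text \<open>An odd element is determined by its first column, and the even ones have no entries
  there.\<close>

lemma m_l_zero: "x \<in> mm \<Longrightarrow> x \<in> ll \<Longrightarrow> x = 0"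
proof -
  assume "x \<in> mm" "x \<in> ll"
  then obtain X where X: "x = M X" by (auto simp: tau_m_range)
  have "x \<in> Lset" using \<open>x \<in> ll\<close> ll_Lset by blast
  then obtain a' A' where "x = lelem a' A'" by (elim Lset_E)
  then have "X = first_col (lelem a' A')" using X first_col_M by metis
  then have "X = 0" by (simp add: first_col_def lelem_def vec_eq_iff)
  then show "x = 0" using X linear_0[OF linear_M] by simp
qed

lemma qb_mm: "x \<in> mm \<Longrightarrow> y \<in> mm \<Longrightarrow> qb x y \<in> ll"
  unfolding tau_l_def bracket_span_def by (rule span_base) blast

lemma qb_lm: "z \<in> ll \<Longrightarrow> x \<in> mm \<Longrightarrow> qb z x \<in> mm"
proof -
  assume "z \<in> ll" "x \<in> mm"
  then obtain X where "x = M X" "z \<in> Lset" using ll_Lset by (auto simp: tau_m_range)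
  then show ?thesis by (elim Lset_E) (simp add: tau_m_range)
qed

text \<open>By linearity the second factor may be taken to be a bracket of odd elements, and the
  Jacobi identity then moves z inside.\<close>

lemma qb_ll: "z \<in> ll \<Longrightarrow> w \<in> ll \<Longrightarrow> qb z w \<in> ll"
proof -
  assume z: "z \<in> ll" and w: "w \<in> ll"
  have "w \<in> {w. qb z w \<in> ll}"
  proof (rule span_induct[of w "{qb x y |x y. x \<in> mm \<and> y \<in> mm}"])
    show "w \<in> span {qb x y |x y. x \<in> mm \<and> y \<in> mm}" using w by (simp add: tau_l_def bracket_span_def)
    have "qb z 0 = 0" using qb_linear(4)[of z 0 0] by simp
    then show "subspace {w. w \<in> {w. qb z w \<in> ll}}"
      by (intro subspaceI) (simp_all add: qb_linear subspace_0[OF subspace_ll] subspace_add[OF subspace_ll] subspace_scale[OF subspace_ll])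
    fix u assume "u \<in> {qb x y |x y. x \<in> mm \<and> y \<in> mm}"
    then obtain x y where xy: "u = qb x y" "x \<in> mm" "y \<in> mm" by blast
    have "qb z (qb x y) + qb x (qb y z) + qb y (qb z x) = 0"
      by (rule qb_jacobi) (use z xy comm_tau in blast)+
    then have "qb z u = - (qb x (qb y z) + qb y (qb z x))"
      unfolding xy(1) eq_neg_iff_add_eq_0 by (simp only: add.assoc)
    also have "\<dots> = qb x (qb z y) - qb y (qb z x)"
      unfolding qb_skew[of y z] by (simp add: qb_linear)
    finally show "u \<in> {w. qb z w \<in> ll}"
      using subspace_diff[OF subspace_ll] qb_mm qb_lm z xy by simp
  qed
  then show ?thesis by simp
qed

lemma alg_T: "alg T = {u + v | u v. u \<in> mm \<and> v \<in> ll}" and brk_T: "brk T = qb"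
  and qstr_T: "qstr T = {\<lambda>N\<in>mm. M (rmult (first_col N) q) | q. qre q = 0}"
  and sform_T: "sform T = (\<lambda>N N'. bottom_left (comm N N'))"
  by (simp_all add: tau_tila_def)

lemma subspace_alg: "subspace (alg T)"
  unfolding alg_T by (rule subspace_sums[OF subspace_m subspace_ll])

lemma decomp_unique:
  assumes "u \<in> mm" "v \<in> ll" "u' \<in> mm" "v' \<in> ll" "u + v = u' + v'"
  shows "u = u'" "v = v'"
proof -
  have "u - u' = v' - v" using assms(5) by (simp add: algebra_simps)
  then have "u - u' = 0"
    using assms subspace_diff[OF subspace_m, of u u'] subspace_diff[OF subspace_ll, of v' v] m_l_zero by metis
  then show "u = u'" "v = v'" using assms(5) by simp_all
qed

lemma invol_T: "u \<in> mm \<Longrightarrow> v \<in> ll \<Longrightarrow> invol T (u + v) = - u + v"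
proof -
  assume u: "u \<in> mm" and v: "v \<in> ll"
  have "(THE N'. \<exists>u'\<in>mm. \<exists>v'\<in>ll. u + v = u' + v' \<and> N' = - u' + v') = - u + v"
  proof (rule the_equality)
    show "\<exists>u'\<in>mm. \<exists>v'\<in>ll. u + v = u' + v' \<and> - u + v = - u' + v'" using u v by blast
    fix N' assume "\<exists>u'\<in>mm. \<exists>v'\<in>ll. u + v = u' + v' \<and> N' = - u' + v'"
    then obtain u' v' where *: "u' \<in> mm" "v' \<in> ll" "u + v = u' + v'" "N' = - u' + v'" by blast
    show "N' = - u + v" using decomp_unique[OF u v *(1-3)] *(4) by simp
  qed
  then show ?thesis by (simp add: tau_tila_def)
qed

lemma alg_cases:
  assumes "x \<in> alg T" obtains u v where "u \<in> mm" "v \<in> ll" "x = u + v" "invol T x = - u + v"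
  using assms invol_T unfolding alg_T by blast

lemma alg_I: "u \<in> mm \<Longrightarrow> v \<in> ll \<Longrightarrow> u + v \<in> alg T" "u \<in> mm \<Longrightarrow> u \<in> alg T" "v \<in> ll \<Longrightarrow> v \<in> alg T"
  unfolding alg_T using subspace_0[OF subspace_m] subspace_0[OF subspace_ll]
  by (auto intro: exI[of _ 0]) (metis add.right_neutral add.left_neutral)+

lemma m_part_T: "m_part T = mm" and l_part_T: "l_part T = ll"
proof -
  have two: "v = - v \<longleftrightarrow> v = 0" "- v = v \<longleftrightarrow> v = 0" for v :: "'n ext qmat"
    by (metis add_eq_0_iff scaleR_2 scaleR_eq_0_iff zero_neq_numeral add.inverse_neutral)+
  show "m_part T = mm"
  proof (intro equalityI subsetI)
    fix x assume "x \<in> m_part T"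
    then have x: "x \<in> alg T" "invol T x = - x" by (auto simp: m_part_def)
    obtain u v where uv: "u \<in> mm" "v \<in> ll" "x = u + v" "invol T x = - u + v" by (rule alg_cases[OF x(1)])
    then have "v = - v" using x(2) by simp
    then show "x \<in> mm" using uv two by simp
  next
    fix x assume x: "x \<in> mm"
    then show "x \<in> m_part T"
      using invol_T[OF x subspace_0[OF subspace_ll]] alg_I(2) by (simp add: m_part_def)
  qed
  show "l_part T = ll"
  proof (intro equalityI subsetI)
    fix x assume "x \<in> l_part T"
    then have x: "x \<in> alg T" "invol T x = x" by (auto simp: l_part_def)
    obtain u v where uv: "u \<in> mm" "v \<in> ll" "x = u + v" "invol T x = - u + v" by (rule alg_cases[OF x(1)])
    then have "- u = u" using x(2) by simp
    then show "x \<in> ll" using uv two by simp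
  next
    fix x assume x: "x \<in> ll"
    then show "x \<in> l_part T"
      using invol_T[OF subspace_0[OF subspace_m] x] alg_I(3) by (simp add: l_part_def)
  qed
qed

lemma matrix_zero: "(\<And>X. (B :: 'n qmat) *v X = 0) \<Longrightarrow> B = 0"
  by (metis matrix_eq matrix_vector_mult_0)

lemma tila_T: "tila T"
  unfolding tila_def m_part_T l_part_T
proof (intro conjI)
  have closed: "qb x y \<in> alg T" if xT: "x \<in> alg T" and yT: "y \<in> alg T" for x y
  proof -
    obtain u v where x: "u \<in> mm" "v \<in> ll" "x = u + v" by (rule alg_cases[OF xT])
    obtain u' v' where y: "u' \<in> mm" "v' \<in> ll" "y = u' + v'" by (rule alg_cases[OF yT])
    have "qb x y = (qb v u' - qb v' u) + (qb u u' + qb v v')"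
      unfolding x(3) y(3) qb_linear qb_skew[of u v'] by simp
    then show ?thesis
      using alg_I(1) subspace_diff[OF subspace_m] subspace_add[OF subspace_ll] qb_mm qb_lm qb_ll x y by simp
  qed
  have comm: "comm x \<tau> = 0" if "x \<in> alg T" for x
    by (rule alg_cases[OF that]) (simp add: comm_linear(1) comm_tau)
  show "fin_dim_lie_algebra (alg T) (brk T)"
    unfolding fin_dim_lie_algebra_def brk_T
  proof (intro conjI ballI)
    obtain B where B: "B \<subseteq> alg T" "independent B" "alg T \<subseteq> span B" "card B = dim (alg T)" by (rule basis_exists)
    have "span B \<subseteq> alg T" using B(1) subspace_alg by (rule span_minimal)
    then show "\<exists>B. finite B \<and> alg T = span B" using B(2,3) independent_imp_finite by blast
    show "bilinear_map_on (alg T) qb" by (simp add: bilinear_map_on_def linear_map_on_def qb_linear)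
  qed (use closed comm qb_jacobi qb_linear(5) in auto)
  show "invol T \<in> alg T \<rightarrow> alg T"
  proof
    fix x assume "x \<in> alg T"
    then obtain u v where "u \<in> mm" "v \<in> ll" "invol T x = - u + v" by (rule alg_cases)
    then show "invol T x \<in> alg T" using alg_I(1)[OF subspace_neg[OF subspace_m]] by metis
  qed
  show "linear_map_on (alg T) (invol T)"
    unfolding linear_map_on_def
  proof (intro conjI ballI allI)
    fix x y assume "x \<in> alg T" "y \<in> alg T"
    then obtain u v u' v' where x: "u \<in> mm" "v \<in> ll" "x = u + v" "u' \<in> mm" "v' \<in> ll" "y = u' + v'"
      by (elim alg_cases)
    have "x + y = (u + u') + (v + v')" by (simp add: x)
    then have "invol T (x + y) = - (u + u') + (v + v')"
      using invol_T[OF subspace_add[OF subspace_m x(1,4)] subspace_add[OF subspace_ll x(2,5)]] by simp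
    then show "invol T (x + y) = invol T x + invol T y"
      using invol_T[OF x(1,2)] invol_T[OF x(4,5)] by (simp add: x(3,6))
  next
    fix r x assume "x \<in> alg T"
    then obtain u v where x: "u \<in> mm" "v \<in> ll" "x = u + v" by (elim alg_cases)
    have "r *\<^sub>R x = r *\<^sub>R u + r *\<^sub>R v" by (simp add: x scaleR_add_right)
    then have "invol T (r *\<^sub>R x) = - (r *\<^sub>R u) + r *\<^sub>R v"
      using invol_T[OF subspace_scale[OF subspace_m x(1)] subspace_scale[OF subspace_ll x(2)]] by simp
    then show "invol T (r *\<^sub>R x) = r *\<^sub>R invol T x"
      using invol_T[OF x(1,2)] by (simp add: x(3) scaleR_diff_right)
  qed
  show "\<forall>x\<in>alg T. invol T (invol T x) = x"
  proof
    fix x assume "x \<in> alg T"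
    then obtain u v where uv: "u \<in> mm" "v \<in> ll" "x = u + v" "invol T x = - u + v" by (rule alg_cases)
    then show "invol T (invol T x) = x" using invol_T[OF subspace_neg[OF subspace_m uv(1)] uv(2)] by simp
  qed
  show "\<forall>x\<in>alg T. \<forall>y\<in>alg T. invol T (brk T x y) = brk T (invol T x) (invol T y)"
  proof (intro ballI)
    fix x y assume "x \<in> alg T" "y \<in> alg T"
    then obtain u v u' v' where x: "u \<in> mm" "v \<in> ll" "x = u + v" "invol T x = - u + v"
      "u' \<in> mm" "v' \<in> ll" "y = u' + v'" "invol T y = - u' + v'"
      by (elim alg_cases)
    have "qb x y = (qb v u' - qb v' u) + (qb u u' + qb v v')"
      unfolding x(3,7) qb_linear qb_skew[of u v'] by simp
    then have "invol T (qb x y) = - (qb v u' - qb v' u) + (qb u u' + qb v v')"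
      using invol_T[OF subspace_diff[OF subspace_m qb_lm[OF x(2,5)] qb_lm[OF x(6,1)]]
          subspace_add[OF subspace_ll qb_mm[OF x(1,5)] qb_ll[OF x(2,6)]]] by simp
    also have "\<dots> = qb (- u + v) (- u' + v')"
      unfolding qb_linear qb_skew[of u v'] by simp
    finally show "invol T (brk T x y) = brk T (invol T x) (invol T y)" by (simp add: brk_T x(4,8))
  qed
  show "ll = bracket_span (brk T) mm" by (simp add: brk_T tau_l_def)
  show "\<forall>I. lie_ideal (alg T) (brk T) I \<and> I \<subseteq> ll \<longrightarrow> I = {0}"
  proof (intro allI impI)
    fix I assume I: "lie_ideal (alg T) (brk T) I \<and> I \<subseteq> ll"
    \<comment> \<open>Bracketing z with an odd element lands in the ideal, hence in l, but also in
      m; so z acts as 0 on m. This means A' X = X a' for all X, which forces a' = 0 and A' =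
      0.\<close>
    have "z = 0" if z: "z \<in> I" for z
    proof -
      have zl: "z \<in> ll" "z \<in> Lset" using I z ll_Lset by auto
      obtain a' A' where A': "z = lelem a' A'" "qre a' = 0" "A' \<in> so_star J"
        "\<And>X. qb z (M X) = M (A' *v X - rmult X a')"
        by (rule Lset_E[OF zl(2)], rule that)
      have "M (A' *v X - rmult X a') = 0" for X
      proof -
        have MX: "M X \<in> mm" by (simp add: tau_m_range)
        have "qb (M X) z \<in> I" using I z alg_I(2)[OF MX] by (auto simp: lie_ideal_def brk_T)
        then have "qb z (M X) \<in> ll" using I qb_skew[of z "M X"] subspace_neg[OF subspace_ll] by auto
        then have "qb z (M X) = 0" using qb_lm[OF zl(1) MX] m_l_zero by blast
        then show ?thesis using A'(4) by simp
      qed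
      then have e: "A' *v X = rmult X a'" for X
        using first_col_M[of "A' *v X - rmult X a'"] first_col_M[of 0] linear_0[OF linear_M] by simp
      have "a' = 0" by (rule so_op_act_zero[OF so_op_matrix[OF A'(3)] e A'(2)])
      moreover then have "A' = 0" using e by (intro matrix_zero) simp
      ultimately show "z = 0" by (simp add: A'(1) lelem_linear)
    qed
    moreover have "0 \<in> I" using I by (simp add: lie_ideal_def subspace_0)
    ultimately show "I = {0}" by blast
  qed
qed

lemma sform_M: "sform T (M X) (M Y) = - 2 * qre (hf X Y)"
  by (simp add: sform_T bottom_left_comm_M)

lemma trip_T: "trip T (M X) (M Y) (M Z) = M (RD D X Y Z)"
  by (simp add: trip_def brk_T trip_M)

lemma M_mm: "M X \<in> mm"
  by (simp add: tau_m_range)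

theorem qsH_tila_T: "qsH_tila CARD('n) T"
  unfolding qsH_tila_def m_part_T l_part_T
proof (intro conjI tila_T)
  have "dim mm = dim (UNIV :: (quat ^ 'n) set)"
    unfolding tau_m_range by (rule dim_image_eq[OF linear_M]) (use inj_M in simp)
  then show "dim mm = 4 * CARD('n)" by simp
  note lM = linear_add[OF linear_M] linear_scale[OF linear_M] linear_neg[OF linear_M] linear_diff[OF linear_M]
  define R where "R q = (\<lambda>N\<in>mm. M (rmult (first_col N) q))" for q
  have RM: "R q (M X) = M (rmult X q)" for q X by (simp add: R_def M_mm)
  have Q: "qstr T = {R q | q. qre q = 0}" by (simp add: qstr_T R_def)
  have mE: "\<exists>X. N = M X" if "N \<in> mm" for N using that by (auto simp: tau_m_range)
  have RE: "R q \<in> End_on mm" for q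
    unfolding End_on_def linear_map_on_def
  proof (intro CollectI conjI ballI allI)
    show "R q \<in> mm \<rightarrow>\<^sub>E mm" by (auto simp: R_def M_mm)
    show "R q (x + y) = R q x + R q y" if "x \<in> mm" "y \<in> mm" for x y
      using mE[OF that(1)] mE[OF that(2)] by (auto simp: RM act_linear lM simp flip: lM(1))
    show "R q (r *\<^sub>R x) = r *\<^sub>R R q x" if "x \<in> mm" for r x
      using mE[OF that] by (auto simp: RM act_linear simp flip: lM(2))
  qed
  show "linear_quaternionic_structure mm (qstr T)"
    unfolding linear_quaternionic_structure_def
  \<comment> \<open>The order is j, i, k because right multiplications compose in reverse: applying
    i and then j multiplies by i j = k.\<close>
  proof (rule bexI[OF _ RE[of quat_j]], rule bexI[OF _ RE[of quat_i]], rule bexI[OF _ RE[of quat_k]], intro conjI ballI)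
    fix x assume "x \<in> mm"
    then obtain X where X: "x = M X" using mE by blast
    show "R quat_j (R quat_j x) = - x" "R quat_i (R quat_i x) = - x" "R quat_k (R quat_k x) = - x"
      "R quat_j (R quat_i x) = R quat_k x" "R quat_k x = - R quat_i (R quat_j x)"
      by (simp_all add: X RM act_units lM)
  next
    have "(\<lambda>x\<in>mm. b *\<^sub>R R quat_j x + c *\<^sub>R R quat_i x + e *\<^sub>R R quat_k x) = R (Quat 0 c b e)" for b c e
    proof
      fix x
      show "(\<lambda>x\<in>mm. b *\<^sub>R R quat_j x + c *\<^sub>R R quat_i x + e *\<^sub>R R quat_k x) x = R (Quat 0 c b e) x"
      proof (cases "x \<in> mm")
        case True
        then obtain X where X: "x = M X" using mE by blast
        have "Quat 0 c b e = b *\<^sub>R quat_j + c *\<^sub>R quat_i + e *\<^sub>R quat_k" by (simp add: quat_eq_iff)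
        then show ?thesis using True by (simp add: X RM M_mm act_linear lM)
      qed (simp add: R_def)
    qed
    then have e: "R (Quat 0 c b e) = (\<lambda>x\<in>mm. b *\<^sub>R R quat_j x + c *\<^sub>R R quat_i x + e *\<^sub>R R quat_k x)" for b c e by simp
    show "qstr T = {\<lambda>x\<in>mm. b *\<^sub>R R quat_j x + c *\<^sub>R R quat_i x + e *\<^sub>R R quat_k x | b c e. True}"
    proof (intro set_eqI iffI)
      fix g assume "g \<in> qstr T"
      then obtain q where q: "g = R q" "qre q = 0" by (auto simp: Q)
      have "q = Quat 0 (qim1 q) (qim2 q) (qim3 q)" using q(2) by (simp add: quat_eq_iff)
      then have "g = R (Quat 0 (qim1 q) (qim2 q) (qim3 q))" using q(1) by metis
      then show "g \<in> {\<lambda>x\<in>mm. b *\<^sub>R R quat_j x + c *\<^sub>R R quat_i x + e *\<^sub>R R quat_k x | b c e. True}"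
        unfolding e by blast
    next
      fix g assume "g \<in> {\<lambda>x\<in>mm. b *\<^sub>R R quat_j x + c *\<^sub>R R quat_i x + e *\<^sub>R R quat_k x | b c e. True}"
      then obtain b c e' where "g = R (Quat 0 c b e')" unfolding e[symmetric] by blast
      then show "g \<in> qstr T" unfolding Q by (intro CollectI exI[of _ "Quat 0 c b e'"]) simp
    qed
  qed
  show "bilinear_map_on mm (sform T)"
    unfolding bilinear_map_on_def linear_map_on_def
    by (auto simp: sform_M h_linear tau_m_range simp flip: lM(1,2))
  show "\<forall>x\<in>mm. \<forall>y\<in>mm. sform T x y = - sform T y x"
  proof (intro ballI)
    fix x y assume "x \<in> mm" "y \<in> mm"
    then obtain X Y where XY: "x = M X" "y = M Y" using mE by blast
    show "sform T x y = - sform T y x" unfolding XY sform_M h_skew[of Y X] by simp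
  qed
  show "\<forall>x\<in>mm. (\<forall>y\<in>mm. sform T x y = 0) \<longrightarrow> x = 0"
  proof (intro ballI impI)
    fix x assume x: "x \<in> mm" "\<forall>y\<in>mm. sform T x y = 0"
    then obtain X where X: "x = M X" using mE by blast
    have re: "qre (hf X Y) = 0" for Y using x(2) M_mm[of Y] by (auto simp: X sform_M)
    have "hf X Y = 0" for Y
      using re[of Y] re[of "rmult Y quat_i"] re[of "rmult Y quat_j"] re[of "rmult Y quat_k"]
      by (simp add: h_act_right quat_eq_iff quat_sel_mult)
    then have "X = 0" by (rule h_nondeg)
    then show "x = 0" by (simp add: X linear_0[OF linear_M])
  qed
  show "\<forall>J\<in>qstr T. (\<forall>x\<in>mm. J (J x) = - x) \<longrightarrow> (\<forall>x\<in>mm. \<forall>y\<in>mm. sform T (J x) (J y) = sform T x y)"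
  proof (intro ballI impI)
    fix K x y assume K: "K \<in> qstr T" "\<forall>x\<in>mm. K (K x) = - x" and xy: "x \<in> mm" "y \<in> mm"
    obtain X Y where XY: "x = M X" "y = M Y" using mE xy by blast
    obtain q where q: "K = R q" "qre q = 0" using K(1) by (auto simp: Q)
    obtain X0 :: "quat ^ 'n" where X0: "X0 \<noteq> 0" using exists_nonzero by auto
    have "M (rmult (rmult X0 q) q) = M (- X0)" using K(2) M_mm[of X0] by (auto simp: q(1) RM lM)
    then have "rmult X0 (q * q + 1) = 0" by (simp add: act_linear act_mult)
    then have "q * q = -1" using X0 act_eq_0_iff by (metis eq_neg_iff_add_eq_0)
    \<comment> \<open>A right multiplication by imaginary q squares to -1 only for unit q, and then
      it preserves Re h.\<close>
    then have "qnorm2 q = 1" using imag_square[OF q(2)] by (metis neg_equal_iff_equal of_real_eq_1_iff)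
    then show "sform T (K x) (K y) = sform T x y"
      unfolding XY q(1) RM sform_M qre_h_act by simp
  qed
  have lE: "\<exists>a' A'. qre a' = 0 \<and> A' \<in> so_star J \<and> (\<forall>X. qb z (M X) = M (A' *v X - rmult X a'))" if z: "z \<in> ll" for z
    by (rule Lset_E[OF subsetD[OF ll_Lset z]]) blast
  show "\<forall>z\<in>ll. \<forall>J\<in>qstr T. (\<lambda>x\<in>mm. brk T z (J x) - J (brk T z x)) \<in> qstr T"
  proof (intro ballI)
    fix z K assume z: "z \<in> ll" and "K \<in> qstr T"
    then obtain q where q: "K = R q" "qre q = 0" by (auto simp: Q)
    obtain a' A' where A': "qre a' = 0" "A' \<in> so_star J" "\<And>X. qb z (M X) = M (A' *v X - rmult X a')"
      using lE[OF z] by blast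
    have "(\<lambda>x\<in>mm. brk T z (K x) - K (brk T z x)) = R (a' * q - q * a')"
    proof
      fix x
      show "(\<lambda>x\<in>mm. brk T z (K x) - K (brk T z x)) x = R (a' * q - q * a') x"
      proof (cases "x \<in> mm")
        case True
        then obtain X where X: "x = M X" using mE by blast
        show ?thesis
          using True by (simp add: X q(1) RM M_mm brk_T A'(3) act_linear act_mult matrix_rmult flip: lM(4))
      qed (simp add: R_def)
    qed
    moreover have "qre (a' * q - q * a') = 0" by (simp add: quat_sel_mult)
    ultimately show "(\<lambda>x\<in>mm. brk T z (K x) - K (brk T z x)) \<in> qstr T" unfolding Q by blast
  qed
  show "\<forall>z\<in>ll. \<forall>x\<in>mm. \<forall>y\<in>mm. sform T (brk T z x) y + sform T x (brk T z y) = 0"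
  proof (intro ballI)
    fix z x y assume z: "z \<in> ll" and xy: "x \<in> mm" "y \<in> mm"
    obtain X Y where XY: "x = M X" "y = M Y" using mE xy by blast
    obtain a' A' where A': "qre a' = 0" "A' \<in> so_star J" "\<And>X. qb z (M X) = M (A' *v X - rmult X a')"
      using lE[OF z] by blast
    have "hf (A' *v X) Y = - hf X (A' *v Y)" using so_op_matrix[OF A'(2)] by (simp add: so_op_def)
    then show "sform T (brk T z x) y + sform T x (brk T z y) = 0"
      by (simp add: XY brk_T A'(3) sform_M h_linear h_act_left h_act_right quat_sel_mult A'(1))
  qed
qed

end

section \<open>The listed matrices\<close>

text \<open>All forms and middle blocks of the list have at most one nonzero entry in each row. Such
  matrices multiply by composing the maps \<sigma>, so every matrix identity reduces to an identity
  of coefficients.\<close>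

definition monomial :: "(nat \<Rightarrow> nat) \<Rightarrow> (nat \<Rightarrow> quat) \<Rightarrow> ('n::finite) qmat" where
  "monomial \<sigma> f = mat_from (\<lambda>r s. if s = \<sigma> r then f r else 0)"

lemma sum_to_nat_on:
  "(\<Sum>i\<in>(UNIV :: 'n::finite set). f (to_nat_on UNIV i)) = (\<Sum>r<CARD('n). f r)"
  by (rule sum.reindex_bij_betw[OF to_nat_on_bij])

lemma to_nat_on_eq_iff [simp]:
  "to_nat_on (UNIV :: 'n::finite set) i = to_nat_on UNIV k \<longleftrightarrow> i = k"
  using to_nat_on_bij[where 'n='n] by (auto simp: bij_betw_def inj_eq)

lemma to_nat_on_ex:
  assumes "r < CARD('n::finite)" obtains i :: "'n::finite" where "to_nat_on UNIV i = r"
proof -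
  have "r \<in> range (to_nat_on (UNIV :: 'n set))"
    using to_nat_on_bij[where 'n='n] assms by (simp add: bij_betw_def)
  then show ?thesis using that by blast
qed

lemma mat_from_cong:
  assumes "\<And>r s. r < CARD('n) \<Longrightarrow> s < CARD('n) \<Longrightarrow> f r s = g r s"
  shows "(mat_from f :: ('n::finite) qmat) = mat_from g"
  using assms by (simp add: mat_from_def vec_eq_iff)

lemma monomial_mult:
  assumes "\<And>r. r < CARD('n) \<Longrightarrow> \<sigma> r < CARD('n)"
  shows "(monomial \<sigma> f :: ('n::finite) qmat) ** monomial \<rho> g = monomial (\<rho> \<circ> \<sigma>) (\<lambda>r. f r * g (\<sigma> r))"
proof -
  have "(\<Sum>t<CARD('n). (if t = \<sigma> r then f r else 0) * (if s = \<rho> t then g t else 0)) =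
    (if s = \<rho> (\<sigma> r) then f r * g (\<sigma> r) else 0)" if "r < CARD('n)" for r s
    using assms[OF that] by (subst sum_single[of _ "\<sigma> r"]) auto
  then show ?thesis
    unfolding monomial_def mat_from_def matrix_matrix_mult_def
    using sum_to_nat_on[where 'n='n, of "\<lambda>t. (if t = \<sigma> r then f r else 0) * (if s = \<rho> t then g t else 0)" for r s]
    by (simp add: vec_eq_iff)
qed

lemma monomial_adj:
  assumes "\<And>r. r < CARD('n) \<Longrightarrow> \<sigma> r < CARD('n)" "\<And>r. r < CARD('n) \<Longrightarrow> \<sigma> (\<sigma> r) = r"
  shows "qadj (monomial \<sigma> f :: ('n::finite) qmat) = monomial \<sigma> (\<lambda>r. qconj (f (\<sigma> r)))"
proof -
  have "s = \<sigma> r \<longleftrightarrow> r = \<sigma> s" if "r < CARD('n)" "s < CARD('n)" for r s using assms that by metis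
  then show ?thesis
    by (auto simp: monomial_def mat_from_def qadj_def vec_eq_iff assms(2))
qed

lemma monomial_cong:
  assumes "\<And>r. r < CARD('n) \<Longrightarrow> \<sigma> r = \<rho> r" "\<And>r. r < CARD('n) \<Longrightarrow> f r = g r"
  shows "(monomial \<sigma> f :: ('n::finite) qmat) = monomial \<rho> g"
  unfolding monomial_def by (rule mat_from_cong) (simp add: assms)

lemma monomial_simps:
  "monomial \<sigma> f + monomial \<sigma> g = (monomial \<sigma> (\<lambda>r. f r + g r) :: ('n::finite) qmat)"
  "- monomial \<sigma> f = (monomial \<sigma> (\<lambda>r. - f r) :: ('n::finite) qmat)"
  "monomial \<sigma> (\<lambda>r. 0) = (0 :: ('n::finite) qmat)"
  "(mat 1 :: ('n::finite) qmat) = monomial (\<lambda>r. r) (\<lambda>r. 1)"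
  by (auto simp: monomial_def mat_from_def mat_def vec_eq_iff)

lemma monomial_quadratic:
  "(\<Sum>i\<in>UNIV. \<Sum>k\<in>UNIV. qconj (X $ i) * (monomial (\<lambda>r. r) (\<lambda>r. of_real (s r)) :: ('n::finite) qmat) $ i $ k * X $ k)
     = of_real (\<Sum>i\<in>UNIV. s (to_nat_on UNIV i) * qnorm2 (X $ i))"
proof -
  have "(\<Sum>k\<in>UNIV. qconj (X $ i) * (monomial (\<lambda>r. r) (\<lambda>r. of_real (s r)) :: 'n qmat) $ i $ k * X $ k)
    = of_real (s (to_nat_on UNIV i) * qnorm2 (X $ i))" for i
  proof -
    have "(\<Sum>k\<in>UNIV. qconj (X $ i) * (monomial (\<lambda>r. r) (\<lambda>r. of_real (s r)) :: 'n qmat) $ i $ k * X $ k)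
      = qconj (X $ i) * of_real (s (to_nat_on UNIV i)) * X $ i"
      by (subst sum_single[of _ i]) (auto simp: monomial_def mat_from_def)
    also have "\<dots> = of_real (s (to_nat_on UNIV i)) * (qconj (X $ i) * X $ i)"
      by (simp add: of_real_commute mult.assoc)
    finally show ?thesis by (simp add: qconj_mult_self)
  qed
  then show ?thesis by simp
qed

text \<open>The involution exchanging the first N positions with the last N and fixing the middle
  one, if there is one.\<close>

definition swap_ix :: "nat \<Rightarrow> nat \<Rightarrow> nat \<Rightarrow> nat" where
  "swap_ix N t r = (if r < N then r + t else if r < t then r else r - t)"

definition split_coeff :: "nat \<Rightarrow> nat \<Rightarrow> nat \<Rightarrow> quat" where
  "split_coeff N t r = (if r < N then 1 else if r < t then quat_j else - 1)"

definition nilp_coeff :: "nat \<Rightarrow> nat \<Rightarrow> nat \<Rightarrow> nat \<Rightarrow> nat \<Rightarrow> quat" where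
  "nilp_coeff N t p q r =
     (if r < N then (if p \<le> r \<and> r < p + q then 1 else 0) else if r < t then 0 else if r - t < p then 1 else 0)"

locale split_size =
  fixes N t n :: nat
  assumes n: "n = t + N" "t = N \<or> t = N + 1"
begin

lemma swap_less: "r < n \<Longrightarrow> swap_ix N t r < n"
  using n by (auto simp: swap_ix_def)

lemma swap_swap: "r < n \<Longrightarrow> swap_ix N t (swap_ix N t r) = r"
  using n by (auto simp: swap_ix_def)

lemma split_entry: "r < n \<Longrightarrow> s < n \<Longrightarrow>
  anti_block N t (diag_of (\<lambda>_. 1)) quat_j (diag_of (\<lambda>_. - 1)) r s = (if s = swap_ix N t r then split_coeff N t r else 0)"
  using n by (auto simp: anti_block_def diag_of_def swap_ix_def split_coeff_def)

lemma nilp_entry: "r < n \<Longrightarrow> s < n \<Longrightarrow>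
  anti_block N t (B_blk p q) 0 (C_blk p) r s = (if s = swap_ix N t r then nilp_coeff N t p q r else 0)"
  using n by (auto simp: anti_block_def diag_of_def swap_ix_def nilp_coeff_def B_blk_def C_blk_def)

end

lemma form_diag_monomial: "form_diag = (monomial (\<lambda>r. r) (\<lambda>r. quat_j) :: ('n::finite) qmat)"
  unfolding form_diag_def monomial_def by (rule mat_from_cong) (simp add: diag_of_def)

lemma diag_monomial: "mat_from (diag_of f) = (monomial (\<lambda>r. r) f :: ('n::finite) qmat)"
  unfolding monomial_def by (rule mat_from_cong) (simp add: diag_of_def)

lemma form_split_monomial:
  assumes "CARD('n) = t + N" "t = N \<or> t = N + 1"
  shows "form_split N t = (monomial (swap_ix N t) (split_coeff N t) :: ('n::finite) qmat)"
proof -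
  interpret split_size N t "CARD('n)" using assms by unfold_locales
  show ?thesis unfolding form_split_def monomial_def by (rule mat_from_cong) (rule split_entry)
qed

lemma A_nilp_monomial:
  assumes "CARD('n) = t + N" "t = N \<or> t = N + 1"
  shows "A_nilp N t p q = (monomial (swap_ix N t) (nilp_coeff N t p q) :: ('n::finite) qmat)"
proof -
  interpret split_size N t "CARD('n)" using assms by unfold_locales
  show ?thesis unfolding A_nilp_def monomial_def by (rule mat_from_cong) (rule nilp_entry)
qed

lemma split_mult:
  assumes "CARD('n) = t + N" "t = N \<or> t = N + 1"
  shows "(monomial (swap_ix N t) f :: ('n::finite) qmat) ** monomial \<rho> g =
      monomial (\<rho> \<circ> swap_ix N t) (\<lambda>r. f r * g (swap_ix N t r))"
    and "qadj (monomial (swap_ix N t) f :: 'n qmat) = monomial (swap_ix N t) (\<lambda>r. qconj (f (swap_ix N t r)))"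
proof -
  interpret split_size N t "CARD('n)" using assms by unfold_locales
  show "(monomial (swap_ix N t) f :: 'n qmat) ** monomial \<rho> g =
      monomial (\<rho> \<circ> swap_ix N t) (\<lambda>r. f r * g (swap_ix N t r))"
    by (rule monomial_mult) (rule swap_less)
  show "qadj (monomial (swap_ix N t) f :: 'n qmat) = monomial (swap_ix N t) (\<lambda>r. qconj (f (swap_ix N t r)))"
    by (rule monomial_adj) (rule swap_less swap_swap, assumption)+
qed

lemma form_model_diag: "form_model (form_diag :: ('n::finite) qmat)"
  by unfold_locales
    (simp_all add: form_diag_monomial monomial_adj monomial_mult monomial_simps o_def)

lemma form_model_split:
  assumes n: "CARD('n) = t + N" "t = N \<or> t = N + 1"
  shows "form_model (form_split N t :: ('n::finite) qmat)"
proof -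
  interpret split_size N t "CARD('n)" using n by unfold_locales
  have 1: "qconj (split_coeff N t (swap_ix N t r)) = - split_coeff N t r"
    "split_coeff N t r * split_coeff N t (swap_ix N t r) = - 1" if "r < CARD('n)" for r
    using that n by (auto simp: split_coeff_def swap_ix_def)
  show ?thesis
  proof
    show "qadj (form_split N t :: 'n qmat) = - form_split N t"
      unfolding form_split_monomial[OF n] split_mult(2)[OF n] monomial_simps(2)
      by (rule monomial_cong) (simp_all add: 1)
    show "(form_split N t :: 'n qmat) ** form_split N t = - mat 1"
      unfolding form_split_monomial[OF n] split_mult(1)[OF n] monomial_simps(2,4)
      by (rule monomial_cong) (simp_all add: 1 swap_swap)
  qed
qed

text \<open>\<open>C_blk\<close> and \<open>B_blk\<close> occupy different positions on their
  diagonals, so both of their products vanish and A has square 0.\<close>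

lemma tau_model_nilp:
  assumes n: "CARD('n) = t + N" "t = N \<or> t = N + 1"
  shows "tau_model (form_split N t) 0 (A_nilp N t p q :: ('n::finite) qmat) 0"
proof -
  interpret split_size N t "CARD('n)" using n by unfold_locales
  interpret form_model "form_split N t :: 'n qmat" by (rule form_model_split[OF n])
  have 1: "qconj (nilp_coeff N t p q (swap_ix N t r)) * split_coeff N t (swap_ix N t r) +
      split_coeff N t r * nilp_coeff N t p q (swap_ix N t r) = 0"
    "nilp_coeff N t p q r * nilp_coeff N t p q (swap_ix N t r) = 0" if "r < CARD('n)" for r
    using that n by (auto simp: split_coeff_def swap_ix_def nilp_coeff_def)
  have sq: "(A_nilp N t p q :: 'n qmat) ** A_nilp N t p q = 0"
    unfolding A_nilp_monomial[OF n] split_mult(1)[OF n]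
    unfolding monomial_simps(3)[of "\<lambda>r. r", symmetric]
    by (rule monomial_cong) (simp_all add: 1 swap_swap)
  show ?thesis
  proof
    show "A_nilp N t p q \<in> so_star (form_split N t :: 'n qmat)"
      unfolding so_star_def form_split_monomial[OF n] A_nilp_monomial[OF n] split_mult(2)[OF n]
        split_mult(1)[OF n] mem_Collect_eq monomial_simps(1)
      unfolding monomial_simps(3)[of "\<lambda>r. r", symmetric]
      by (rule monomial_cong) (simp_all add: 1 swap_swap)
    show "Dop (\<lambda>X. A_nilp N t p q *v X) 0 (Dop (\<lambda>X. A_nilp N t p q *v X) 0 X) = 0 *\<^sub>R X" for X :: "quat ^ 'n"
      by (simp add: Dop_def matrix_vector_mul_assoc sq)
  qed simp
qed

lemma tau_model_rot: "tau_model form_diag quat_i (0 :: ('n::finite) qmat) (- 1)"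
proof -
  interpret form_model "form_diag :: 'n qmat" by (rule form_model_diag)
  show ?thesis
  proof
    show "(0 :: 'n qmat) \<in> so_star form_diag" by (simp add: so_star_def qadj_def vec_eq_iff matrix_matrix_mult_def)
    show "Dop (\<lambda>X. (0 :: 'n qmat) *v X) quat_i (Dop (\<lambda>X. (0 :: 'n qmat) *v X) quat_i X) = - 1 *\<^sub>R X" for X
      by (simp add: Dop_def act_linear act_units)
  qed simp
qed

lemma I_sig_square: "I_sig p r * I_sig p r = 1" "quat_j * I_sig p r = I_sig p r * quat_j"
  "qconj (I_sig p r) = I_sig p r"
  by (simp_all add: I_sig_def)

lemma tau_model_complex:
  "tau_model form_diag 0 (mat_from (diag_of (\<lambda>r. quat_j * I_sig p r)) :: ('n::finite) qmat) (- 1)"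
proof -
  interpret form_model "form_diag :: 'n qmat" by (rule form_model_diag)
  let ?A = "mat_from (diag_of (\<lambda>r. quat_j * I_sig p r)) :: 'n qmat"
  have j: "quat_j * (quat_j * q) = - q" for q by (simp flip: mult.assoc)
  have I: "I_sig p r * (I_sig p r * q) = q" for r q by (simp add: I_sig_square flip: mult.assoc)
  have j2: "quat_j * (I_sig p r * q) = I_sig p r * (quat_j * q)" for r q
    by (simp add: I_sig_square(2) flip: mult.assoc)
  have sq: "?A ** ?A = - mat 1"
    unfolding diag_monomial
    by (simp add: monomial_mult monomial_simps o_def I_sig_square(1,2) mult.assoc j j2 I)
  show ?thesis
  proof
    show "?A \<in> so_star form_diag"
      unfolding so_star_def diag_monomial form_diag_monomial
      by (simp add: monomial_adj monomial_mult monomial_simps o_def qconj_mult I_sig_square(3) mult.assoc j j2)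
    show "Dop (\<lambda>X. ?A *v X) 0 (Dop (\<lambda>X. ?A *v X) 0 X) = - 1 *\<^sub>R X" for X
      by (simp add: Dop_def matrix_vector_mul_assoc sq matrix_vector_real)
  qed simp
qed

lemma tau_model_paracomplex:
  assumes n: "CARD('n) = 2 * N"
  shows "tau_model (form_split N N) 0 (mat_from (diag_of (I_sig N)) :: ('n::finite) qmat) 1"
proof -
  have n': "CARD('n) = N + N" "N = N \<or> N = N + 1" using n by auto
  interpret split_size N N "CARD('n)" using n' by unfold_locales
  interpret form_model "form_split N N :: 'n qmat" by (rule form_model_split[OF n'])
  let ?A = "mat_from (diag_of (I_sig N)) :: 'n qmat"
  have sq: "?A ** ?A = mat 1"
    unfolding diag_monomial by (simp add: monomial_mult monomial_simps o_def I_sig_square(1))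
  have 1: "qconj (I_sig N r) * split_coeff N N r + split_coeff N N r * I_sig N (swap_ix N N r) = 0"
    if "r < CARD('n)" for r
    using that n by (auto simp: I_sig_def split_coeff_def swap_ix_def)
  show ?thesis
  proof
    show "?A \<in> so_star (form_split N N)"
    proof -
      have "qadj ?A ** form_split N N + form_split N N ** ?A
        = (monomial (swap_ix N N) (\<lambda>r. qconj (I_sig N r) * split_coeff N N r + split_coeff N N r * I_sig N (swap_ix N N r)) :: 'n qmat)"
        unfolding diag_monomial form_split_monomial[OF n']
        by (simp add: monomial_adj split_mult(1)[OF n'] monomial_mult o_def monomial_simps(1))
      also have "\<dots> = monomial (swap_ix N N) (\<lambda>r. 0)"
        by (rule monomial_cong) (simp_all add: 1)
      finally show ?thesis by (simp add: so_star_def monomial_simps(3))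
    qed
    show "Dop (\<lambda>X. ?A *v X) 0 (Dop (\<lambda>X. ?A *v X) 0 X) = 1 *\<^sub>R X" for X
      by (simp add: Dop_def matrix_vector_mul_assoc sq)
  qed simp
qed

context tau_model
begin

lemma tau_so_star_ext: "\<tau> \<in> so_star_ext J"
proof -
  have "\<tau> = block3 a (star_row 0 J) (of_real d) 0 A 0 (of_real 1) (- star_row 0 J) (- qconj a)"
    by (simp add: tau_mat_def star_row_linear qconj_imag[OF a_imag])
  then show ?thesis using A_so unfolding so_star_ext_def by blast
qed

lemma tau_m_centralizer: "tau_m J \<tau> \<subseteq> tau_centralizer J \<tau>"
proof
  fix x assume "x \<in> tau_m J \<tau>"
  then obtain X where X: "x = M X" by (auto simp: tau_m_range)
  have "M X = block3 0 (star_row (D X) J) (of_real 0) X 0 (D X) (of_real 0) (- star_row X J) (- qconj 0)"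
    by (simp add: M_eq)
  then have "M X \<in> so_star_ext J" using so_star_linear(3) unfolding so_star_ext_def by blast
  then show "x \<in> tau_centralizer J \<tau>" by (simp add: tau_centralizer_def X M_tau)
qed

end

text \<open>The families for even and odd n are merged: t = N is the first, t = N + 1 the
  second.\<close>

lemma listed_cases:
  assumes "(J, \<tau>) \<in> (listed :: (('n::finite) qmat \<times> 'n ext qmat) set)"
  obtains (nilp) N t p q where "CARD('n) = t + N" "t = N \<or> t = N + 1" "p + q \<le> N"
      "J = form_split N t" "\<tau> = tau_mat 0 (A_nilp N t p q) 0"
    | (rot) "J = form_diag" "\<tau> = tau_mat quat_i 0 (- 1)"
    | (complex) p where "p \<le> CARD('n)" "J = form_diag"
      "\<tau> = tau_mat 0 (mat_from (diag_of (\<lambda>r. quat_j * I_sig p r))) (- 1)"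
    | (paracomplex) N where "CARD('n) = 2 * N" "J = form_split N N" "\<tau> = tau_mat 0 (mat_from (diag_of (I_sig N))) 1"
proof -
  consider "(J, \<tau>) \<in> listed_i" | "(J, \<tau>) \<in> listed_ii" | "(J, \<tau>) \<in> listed_iii" | "(J, \<tau>) \<in> listed_iv" | "(J, \<tau>) \<in> listed_v"
    using assms by (auto simp: listed_def)
  then show thesis
  proof cases
    case 1
    then obtain N p q where "J = form_split N N" "\<tau> = tau_mat 0 (A_nilp N N p q) 0" "CARD('n) = 2 * N" "p + q \<le> N"
      by (auto simp: listed_i_def)
    then show ?thesis using nilp[of N N p q] by simp
  next
    case 2
    then obtain N p q where "J = form_split N (N + 1)" "\<tau> = tau_mat 0 (A_nilp N (N + 1) p q) 0"
      "CARD('n) = 2 * N + 1" "p + q \<le> N" by (auto simp: listed_ii_def)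
    then show ?thesis using nilp[of "N + 1" N p q] by simp
  next
    case 3
    then show ?thesis using rot by (simp add: listed_iii_def)
  next
    case 4
    then obtain p q where "J = form_diag" "\<tau> = tau_mat 0 (mat_from (diag_of (\<lambda>r. quat_j * I_sig p r))) (- 1)" "p + q = CARD('n)"
      by (auto simp: listed_iv_def)
    then show ?thesis using complex[of p] by simp
  next
    case 5
    then show ?thesis using paracomplex by (auto simp: listed_v_def)
  qed
qed

lemma listed_nilp:
  "CARD('n) = t + N \<Longrightarrow> t = N \<or> t = N + 1 \<Longrightarrow> p + q \<le> N \<Longrightarrow>
     (form_split N t, tau_mat 0 (A_nilp N t p q) 0) \<in> (listed :: (('n::finite) qmat \<times> 'n ext qmat) set)"
proof (elim disjE)
  assume a: "CARD('n) = t + N" "p + q \<le> N" "t = N"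
  then have "(form_split N t, tau_mat 0 (A_nilp N t p q) 0) \<in> (listed_i :: ('n qmat \<times> 'n ext qmat) set)"
    unfolding listed_i_def by (intro CollectI exI[of _ N] exI[of _ p] exI[of _ q]) simp
  then show ?thesis by (simp add: listed_def)
next
  assume a: "CARD('n) = t + N" "p + q \<le> N" "t = N + 1"
  then have "(form_split N t, tau_mat 0 (A_nilp N t p q) 0) \<in> (listed_ii :: ('n qmat \<times> 'n ext qmat) set)"
    unfolding listed_ii_def by (intro CollectI exI[of _ N] exI[of _ p] exI[of _ q]) simp
  then show ?thesis by (simp add: listed_def)
qed

lemma listed_others:
  "(form_diag, tau_mat quat_i 0 (- 1)) \<in> (listed :: (('n::finite) qmat \<times> 'n ext qmat) set)"
  "p + q = CARD('n) \<Longrightarrow> (form_diag, tau_mat 0 (mat_from (diag_of (\<lambda>r. quat_j * I_sig p r))) (- 1))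
     \<in> (listed :: ('n qmat \<times> 'n ext qmat) set)"
  "CARD('n) = 2 * N \<Longrightarrow> (form_split N N, tau_mat 0 (mat_from (diag_of (I_sig N))) 1)
     \<in> (listed :: ('n qmat \<times> 'n ext qmat) set)"
  unfolding listed_def listed_iii_def listed_iv_def listed_v_def by blast+

lemma listed_tau_model:
  assumes "(J, \<tau>) \<in> (listed :: (('n::finite) qmat \<times> 'n ext qmat) set)"
  obtains a A d where "\<tau> = tau_mat a A d" "tau_model J a A d"
  using assms
proof (cases rule: listed_cases)
  case (nilp N t p q)
  then show ?thesis using that tau_model_nilp by blast
next
  case rot
  then show ?thesis using that tau_model_rot by blast
next
  case (complex p)
  then show ?thesis using that tau_model_complex by blast
next
  case (paracomplex N)
  then show ?thesis using that tau_model_paracomplex by blast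
qed

section \<open>Similarities between models\<close>

text \<open>An isomorphism preserves the space of imaginary scalars but not its elements, hence the
  twist \<theta>; \<nu> accounts for the scale of the 2-form.\<close>

locale similarity = q1: qform act1 h1 + q2: qform act2 h2
  for act1 :: "'v::euclidean_space \<Rightarrow> quat \<Rightarrow> 'v" and h1
    and act2 :: "'w::euclidean_space \<Rightarrow> quat \<Rightarrow> 'w" and h2 +
  fixes \<psi> :: "'v \<Rightarrow> 'w" and \<theta> :: "quat \<Rightarrow> quat" and \<nu> :: real
  assumes lin: "linear \<psi>" and act: "\<psi> (act1 x q) = act2 (\<psi> x) (\<theta> q)"
    and form: "h2 (\<psi> x) (\<psi> y) = \<nu> *\<^sub>R \<theta> (h1 x y)" and re: "qre (\<theta> q) = qre q" and nu: "\<nu> \<noteq> 0"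
begin

text \<open>Every term of \<open>RD\<close> contains one h and one D, so the factors \<nu> and
  1/\<nu> cancel.\<close>

lemma RD_similarity:
  assumes D: "\<And>x. D2 (\<psi> x) = (1 / \<nu>) *\<^sub>R \<psi> (D1 x)"
  shows "\<psi> (q1.RD D1 x y z) = q2.RD D2 (\<psi> x) (\<psi> y) (\<psi> z)"
  unfolding q1.RD_def q2.RD_def D q1.act_diff_right q2.act_diff_right
  by (simp add: linear_add[OF lin] linear_diff[OF lin] linear_scale[OF lin] q2.h_scaleR form act re nu
      q2.act_scaleR_left q2.act_scaleR_right)

end

context qform
begin

lemma qform_scale: "0 < c \<Longrightarrow> qform (\<cdot>) (\<lambda>x y. c *\<^sub>R h x y)"
proof unfold_locales
  fix x y z :: 'a and p q and X :: 'a
  assume c: "0 < c"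
  show "c *\<^sub>R h (x + y) z = c *\<^sub>R h x z + c *\<^sub>R h y z" by (simp add: h_add_left scaleR_add_right)
  show "c *\<^sub>R h (x \<cdot> p) (y \<cdot> q) = qconj p * (c *\<^sub>R h x y) * q" by (simp add: h_act)
  show "c *\<^sub>R h x y = - qconj (c *\<^sub>R h y x)"
    by (subst h_skew) (simp add: quat_eq_iff qconj_simps)
  show "x = 0" if "\<And>y. c *\<^sub>R h x y = 0" using h_nondeg[of x] that c by simp
qed

lemma so_op_scale: "so_op A \<Longrightarrow> so_op (\<lambda>x. c *\<^sub>R A x)"
  unfolding so_op_def by (simp add: linear_compose_scale_right act_scaleR_left h_scaleR)

text \<open>The coordinate map of the realizing family is onto because the family spans; bijectivity
  follows by counting dimensions.\<close>

lemma realizes_imp_isometry: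
  fixes J M :: "('n::finite) qmat"
  assumes r: "realizes J M A v" and A: "so_op A" and dim: "DIM('a) = 4 * CARD('n::finite)"
  obtains \<psi> where "linear \<psi>" "bij \<psi>" "\<And>X q. \<psi> (rmult X q) = \<psi> X \<cdot> q"
    "\<And>X Y. h (\<psi> X) (\<psi> Y) = hform J X Y" "\<And>X. A (\<psi> X) = \<psi> (M *v X)"
proof
  define \<psi> where "\<psi> X = (\<Sum>i\<in>UNIV. v i \<cdot> X $ i)" for X
  have v: "h (v i) (v k) = J $ i $ k" "A (v k) = (\<Sum>i\<in>UNIV. v i \<cdot> M $ i $ k)"
    "span (\<Union>i. range (\<lambda>q. v i \<cdot> q)) = UNIV" for i k
    using r by (auto simp: realizes_def)
  show lin: "linear \<psi>"
    by (rule linearI) (simp_all add: \<psi>_def act_linear sum.distrib scaleR_sum_right)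
  have "v i \<cdot> q \<in> range \<psi>" for i q
  proof -
    have "\<psi> (axis i q) = (\<Sum>k\<in>UNIV. if k = i then v k \<cdot> q else 0)"
      unfolding \<psi>_def by (rule sum.cong) (simp_all add: axis_def)
    then have "\<psi> (axis i q) = v i \<cdot> q" by simp
    then show ?thesis by (metis rangeI)
  qed
  then have "span (\<Union>i. range (\<lambda>q. v i \<cdot> q)) \<subseteq> range \<psi>"
    by (intro span_minimal linear_subspace_image[OF lin subspace_UNIV]) auto
  then have surj: "surj \<psi>" using v(3) by auto
  moreover have "inj \<psi>"
    by (rule linear_surjective_imp_injective[OF lin surj]) (simp add: dim)
  ultimately show "bij \<psi>" by (simp add: bij_def)
  show "\<psi> (rmult X q) = \<psi> X \<cdot> q" for X q
    by (simp add: \<psi>_def rmult_def act_mult act_sum_left)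
  show "h (\<psi> X) (\<psi> Y) = hform J X Y" for X Y
  proof -
    have "h (\<psi> X) (\<psi> Y) = (\<Sum>i\<in>UNIV. \<Sum>k\<in>UNIV. qconj (X $ i) * J $ i $ k * Y $ k)"
      unfolding \<psi>_def h_sum by (subst sum.swap) (simp add: h_act v(1))
    also have "\<dots> = hform J X Y"
      unfolding hform_def star_row_def by (subst sum.swap) (simp add: sum_distrib_right)
    finally show ?thesis .
  qed
  have lA: "linear A" using A by (simp add: so_op_def)
  show "A (\<psi> X) = \<psi> (M *v X)" for X
  proof -
    have "A (\<psi> X) = (\<Sum>k\<in>UNIV. \<Sum>i\<in>UNIV. v i \<cdot> (M $ i $ k * X $ k))"
      unfolding \<psi>_def linear_sum[OF lA] by (simp add: so_op_linear[OF A] v(2) act_sum_left act_mult)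
    also have "\<dots> = (\<Sum>i\<in>UNIV. \<Sum>k\<in>UNIV. v i \<cdot> (M $ i $ k * X $ k))" by (rule sum.swap)
    also have "\<dots> = \<psi> (M *v X)"
      by (simp add: \<psi>_def matrix_vector_mult_def linear_sum[OF linear_act_right])
    finally show ?thesis .
  qed
qed

text \<open>For a = 0 the form is rescaled until A A is 0, 1 or -1 and a normal form applies. For A
  = 0 the imaginary a is rescaled to a unit and rotated to i, at the price of twisting the
  scalars.\<close>

theorem classification:
  assumes A: "so_op A" and a: "qre a = 0" and dim: "DIM('a) = 4 * CARD('n::finite)"
    and cases: "(\<forall>x. A x = 0) \<or> a = 0 \<and> (\<exists>d. \<forall>x. A (A x) = d *\<^sub>R x)"
  obtains J :: "('n::finite) qmat" and a' A' d' \<psi> \<theta> \<nu> where "(J, tau_mat a' A' d') \<in> listed" "tau_model J a' A' d'"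
    "linear \<psi>" "bij \<psi>" "0 < \<nu>" "\<And>X q. \<psi> (rmult X q) = \<psi> X \<cdot> \<theta> q" "\<And>q. qre (\<theta> q) = qre q" "surj \<theta>"
    "\<And>X Y. h (\<psi> X) (\<psi> Y) = \<nu> *\<^sub>R \<theta> (hform J X Y)"
    "\<And>X. A (\<psi> X) - \<psi> X \<cdot> a = (1 / \<nu>) *\<^sub>R \<psi> (A' *v X - rmult X a')"
proof -
  note l = so_op_linear[OF A] and thesisI = that
  \<comment> \<open>All cases with a = 0 conclude alike: a normal form for c h and A / c is a
    similarity of factor 1 / c for h and A.\<close>
  have skew: thesis
    if c: "c > 0" and a0: "a = 0" and m: "tau_model J 0 M d'" "(J, tau_mat 0 M d') \<in> listed"
      and r: "qform.realizes (\<cdot>) (\<lambda>x y. c *\<^sub>R h x y) J M (\<lambda>x. (1 / c) *\<^sub>R A x) v"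
    for c and J M :: "'n qmat" and d' v
  proof -
    interpret s: qform "(\<cdot>)" "\<lambda>x y. c *\<^sub>R h x y" by (rule qform_scale[OF c])
    have so: "s.so_op (\<lambda>x. (1 / c) *\<^sub>R A x)"
      using so_op_scale[OF A, of "1 / c"] c by (simp add: so_op_def s.so_op_def)
    obtain \<psi> where p: "linear \<psi>" "bij \<psi>" "\<And>X q. \<psi> (rmult X q) = \<psi> X \<cdot> q"
      "\<And>X Y. c *\<^sub>R h (\<psi> X) (\<psi> Y) = hform J X Y" "\<And>X. (1 / c) *\<^sub>R A (\<psi> X) = \<psi> (M *v X)"
      using s.realizes_imp_isometry[OF r so dim] by blast
    show thesis
    proof (rule thesisI[of J 0 M d' \<psi> "1 / c" "\<lambda>q. q"])
      show "h (\<psi> X) (\<psi> Y) = (1 / c) *\<^sub>R hform J X Y" for X Y using c by (simp flip: p(4))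
      show "A (\<psi> X) - \<psi> X \<cdot> a = (1 / (1 / c)) *\<^sub>R \<psi> (M *v X - rmult X 0)" for X
        using c by (simp add: a0 flip: p(5))
    qed (use m p(1-3) c in auto)
  qed
  show thesis
  proof (cases "a = 0")
    case True
    then obtain d where d: "\<And>x. A (A x) = d *\<^sub>R x" using cases l(6) by (metis scaleR_zero_left)
    have so: "qform.so_op (\<cdot>) (\<lambda>x y. c *\<^sub>R h x y) (\<lambda>x. (1 / c) *\<^sub>R A x)" if c: "c > 0" for c
    proof -
      interpret s: qform "(\<cdot>)" "\<lambda>x y. c *\<^sub>R h x y" by (rule qform_scale[OF c])
      show ?thesis using so_op_scale[OF A, of "1 / c"] c by (simp add: so_op_def s.so_op_def)
    qed
    \<comment> \<open>The square is divided by the square of c, so c is the square root of the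
      absolute value of d unless d = 0.\<close>
    have sq: "(1 / c) *\<^sub>R A ((1 / c) *\<^sub>R A x) = (d / (c * c)) *\<^sub>R x" for c x by (simp add: l d)
    consider "d = 0" | "d > 0" | "d < 0" by linarith
    then show thesis
    proof cases
      case 1
      define c :: real where "c = 1"
      have c: "c > 0" by (simp add: c_def)
      interpret s: qform "(\<cdot>)" "\<lambda>x y. c *\<^sub>R h x y" by (rule qform_scale[OF c])
      have sq': "(1 / c) *\<^sub>R A ((1 / c) *\<^sub>R A x) = 0" for x using sq[of c x] 1 by simp
      obtain N t p q v where n: "CARD('n) = t + N" "t = N \<or> t = N + 1" "p + q \<le> N"
        and r: "s.realizes (form_split N t :: 'n qmat) (A_nilp N t p q) (\<lambda>x. (1 / c) *\<^sub>R A x) v"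
        using s.normal_form_nilpotent[OF so[OF c] sq' dim] by blast
      show thesis
        by (rule skew[OF c True tau_model_nilp[OF n(1,2)] listed_nilp[OF n] r])
    next
      case 2
      define c where "c = sqrt d"
      have c: "c > 0" "d / (c * c) = 1" using 2 by (simp_all add: c_def)
      interpret s: qform "(\<cdot>)" "\<lambda>x y. c *\<^sub>R h x y" by (rule qform_scale[OF c(1)])
      have sq': "(1 / c) *\<^sub>R A ((1 / c) *\<^sub>R A x) = x" for x using sq[of c x] c(2) by simp
      obtain N v where n: "CARD('n) = 2 * N"
        and r: "s.realizes (form_split N N :: 'n qmat) (mat_from (diag_of (I_sig N))) (\<lambda>x. (1 / c) *\<^sub>R A x) v"
        using s.normal_form_paracomplex[OF so[OF c(1)] sq' dim] by blast
      show thesis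
        by (rule skew[OF c(1) True tau_model_paracomplex[OF n] listed_others(3)[OF n] r])
    next
      case 3
      define c where "c = sqrt (- d)"
      have c: "c > 0" "d / (c * c) = - 1" using 3 by (simp_all add: c_def)
      interpret s: qform "(\<cdot>)" "\<lambda>x y. c *\<^sub>R h x y" by (rule qform_scale[OF c(1)])
      have sq': "(1 / c) *\<^sub>R A ((1 / c) *\<^sub>R A x) = - x" for x using sq[of c x] c(2) by simp
      obtain p q v where n: "p + q = CARD('n)"
        and r: "s.realizes (form_diag :: 'n qmat) (mat_from (diag_of (\<lambda>r. quat_j * I_sig p r))) (\<lambda>x. (1 / c) *\<^sub>R A x) v"
        using s.normal_form_complex[OF so[OF c(1)] sq' dim] by blast
      show thesis
        by (rule skew[OF c(1) True tau_model_complex listed_others(2)[OF n] r])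
    qed
  next
    case False
    then have A0: "A x = 0" for x using cases by blast
    define c where "c = sqrt (qnorm2 a)"
    have c: "c > 0" "c * c = qnorm2 a" using qnorm2_pos[OF False] by (simp_all add: c_def)
    define b where "b = (1 / c) *\<^sub>R a"
    have b: "qre b = 0" "b \<noteq> 0" "a = c *\<^sub>R b" "b * b = -1"
      using a False c(1) imag_square[OF a] qnorm2_pos[OF False] by (simp_all add: b_def of_real_def c(2))
    interpret s: qform "(\<cdot>)" "\<lambda>x y. c *\<^sub>R h x y" by (rule qform_scale[OF c(1)])
    obtain v where r: "s.realizes (form_diag :: 'n qmat) 0 (\<lambda>_. 0) v"
      using s.normal_form_zero[OF dim] by blast
    have so0: "s.so_op (\<lambda>_. 0)" by (simp add: s.so_op_def linear_zero)
    obtain \<psi> where p: "linear \<psi>" "bij \<psi>" "\<And>X q. \<psi> (rmult X q) = \<psi> X \<cdot> q"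
      "\<And>X Y. c *\<^sub>R h (\<psi> X) (\<psi> Y) = hform (form_diag :: 'n qmat) X Y" "\<And>X. (0 :: 'a) = \<psi> ((0 :: 'n qmat) *v X)"
      by (rule s.realizes_imp_isometry[OF r so0 dim]) (rule that, assumption+)
    obtain u where u: "qconj u * b * u = quat_i" "u \<noteq> 0"
      using imag_conjugate[OF b(1,2), of quat_i] by auto
    \<comment> \<open>Squaring the relation between b and i compares -1 with -1 times the squared
      \<open>qnorm2 u\<close>, so u is a unit quaternion.\<close>
    have "quat_i * quat_i = qconj u * b * (u * qconj u) * b * u" by (simp add: mult.assoc flip: u(1))
    also have "\<dots> = (qnorm2 u * qnorm2 u) *\<^sub>R (b * b)"
    proof -
      have "qconj u * b * (u * qconj u) * b * u = qnorm2 u *\<^sub>R (qconj u * (b * b) * u)"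
        by (simp add: qconj_mult_self of_real_def mult.assoc)
      also have "\<dots> = - (qnorm2 u *\<^sub>R (qconj u * u))" by (simp add: b(4))
      also have "\<dots> = (qnorm2 u * qnorm2 u) *\<^sub>R (b * b)" by (simp add: b(4) qconj_mult_self of_real_def)
      finally show ?thesis .
    qed
    finally have "(qnorm2 u * qnorm2 u) *\<^sub>R (1::quat) = 1" by (simp add: b(4))
    then have "qnorm2 u * qnorm2 u = 1" by (simp add: quat_eq_iff)
    then have "qnorm2 u = 1" using qnorm2_nonneg[of u] by (metis abs_of_nonneg abs_square_eq_1 power2_eq_square)
    then have uu: "u * qconj u = 1" "qconj u * u = 1" by (simp_all add: qconj_mult_self)
    have uu': "u * (qconj u * q) = q" "qconj u * (u * q) = q" for q
      by (simp_all add: uu flip: mult.assoc)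
    have "u * quat_i * qconj u = b"
      by (simp add: uu uu' mult.assoc flip: u(1))
    then have ui: "u * (quat_i * qconj u) = b" by (simp add: mult.assoc)
    \<comment> \<open>Multiplying by the conjugate of u carries right multiplication by i to right
      multiplication by b; scalars are conjugated by u accordingly.\<close>
    let ?\<psi> = "\<lambda>X. \<psi> X \<cdot> qconj u"
    show thesis
    proof (rule thesisI[of form_diag quat_i 0 "- 1" ?\<psi> "1 / c" "\<lambda>q. u * q * qconj u"])
      show "(form_diag, tau_mat quat_i 0 (- 1)) \<in> (listed :: ('n qmat \<times> 'n ext qmat) set)" by (rule listed_others(1))
      show "tau_model (form_diag :: 'n qmat) quat_i 0 (- 1)" by (rule tau_model_rot)
      show "linear ?\<psi>" using linear_compose[OF p(1) linear_act_left[of "qconj u"]] by (simp add: o_def)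
      have "bij (\<lambda>x. x \<cdot> qconj u)"
        by (rule o_bij[of "\<lambda>x. x \<cdot> u"]) (simp_all add: fun_eq_iff uu flip: act_mult)
      then show "bij ?\<psi>" using bij_comp[OF p(2)] by (simp add: o_def)
      show "?\<psi> (rmult X q) = ?\<psi> X \<cdot> (u * q * qconj u)" for X q
        by (simp add: p(3) uu' mult.assoc flip: act_mult)
      show "qre (u * q * qconj u) = qre q" for q
        using qre_mult_commute[of "u * q" "qconj u"] by (simp add: uu' mult.assoc)
      show "surj (\<lambda>q. u * q * qconj u)"
        by (rule surjI[of _ "\<lambda>q. qconj u * q * u"]) (simp add: uu' uu mult.assoc)
      show "h (?\<psi> X) (?\<psi> Y) = (1 / c) *\<^sub>R (u * hform form_diag X Y * qconj u)" for X Y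
        using c(1) by (simp add: h_act mult.assoc flip: p(4))
      show "A (?\<psi> X) - ?\<psi> X \<cdot> a = (1 / (1 / c)) *\<^sub>R ?\<psi> (0 *v X - rmult X quat_i)" for X
        by (simp add: A0 b(3) linear_neg[OF p(1)] p(3) act_linear uu' flip: act_mult ui)
    qed (use c in auto)
  qed
qed

end

section \<open>Signatures\<close>

definition sig_form :: "(nat \<Rightarrow> real) \<Rightarrow> quat ^ ('n::finite) \<Rightarrow> real" where
  "sig_form s X = (\<Sum>i\<in>UNIV. s (to_nat_on UNIV i) * qnorm2 (X $ i))"

lemma dim_coordinate_subspace:
  "dim {X :: quat ^ ('n::finite). \<forall>i. i \<notin> S \<longrightarrow> X $ i = 0} = 4 * card S"
proof -
  define B where "B = (\<lambda>(i, b). axis i b :: quat ^ 'n) ` (S \<times> Basis)"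
  have BB: "B \<subseteq> Basis" by (auto simp: B_def Basis_vec_def)
  have "inj_on (\<lambda>(i, b). axis i b :: quat ^ 'n) (S \<times> Basis)"
    by (auto simp: inj_on_def axis_eq_axis nonzero_Basis)
  then have "card B = 4 * card S" by (simp add: B_def card_image card_cartesian_product)
  moreover have "{X :: quat ^ 'n. \<forall>i. i \<notin> S \<longrightarrow> X $ i = 0} = {X. \<forall>i\<in>Basis. i \<notin> B \<longrightarrow> X \<bullet> i = 0}"
  proof (intro equalityI subsetI CollectI ballI impI allI)
    fix X :: "quat ^ 'n" and e assume X: "X \<in> {X. \<forall>i. i \<notin> S \<longrightarrow> X $ i = 0}" and e: "e \<in> Basis" "e \<notin> B"
    obtain i b where ib: "e = axis i b" "b \<in> Basis" using e(1) by (auto simp: Basis_vec_def)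
    then have "i \<notin> S" using e(2) by (auto simp: B_def)
    then show "X \<bullet> e = 0" using X by (simp add: ib inner_axis)
  next
    fix X :: "quat ^ 'n" and i assume X: "X \<in> {X. \<forall>i\<in>Basis. i \<notin> B \<longrightarrow> X \<bullet> i = 0}" and i: "i \<notin> S"
    have "X $ i \<bullet> b = 0" if b: "b \<in> Basis" for b
    proof -
      have "axis i b \<notin> B" using i nonzero_Basis[OF b] by (auto simp: B_def axis_eq_axis)
      moreover have "axis i b \<in> (Basis :: (quat ^ 'n) set)" using b by (auto simp: Basis_vec_def)
      ultimately show ?thesis using X by (auto simp flip: inner_axis)
    qed
    then show "X $ i = 0" by (simp add: euclidean_eq_iff[of "X $ i" 0])
  qed
  ultimately show ?thesis using dim_substandard[OF BB] by simp
qed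

text \<open>Sylvester's law of inertia. Coordinates positive for s1 span a subspace that injects
  into those positive for s2: a vector in the kernel of the projection would have form value both
  nonnegative and nonpositive, hence vanish.\<close>

lemma signature_le:
  fixes \<psi> :: "quat ^ ('n::finite) \<Rightarrow> quat ^ 'n"
  assumes lin: "linear \<psi>" and inv: "\<And>X. sig_form s2 (\<psi> X) = sig_form s1 X"
  shows "card {r. r < CARD('n) \<and> s1 r > 0} \<le> card {r. r < CARD('n) \<and> s2 r > 0}"
proof -
  define S where "S s = {i :: 'n. s (to_nat_on UNIV i) > (0::real)}" for s
  have card: "card (S s) = card {r. r < CARD('n) \<and> s r > 0}" for s
  proof (rule bij_betw_same_card[of "to_nat_on UNIV"])
    show "bij_betw (to_nat_on UNIV) (S s) {r. r < CARD('n) \<and> s r > 0}"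
      unfolding bij_betw_def
    proof
      show "inj_on (to_nat_on UNIV) (S s)" by (simp add: inj_on_def)
      show "to_nat_on UNIV ` S s = {r. r < CARD('n) \<and> s r > 0}"
        by (auto simp: S_def) (metis (mono_tags, lifting) image_eqI mem_Collect_eq to_nat_on_ex)
    qed
  qed
  define P where "P s = {X :: quat ^ 'n. \<forall>i. i \<notin> S s \<longrightarrow> X $ i = 0}" for s
  define \<pi> where "\<pi> s X = (\<chi> i. if i \<in> S s then X $ i else (0 :: quat))" for s and X :: "quat ^ 'n"
  have lp: "linear (\<pi> s)" for s by (rule linearI) (simp_all add: \<pi>_def vec_eq_iff)
  have sub: "subspace (P s)" for s by (auto simp: P_def subspace_def)
  have lin': "linear (\<lambda>X. \<pi> s2 (\<psi> X))" using linear_compose[OF lin lp] by (simp add: o_def)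
  have zero: "X = 0" if X: "X \<in> P s1" and 0: "\<pi> s2 (\<psi> X) = 0" for X
  proof -
    have "\<psi> X $ i = 0" if "i \<in> S s2" for i
      using arg_cong[OF 0, of "\<lambda>Y. Y $ i"] that by (simp add: \<pi>_def)
    then have "s2 (to_nat_on UNIV i) * qnorm2 (\<psi> X $ i) \<le> 0" for i
      using qnorm2_nonneg[of "\<psi> X $ i"] by (cases "i \<in> S s2") (auto simp: S_def qnorm2_def not_less mult_nonpos_nonneg)
    then have "sig_form s2 (\<psi> X) \<le> 0" unfolding sig_form_def by (intro sum_nonpos) simp
    then have le: "sig_form s1 X \<le> 0" by (simp add: inv)
    have nn: "0 \<le> s1 (to_nat_on UNIV i) * qnorm2 (X $ i)" for i
      using X qnorm2_nonneg[of "X $ i"] by (cases "i \<in> S s1") (auto simp: P_def S_def qnorm2_def)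
    then have "sig_form s1 X = 0" using le unfolding sig_form_def by (meson antisym sum_nonneg)
    then have "s1 (to_nat_on UNIV i) * qnorm2 (X $ i) = 0" for i
      using nn unfolding sig_form_def by (simp add: sum_nonneg_eq_0_iff)
    then have "X $ i = 0" for i
      using X qnorm2_pos[of "X $ i"] by (cases "i \<in> S s1") (auto simp: P_def S_def, metis less_irrefl)
    then show "X = 0" by (simp add: vec_eq_iff)
  qed
  have "inj_on (\<lambda>X. \<pi> s2 (\<psi> X)) (span (P s1))"
    using zero sub by (simp add: linear_inj_on_iff_eq_0[OF lin' sub] span_eq_iff[THEN iffD2])
  then have "dim (P s1) = dim ((\<lambda>X. \<pi> s2 (\<psi> X)) ` P s1)" using dim_image_eq[OF lin'] by simp
  also have "\<dots> \<le> dim (P s2)" by (rule dim_subset) (auto simp: \<pi>_def P_def)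
  finally have "4 * card (S s1) \<le> 4 * card (S s2)" unfolding P_def dim_coordinate_subspace .
  then show ?thesis by (simp add: card)
qed

lemma signature_eq:
  fixes \<psi> :: "quat ^ ('n::finite) \<Rightarrow> quat ^ 'n"
  assumes lin: "linear \<psi>" and bij: "bij \<psi>" and inv: "\<And>X. sig_form s2 (\<psi> X) = sig_form s1 X"
  shows "card {r. r < CARD('n) \<and> s1 r > 0} = card {r. r < CARD('n) \<and> s2 r > 0}"
    and "card {r. r < CARD('n) \<and> s1 r < 0} = card {r. r < CARD('n) \<and> s2 r < 0}"
proof -
  have lin': "linear (inv \<psi>)" using lin bij by (simp add: bij_def inj_linear_imp_inv_linear)
  have inv': "sig_form s1 (inv \<psi> X) = sig_form s2 X" for X
    using inv[of "inv \<psi> X"] bij by (simp add: bij_def surj_f_inv_f)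
  have neg: "sig_form (\<lambda>r. - s r) X = - sig_form s X" for s and X :: "quat ^ 'n"
    by (simp add: sig_form_def sum_negf)
  show "card {r. r < CARD('n) \<and> s1 r > 0} = card {r. r < CARD('n) \<and> s2 r > 0}"
    using signature_le[OF lin inv] signature_le[OF lin' inv'] by simp
  have "sig_form (\<lambda>r. - s2 r) (\<psi> X) = sig_form (\<lambda>r. - s1 r) X"
    "sig_form (\<lambda>r. - s1 r) (inv \<psi> X) = sig_form (\<lambda>r. - s2 r) X" for X
    by (simp_all add: neg inv inv')
  from signature_le[OF lin this(1)] signature_le[OF lin' this(2)]
  show "card {r. r < CARD('n) \<and> s1 r < 0} = card {r. r < CARD('n) \<and> s2 r < 0}" by simp
qed

section \<open>Coordinates on the odd part\<close>

lemma qre_mult_ext: "(\<And>w. qre (p * w) = qre (q * w)) \<Longrightarrow> p = q"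
proof -
  assume 1: "\<And>w. qre (p * w) = qre (q * w)"
  show "p = q"
    using 1[of 1] 1[of "Quat 0 1 0 0"] 1[of "Quat 0 0 1 0"] 1[of "Quat 0 0 0 1"]
    by (simp add: quat_eq_iff quat_sel_mult)
qed

text \<open>Coordinates on m in which the quaternionic structure becomes a right action and the
  2-form becomes -2 Re h, the normalization produced by the matrix model. The action is a choice:
  the structure determines only the space of its imaginary scalars.\<close>

locale qsH_coordinates = qform act h
  for act :: "'v::euclidean_space \<Rightarrow> quat \<Rightarrow> 'v" (infixl "\<cdot>" 72) and h +
  fixes L :: "'g::real_vector qsH_data" and \<Psi> :: "'v \<Rightarrow> 'g"
  assumes linear: "linear \<Psi>" and inj: "inj \<Psi>" and range: "range \<Psi> = m_part L"
    and qstr: "qstr L = {\<lambda>x\<in>m_part L. \<Psi> (inv \<Psi> x \<cdot> q) | q. qre q = 0}"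
    and sform: "sform L (\<Psi> x) (\<Psi> y) = - 2 * qre (h x y)"
    and trip_range: "trip L (\<Psi> x) (\<Psi> y) (\<Psi> z) \<in> range \<Psi>"
begin

lemma in_m [simp]: "\<Psi> x \<in> m_part L"
  using range by blast

lemma inv_\<Psi> [simp]: "inv \<Psi> (\<Psi> x) = x"
  using inj by simp

lemma \<Psi>_inv: "x \<in> m_part L \<Longrightarrow> \<Psi> (inv \<Psi> x) = x"
  using range by (metis f_inv_into_f)

definition R :: "'v \<Rightarrow> 'v \<Rightarrow> 'v \<Rightarrow> 'v" where
  "R x y z = inv \<Psi> (trip L (\<Psi> x) (\<Psi> y) (\<Psi> z))"

lemma trip_\<Psi>: "trip L (\<Psi> x) (\<Psi> y) (\<Psi> z) = \<Psi> (R x y z)"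
  unfolding R_def using trip_range by (simp add: f_inv_into_f)

lemma qstr_\<Psi>: "J \<in> qstr L \<Longrightarrow> \<exists>q. qre q = 0 \<and> (\<forall>x. J (\<Psi> x) = \<Psi> (x \<cdot> q))"
  "qre q = 0 \<Longrightarrow> (\<lambda>x\<in>m_part L. \<Psi> (inv \<Psi> x \<cdot> q)) \<in> qstr L"
  unfolding qstr by auto

end

theorem similarity_imp_miso:
  assumes c1: "qsH_coordinates act1 h1 L1 \<Psi>1" and c2: "qsH_coordinates act2 h2 L2 \<Psi>2"
    and s: "similarity act1 h1 act2 h2 \<psi> \<theta> (exp (2 * t))" and bij: "bij \<psi>" and surj: "surj \<theta>"
    and R: "\<And>x y z. \<psi> (qsH_coordinates.R L1 \<Psi>1 x y z) = qsH_coordinates.R L2 \<Psi>2 (\<psi> x) (\<psi> y) (\<psi> z)"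
  shows "miso (rescale t L1) L2 (\<lambda>x. \<Psi>2 (\<psi> (inv \<Psi>1 x)))"
proof -
  interpret c1: qsH_coordinates act1 h1 L1 \<Psi>1 by (rule c1)
  interpret c2: qsH_coordinates act2 h2 L2 \<Psi>2 by (rule c2)
  interpret similarity act1 h1 act2 h2 \<psi> \<theta> "exp (2 * t)" by (rule s)
  let ?g = "\<lambda>x. \<Psi>2 (\<psi> (inv \<Psi>1 x))"
  have m1: "\<exists>X. x = \<Psi>1 X" if "x \<in> m_part L1" for x using c1.\<Psi>_inv[OF that] by metis
  have m2: "\<exists>X. y = ?g (\<Psi>1 X)" if "y \<in> m_part L2" for y
    using c2.\<Psi>_inv[OF that] bij by (metis bij_inv_eq_iff c1.inv_\<Psi>)
  have l1: "inv \<Psi>1 (x + y) = inv \<Psi>1 x + inv \<Psi>1 y" "inv \<Psi>1 (r *\<^sub>R x) = r *\<^sub>R inv \<Psi>1 x"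
    if "x \<in> m_part L1" "y \<in> m_part L1" for x y r
    using m1[OF that(1)] m1[OF that(2)]
    by (auto simp flip: linear_add[OF c1.linear] linear_scale[OF c1.linear])
  show ?thesis
    unfolding miso_def rescale_simps
  proof (intro conjI ballI)
    show "bij_betw ?g (m_part L1) (m_part L2)"
      unfolding bij_betw_def
    proof
      have "inj \<psi>" using bij by (simp add: bij_def)
      then show "inj_on ?g (m_part L1)"
        by (intro inj_onI) (metis c1.\<Psi>_inv c2.inv_\<Psi> injD)
      have "y \<in> ?g ` m_part L1" if "y \<in> m_part L2" for y
        using m2[OF that] imageI[OF c1.in_m, of ?g] by metis
      then show "?g ` m_part L1 = m_part L2" by auto
    qed
    show "linear_map_on (m_part L1) ?g"
      unfolding linear_map_on_def
      by (simp add: l1 linear_add[OF lin] linear_scale[OF lin] linear_add[OF c2.linear] linear_scale[OF c2.linear])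
    show "?g (trip L1 x y z) = trip L2 (?g x) (?g y) (?g z)"
      if "x \<in> m_part L1" "y \<in> m_part L1" "z \<in> m_part L1" for x y z
      using m1[OF that(1)] m1[OF that(2)] m1[OF that(3)] by (auto simp: c1.trip_\<Psi> c2.trip_\<Psi> R)
    show "\<exists>J'\<in>qstr L2. \<forall>x\<in>m_part L1. ?g (J x) = J' (?g x)" if J: "J \<in> qstr L1" for J
    proof -
      obtain q where q: "qre q = 0" "\<And>x. J (\<Psi>1 x) = \<Psi>1 (act1 x q)" using c1.qstr_\<Psi>(1)[OF J] by blast
      have "?g (J x) = (\<lambda>x\<in>m_part L2. \<Psi>2 (act2 (inv \<Psi>2 x) (\<theta> q))) (?g x)" if "x \<in> m_part L1" for x
        using m1[OF that] by (auto simp: q act)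
      moreover have "qre (\<theta> q) = 0" using q(1) re by simp
      ultimately show ?thesis using c2.qstr_\<Psi>(2)[of "\<theta> q"] by blast
    qed
    show "\<exists>J\<in>qstr L1. \<forall>x\<in>m_part L1. ?g (J x) = J' (?g x)" if J': "J' \<in> qstr L2" for J'
    proof -
      obtain q' where q': "qre q' = 0" "\<And>x. J' (\<Psi>2 x) = \<Psi>2 (act2 x q')" using c2.qstr_\<Psi>(1)[OF J'] by blast
      obtain q where q: "\<theta> q = q'" using surj by (metis surj_def)
      then have "qre q = 0" using q'(1) re by metis
      moreover have "?g ((\<lambda>x\<in>m_part L1. \<Psi>1 (act1 (inv \<Psi>1 x) q)) x) = J' (?g x)" if "x \<in> m_part L1" for x
        using m1[OF that] by (auto simp: q q' act)
      ultimately show ?thesis using c1.qstr_\<Psi>(2)[of q] by blast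
    qed
    show "sform L2 (?g x) (?g y) = exp (2 * t) * sform L1 x y" if "x \<in> m_part L1" "y \<in> m_part L1" for x y
      using m1[OF that(1)] m1[OF that(2)] by (auto simp: c1.sform c2.sform form re)
  qed
qed

text \<open>The twist \<theta> is read off from the correspondence of the quaternionic structures;
  real parts of h are known from the 2-form, and multiplicativity of \<theta> promotes them to all
  of h.\<close>

theorem miso_imp_similarity:
  assumes c1: "qsH_coordinates act1 h1 L1 \<Psi>1" and c2: "qsH_coordinates act2 h2 L2 \<Psi>2"
    and iso: "miso L1 (rescale t L2) g"
  obtains \<psi> \<theta> where "similarity act1 h1 act2 h2 \<psi> \<theta> (exp (- 2 * t))" "bij \<psi>" "surj \<theta>"
    "\<And>x y z. \<psi> (qsH_coordinates.R L1 \<Psi>1 x y z) = qsH_coordinates.R L2 \<Psi>2 (\<psi> x) (\<psi> y) (\<psi> z)"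
proof -
  interpret c1: qsH_coordinates act1 h1 L1 \<Psi>1 by (rule c1)
  interpret c2: qsH_coordinates act2 h2 L2 \<Psi>2 by (rule c2)
  note d = misoD[OF iso, unfolded rescale_simps]
  define \<psi> where "\<psi> x = inv \<Psi>2 (g (\<Psi>1 x))" for x
  have g: "g (\<Psi>1 x) = \<Psi>2 (\<psi> x)" for x
    unfolding \<psi>_def by (rule c2.\<Psi>_inv[symmetric]) (simp add: d(7))
  have eqI: "x = y" if "\<Psi>2 x = \<Psi>2 y" for x y using that c2.inj by (rule injD[rotated])
  have lin: "linear \<psi>"
  proof (rule linearI)
    have lm: "x \<in> m_part L1 \<Longrightarrow> y \<in> m_part L1 \<Longrightarrow> g (x + y) = g x + g y"
      "x \<in> m_part L1 \<Longrightarrow> g (r *\<^sub>R x) = r *\<^sub>R g x" for x y r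
      using d(2) by (auto simp: linear_map_on_def)
    show "\<psi> (x + y) = \<psi> x + \<psi> y" "\<psi> (r *\<^sub>R x) = r *\<^sub>R \<psi> x" for x y r
      by (rule eqI, simp add: linear_add[OF c1.linear] linear_scale[OF c1.linear]
          linear_add[OF c2.linear] linear_scale[OF c2.linear] lm flip: g)+
  qed
  have bij: "bij \<psi>"
    unfolding bij_def
  proof
    have "inj_on g (m_part L1)" using d(1) by (simp add: bij_betw_def)
    then show "inj \<psi>" by (intro injI) (metis g c1.in_m c1.inv_\<Psi> inj_onD)
    have "\<exists>x. \<psi> x = y" for y
    proof -
      have "\<Psi>2 y \<in> g ` m_part L1" using d(1) by (simp add: bij_betw_def)
      then obtain x where "x \<in> m_part L1" "\<Psi>2 y = g x" by blast
      then show ?thesis by (metis g c1.\<Psi>_inv c2.inv_\<Psi>)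
    qed
    then show "surj \<psi>" by (metis surj_def)
  qed
  have split: "q = of_real (qre q) + (q - of_real (qre q))" "qre (q - of_real (qre q)) = 0" for q :: quat
    by (simp_all add: quat_eq_iff of_real_def)
  \<comment> \<open>Only imaginary scalars belong to the structure; the real part of q is treated by
    linearity.\<close>
  have "\<exists>q'. qre q' = qre q \<and> (\<forall>x. \<psi> (act1 x q) = act2 (\<psi> x) q')" for q
  proof -
    define p where "p = q - of_real (qre q)"
    have p: "qre p = 0" "q = of_real (qre q) + p" using split by (auto simp: p_def)
    obtain J' where J': "J' \<in> qstr L2" "\<And>x. x \<in> m_part L1 \<Longrightarrow> g ((\<lambda>x\<in>m_part L1. \<Psi>1 (act1 (inv \<Psi>1 x) p)) x) = J' (g x)"
      using d(4)[OF c1.qstr_\<Psi>(2)[OF p(1)]] by blast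
    obtain p' where p': "qre p' = 0" "\<And>x. J' (\<Psi>2 x) = \<Psi>2 (act2 x p')" using c2.qstr_\<Psi>(1)[OF J'(1)] by blast
    have "\<psi> (act1 x p) = act2 (\<psi> x) p'" for x
      using J'(2)[OF c1.in_m, of x] by (intro eqI) (simp add: p' g)
    then have "\<psi> (act1 x (of_real (qre q) + p)) = act2 (\<psi> x) (of_real (qre q) + p')" for x
      by (simp add: c1.act_add_right c2.act_add_right c1.act_of_real c2.act_of_real linear_add[OF lin] linear_scale[OF lin])
    then show ?thesis using p(2) p'(1) by (intro exI[of _ "of_real (qre q) + p'"]) (simp add: of_real_def)
  qed
  then obtain \<theta> where \<theta>: "\<And>q. qre (\<theta> q) = qre q" "\<And>x q. \<psi> (act1 x q) = act2 (\<psi> x) (\<theta> q)" by metis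
  have "\<exists>y0 :: 'c. y0 \<noteq> 0" by (rule c2.exists_nonzero) simp
  then obtain y0 :: 'c where y0: "y0 \<noteq> 0" by blast
  have cancel: "p = q" if "\<And>x. act2 (\<psi> x) p = act2 (\<psi> x) q" for p q
  proof -
    obtain x where "\<psi> x = y0" using bij by (metis bij_pointE)
    then have "act2 y0 (p - q) = 0" using that[of x] by (simp add: c2.act_diff_right)
    then show ?thesis using y0 by (simp add: c2.act_eq_0_iff)
  qed
  have surj: "surj \<theta>"
  proof -
    have "\<exists>q. \<theta> q = q'" for q'
    proof -
      define p' where "p' = q' - of_real (qre q')"
      have p': "qre p' = 0" "q' = of_real (qre q') + p'" using split by (auto simp: p'_def)
      obtain J where J: "J \<in> qstr L1" "\<And>x. x \<in> m_part L1 \<Longrightarrow> g (J x) = (\<lambda>x\<in>m_part L2. \<Psi>2 (act2 (inv \<Psi>2 x) p')) (g x)"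
        using d(5)[OF c2.qstr_\<Psi>(2)[OF p'(1)]] by blast
      obtain p where p: "qre p = 0" "\<And>x. J (\<Psi>1 x) = \<Psi>1 (act1 x p)" using c1.qstr_\<Psi>(1)[OF J(1)] by blast
      have "\<psi> (act1 x p) = act2 (\<psi> x) p'" for x
        using J(2)[OF c1.in_m, of x] by (intro eqI) (simp add: p g)
      then have "\<psi> (act1 x (of_real (qre q') + p)) = act2 (\<psi> x) (of_real (qre q') + p')" for x
        by (simp add: c1.act_add_right c2.act_add_right c1.act_of_real c2.act_of_real linear_add[OF lin] linear_scale[OF lin])
      then have "\<theta> (of_real (qre q') + p) = q'" using p'(2) by (intro cancel) (simp flip: \<theta>(2))
      then show ?thesis ..
    qed
    then show ?thesis by (metis surj_def)
  qed
  \<comment> \<open>Scalars are determined by their action on a nonzero vector, so compatibility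
    with composition makes \<theta> multiplicative.\<close>
  have mult: "\<theta> (p * q) = \<theta> p * \<theta> q" for p q
    by (rule cancel) (simp add: c2.act_mult c1.act_mult flip: \<theta>(2))
  have re: "qre (h2 (\<psi> x) (\<psi> y)) = exp (- 2 * t) * qre (h1 x y)" for x y
  proof -
    have "exp (2 * t) * qre (h2 (\<psi> x) (\<psi> y)) = qre (h1 x y)"
      using d(6)[OF c1.in_m c1.in_m, of x y] by (simp add: g c1.sform c2.sform)
    then show ?thesis by (simp add: exp_minus field_simps)
  qed
  \<comment> \<open>Any w is a value of \<theta>, so multiplying by w can be absorbed into the
    second argument, where the real-part identity applies.\<close>
  have form: "h2 (\<psi> x) (\<psi> y) = exp (- 2 * t) *\<^sub>R \<theta> (h1 x y)" for x y
  proof (rule qre_mult_ext)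
    fix w
    obtain q where q: "w = \<theta> q" using surj by (metis surj_def)
    have "qre (h2 (\<psi> x) (\<psi> y) * w) = qre (h2 (\<psi> x) (\<psi> (act1 y q)))"
      by (simp add: q \<theta>(2) c2.h_act_right)
    also have "\<dots> = exp (- 2 * t) * qre (\<theta> (h1 x y * q))" unfolding re by (simp add: c1.h_act_right \<theta>(1))
    also have "\<dots> = qre (exp (- 2 * t) *\<^sub>R \<theta> (h1 x y) * w)" by (simp add: mult q)
    finally show "qre (h2 (\<psi> x) (\<psi> y) * w) = qre (exp (- 2 * t) *\<^sub>R \<theta> (h1 x y) * w)" .
  qed
  show thesis
  proof (rule that)
    show "similarity act1 h1 act2 h2 \<psi> \<theta> (exp (- 2 * t))"
      by (intro similarity.intro similarity_axioms.intro c1.qform_axioms c2.qform_axioms)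
        (use lin form \<theta> in simp_all)
    show "\<psi> (c1.R x y z) = c2.R (\<psi> x) (\<psi> y) (\<psi> z)" for x y z
      using d(3)[OF c1.in_m c1.in_m c1.in_m, of x y z]
      by (intro eqI) (simp add: c1.trip_\<Psi> c2.trip_\<Psi> g flip: c2.trip_\<Psi>)
  qed (fact bij surj)+
qed

context tau_model
begin

lemma coordinates_T: "qsH_coordinates rmult hf T M"
proof unfold_locales
  have iM: "inv M (M X) = X" for X by (simp add: inj_M)
  show "qstr T = {\<lambda>x\<in>m_part T. M (rmult (inv M x) q) | q. qre q = 0}"
  proof -
    have "(\<lambda>N\<in>mm. M (rmult (first_col N) q)) = (\<lambda>N\<in>mm. M (rmult (inv M N) q))" for q
      by (rule restrict_ext) (auto simp: tau_m_range iM)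
    then show ?thesis by (simp add: qstr_T m_part_T)
  qed
qed (simp_all add: linear_add[OF linear_M] linear_scale[OF linear_M] inj_M m_part_T tau_m_range sform_M trip_T)

lemma R_T: "qsH_coordinates.R T M x y z = RD D x y z"
proof -
  interpret c: qsH_coordinates rmult hf T M by (rule coordinates_T)
  show ?thesis by (simp add: c.R_def trip_T)
qed

end

theorem qsH_coordinates_exist:
  fixes L :: "'g::real_vector qsH_data"
  assumes L: "qsH_tila CARD('n::finite) L"
  obtains \<Psi> :: "quat ^ 'n \<Rightarrow> 'g" and act h where "qsH_coordinates act h L \<Psi>"
proof -
  interpret tila_loc L using qsH_tilaD(1)[OF L] by unfold_locales
  note d = qsH_tilaD[OF L]
  obtain B where B: "B \<subseteq> m" "independent B" "m \<subseteq> span B" "card B = dim m"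
    using basis_exists by blast
  have fin: "finite B" using B(4) d(2) by (intro card_ge_0_finite) simp
  obtain \<beta> where \<beta>: "bij_betw \<beta> (Basis :: (quat ^ 'n) set) B"
    using finite_same_card_bij[OF finite_Basis[where 'a = "quat ^ 'n"] fin] B(4) d(2) by auto
  obtain \<Psi> where \<Psi>: "linear \<Psi>" "\<And>b. b \<in> Basis \<Longrightarrow> \<Psi> b = \<beta> b"
    using linear_independent_extend[OF independent_Basis, of \<beta>] by blast
  have im: "\<Psi> ` Basis = B" using \<Psi>(2) \<beta> by (auto simp: bij_betw_def)
  have "inj_on \<Psi> (span Basis)"
  proof (rule linear_inj_on_span_independent_image[OF \<Psi>(1)])
    show "independent (\<Psi> ` Basis)" using B(2) im by simp
    show "inj_on \<Psi> Basis" using \<beta> \<Psi>(2) by (simp add: bij_betw_def inj_on_def)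
  qed
  then have inj: "inj \<Psi>" by simp
  have "range \<Psi> = span B" using linear_span_image[OF \<Psi>(1), of Basis] im by simp
  also have "\<dots> = m" using B(1,3) span_minimal[OF B(1) subm] by blast
  finally have range: "range \<Psi> = m" .
  have in_m [simp]: "\<Psi> x \<in> m" for x using range by blast
  define \<iota> where "\<iota> = inv \<Psi>"
  have \<iota> [simp]: "\<iota> (\<Psi> x) = x" for x using inj by (simp add: \<iota>_def)
  have \<Psi>\<iota>: "\<Psi> (\<iota> x) = x" if "x \<in> m" for x using that range by (metis \<iota>_def f_inv_into_f)
  have eqI: "x = y" if "\<Psi> x = \<Psi> y" for x y using that inj by (rule injD[rotated])
  note lin\<Psi> = linear_add[OF \<Psi>(1)] linear_scale[OF \<Psi>(1)] linear_neg[OF \<Psi>(1)]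
  obtain J1 J2 J3 where E: "J1 \<in> End_on m" "J2 \<in> End_on m" "J3 \<in> End_on m"
    and J: "\<forall>x\<in>m. J1 (J1 x) = - x \<and> J2 (J2 x) = - x \<and> J3 (J3 x) = - x"
      "\<forall>x\<in>m. J1 (J2 x) = J3 x \<and> J3 x = - J2 (J1 x)"
    and Q: "qstr L = {\<lambda>x\<in>m. a *\<^sub>R J1 x + b *\<^sub>R J2 x + c *\<^sub>R J3 x | a b c. True}"
    using d(3) unfolding linear_quaternionic_structure_def by (elim bexE conjE) (rule that, assumption+)
  define j1 j2 j3 where "j1 x = \<iota> (J1 (\<Psi> x))" and "j2 x = \<iota> (J2 (\<Psi> x))" and "j3 x = \<iota> (J3 (\<Psi> x))" for x
  have pull: "linear (\<lambda>x. \<iota> (F (\<Psi> x))) \<and> (\<forall>x. \<Psi> (\<iota> (F (\<Psi> x))) = F (\<Psi> x))" if F: "F \<in> End_on m" for F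
  proof -
    have Fm: "F x \<in> m" if "x \<in> m" for x using F that by (auto simp: End_on_def)
    have l: "linear_map_on m F" using F by (simp add: End_on_def)
    show ?thesis
      by (intro conjI linearI allI eqI)
         (simp_all add: \<Psi>\<iota> Fm lin\<Psi> linear_map_onD[OF l subm] subspace_add[OF subm] subspace_scale[OF subm])
  qed
  have lj: "linear j1" "linear j2" "linear j3" and \<Psi>j: "\<Psi> (j1 x) = J1 (\<Psi> x)" "\<Psi> (j2 x) = J2 (\<Psi> x)" "\<Psi> (j3 x) = J3 (\<Psi> x)" for x
    using pull[OF E(1)] pull[OF E(2)] pull[OF E(3)] by (simp_all add: j1_def[abs_def] j2_def[abs_def] j3_def[abs_def])
  note lin_j = linear_add[OF lj(1)] linear_add[OF lj(2)] linear_add[OF lj(3)]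
    linear_scale[OF lj(1)] linear_scale[OF lj(2)] linear_scale[OF lj(3)]
    linear_diff[OF lj(1)] linear_diff[OF lj(2)] linear_diff[OF lj(3)]
    linear_neg[OF lj(1)] linear_neg[OF lj(2)] linear_neg[OF lj(3)]
  have jj0: "j1 (j1 x) = - x" "j2 (j2 x) = - x" "j3 (j3 x) = - x" "j1 (j2 x) = j3 x" "j2 (j1 x) = - j3 x" for x
    using bspec[OF J(1) in_m, of x] bspec[OF J(2) in_m, of x] by (auto intro!: eqI simp: lin\<Psi> \<Psi>j)
  have jj: "j1 (j3 x) = - j2 x" "j3 (j1 x) = j2 x" "j3 (j2 x) = - j1 x" "j2 (j3 x) = j1 x" for x
  proof -
    show a: "j1 (j3 x) = - j2 x" by (simp add: jj0 flip: jj0(4))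
    show "j3 (j1 x) = j2 x" using jj0(4)[of "j1 x"] by (simp add: jj0 lin_j a)
    show "j3 (j2 x) = - j1 x" using jj0(4)[of "j2 x"] by (simp add: jj0 lin_j)
    have "j2 (j3 x) = - j2 (j2 (j1 x))" by (simp add: jj0(5) lin_j)
    then show "j2 (j3 x) = j1 x" by (simp add: jj0(2))
  qed
  \<comment> \<open>The minus sign turns the left relations J1 J2 = J3 into those of a right action:
    acting by i and then by j is J2 J1 = - J3, which has to be the action of k.\<close>
  define act where "act x q = qre q *\<^sub>R x + qim1 q *\<^sub>R j1 x + qim2 q *\<^sub>R j2 x - qim3 q *\<^sub>R j3 x" for x q
  interpret qmodule act
  proof
    fix x y :: "quat ^ 'n" and p q :: quat and r :: real
    show "act (x + y) q = act x q + act y q" by (simp add: act_def lin_j algebra_simps)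
    show "act x (p + q) = act x p + act x q" by (simp add: act_def algebra_simps)
    show "act x (p * q) = act (act x p) q" by (simp add: act_def quat_sel_mult lin_j jj0 jj algebra_simps)
    show "act x (of_real r) = r *\<^sub>R x" by (simp add: act_def of_real_def)
  qed
  define \<rho> where "\<rho> x y = - (sform L (\<Psi> x) (\<Psi> y)) / 2" for x y
  have \<rho>_lin: "\<rho> (x + y) z = \<rho> x z + \<rho> y z" "\<rho> (r *\<^sub>R x) z = r * \<rho> x z"
     "\<rho> z (x + y) = \<rho> z x + \<rho> z y" "\<rho> z (r *\<^sub>R x) = r * \<rho> z x" for x y z r
    using d(4) unfolding \<rho>_def bilinear_map_on_def linear_map_on_def by (auto simp: lin\<Psi>)
  have \<rho>_neg: "\<rho> (- x) z = - \<rho> x z" "\<rho> z (- x) = - \<rho> z x" for x z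
    using \<rho>_lin(2)[of "-1" x z] \<rho>_lin(4)[of z "-1" x] by simp_all
  have \<rho>_skew: "\<rho> y x = - \<rho> x y" for x y using d(5)[OF in_m in_m, of y x] by (simp add: \<rho>_def)
  have \<rho>_nondeg: "x = 0" if "\<And>y. \<rho> x y = 0" for x
  proof -
    have "sform L (\<Psi> x) y = 0" if "y \<in> m" for y
      using \<open>\<rho> x (\<iota> y) = 0\<close> by (simp add: \<rho>_def \<Psi>\<iota>[OF that])
    then have "\<Psi> x = \<Psi> 0" using d(6)[OF in_m, of x] by (simp add: linear_0[OF \<Psi>(1)])
    then show ?thesis by (rule eqI)
  qed
  \<comment> \<open>Invariance of the 2-form under J together with J J = -1 makes J skew.\<close>
  have unit: "\<rho> (j x) y = - \<rho> x (j y)" if j: "j \<in> {j1, j2, j3}" for j x y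
  proof -
    have q: "(\<lambda>x\<in>m. J1 x) \<in> qstr L" "(\<lambda>x\<in>m. J2 x) \<in> qstr L" "(\<lambda>x\<in>m. J3 x) \<in> qstr L"
      unfolding Q
      by (rule CollectI, rule exI[of _ 1], rule exI[of _ 0], rule exI[of _ 0], simp)
         (rule CollectI, rule exI[of _ 0], rule exI[of _ 1], rule exI[of _ 0], simp,
          rule CollectI, rule exI[of _ 0], rule exI[of _ 0], rule exI[of _ 1], simp)
    have inv: "\<rho> (j x) (j y) = \<rho> x y" for x y
    proof -
      have Jm: "J1 z \<in> m" "J2 z \<in> m" "J3 z \<in> m" if "z \<in> m" for z using E that by (auto simp: End_on_def)
      have "sform L (\<Psi> (j x)) (\<Psi> (j y)) = sform L (\<Psi> x) (\<Psi> y)"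
        using j d(7)[OF q(1) _ in_m in_m, of x y] d(7)[OF q(2) _ in_m in_m, of x y] d(7)[OF q(3) _ in_m in_m, of x y] J(1)
        by (auto simp: \<Psi>j Jm)
      then show ?thesis by (simp add: \<rho>_def)
    qed
    have "j (j z) = - z" for z using j by (auto simp: jj0)
    then show ?thesis using inv[of x "j y"] by (simp add: \<rho>_neg)
  qed
  have \<rho>_act: "\<rho> (act x q) y = \<rho> x (act y (qconj q))" for x y q
    by (simp add: act_def \<rho>_lin \<rho>_neg diff_conv_add_uminus unit qconj_def del: add_uminus_conv_diff)
  \<comment> \<open>The components are forced by the requirement that the real part of h x y w be
    \<rho> of x and the translate of y by w; the sign in the last one comes from the action of
    k.\<close>
  define h where "h x y = Quat (\<rho> x y) (- \<rho> x (j1 y)) (- \<rho> x (j2 y)) (\<rho> x (j3 y))" for x y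
  have h_re: "qre (h x y * w) = \<rho> x (act y w)" for x y w
    by (simp add: h_def act_def \<rho>_lin \<rho>_neg quat_sel_mult diff_conv_add_uminus del: add_uminus_conv_diff)
  have "qform act h"
  proof unfold_locales
    fix x y z :: "quat ^ 'n" and p q :: quat
    show "h (x + y) z = h x z + h y z" by (simp add: h_def \<rho>_lin quat_eq_iff)
    show "h (act x p) (act y q) = qconj p * h x y * q"
    proof (rule qre_mult_ext)
      fix w
      have "qre (h (act x p) (act y q) * w) = qre (h x y * (q * w * qconj p))" by (simp add: h_re \<rho>_act act_mult)
      also have "\<dots> = qre (qconj p * h x y * q * w)"
        using qre_mult_commute[of "h x y * q * w" "qconj p"] by (simp add: mult.assoc)
      finally show "qre (h (act x p) (act y q) * w) = qre (qconj p * h x y * q * w)" .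
    qed
    show "h y x = - qconj (h x y)"
    proof (rule qre_mult_ext)
      fix w
      have "qre (h y x * w) = - qre (h x y * qconj w)"
        unfolding h_re \<rho>_skew[of y "act x w"] \<rho>_act ..
      also have "\<dots> = qre (- qconj (h x y) * w)" by (simp add: quat_sel_mult qconj_simps)
      finally show "qre (h y x * w) = qre (- qconj (h x y) * w)" .
    qed
    show "x = 0" if "\<And>y. h x y = 0"
      by (rule \<rho>_nondeg) (metis h_re[of x _ 1] act_1 mult_zero_left that quat_sel_simps(1))
  qed
  moreover have "qstr L = {\<lambda>x\<in>m. \<Psi> (act (\<iota> x) q) | q. qre q = 0}"
  proof -
    have eq: "(\<lambda>x\<in>m. \<Psi> (act (\<iota> x) q)) = (\<lambda>x\<in>m. qim1 q *\<^sub>R J1 x + qim2 q *\<^sub>R J2 x + (- qim3 q) *\<^sub>R J3 x)"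
      if "qre q = 0" for q
      by (rule restrict_ext) (simp add: act_def that lin\<Psi> linear_diff[OF \<Psi>(1)] \<Psi>j \<Psi>\<iota>)
    have "\<exists>q. (\<lambda>x\<in>m. a *\<^sub>R J1 x + b *\<^sub>R J2 x + c *\<^sub>R J3 x) = (\<lambda>x\<in>m. \<Psi> (act (\<iota> x) q)) \<and> qre q = 0" for a b c
      by (rule exI[of _ "Quat 0 a b (- c)"]) (simp add: eq)
    moreover have "\<exists>a b c. (\<lambda>x\<in>m. \<Psi> (act (\<iota> x) q)) = (\<lambda>x\<in>m. a *\<^sub>R J1 x + b *\<^sub>R J2 x + c *\<^sub>R J3 x)"
      if "qre q = 0" for q using eq[OF that] by blast
    ultimately show ?thesis unfolding Q by blast
  qed
  moreover have "sform L (\<Psi> x) (\<Psi> y) = - 2 * qre (h x y)" for x y by (simp add: h_def \<rho>_def)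
  ultimately have "qsH_coordinates act h L \<Psi>"
    unfolding qsH_coordinates_def qsH_coordinates_axioms_def using \<Psi>(1) inj range trip_m by (simp add: \<iota>_def)
  then show thesis by (rule that)
qed

context qsH_coordinates
begin

text \<open>The Jacobi identity and the invariance of Q and of the 2-form under l, rewritten as the
  hypotheses of \<open>curvature_form\<close> and \<open>curvature_operator_square\<close>.\<close>

lemma R_curvature:
  assumes L: "qsH_tila n L"
  shows "linear (\<lambda>x. R x y z)" "R y x z = - R x y z" "R x y z + R y z x + R z x y = 0" "derivation (R x y)"
    "R x y (R u v w) = R (R x y u) v w + R u (R x y v) w + R u v (R x y w)"
proof -
  interpret tila_loc L using qsH_tilaD(1)[OF L] by unfold_locales
  note d = qsH_tilaD[OF L]
  have eqI: "x = y" if "\<Psi> x = \<Psi> y" for x y using that inj by (rule injD[rotated])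
  have V [simp]: "\<Psi> x \<in> V" for x by (rule mV) simp
  have Vb [simp]: "br (\<Psi> x) (\<Psi> y) \<in> V" for x y by (simp add: br_closed)
  note lin\<Psi> = linear_add[OF linear] linear_scale[OF linear] linear_neg[OF linear]
  have R: "\<Psi> (R x y z) = br (br (\<Psi> x) (\<Psi> y)) (\<Psi> z)" for x y z
    by (simp add: trip_def flip: trip_\<Psi>)
  have zero: "\<Psi> 0 = 0" by (rule linear_0[OF linear])
  show "linear (\<lambda>x. R x y z)"
    by (intro linearI eqI) (simp_all add: R lin\<Psi> br_left)
  show "R y x z = - R x y z"
    by (rule eqI) (simp add: R lin\<Psi> br_skew[of "\<Psi> x" "\<Psi> y"] br_left)
  show "R x y z + R y z x + R z x y = 0"
  proof (rule eqI)
    have "\<Psi> (R x y z + R y z x + R z x y) = - (br (\<Psi> z) (br (\<Psi> x) (\<Psi> y)) + br (\<Psi> x) (br (\<Psi> y) (\<Psi> z)) + br (\<Psi> y) (br (\<Psi> z) (\<Psi> x)))"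
      by (simp add: R lin\<Psi> br_skew[of "\<Psi> z" "br (\<Psi> x) (\<Psi> y)"] br_skew[of "\<Psi> x" "br (\<Psi> y) (\<Psi> z)"]
          br_skew[of "\<Psi> y" "br (\<Psi> z) (\<Psi> x)"])
    then show "\<Psi> (R x y z + R y z x + R z x y) = \<Psi> 0" by (simp add: jacobi zero)
  qed
  have l: "br (\<Psi> x) (\<Psi> y) \<in> l" for x y by (rule mm) simp_all
  show "derivation (R x y)"
    unfolding derivation_def
  proof (intro conjI allI impI)
    show "linear (R x y)" by (intro linearI eqI) (simp_all add: R lin\<Psi> br_right)
    show "\<exists>q'. qre q' = 0 \<and> (\<forall>z. R x y (z \<cdot> q) = R x y z \<cdot> q + z \<cdot> q')" if q: "qre q = 0" for q
    proof -
      let ?z = "br (\<Psi> x) (\<Psi> y)" and ?J = "\<lambda>x\<in>m. \<Psi> (inv \<Psi> x \<cdot> q)"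
      obtain q' where q': "qre q' = 0"
        "\<And>u. (\<lambda>x\<in>m. br ?z (?J x) - ?J (br ?z x)) (\<Psi> u) = \<Psi> (u \<cdot> q')"
        using qstr_\<Psi>(1)[OF d(8)[OF l qstr_\<Psi>(2)[OF q]]] by blast
      have "R x y (z \<cdot> q) = R x y z \<cdot> q + z \<cdot> q'" for z
      proof (rule eqI)
        have "br ?z (\<Psi> (z \<cdot> q)) - ?J (br ?z (\<Psi> z)) = \<Psi> (z \<cdot> q')" using q'(2)[of z] by simp
        then show "\<Psi> (R x y (z \<cdot> q)) = \<Psi> (R x y z \<cdot> q + z \<cdot> q')"
          by (simp add: lin\<Psi> algebra_simps flip: R)
      qed
      then show ?thesis using q'(1) by blast
    qed
    show "qre (h (R x y u) v) + qre (h u (R x y v)) = 0" for u v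
    proof -
      have "sform L (\<Psi> (R x y u)) (\<Psi> v) + sform L (\<Psi> u) (\<Psi> (R x y v)) = 0"
        unfolding R by (rule d(9)[OF l]) simp_all
      then show ?thesis by (simp add: sform)
    qed
  qed
  show "R x y (R u v w) = R (R x y u) v w + R u (R x y v) w + R u v (R x y w)"
  proof (rule eqI)
    let ?z = "br (\<Psi> x) (\<Psi> y)"
    have 1: "br ?z (br a b) = br (br ?z a) b + br a (br ?z b)" if "a \<in> V" "b \<in> V" for a b
      using br_derivation[OF Vb that, of x y] by simp
    have Vz: "br ?z (\<Psi> u) \<in> V" for u by (simp add: br_closed)
    show "\<Psi> (R x y (R u v w)) = \<Psi> (R (R x y u) v w + R u (R x y v) w + R u v (R x y w))"
      by (simp add: R lin\<Psi> 1 Vz br_left br_closed algebra_simps)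
  qed
qed

end

theorem qsH_tila_realized:
  fixes L :: "'g::real_vector qsH_data"
  assumes n: "CARD('n::finite) > 1" and L: "qsH_tila CARD('n) L"
  obtains J and \<tau> :: "('n::finite) ext qmat" where "(J, \<tau>) \<in> listed"
    "one_param_family CARD('n) L = (one_param_family CARD('n) (tau_tila J \<tau>) :: 'b::real_vector qsH_data set set)"
proof -
  obtain \<Psi> :: "quat ^ 'n \<Rightarrow> 'g" and act h where c: "qsH_coordinates act h L \<Psi>"
    using qsH_coordinates_exist[OF L] by blast
  interpret c: qsH_coordinates act h L \<Psi> by (rule c)
  note R = c.R_curvature[OF L]
  obtain A a where A: "c.so_op A" "qre a = 0" "\<And>x y z. c.R x y z = c.RD (c.Dop A a) x y z"
    using c.curvature_form[OF R(1-4)] n by auto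
  have cases: "(\<forall>x. A x = 0) \<or> a = 0 \<and> (\<exists>d. \<forall>x. A (A x) = d *\<^sub>R x)"
    by (rule c.curvature_operator_square[OF A(1,2)]) (rule R(5)[unfolded A(3)])
  obtain J :: "'n qmat" and a' A' d' \<psi> \<theta> \<nu> where *: "(J, tau_mat a' A' d') \<in> listed" "tau_model J a' A' d'"
    "linear \<psi>" "bij \<psi>" "0 < \<nu>" "\<And>X q. \<psi> (rmult X q) = act (\<psi> X) (\<theta> q)" "\<And>q. qre (\<theta> q) = qre q" "surj \<theta>"
    "\<And>X Y. h (\<psi> X) (\<psi> Y) = \<nu> *\<^sub>R \<theta> (hform J X Y)"
    "\<And>X. A (\<psi> X) - act (\<psi> X) a = (1 / \<nu>) *\<^sub>R \<psi> (A' *v X - rmult X a')"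
    by (rule c.classification[OF A(1,2) _ cases, where 'n = 'n]) auto
  interpret t: tau_model J a' A' d' by (rule *(2))
  \<comment> \<open>The similarity factor becomes a parameter of the family, since rescaling
    multiplies the form by exp (2 s).\<close>
  define s where "s = ln \<nu> / 2"
  have s: "exp (2 * s) = \<nu>" using *(5) by (simp add: s_def)
  have sim: "similarity rmult t.hf act h \<psi> \<theta> (exp (2 * s))"
    unfolding s
    by (intro similarity.intro similarity_axioms.intro c.qform_axioms t.qform_axioms) (use * in simp_all)
  interpret similarity rmult t.hf act h \<psi> \<theta> "exp (2 * s)" by (rule sim)
  have "\<psi> (t.RD t.D x y z) = c.RD (c.Dop A a) (\<psi> x) (\<psi> y) (\<psi> z)" for x y z
    by (rule RD_similarity) (simp add: c.Dop_def t.Dop_def *(10) s)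
  then have R: "\<psi> (qsH_coordinates.R t.T t.M x y z) = c.R (\<psi> x) (\<psi> y) (\<psi> z)" for x y z
    by (simp add: t.R_T A(3))
  have "miso (rescale s t.T) L (\<lambda>x. \<Psi> (\<psi> (inv t.M x)))"
    by (rule similarity_imp_miso[OF t.coordinates_T c sim *(4,8) R])
  from miso_inverse[OF qsH_tila_rescale[OF t.qsH_tila_T] L this]
  have "one_param_family CARD('n) L = (one_param_family CARD('n) t.T :: 'b qsH_data set set)"
    by (rule one_param_family_eq[OF L t.qsH_tila_T])
  then show thesis using that *(1) by blast
qed

section \<open>Inequivalence of the listed matrices\<close>

context qform
begin

lemma RD_diff: "RD D x y z - RD D' x y z = RD (\<lambda>x. D x - D' x) x y z"
  by (simp add: RD_def h_linear act_linear algebra_simps)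

lemma Dop_skew:
  assumes A: "so_op A" and a: "qre a = 0"
  shows "qre (h (Dop A a x) y) + qre (h x (Dop A a y)) = 0"
proof -
  have "h (A x) y + h x (A y) = 0" using A by (simp add: so_op_def)
  from arg_cong[OF this, of qre] show ?thesis
    using qre_mult_commute[of a "h x y"] by (simp add: Dop_def h_linear h_act_left h_act_right qconj_imag[OF a])
qed

lemma Dop_act: "so_op A \<Longrightarrow> Dop A a (x \<cdot> q) = Dop A a x \<cdot> q + x \<cdot> (a * q - q * a)"
  by (simp add: Dop_def so_op_linear act_linear act_mult)

end

context similarity
begin

text \<open>Since \<open>D \<mapsto> RD D\<close> is injective, the operator is determined by the triple product.\<close>

lemma intertwines:
  assumes A1: "q1.so_op A1" "qre a1 = 0" and A2: "q2.so_op A2" "qre a2 = 0"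
    and bij: "bij \<psi>" and surj: "surj \<theta>"
    and R: "\<And>x y z. \<psi> (q1.RD (q1.Dop A1 a1) x y z) = q2.RD (q2.Dop A2 a2) (\<psi> x) (\<psi> y) (\<psi> z)"
  shows "q2.Dop A2 a2 (\<psi> x) = (1 / \<nu>) *\<^sub>R \<psi> (q1.Dop A1 a1 x)"
proof -
  let ?D1 = "q1.Dop A1 a1" and ?D2 = "q2.Dop A2 a2"
  \<comment> \<open>The second operator transported back and freed of the scale. Its tensor equals
    that of the first operator, so it remains to see that it is again of the form
    \<open>Dop\<close>.\<close>
  define E where "E x = \<nu> *\<^sub>R inv \<psi> (?D2 (\<psi> x))" for x
  have \<psi>i: "\<psi> (inv \<psi> y) = y" and i\<psi>: "inv \<psi> (\<psi> x) = x" for x y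
    using bij by (simp_all add: bij_def surj_f_inv_f)
  have eqI: "x = y" if "\<psi> x = \<psi> y" for x y using that bij by (metis i\<psi>)
  note l = linear_add[OF lin] linear_diff[OF lin] linear_scale[OF lin]
  have \<psi>E: "\<psi> (E x) = \<nu> *\<^sub>R ?D2 (\<psi> x)" for x by (simp add: E_def l \<psi>i)
  then have DE: "?D2 (\<psi> x) = (1 / \<nu>) *\<^sub>R \<psi> (E x)" for x using nu by simp
  have D2: "?D2 (x + y) = ?D2 x + ?D2 y" "?D2 (r *\<^sub>R x) = r *\<^sub>R ?D2 x" for x y r
    by (simp_all add: q2.Dop_def q2.so_op_linear[OF A2(1)] q2.act_linear algebra_simps)
  have linE: "linear E" by (intro linearI eqI) (simp_all add: \<psi>E l D2 algebra_simps)
  have nrm: "\<exists>q'. qre q' = 0 \<and> (\<forall>x. E (act1 x q) = act1 (E x) q + act1 x q')" for q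
  proof -
    obtain q' where q': "\<theta> q' = \<nu> *\<^sub>R (a2 * \<theta> q - \<theta> q * a2)" using surj by (metis surj_def)
    have "qre q' = qre (\<theta> q')" by (simp add: re)
    also have "\<dots> = 0" using qre_mult_commute[of a2 "\<theta> q"] by (simp add: q')
    finally have "qre q' = 0" .
    moreover have "E (act1 x q) = act1 (E x) q + act1 x q'" for x
      by (rule eqI) (simp add: \<psi>E l act q2.Dop_act[OF A2(1)] q' q2.act_scaleR_left q2.act_scaleR_right scaleR_add_right)
    ultimately show ?thesis by blast
  qed
  have sk: "qre (h1 (E x) y) + qre (h1 x (E y)) = 0" for x y
  proof -
    have "qre (h2 (\<psi> (E x)) (\<psi> y)) + qre (h2 (\<psi> x) (\<psi> (E y))) = 0"
      using q2.Dop_skew[OF A2, of "\<psi> x" "\<psi> y"] by (simp add: \<psi>E q2.h_scaleR flip: distrib_left)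
    then show ?thesis using nu by (simp add: form re flip: distrib_left)
  qed
  obtain A s where E: "q1.so_op A" "qre s = 0" "\<And>x. E x = A x - act1 x s"
    by (rule q1.derivation_split[OF linE nrm sk]) (rule that, assumption+)
  have EE: "E = q1.Dop A s" by (simp add: fun_eq_iff q1.Dop_def E(3))
  have "\<psi> (q1.RD E x y z) = \<psi> (q1.RD ?D1 x y z)" for x y z
    unfolding R by (rule RD_similarity) (rule DE)
  then have "q1.RD E x y z - q1.RD ?D1 x y z = 0" for x y z using eqI by simp
  moreover have "(\<lambda>x. E x - ?D1 x) = q1.Dop (\<lambda>x. A x - A1 x) (s - a1)"
    by (simp add: fun_eq_iff EE q1.Dop_def q1.act_linear)
  ultimately have z: "q1.RD (q1.Dop (\<lambda>x. A x - A1 x) (s - a1)) x y z = 0" for x y z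
    by (simp add: q1.RD_diff)
  have so: "q1.so_op (\<lambda>x. A x - A1 x)"
  proof -
    have "h1 (A x) y = - h1 x (A y)" "h1 (A1 x) y = - h1 x (A1 y)" for x y
      using E(1) A1(1) by (simp_all add: q1.so_op_def)
    then show ?thesis
      unfolding q1.so_op_def
      by (intro conjI allI linearI)
        (simp_all add: q1.so_op_linear[OF E(1)] q1.so_op_linear[OF A1(1)] q1.act_linear q1.h_linear algebra_simps)
  qed
  have "A x = A1 x" "s = a1" for x
    using q1.RD_zero[OF so _ z] E(2) A1(2) by auto
  then have "E x = ?D1 x" by (simp add: EE q1.Dop_def)
  then show ?thesis using DE by simp
qed

end

theorem tau_intertwining:
  fixes A1 A2 :: "('n::finite) qmat"
  assumes t1: "tau_model J1 a1 A1 d1" and t2: "tau_model J2 a2 A2 d2"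
    and iso: "miso (tau_tila J1 (tau_mat a1 A1 d1)) (rescale t (tau_tila J2 (tau_mat a2 A2 d2))) g"
  obtains \<psi> \<theta> \<nu> where "0 < \<nu>" "linear \<psi>" "bij \<psi>" "\<And>X q. \<psi> (rmult X q) = rmult (\<psi> X) (\<theta> q)"
    "\<And>q. qre (\<theta> q) = qre q" "\<And>X Y. hform J2 (\<psi> X) (\<psi> Y) = \<nu> *\<^sub>R \<theta> (hform J1 X Y)"
    "\<And>X. A2 *v \<psi> X - rmult (\<psi> X) a2 = (1 / \<nu>) *\<^sub>R \<psi> (A1 *v X - rmult X a1)"
proof -
  interpret t1: tau_model J1 a1 A1 d1 by (rule t1)
  interpret t2: tau_model J2 a2 A2 d2 by (rule t2)
  obtain \<psi> \<theta> where s: "similarity rmult t1.hf rmult t2.hf \<psi> \<theta> (exp (- 2 * t))" and b: "bij \<psi>" "surj \<theta>"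
    and R: "\<And>x y z. \<psi> (t1.RD t1.D x y z) = t2.RD t2.D (\<psi> x) (\<psi> y) (\<psi> z)"
    using miso_imp_similarity[OF t1.coordinates_T t2.coordinates_T iso] unfolding t1.R_T t2.R_T by metis
  interpret similarity rmult t1.hf rmult t2.hf \<psi> \<theta> "exp (- 2 * t)" by (rule s)
  show thesis
  proof (rule that)
    show "A2 *v \<psi> X - rmult (\<psi> X) a2 = (1 / exp (- 2 * t)) *\<^sub>R \<psi> (A1 *v X - rmult X a1)" for X
      using intertwines[OF t1.so_op_matrix[OF t1.A_so] t1.a_imag t2.so_op_matrix[OF t2.A_so] t2.a_imag b R, of X]
      by (simp add: t1.Dop_def t2.Dop_def)
  qed (use lin b act re form in simp_all)
qed

lemma hform_matrix: "hform J X (A *v Y) = hform (J ** A) X (Y :: quat ^ ('n::finite))"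
proof -
  have "star_row X (J ** A) $ l = (\<Sum>k\<in>UNIV. star_row X J $ k * A $ k $ l)" for l
    unfolding star_row_def matrix_matrix_mult_def
    by (simp add: sum_distrib_left sum_distrib_right mult.assoc) (rule sum.swap)
  then show ?thesis
    unfolding hform_def matrix_vector_mult_def
    by (simp add: sum_distrib_left sum_distrib_right mult.assoc) (rule sum.swap)
qed

lemma hform_monomial:
  "qre (hform (monomial (\<lambda>r. r) (\<lambda>r. of_real (s r))) X X) = sig_form s (X :: quat ^ ('n::finite))"
proof -
  have "hform J X X = (\<Sum>i\<in>UNIV. \<Sum>k\<in>UNIV. qconj (X $ i) * J $ i $ k * X $ k)" for J :: "'n qmat"
    unfolding hform_def star_row_def by (subst sum.swap) (simp add: sum_distrib_right)
  then show ?thesis by (simp only: monomial_quadratic sig_form_def) (simp add: of_real_def)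
qed

text \<open>J A is the Gram matrix of Re h(X, A X). For the nilpotent matrices it is diagonal with p
  positive and q negative entries, which is how p and q become invariants.\<close>

lemma nilp_signature:
  assumes n: "CARD('n) = t + N" "t = N \<or> t = N + 1"
  shows "form_split N t ** A_nilp N t p q = (monomial (\<lambda>r. r) (\<lambda>r. of_real
    (if r < N then (if r < p then 1 else 0) else if r < t then 0 else
      if p \<le> r - t \<and> r - t < p + q then - 1 else 0)) :: ('n::finite) qmat)"
proof -
  interpret split_size N t "CARD('n)" using n by unfold_locales
  show ?thesis
    unfolding form_split_monomial[OF n] A_nilp_monomial[OF n] split_mult(1)[OF n]
  proof (rule monomial_cong)
    fix r assume r: "r < CARD('n)"
    show "(swap_ix N t \<circ> swap_ix N t) r = r" using swap_swap[OF r] by simp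
    show "split_coeff N t r * nilp_coeff N t p q (swap_ix N t r) = of_real
      (if r < N then (if r < p then 1 else 0) else if r < t then 0 else
        if p \<le> r - t \<and> r - t < p + q then - 1 else 0)"
      using n r by (auto simp: split_coeff_def nilp_coeff_def swap_ix_def)
  qed
qed

lemma complex_signature:
  "form_diag ** mat_from (diag_of (\<lambda>r. quat_j * I_sig p r)) =
     (monomial (\<lambda>r. r) (\<lambda>r. of_real (if r < p then - 1 else 1)) :: ('n::finite) qmat)"
proof -
  have j: "quat_j * quat_j = -1" by (simp add: quat_eq_iff quat_sel_mult quat_units)
  have "quat_j * (quat_j * I_sig p r) = of_real (if r < p then - 1 else 1)" for r
    by (simp add: I_sig_def j flip: mult.assoc)
  then show ?thesis by (simp add: form_diag_monomial diag_monomial monomial_mult o_def)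
qed

text \<open>In Re h(X, A X) the factor \<nu> of h cancels the factor 1/\<nu> of A, so the real
  quadratic form is preserved exactly.\<close>

lemma signature_invariant:
  fixes A1 A2 :: "('n::finite) qmat"
  assumes t: "tau_model J1 0 A1 d1" "tau_model J2 0 A2 d2"
    and iso: "miso (tau_tila J1 (tau_mat 0 A1 d1)) (rescale t (tau_tila J2 (tau_mat 0 A2 d2))) g"
    and s: "J1 ** A1 = monomial (\<lambda>r. r) (\<lambda>r. of_real (s1 r))" "J2 ** A2 = monomial (\<lambda>r. r) (\<lambda>r. of_real (s2 r))"
  shows "card {r. r < CARD('n) \<and> s1 r > 0} = card {r. r < CARD('n) \<and> s2 r > 0}"
    "card {r. r < CARD('n) \<and> s1 r < 0} = card {r. r < CARD('n) \<and> s2 r < 0}"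
proof -
  interpret t1: tau_model J1 0 A1 d1 by (rule t(1))
  interpret t2: tau_model J2 0 A2 d2 by (rule t(2))
  obtain \<psi> \<theta> \<nu> where \<psi>: "0 < \<nu>" "linear \<psi>" "bij \<psi>" "\<And>X q. \<psi> (rmult X q) = rmult (\<psi> X) (\<theta> q)"
    "\<And>q. qre (\<theta> q) = qre q" "\<And>X Y. hform J2 (\<psi> X) (\<psi> Y) = \<nu> *\<^sub>R \<theta> (hform J1 X Y)"
    "\<And>X. A2 *v \<psi> X - rmult (\<psi> X) 0 = (1 / \<nu>) *\<^sub>R \<psi> (A1 *v X - rmult X 0)"
    using tau_intertwining[OF t iso] by metis
  have "sig_form s2 (\<psi> X) = sig_form s1 X" for X
  proof -
    have A: "A2 *v \<psi> X = (1 / \<nu>) *\<^sub>R \<psi> (A1 *v X)" using \<psi>(7)[of X] by simp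
    have "sig_form s2 (\<psi> X) = qre (hform J2 (\<psi> X) (A2 *v \<psi> X))"
      unfolding hform_matrix s(2) hform_monomial ..
    also have "\<dots> = qre (hform J1 X (A1 *v X))"
      unfolding A using \<psi>(1) by (simp add: t2.h_scaleR \<psi>(5,6))
    also have "\<dots> = sig_form s1 X"
      unfolding hform_matrix s(1) hform_monomial ..
    finally show ?thesis .
  qed
  from signature_eq[OF \<psi>(2,3) this]
  show "card {r. r < CARD('n) \<and> s1 r > 0} = card {r. r < CARD('n) \<and> s2 r > 0}"
    "card {r. r < CARD('n) \<and> s1 r < 0} = card {r. r < CARD('n) \<and> s2 r < 0}" by auto
qed

text \<open>Intertwining twice multiplies the square of D, hence d, by the square of
  1/\<nu>.\<close>

lemma corner_invariant:
  fixes A1 A2 :: "('n::finite) qmat"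
  assumes t: "tau_model J1 a1 A1 d1" "tau_model J2 a2 A2 d2"
    and iso: "miso (tau_tila J1 (tau_mat a1 A1 d1)) (rescale t (tau_tila J2 (tau_mat a2 A2 d2))) g"
  shows "sgn d1 = sgn d2"
proof -
  interpret t1: tau_model J1 a1 A1 d1 by (rule t(1))
  interpret t2: tau_model J2 a2 A2 d2 by (rule t(2))
  obtain \<psi> \<theta> \<nu> where \<psi>: "0 < \<nu>" "linear \<psi>" "bij \<psi>" "\<And>X q. \<psi> (rmult X q) = rmult (\<psi> X) (\<theta> q)"
    "\<And>q. qre (\<theta> q) = qre q" "\<And>X Y. hform J2 (\<psi> X) (\<psi> Y) = \<nu> *\<^sub>R \<theta> (hform J1 X Y)"
    "\<And>X. A2 *v \<psi> X - rmult (\<psi> X) a2 = (1 / \<nu>) *\<^sub>R \<psi> (A1 *v X - rmult X a1)"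
    using tau_intertwining[OF t iso] by metis
  have D: "t2.D (\<psi> X) = (1 / \<nu>) *\<^sub>R \<psi> (t1.D X)" for X using \<psi>(7) by (simp add: t1.Dop_def t2.Dop_def)
  obtain y :: "quat ^ 'n" where y: "y \<noteq> 0" using t1.exists_nonzero by auto
  obtain X where X: "\<psi> X = y" using \<psi>(3) by (metis bij_pointE)
  have "d2 *\<^sub>R \<psi> X = t2.D (t2.D (\<psi> X))" by (simp add: t2.D_sq)
  also have "\<dots> = (1 / \<nu> * (1 / \<nu>)) *\<^sub>R \<psi> (t1.D (t1.D X))"
    unfolding D linear_scale[OF t2.linear_D] by simp
  also have "\<dots> = (1 / \<nu> * (1 / \<nu>) * d1) *\<^sub>R \<psi> X" by (simp only: t1.D_sq linear_scale[OF \<psi>(2)] scaleR_scaleR)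
  finally have "d2 = 1 / \<nu> * (1 / \<nu>) * d1" using y by (simp only: X scaleR_cancel_right) auto
  then show ?thesis using \<psi>(1) by (simp add: sgn_mult)
qed

text \<open>The sign of d cannot separate these two. But an A commutes with all right scalars,
  whereas right multiplication by i does not commute with j.\<close>

lemma rot_not_complex:
  fixes A :: "('n::finite) qmat"
  assumes t: "tau_model J 0 A d"
    and iso: "miso (tau_tila form_diag (tau_mat quat_i (0 :: 'n qmat) (- 1))) (rescale t (tau_tila J (tau_mat 0 A d))) g"
  shows False
proof -
  interpret t1: tau_model "form_diag :: 'n qmat" quat_i 0 "- 1" by (rule tau_model_rot)
  interpret t2: tau_model J 0 A d by (rule t)
  obtain \<psi> \<theta> \<nu> where \<psi>: "0 < \<nu>" "linear \<psi>" "bij \<psi>" "\<And>X q. \<psi> (rmult X q) = rmult (\<psi> X) (\<theta> q)"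
    "\<And>q. qre (\<theta> q) = qre q" "\<And>X Y. hform J (\<psi> X) (\<psi> Y) = \<nu> *\<^sub>R \<theta> (hform (form_diag :: 'n qmat) X Y)"
    "\<And>X. A *v \<psi> X - rmult (\<psi> X) 0 = (1 / \<nu>) *\<^sub>R \<psi> (0 *v X - rmult X quat_i)"
    using tau_intertwining[OF tau_model_rot t iso] by metis
  have A: "A *v \<psi> X = - (1 / \<nu>) *\<^sub>R \<psi> (rmult X quat_i)" for X
    using \<psi>(7)[of X] by (simp add: linear_neg[OF \<psi>(2)])
  obtain X :: "quat ^ 'n" where X: "X \<noteq> 0" using t1.exists_nonzero by auto
  have "- (1 / \<nu>) *\<^sub>R \<psi> (rmult (rmult X quat_j) quat_i) = A *v \<psi> (rmult X quat_j)" by (simp add: A)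
  also have "\<dots> = rmult (A *v \<psi> X) (\<theta> quat_j)" by (simp add: \<psi>(4) t2.matrix_rmult)
  also have "\<dots> = - (1 / \<nu>) *\<^sub>R \<psi> (rmult (rmult X quat_i) quat_j)"
    by (simp add: A \<psi>(4) t1.act_scaleR_left t1.act_minus_left)
  finally have "\<psi> (rmult (rmult X quat_j) quat_i) = \<psi> (rmult (rmult X quat_i) quat_j)" using \<psi>(1) by simp
  then have "rmult X (quat_j * quat_i) = rmult X (quat_i * quat_j)"
    using \<psi>(3) unfolding t1.act_mult by (simp add: bij_def inj_eq)
  then have "rmult X (quat_j * quat_i - quat_i * quat_j) = 0" by (simp add: t1.act_diff_right)
  moreover have "quat_j * quat_i - quat_i * quat_j \<noteq> 0" by (simp add: quat_eq_iff quat_sel_mult quat_units)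
  ultimately show False using X by (simp add: t1.act_eq_0_iff)
qed

text \<open>Isomorphisms in both directions are supplied because \<open>rot_not_complex\<close> is
  one-sided, with the rotation as the source. The sign of d settles most of the mixed cases.\<close>

lemma listed_injective:
  assumes l: "(J1, \<tau>1) \<in> (listed :: (('n::finite) qmat \<times> 'n ext qmat) set)" "(J2, \<tau>2) \<in> listed"
    and iso: "miso (tau_tila J1 \<tau>1) (rescale t (tau_tila J2 \<tau>2)) g"
      "miso (tau_tila J2 \<tau>2) (rescale t' (tau_tila J1 \<tau>1)) g'"
  shows "\<tau>1 = \<tau>2"
proof -
  have half: "N = CARD('n) div 2" if "CARD('n) = t + N" "t = N \<or> t = N + 1" for t N using that by auto
  obtain a1 A1 d1 where 1: "\<tau>1 = tau_mat a1 A1 d1" "tau_model J1 a1 A1 d1" by (rule listed_tau_model[OF l(1)])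
  obtain a2 A2 d2 where 2: "\<tau>2 = tau_mat a2 A2 d2" "tau_model J2 a2 A2 d2" by (rule listed_tau_model[OF l(2)])
  have corner: "sgn d1 = sgn d2" by (rule corner_invariant[OF 1(2) 2(2) iso(1)[unfolded 1 2]])
  have mat_eq: "tau_mat a A d = tau_mat a' A' d' \<longleftrightarrow> a = a' \<and> A = A' \<and> d = d'" for a a' A d d' and A' :: "'n qmat"
    by (auto simp: tau_mat_def block3_eq_iff)
  from l(1) show ?thesis
  proof (cases rule: listed_cases)
    case (nilp N t p q)
    from l(2) show ?thesis
    proof (cases rule: listed_cases)
      case nilp2: (nilp N' t' p' q')
      have eq: "N' = N" "t' = t" using half[OF nilp(1,2)] half[OF nilp2(1,2)] nilp(1) nilp2(1) by auto
      define s :: "nat \<Rightarrow> nat \<Rightarrow> nat \<Rightarrow> real" where "s p q r =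
        (if r < N then (if r < p then 1 else 0) else if r < t then 0 else
          if p \<le> r - t \<and> r - t < p + q then - 1 else 0)" for p q r
      have pos: "card {r. r < CARD('n) \<and> s p q r > 0} = p" and neg: "card {r. r < CARD('n) \<and> s p q r < 0} = q"
        if "p + q \<le> N" for p q
      proof -
        have "{r. r < CARD('n) \<and> s p q r > 0} = {..<p}" using that nilp(1) by (auto simp: s_def)
        then show "card {r. r < CARD('n) \<and> s p q r > 0} = p" by simp
        have "{r. r < CARD('n) \<and> s p q r < 0} = {t + p..<t + p + q}"
          using that nilp(1,2) by (auto simp: s_def split: if_splits)
        then show "card {r. r < CARD('n) \<and> s p q r < 0} = q" by simp
      qed
      note sg = signature_invariant[OF tau_model_nilp[OF nilp(1,2)] tau_model_nilp[OF nilp(1,2)]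
          iso(1)[unfolded nilp(4,5) nilp2(4,5) eq] nilp_signature[OF nilp(1,2)] nilp_signature[OF nilp(1,2)], folded s_def]
      have "p = p'" "q = q'" using sg pos neg nilp(3) nilp2(3) by (simp_all add: eq)
      then show ?thesis by (simp add: nilp nilp2 eq)
    qed (use corner nilp(5) 1(1) 2(1) in \<open>auto simp: mat_eq\<close>)
  next
    case rot
    from l(2) show ?thesis
    proof (cases rule: listed_cases)
      case (complex p)
      show ?thesis using rot_not_complex[OF tau_model_complex iso(1)[unfolded rot complex(2,3)]] ..
    qed (use corner rot 1(1) 2(1) in \<open>auto simp: mat_eq\<close>)
  next
    case (complex p)
    from l(2) show ?thesis
    proof (cases rule: listed_cases)
      case rot
      show ?thesis using rot_not_complex[OF tau_model_complex iso(2)[unfolded rot complex(2,3)]] ..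
    next
      case complex2: (complex p')
      have card: "card {r. r < CARD('n) \<and> (if r < p then - 1 else 1) < (0 :: real)} = p" if "p \<le> CARD('n)" for p
      proof -
        have "{r. r < CARD('n) \<and> (if r < p then - 1 else 1) < (0 :: real)} = {..<p}" using that by auto
        then show ?thesis by simp
      qed
      have "p = p'"
        using signature_invariant(2)[OF tau_model_complex tau_model_complex
            iso(1)[unfolded complex(2,3) complex2(2,3)] complex_signature complex_signature]
        by (simp only: card complex(1) complex2(1))
      then show ?thesis by (simp add: complex complex2)
    qed (use corner complex(3) 1(1) 2(1) in \<open>auto simp: mat_eq\<close>)
  next
    case (paracomplex N)
    from l(2) show ?thesis
    proof (cases rule: listed_cases)
      case para: (paracomplex N')
      then show ?thesis using paracomplex by simp
    qed (use corner paracomplex(3) 1(1) 2(1) in \<open>auto simp: mat_eq\<close>)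
  qed
qed

text \<open>The bijection is indexed by \<tau> alone, while the model also depends on the form; so
  \<tau> must determine the form within the list.\<close>

lemma listed_form_unique:
  assumes "(J, \<tau>) \<in> (listed :: (('n::finite) qmat \<times> 'n ext qmat) set)" "(J', \<tau>) \<in> listed"
  shows "J = J'"
proof -
  have half: "N = CARD('n) div 2" if "CARD('n) = t + N" "t = N \<or> t = N + 1" for t N using that by auto
  have mat_eq: "tau_mat a A d = tau_mat a' A' d' \<longleftrightarrow> a = a' \<and> A = A' \<and> d = d'" for a a' A d d' and A' :: "'n qmat"
    by (auto simp: tau_mat_def block3_eq_iff)
  from assms(1) show ?thesis
  proof (cases rule: listed_cases)
    case (nilp N t p q)
    from assms(2) show ?thesis
    proof (cases rule: listed_cases)
      case nilp2: (nilp N' t' p' q')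
      have "N' = N" "t' = t" using half[OF nilp(1,2)] half[OF nilp2(1,2)] nilp(1) nilp2(1) by auto
      then show ?thesis by (simp add: nilp nilp2)
    qed (use nilp(5) in \<open>auto simp: mat_eq\<close>)
  next
    case rot
    from assms(2) show ?thesis by (cases rule: listed_cases) (use rot in \<open>auto simp: mat_eq\<close>)
  next
    case (complex p)
    from assms(2) show ?thesis by (cases rule: listed_cases) (use complex in \<open>auto simp: mat_eq\<close>)
  next
    case (paracomplex N)
    from assms(2) show ?thesis by (cases rule: listed_cases) (use paracomplex in \<open>auto simp: mat_eq\<close>)
  qed
qed

section \<open>The classification\<close>

text \<open>Families are sets of classes in the ambient space, and equality says something only if
  these classes have members. A copy of L1 pushed into that space is such a member, and it also
  belongs to a class of the other family.\<close>

lemma one_param_family_eq_imp_miso: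
  fixes L1 L2 :: "'a::real_vector qsH_data" and f :: "'a \<Rightarrow> 'g::real_vector"
  assumes L: "qsH_tila n L1" "qsH_tila n L2" and f: "linear f" "inj f"
    and eq: "(one_param_family n L1 :: 'g qsH_data set set) = one_param_family n L2"
  obtains t g where "miso L1 (rescale t L2) g"
proof -
  note p = qsH_tila_push[OF L(1) f]
  have r0: "rescale 0 L = L" for L :: "'a qsH_data" by (simp add: rescale_def)
  obtain \<phi> where "qsH_isomorphism (push f L1) L1 \<phi>"
    using miso_imp_isomorphism[OF p(1) L(1) miso_inverse[OF L(1) p]] by blast
  then have "push f L1 \<in> iso_class n (rescale 0 L1)" using p(1) by (auto simp: iso_class_def r0)
  moreover have "(iso_class n (rescale 0 L1) :: 'g qsH_data set) \<in> one_param_family n L2"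
    unfolding eq[symmetric] unfolding one_param_family_def by blast
  ultimately obtain t where "push f L1 \<in> iso_class n (rescale t L2)" by (auto simp: one_param_family_def)
  then obtain \<xi> where "qsH_isomorphism (push f L1) (rescale t L2) \<xi>" by (auto simp: iso_class_def)
  then have "miso (push f L1) (rescale t L2) \<xi>" by (rule isomorphism_imp_miso[OF p(1) qsH_tila_rescale[OF L(2)]])
  from miso_trans[OF p(2) this] show thesis by (rule that)
qed

theorem theorem5p7:
  assumes "CARD('n::finite) > 1"
    and "\<not> (\<exists>B :: 'g::real_vector set. finite B \<and> span B = UNIV)"
  shows "(\<forall>(J, \<tau>) \<in> (listed :: ('n qmat \<times> 'n ext qmat) set).
            \<tau> \<in> so_star_ext J \<and> tau_m J \<tau> \<subseteq> tau_centralizer J \<tau> \<and>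
            qsH_tila CARD('n) (tau_tila J \<tau>)) \<and>
         (\<exists>F. bij_betw F (snd ` (listed :: ('n qmat \<times> 'n ext qmat) set))
                 (one_param_families CARD('n) :: 'g qsH_data set set set) \<and>
              (\<forall>(J, \<tau>) \<in> (listed :: ('n qmat \<times> 'n ext qmat) set).
                 F \<tau> = one_param_family CARD('n) (tau_tila J \<tau>)))"
proof (intro conjI)
  let ?S = "listed :: ('n qmat \<times> 'n ext qmat) set"
  obtain f :: "'n ext qmat \<Rightarrow> 'g" where f: "linear f" "inj f"
    by (rule exists_linear_injection[OF assms(2)])
  have model: "\<tau> \<in> so_star_ext J \<and> tau_m J \<tau> \<subseteq> tau_centralizer J \<tau> \<and> qsH_tila CARD('n) (tau_tila J \<tau>)"
    if l: "(J, \<tau>) \<in> ?S" for J \<tau>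
  proof -
    obtain a A d where \<tau>: "\<tau> = tau_mat a A d" "tau_model J a A d" by (rule listed_tau_model[OF l])
    interpret tau_model J a A d by (rule \<tau>(2))
    show ?thesis unfolding \<tau>(1) using tau_so_star_ext tau_m_centralizer qsH_tila_T by blast
  qed
  then show "\<forall>(J, \<tau>) \<in> ?S. \<tau> \<in> so_star_ext J \<and> tau_m J \<tau> \<subseteq> tau_centralizer J \<tau> \<and> qsH_tila CARD('n) (tau_tila J \<tau>)"
    by blast
  define G where "G J \<tau> = (one_param_family CARD('n) (tau_tila J \<tau>) :: 'g qsH_data set set)" for J and \<tau> :: "'n ext qmat"
  \<comment> \<open>The choice of the form is harmless by \<open>listed_form_unique\<close>.\<close>
  define F where "F \<tau> = G (SOME J. (J, \<tau>) \<in> ?S) \<tau>" for \<tau>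
  have F: "F \<tau> = G J \<tau>" if "(J, \<tau>) \<in> ?S" for J \<tau>
    using listed_form_unique[OF that] someI[of "\<lambda>J. (J, \<tau>) \<in> ?S", OF that] by (simp add: F_def)
  have mem: "G J \<tau> \<in> one_param_families CARD('n)" if "(J, \<tau>) \<in> ?S" for J \<tau>
  proof -
    have L: "qsH_tila CARD('n) (tau_tila J \<tau>)" using model[OF that] by blast
    note p = qsH_tila_push[OF L f]
    \<comment> \<open>The family of the matrix model is that of its copy in the ambient space, which
      makes it one of the families counted.\<close>
    have "miso (push f (tau_tila J \<tau>)) (rescale 0 (tau_tila J \<tau>)) (inv_into (m_part (tau_tila J \<tau>)) f)"
      using miso_inverse[OF L p] by (simp add: rescale_def)
    from one_param_family_eq[OF p(1) L this] show ?thesis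
      unfolding G_def one_param_families_def using p(1) by blast
  qed
  have inj: "\<tau> = \<tau>'" if l: "(J, \<tau>) \<in> ?S" "(J', \<tau>') \<in> ?S" and eq: "G J \<tau> = G J' \<tau>'" for J \<tau> J' \<tau>'
  proof -
    have L: "qsH_tila CARD('n) (tau_tila J \<tau>)" "qsH_tila CARD('n) (tau_tila J' \<tau>')" using model l by blast+
    obtain t g where "miso (tau_tila J \<tau>) (rescale t (tau_tila J' \<tau>')) g"
      by (rule one_param_family_eq_imp_miso[OF L f eq[unfolded G_def]])
    moreover obtain t' g' where "miso (tau_tila J' \<tau>') (rescale t' (tau_tila J \<tau>)) g'"
      by (rule one_param_family_eq_imp_miso[OF L(2,1) f eq[unfolded G_def, symmetric]])
    ultimately show ?thesis by (rule listed_injective[OF l])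
  qed
  have surj: "\<exists>\<tau> J. (J, \<tau>) \<in> ?S \<and> U = G J \<tau>" if U: "U \<in> one_param_families CARD('n)" for U
  proof -
    obtain L :: "'g qsH_data" where L: "qsH_tila CARD('n) L" "U = one_param_family CARD('n) L"
      using U unfolding one_param_families_def by blast
    obtain J \<tau> where "(J, \<tau>) \<in> ?S"
      "one_param_family CARD('n) L = (one_param_family CARD('n) (tau_tila J \<tau>) :: 'g qsH_data set set)"
      by (rule qsH_tila_realized[OF assms(1) L(1)])
    then show ?thesis unfolding L(2) G_def by blast
  qed
  have "bij_betw F (snd ` ?S) (one_param_families CARD('n))"
    unfolding bij_betw_def
  proof
    show "inj_on F (snd ` ?S)" by (rule inj_onI) (use F inj in force)
    show "F ` snd ` ?S = one_param_families CARD('n)"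
    proof (intro equalityI subsetI)
      show "U \<in> one_param_families CARD('n)" if "U \<in> F ` snd ` ?S" for U using that F mem by force
      show "U \<in> F ` snd ` ?S" if U: "U \<in> one_param_families CARD('n)" for U
      proof -
        obtain \<tau> J where "(J, \<tau>) \<in> ?S" "U = G J \<tau>" using surj[OF U] by blast
        then show ?thesis using F by force
      qed
    qed
  qed
  then show "\<exists>F. bij_betw F (snd ` ?S) (one_param_families CARD('n) :: 'g qsH_data set set set) \<and>
      (\<forall>(J, \<tau>) \<in> ?S. F \<tau> = one_param_family CARD('n) (tau_tila J \<tau>))"
    using F by (intro exI[of _ F]) (auto simp: G_def)
qed

end
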